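(* Let $(\Omega,\mathcal{F},(\mathcal{F}_t)_{t\ge 0},P)$ be a filtered probability space carrying an $(\mathcal{F}_t)_{t\ge 0}$-space--time white noise $W(\mathrm{d}t,\mathrm{d}x)$ on $\mathbb{R}_+\times[0,1]$ based on $\mathrm{d}t\,\mathrm{d}x$, let $U_0\in L^\infty([0,1])$ be deterministic, and let $\sigma,b:\mathbb{R}\to\mathbb{R}$. Assume that $b$ is measurable and has at most linear growth, and that $\sigma$ is Hölder continuous with exponent $\theta\in(1/2,1]$. Let $(U(t,x))_{t>0,x\in[0,1]}$ be a continuous $(\mathcal{F}_t)_{t\ge 0}$-adapted weak solution to the stochastic heat equation with Neumann boundary conditions $$\partial_t U(t,x)=\partial_{xx}U(t,x)+b(U(t,x))+\sigma(U(t,x))\dot W(t,x),\qquad \partial_xU(t,0)=\partial_xU(t,1)=0,$$ with initial condition $U(0,x)=U_0(x)$. Then, for all $x\in[0,1]$ and all $t>0$, the law of $U(t,x)$ has a density on $\{u\in\mathbb{R}:\sigma(u)\neq 0\}$.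
   Context: Let $$G_t(x,y):=\frac{1}{\sqrt{4\pi t}}\sum_{n\in\mathbb{Z}}\Bigl[\mathrm{e}^{-(y-x-2n)^2/(4t)}+\mathrm{e}^{-(y+x-2n)^2/(4t)}\Bigr]$$ be the Neumann heat kernel on $[0,1]$. A continuous $(\mathcal{F}_t)_{t\ge0}$-adapted process $(U(t,x))_{t>0,x\in[0,1]}$ is called a weak solution if a.s., for all $t>0$ and all $x\in[0,1]$, $$U(t,x)=\int_0^1G_t(x,y)U_0(y)\,\mathrm{d}y+\int_0^t\int_0^1G_{t-s}(x,y)b(U(s,y))\,\mathrm{d}y\,\mathrm{d}s+\int_0^t\int_0^1G_{t-s}(x,y)\sigma(U(s,y))\,W(\mathrm{d}s,\mathrm{d}y),$$ where the last integral is the stochastic integral with respect to white noise in the sense of Walsh. Hölder continuous with exponent $\theta$ means $|\sigma(u)-\sigma(v)|\le C|u-v|^\theta$ for all $u,v\in\mathbb{R}$, for some constant $C$. At most linear growth means $|b(u)|\le C(1+|u|)$ for all $u\in\mathbb{R}$, for some constant $C$. A probability measure $\mu$ on $\mathbb{R}$ "has a density on" a Borel set $D\subset\mathbb{R}$ if the restriction of $\mu$ to $D$ is absolutely continuous with respect to Lebesgue measure, i.e. $\mu(A\cap D)=0$ for every Borel set $A$ of Lebesgue measure $0$. Existence of the solution is not part of the claim. *)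

theory Defs
  imports "HOL-Probability.Probability"
begin

definition filtered_prob_space :: "'a measure \<Rightarrow> (real \<Rightarrow> 'a measure) \<Rightarrow> bool" where
  "filtered_prob_space M F \<longleftrightarrow>
     prob_space M \<and>
     (\<forall>t\<ge>0. subalgebra M (F t)) \<and>
     (\<forall>s t. 0 \<le> s \<and> s \<le> t \<longrightarrow> sets (F s) \<subseteq> sets (F t))"

text \<open>The degenerate case \<open>v = 0\<close> has to be listed separately, because
  \<^const>\<open>normal_density\<close> with standard deviation 0 is not the Dirac mass.\<close>

definition centered_gaussian :: "'a measure \<Rightarrow> ('a \<Rightarrow> real) \<Rightarrow> real \<Rightarrow> bool" where
  "centered_gaussian M X v \<longleftrightarrow>
     0 \<le> v \<and> X \<in> borel_measurable M \<and>
     distr M borel X =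
       (if v = 0 then return borel 0 else density lborel (\<lambda>x. ennreal (normal_density 0 (sqrt v) x)))"

definition noise_sets :: "(real \<times> real) set set" where
  "noise_sets = {A \<in> sets borel. A \<subseteq> {0..} \<times> {0..1} \<and> emeasure lborel A < \<infinity>}"

text \<open>Space-time white noise on \<open>[0,\<infinity>) \<times> [0,1]\<close>: a centered Gaussian family indexed by the Borel sets
  of finite area, with covariance \<open>E (W A * W B) = |A \<inter> B|\<close>. In particular \<open>W\<close> is almost surely
  additive on disjoint sets.\<close>

definition white_noise :: "'a measure \<Rightarrow> ((real \<times> real) set \<Rightarrow> 'a \<Rightarrow> real) \<Rightarrow> bool" where
  "white_noise M W \<longleftrightarrow>
     (\<forall>S c. finite S \<and> S \<subseteq> noise_sets \<longrightarrow>
        (\<exists>v. centered_gaussian M (\<lambda>\<omega>. \<Sum>A\<in>S. c A * W A \<omega>) v)) \<and>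
     (\<forall>A\<in>noise_sets. \<forall>B\<in>noise_sets.
        (LINT \<omega>|M. W A \<omega> * W B \<omega>) = measure lborel (A \<inter> B))"

definition noise_after :: "'a measure \<Rightarrow> ((real \<times> real) set \<Rightarrow> 'a \<Rightarrow> real) \<Rightarrow> real \<Rightarrow> 'a set set" where
  "noise_after M W t =
     sigma_sets (space M)
       {W A -` B \<inter> space M | A B. A \<in> noise_sets \<and> A \<subseteq> {t<..} \<times> {0..1} \<and> B \<in> sets borel}"

definition filtration_white_noise ::
  "'a measure \<Rightarrow> (real \<Rightarrow> 'a measure) \<Rightarrow> ((real \<times> real) set \<Rightarrow> 'a \<Rightarrow> real) \<Rightarrow> bool" where
  "filtration_white_noise M F W \<longleftrightarrow>
     white_noise M W \<and>
     (\<forall>t\<ge>0. \<forall>A\<in>noise_sets. A \<subseteq> {0..t} \<times> {0..1} \<longrightarrow> W A \<in> borel_measurable (F t)) \<and>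
     (\<forall>t\<ge>0. prob_space.indep_set M (sets (F t)) (noise_after M W t))"

text \<open>An entry \<open>(a, b, A, X)\<close> of the list stands for the elementary random field
  \<open>X(\<omega>) 1\<^bsub>(a,b]\<^esub>(s) 1\<^bsub>A\<^esub>(y)\<close> with \<open>X\<close> bounded and measurable with respect to \<open>F a\<close>.\<close>

type_synonym 'a simple_field = "(real \<times> real \<times> real set \<times> ('a \<Rightarrow> real)) list"

definition simple_field :: "'a measure \<Rightarrow> (real \<Rightarrow> 'a measure) \<Rightarrow> real \<Rightarrow> 'a simple_field \<Rightarrow> bool" where
  "simple_field M F T hs \<longleftrightarrow>
     (\<forall>(a, b, A, X) \<in> set hs.
        0 \<le> a \<and> a \<le> b \<and> b \<le> T \<and> A \<in> sets borel \<and> A \<subseteq> {0..1} \<and>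
        X \<in> borel_measurable (F a) \<and> bounded (X ` space M))"

definition simple_value :: "'a simple_field \<Rightarrow> real \<Rightarrow> real \<Rightarrow> 'a \<Rightarrow> real" where
  "simple_value hs s y \<omega> = (\<Sum>(a, b, A, X)\<leftarrow>hs. X \<omega> * indicator {a<..b} s * indicator A y)"

definition simple_integral :: "((real \<times> real) set \<Rightarrow> 'a \<Rightarrow> real) \<Rightarrow> 'a simple_field \<Rightarrow> 'a \<Rightarrow> real" where
  "simple_integral W hs \<omega> = (\<Sum>(a, b, A, X)\<leftarrow>hs. X \<omega> * W ({a<..b} \<times> A) \<omega>)"

definition predictable_sigma ::
  "'a measure \<Rightarrow> (real \<Rightarrow> 'a measure) \<Rightarrow> real \<Rightarrow> (real \<times> real \<times> 'a) measure" where
  "predictable_sigma M F T =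
     sigma ({0<..T} \<times> {0..1} \<times> space M)
       {{a<..b} \<times> A \<times> E | a b A E.
          0 \<le> a \<and> a \<le> b \<and> b \<le> T \<and> A \<in> sets borel \<and> A \<subseteq> {0..1} \<and> E \<in> sets (F a)}"

definition tends_to_0_in_prob :: "'a measure \<Rightarrow> (nat \<Rightarrow> 'a \<Rightarrow> ennreal) \<Rightarrow> bool" where
  "tends_to_0_in_prob M D \<longleftrightarrow>
     (\<forall>\<epsilon>>0. (\<lambda>n. measure M {\<omega> \<in> space M. ennreal \<epsilon> < D n \<omega>}) \<longlonglongrightarrow> 0)"

text \<open>\<open>walsh_integral M F W T H I\<close>: the random variable \<open>I\<close> is a version of the Walsh integral
  \<open>\<integral>\<^sub>0\<^sup>T \<integral>\<^sub>0\<^sup>1 H(s,y) W(ds,dy)\<close> of the predictable field \<open>H\<close>. It is the extension by approximation in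
  probability from simple fields, which is defined exactly when \<open>\<integral>\<^sub>0\<^sup>T \<integral>\<^sub>0\<^sup>1 H(s,y)\<^sup>2 dy ds < \<infinity>\<close> almost
  surely, and which is the usual isometric extension when this quantity has finite expectation. The
  integral is determined only up to almost sure equality.\<close>

definition walsh_integral ::
  "'a measure \<Rightarrow> (real \<Rightarrow> 'a measure) \<Rightarrow> ((real \<times> real) set \<Rightarrow> 'a \<Rightarrow> real) \<Rightarrow> real \<Rightarrow>
   (real \<Rightarrow> real \<Rightarrow> 'a \<Rightarrow> real) \<Rightarrow> ('a \<Rightarrow> real) \<Rightarrow> bool" where
  "walsh_integral M F W T H I \<longleftrightarrow>
     (\<lambda>(s, y, \<omega>). H s y \<omega>) \<in> borel_measurable (predictable_sigma M F T) \<and>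
     I \<in> borel_measurable M \<and>
     (\<exists>hs :: nat \<Rightarrow> 'a simple_field.
        (\<forall>n. simple_field M F T (hs n)) \<and>
        tends_to_0_in_prob M
          (\<lambda>n \<omega>. \<integral>\<^sup>+(s, y)\<in>{0<..T} \<times> {0..1}. ennreal ((simple_value (hs n) s y \<omega> - H s y \<omega>)\<^sup>2) \<partial>lborel) \<and>
        tends_to_0_in_prob M (\<lambda>n \<omega>. ennreal \<bar>simple_integral W (hs n) \<omega> - I \<omega>\<bar>))"

definition neumann_kernel :: "real \<Rightarrow> real \<Rightarrow> real \<Rightarrow> real" where
  "neumann_kernel t x y =
     1 / sqrt (4 * pi * t) *
       (\<Sum>\<^sub>\<infinity>n\<in>(UNIV :: int set).
          exp (- (y - x - 2 * real_of_int n)\<^sup>2 / (4 * t)) + exp (- (y + x - 2 * real_of_int n)\<^sup>2 / (4 * t)))"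

definition in_Linf_unit_interval :: "(real \<Rightarrow> real) \<Rightarrow> bool" where
  "in_Linf_unit_interval f \<longleftrightarrow>
     f \<in> borel_measurable (lebesgue_on {0..1}) \<and> (\<exists>C. AE y in lebesgue_on {0..1}. \<bar>f y\<bar> \<le> C)"

definition holder_continuous :: "real \<Rightarrow> (real \<Rightarrow> real) \<Rightarrow> bool" where
  "holder_continuous \<theta> f \<longleftrightarrow> (\<exists>C. \<forall>u v. \<bar>f u - f v\<bar> \<le> C * \<bar>u - v\<bar> powr \<theta>)"

definition linear_growth :: "(real \<Rightarrow> real) \<Rightarrow> bool" where
  "linear_growth f \<longleftrightarrow> (\<exists>C. \<forall>u. \<bar>f u\<bar> \<le> C * (1 + \<bar>u\<bar>))"

definition continuous_field :: "'a measure \<Rightarrow> (real \<Rightarrow> real \<Rightarrow> 'a \<Rightarrow> real) \<Rightarrow> bool" where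
  "continuous_field M U \<longleftrightarrow>
     (\<forall>\<omega>\<in>space M. continuous_on ({0<..} \<times> {0..1}) (\<lambda>(t, x). U t x \<omega>))"

definition adapted_field :: "(real \<Rightarrow> 'a measure) \<Rightarrow> (real \<Rightarrow> real \<Rightarrow> 'a \<Rightarrow> real) \<Rightarrow> bool" where
  "adapted_field F U \<longleftrightarrow> (\<forall>t>0. \<forall>x\<in>{0..1}. U t x \<in> borel_measurable (F t))"

text \<open>For each \<open>(t,x)\<close> the stochastic integral is only defined up to a null set, so the requirement
  that the equation hold almost surely for all \<open>(t,x)\<close> simultaneously is expressed through a random
  field \<open>I\<close> of versions of it. That the drift integral makes sense is part of the equation.\<close>

definition weak_solution ::
  "'a measure \<Rightarrow> (real \<Rightarrow> 'a measure) \<Rightarrow> ((real \<times> real) set \<Rightarrow> 'a \<Rightarrow> real) \<Rightarrow>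
   (real \<Rightarrow> real) \<Rightarrow> (real \<Rightarrow> real) \<Rightarrow> (real \<Rightarrow> real) \<Rightarrow> (real \<Rightarrow> real \<Rightarrow> 'a \<Rightarrow> real) \<Rightarrow> bool" where
  "weak_solution M F W b \<sigma> U0 U \<longleftrightarrow>
     continuous_field M U \<and> adapted_field F U \<and>
     (\<exists>I :: real \<Rightarrow> real \<Rightarrow> 'a \<Rightarrow> real.
        (\<forall>t>0. \<forall>x\<in>{0..1}.
           walsh_integral M F W t (\<lambda>s y \<omega>. neumann_kernel (t - s) x y * \<sigma> (U s y \<omega>)) (I t x)) \<and>
        (AE \<omega> in M. \<forall>t>0. \<forall>x\<in>{0..1}.
           set_integrable lborel ({0<..<t} \<times> {0..1})
             (\<lambda>(s, y). neumann_kernel (t - s) x y * b (U s y \<omega>)) \<and>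
           U t x \<omega> =
             (LINT y|lebesgue_on {0..1}. neumann_kernel t x y * U0 y)
             + set_lebesgue_integral lborel ({0<..<t} \<times> {0..1})
                 (\<lambda>(s, y). neumann_kernel (t - s) x y * b (U s y \<omega>))
             + I t x \<omega>))"

definition has_density_on :: "real measure \<Rightarrow> real set \<Rightarrow> bool" where
  "has_density_on \<mu> D \<longleftrightarrow> (\<forall>A\<in>null_sets lborel. emeasure \<mu> (A \<inter> D) = 0)"

end

theory Submission imports Defs begin

text \<open>Localization and the method of Fournier and Printems. For a short time \<open>\<epsilon>\<close> before \<open>t\<close>, write
  \<open>U(t,x) = Z + D + J\<close> with \<open>Z\<close> known at time \<open>t - \<epsilon>\<close>, \<open>D\<close> the drift and \<open>J\<close> the stochastic integral
  over the last \<open>\<epsilon>\<close> time units. Since \<open>U(s,y)\<close> differs in mean square by \<open>O(\<epsilon>\<^sup>1\<^sup>/\<^sup>4)\<close> from a variable known at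
  time \<open>t - \<epsilon>\<close>, the integrand of \<open>J\<close> can be frozen at the price of an error \<open>O(\<epsilon>\<^sup>(\<^sup>1\<^sup>+\<^sup>\<theta>\<^sup>)\<^sup>/\<^sup>4)\<close>, and the frozen
  integral is conditionally Gaussian with variance at least of order \<open>\<surd>\<epsilon>\<close> wherever \<open>\<sigma>(U)\<close> stays away from \<open>0\<close>. Taking
  \<open>\<epsilon>\<close> slightly larger than \<open>\<bar>\<xi>\<bar>\<^sup>-\<^sup>4\<close>, the localized characteristic function is \<open>O(\<bar>\<xi>\<bar>\<^sup>-\<^sup>p)\<close> with some \<open>p > 1/2\<close>, precisely because
  \<open>\<theta> > 1/2\<close>; being square integrable, it belongs to an absolutely continuous measure.\<close>

text \<open>No moment of the solution is assumed, and near time 0 nothing is known beyond almost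
  sure finiteness of the integrals in the equation. The second moments that the estimates live on
  have to be created by switching off the coefficients along bad paths, and this has its price. The
  stochastic integral is defined by approximation in probability, so changing its integrand off an
  event requires a locality theorem, proved through a truncation inequality for simple fields. The
  event that weights the conditional Gaussian law must be known before the last \<epsilon> time
  units, which a cutoff of the late path is not; the cutoff level is sent to infinity, and this
  works because on a short window (t1, T] the equation bounds the second moment by a contraction,
  independently of the level. The filtration is not assumed complete or right continuous, so
  switches look at rational times and limits are taken pointwise. Nondegeneracy of \<sigma>(U)
  concerns the late path as well; it is replaced by a coefficient modified to be elliptic near x,
  whose integral is the original one on the nondegeneracy event.\<close>

abbreviation msq :: "'a measure => ('a => real) => ennreal" where
  "msq N f \<equiv> \<integral>\<^sup>+x. ennreal ((f x)\<^sup>2) \<partial>N"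

abbreviation defect :: "'a simple_field => (real => real => 'a => real) => real => real => 'a => real" where
  "defect hs H \<equiv> \<lambda>s y w. simple_value hs s y w - H s y w"

abbreviation kernel_sq :: "real => real => real => real => real \<times> real => ennreal" where
  "kernel_sq t x a b p \<equiv> ennreal ((neumann_kernel (t - fst p) x (snd p))\<^sup>2) * indicator ({a<..b} \<times> {0..1}) p"

section \<open>White noise\<close>

lemma char_normal_density:
  assumes "0 < s"
  shows "char (density lborel (\<lambda>x. ennreal (normal_density 0 s x))) \<xi> = of_real (exp (- (\<xi>\<^sup>2 * s\<^sup>2 / 2)))"
proof -
  interpret S: prob_space std_normal_distribution
    by (rule prob_space_normal_density) simp
  have id: "distributed std_normal_distribution lborel (\<lambda>x. x) (\<lambda>x. ennreal (std_normal_density x))"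
    unfolding distributed_def by (auto simp: distr_id2)
  have "distributed std_normal_distribution lborel (\<lambda>x. 0 + s * x) (\<lambda>x. ennreal (normal_density (0 + s * 0) (\<bar>s\<bar> * 1) x))"
    by (rule S.normal_density_affine[OF id]) (use assms in auto)
  then have "density lborel (\<lambda>x. ennreal (normal_density 0 s x)) = distr std_normal_distribution lborel (\<lambda>x. s * x)"
    using assms unfolding distributed_def by simp
  then have "char (density lborel (\<lambda>x. ennreal (normal_density 0 s x))) \<xi> =
      (CLINT x|std_normal_distribution. iexp (\<xi> * (s * x)))"
    unfolding char_def by (simp add: integral_distr)
  also have "\<dots> = char std_normal_distribution (\<xi> * s)"
    unfolding char_def by (simp add: mult.assoc)
  finally show ?thesis
    by (simp add: char_std_normal_distribution power_mult_distrib)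
qed

lemma centered_gaussian_moments:
  assumes "prob_space M" and X: "centered_gaussian M X v"
  shows "integrable M (\<lambda>w. (X w)\<^sup>2)" and "integrable M X" and "(LINT w|M. X w) = 0"
    and "(LINT w|M. (X w)\<^sup>2) = v"
    and "(LINT w|M. iexp (\<xi> * X w)) = of_real (exp (- (\<xi>\<^sup>2 * v / 2)))"
proof -
  have m[measurable]: "X \<in> borel_measurable M" and v: "0 \<le> v"
    using X by (auto simp: centered_gaussian_def)
  have D: "distr M borel X =
       (if v = 0 then return borel 0 else density lborel (\<lambda>x. ennreal (normal_density 0 (sqrt v) x)))"
    using X by (auto simp: centered_gaussian_def)
  have *: "integrable (distr M borel X) (\<lambda>x. x\<^sup>2) \<and> integrable (distr M borel X) (\<lambda>x. x)
      \<and> (LINT x|distr M borel X. x) = 0 \<and> (LINT x|distr M borel X. x\<^sup>2) = v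
      \<and> (LINT x|distr M borel X. iexp (\<xi> * x)) = of_real (exp (- (\<xi>\<^sup>2 * v / 2)))"
  proof (cases "v = 0")
    case True
    then show ?thesis unfolding D
      by (simp add: integral_return integrable_iff_bounded nn_integral_return)
  next
    case False
    then have s: "0 < sqrt v" "(sqrt v)\<^sup>2 = v" using v by auto
    have 1: "has_bochner_integral lborel (\<lambda>x. normal_density 0 (sqrt v) x * x\<^sup>2) v"
      using normal_moment_even[OF s(1), of 0 1] s by (simp add: mult.commute)
    have 2: "has_bochner_integral lborel (\<lambda>x. normal_density 0 (sqrt v) x * x) 0"
      using normal_moment_odd[OF s(1), of 0 0] s by (simp add: field_simps)
    show ?thesis unfolding D using False 1 2 char_normal_density[OF s(1), of \<xi>] s
      by (simp add: integrable_density integral_density has_bochner_integral_iff char_def)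
  qed
  show "integrable M (\<lambda>w. (X w)\<^sup>2)" "integrable M X" "(LINT w|M. X w) = 0"
    "(LINT w|M. (X w)\<^sup>2) = v" "(LINT w|M. iexp (\<xi> * X w)) = of_real (exp (- (\<xi>\<^sup>2 * v / 2)))"
    using * by (simp_all add: integrable_distr_eq integral_distr)
qed

lemma integrable_mult_of_squares:
  fixes f g :: "'a => real"
  assumes [measurable]: "f \<in> borel_measurable M" "g \<in> borel_measurable M"
    and "integrable M (\<lambda>x. (f x)\<^sup>2)" "integrable M (\<lambda>x. (g x)\<^sup>2)"
  shows "integrable M (\<lambda>x. f x * g x)"
proof (rule Bochner_Integration.integrable_bound[OF Bochner_Integration.integrable_add[OF assms(3,4)]])
  have "\<bar>a * b\<bar> \<le> a\<^sup>2 + b\<^sup>2" for a b :: real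
    using sum_squares_bound[of a b] sum_squares_bound[of a "-b"] zero_le_power2[of a] zero_le_power2[of b] by (simp add: abs_le_iff)
  then show "AE x in M. norm (f x * g x) \<le> norm ((f x)\<^sup>2 + (g x)\<^sup>2)" by simp
qed simp

lemma integrable_bounded_mult:
  fixes f g :: "'a => real"
  assumes [measurable]: "f \<in> borel_measurable M" and "bounded (f ` space M)" and g: "integrable M g"
  shows "integrable M (\<lambda>x. f x * g x)"
proof -
  obtain C where C: "\<And>x. x \<in> space M ==> \<bar>f x\<bar> \<le> C"
    using assms(2) unfolding bounded_iff by auto
  show ?thesis
  proof (rule Bochner_Integration.integrable_bound[OF integrable_mult_right[of C, OF g]])
    show "AE x in M. norm (f x * g x) \<le> norm (C * g x)"
      by (intro AE_I2) (simp add: abs_mult mult_right_mono order_trans[OF C abs_ge_self])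
  qed (use g in auto)
qed

locale white_noise_space =
  fixes M :: "'a measure" and F :: "real => 'a measure" and W :: "(real \<times> real) set => 'a => real"
  assumes filtered: "filtered_prob_space M F" and noise: "filtration_white_noise M F W"

sublocale white_noise_space \<subseteq> prob_space M
  using filtered by (simp add: filtered_prob_space_def)

context white_noise_space
begin

lemma subalg: "0 \<le> t ==> subalgebra M (F t)"
  using filtered by (simp add: filtered_prob_space_def)

lemma space_F [simp]: "0 \<le> t ==> space (F t) = space M"
  using subalg by (simp add: subalgebra_def)

lemma sets_F_mono: "0 \<le> s ==> s \<le> t ==> sets (F s) \<subseteq> sets (F t)"
  using filtered by (simp add: filtered_prob_space_def)

lemma sets_F_sub: "0 \<le> t ==> A \<in> sets (F t) ==> A \<in> sets M"
  using subalg by (auto simp: subalgebra_def)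

lemma subalg_F: "0 \<le> s ==> s \<le> t ==> subalgebra (F t) (F s)"
  using sets_F_mono by (simp add: subalgebra_def)

lemma measurable_F_mono: "0 \<le> s ==> s \<le> t ==> X \<in> measurable (F s) N ==> X \<in> measurable (F t) N"
  by (rule measurable_from_subalg[OF subalg_F])

lemma measurable_F: "0 \<le> t ==> X \<in> measurable (F t) N ==> X \<in> measurable M N"
  by (rule measurable_from_subalg[OF subalg])

lemma W_gaussian: "finite S ==> S \<subseteq> noise_sets ==> \<exists>v. centered_gaussian M (\<lambda>w. \<Sum>A\<in>S. c A * W A w) v"
  using noise by (auto simp: filtration_white_noise_def white_noise_def)

lemma W_gaussian1: "A \<in> noise_sets ==> \<exists>v. centered_gaussian M (W A) v"
  using W_gaussian[of "{A}" "\<lambda>_. 1"] by simp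

lemma W_measurable: "A \<in> noise_sets ==> W A \<in> borel_measurable M"
  using W_gaussian1[of A] by (auto simp: centered_gaussian_def)

lemma W_square_integrable: "A \<in> noise_sets ==> integrable M (\<lambda>w. (W A w)\<^sup>2)"
  using W_gaussian1[of A] centered_gaussian_moments(1)[OF prob_space_axioms] by blast

lemma W_integrable: "A \<in> noise_sets ==> integrable M (W A)"
  using W_gaussian1[of A] centered_gaussian_moments(2)[OF prob_space_axioms] by blast

lemma W_mean: "A \<in> noise_sets ==> (LINT w|M. W A w) = 0"
  using W_gaussian1[of A] centered_gaussian_moments(3)[OF prob_space_axioms] by blast

lemma W_prod_integrable: "A \<in> noise_sets ==> B \<in> noise_sets ==> integrable M (\<lambda>w. W A w * W B w)"
  by (intro integrable_mult_of_squares W_measurable W_square_integrable)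

lemma W_cov: "A \<in> noise_sets ==> B \<in> noise_sets ==> (LINT w|M. W A w * W B w) = measure lborel (A \<inter> B)"
  using noise by (auto simp: filtration_white_noise_def white_noise_def)

lemma W_adapted: "0 \<le> t ==> A \<in> noise_sets ==> A \<subseteq> {0..t} \<times> {0..1} ==> W A \<in> borel_measurable (F t)"
  using noise by (auto simp: filtration_white_noise_def)

text \<open>The covariance decides: the second moment of the defect expands into covariances, which
  cancel because area is additive. The exceptional null set depends on the two sets.\<close>

lemma W_additive:
  assumes A: "A \<in> noise_sets" and B: "B \<in> noise_sets" and AB: "A \<inter> B = {}"
  shows "AE w in M. W (A \<union> B) w = W A w + W B w"
proof -
  have fin: "emeasure lborel A < \<infinity>" "emeasure lborel B < \<infinity>" and s: "A \<in> sets borel" "B \<in> sets borel"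
    using A B by (auto simp: noise_sets_def)
  have "emeasure lborel (A \<union> B) \<le> emeasure lborel A + emeasure lborel B"
    by (rule emeasure_subadditive) (use s in auto)
  also have "\<dots> < \<infinity>" using fin by (simp add: less_top)
  finally have C: "A \<union> B \<in> noise_sets" using A B by (auto simp: noise_sets_def)
  have mu: "measure lborel (A \<union> B) = measure lborel A + measure lborel B"
    using fin s AB by (intro measure_Union) auto
  note [measurable] = W_measurable[OF A] W_measurable[OF B] W_measurable[OF C]
  note I = W_prod_integrable[OF C C] W_prod_integrable[OF A A] W_prod_integrable[OF B B]
    W_prod_integrable[OF C A] W_prod_integrable[OF C B] W_prod_integrable[OF A B]
  let ?f = "\<lambda>w. (W (A \<union> B) w - (W A w + W B w))\<^sup>2"
  let ?g = "\<lambda>w. W (A \<union> B) w * W (A \<union> B) w + W A w * W A w + W B w * W B w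
     - 2 * (W (A \<union> B) w * W A w) - 2 * (W (A \<union> B) w * W B w) + 2 * (W A w * W B w)"
  have eq: "?f = ?g" by (auto simp: fun_eq_iff power2_eq_square algebra_simps)
  have int: "integrable M ?f" unfolding eq
    by (intro Bochner_Integration.integrable_add Bochner_Integration.integrable_diff integrable_mult_right I)
  have "(A \<union> B) \<inter> A = A" "(A \<union> B) \<inter> B = B" by auto
  then have "(LINT w|M. ?f w) = 0" unfolding eq
    using AB by (simp add: I W_cov A B C mu)
  then have "AE w in M. ?f w = 0"
    by (subst (asm) integral_nonneg_eq_0_iff_AE[OF int]) auto
  then show ?thesis by eventually_elim simp
qed

text \<open>The future noise is packed into a measure, of which only the sets matter, so that
  independence of the past can be phrased through measurability of maps.\<close>

definition after :: "real => 'a measure" where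
  "after t = sigma (space M) {W A -` B \<inter> space M | A B. A \<in> noise_sets \<and> A \<subseteq> {t<..} \<times> {0..1} \<and> B \<in> sets borel}"

lemma space_after [simp]: "space (after t) = space M"
  unfolding after_def by (rule space_measure_of) auto

lemma sets_after: "sets (after t) = noise_after M W t"
  unfolding after_def noise_after_def by (rule sets_measure_of) auto

lemma W_after:
  assumes "A \<in> noise_sets" "A \<subseteq> {t<..} \<times> {0..1}"
  shows "W A \<in> borel_measurable (after t)"
proof (rule measurableI)
  fix B :: "real set" assume "B \<in> sets borel"
  then have "W A -` B \<inter> space M \<in> noise_after M W t"
    unfolding noise_after_def using assms by (intro sigma_sets.Basic) blast
  then show "W A -` B \<inter> space (after t) \<in> sets (after t)"
    by (simp add: sets_after)
qed simp

lemma indep_after: "0 \<le> t ==> indep_set (sets (F t)) (sets (after t))"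
  using noise by (auto simp: filtration_white_noise_def sets_after)

lemma subalg_after: "0 \<le> t ==> subalgebra M (after t)"
  using indep_setD_ev2[OF indep_after] by (auto simp: subalgebra_def)

lemma measurable_after: "0 \<le> t ==> X \<in> measurable (after t) N ==> X \<in> measurable M N"
  by (rule measurable_from_subalg[OF subalg_after])

lemma indep_var_after:
  assumes "0 \<le> t" and X: "X \<in> measurable (F t) N" and Y: "Y \<in> measurable (after t) N'"
  shows "indep_var N X N' Y"
  unfolding indep_var_eq
proof (intro conjI)
  show "random_variable N X" "random_variable N' Y"
    using measurable_F[OF assms(1) X] measurable_after[OF assms(1) Y] by auto
  have a: "sigma_sets (space M) {X -` A \<inter> space M |A. A \<in> sets N} \<subseteq> sets (F t)"
    using sets.sigma_sets_subset[of "{X -` A \<inter> space M |A. A \<in> sets N}" "F t"] measurable_sets[OF X] assms(1)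
    by (auto simp: )
  have b: "sigma_sets (space M) {Y -` A \<inter> space M |A. A \<in> sets N'} \<subseteq> sets (after t)"
    using sets.sigma_sets_subset[of "{Y -` A \<inter> space M |A. A \<in> sets N'}" "after t"] measurable_sets[OF Y]
    by (auto simp: )
  show "indep_set (sigma_sets (space M) {X -` A \<inter> space M |A. A \<in> sets N})
     (sigma_sets (space M) {Y -` A \<inter> space M |A. A \<in> sets N'})"
    using indep_after[OF assms(1)] a b unfolding indep_sets2_eq by blast
qed

lemma rect_noise:
  assumes "0 \<le> a" "A \<in> sets borel" "A \<subseteq> {0..1}"
  shows "{a<..b} \<times> A \<in> noise_sets"
proof -
  have "bounded ({a<..b} \<times> A)"
    using assms by (intro bounded_Times) (auto intro: bounded_subset[of "{a..b}"] bounded_subset[of "{0..1}"])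
  then have "emeasure lborel ({a<..b} \<times> A) < \<infinity>"
    using emeasure_bounded_finite by blast
  then show ?thesis using assms by (auto simp: noise_sets_def intro!: borel_Times)
qed

end

section \<open>Approximation in mean square\<close>

lemma ennreal_twice_add: "0 \<le> a ==> 0 \<le> b ==> 2 * ennreal a + 2 * ennreal b = ennreal (2 * a + 2 * b)"
  by (simp add: ennreal_plus ennreal_mult')

lemma nn_integral_square_add:
  fixes f g :: "'a => real"
  assumes [measurable]: "f \<in> borel_measurable N" "g \<in> borel_measurable N"
  shows "msq N (\<lambda>x. f x + g x) \<le> 2 * msq N f + 2 * msq N g"
proof -
  have "(a + b)\<^sup>2 \<le> 2 * a\<^sup>2 + 2 * b\<^sup>2" for a b :: real
    using sum_squares_bound[of a b] by (simp add: power2_sum)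
  then have "ennreal ((f x + g x)\<^sup>2) \<le> ennreal (2 * (f x)\<^sup>2 + 2 * (g x)\<^sup>2)" for x
    by (rule ennreal_leI)
  then have "ennreal ((f x + g x)\<^sup>2) \<le> 2 * ennreal ((f x)\<^sup>2) + 2 * ennreal ((g x)\<^sup>2)" for x
    by (subst ennreal_twice_add) simp_all
  then have "msq N (\<lambda>x. f x + g x) \<le> (\<integral>\<^sup>+x. 2 * ennreal ((f x)\<^sup>2) + 2 * ennreal ((g x)\<^sup>2) \<partial>N)"
    by (intro nn_integral_mono)
  also have "\<dots> = 2 * msq N f + 2 * msq N g"
    by (simp add: nn_integral_add nn_integral_cmult)
  finally show ?thesis .
qed

definition combination :: "(real \<times> 'a set) list => 'a => real" where
  "combination cs x = (\<Sum>(c, g)\<leftarrow>cs. c * indicator g x)"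

lemma combination_simps [simp]:
  "combination [] x = 0"
  "combination ((c, g) # cs) x = c * indicator g x + combination cs x"
  "combination (cs @ ds) x = combination cs x + combination ds x"
  by (simp_all add: combination_def)

lemma combination_map_cmult: "combination (map (\<lambda>(c, g). (k * c, g)) cs) x = k * combination cs x"
  by (induction cs) (auto simp: algebra_simps)

lemma measurable_combination:
  "snd ` set cs \<subseteq> sets N ==> combination cs \<in> borel_measurable N"
proof (induction cs)
  case Nil
  then show ?case by (simp add: combination_def[abs_def])
next
  case (Cons a cs)
  obtain c g where a: "a = (c, g)" by force
  with Cons have [measurable]: "g \<in> sets N" "combination cs \<in> borel_measurable N" by auto
  show ?case unfolding a combination_simps(2)[abs_def] by simp
qed

text \<open>The bound \<open>e\<close> is for the squared distance. Extended integrals keep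
  finiteness of the norms out of the closure properties below.\<close>

definition approximable :: "'a measure => 'a set set => ('a => real) => bool" where
  "approximable N G f \<longleftrightarrow> f \<in> borel_measurable N \<and>
     (\<forall>e>0. \<exists>cs. snd ` set cs \<subseteq> G \<and> (msq N (\<lambda>x. combination cs x - f x)) \<le> ennreal e)"

lemma approximableD:
  "approximable N G f ==> 0 < e ==>
    \<exists>cs. snd ` set cs \<subseteq> G \<and> (msq N (\<lambda>x. combination cs x - f x)) \<le> ennreal e"
  by (simp add: approximable_def)

lemma approximable_measurable: "approximable N G f ==> f \<in> borel_measurable N"
  by (simp add: approximable_def)

text \<open>Each of the two distances gets e / 4, because squaring a sum costs a factor 2.\<close>

lemma approximable_limit:
  assumes G: "G \<subseteq> sets N" and f[measurable]: "f \<in> borel_measurable N"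
    and *: "\<And>e. 0 < e ==> \<exists>g. approximable N G g \<and> (msq N (\<lambda>x. g x - f x)) \<le> ennreal e"
  shows "approximable N G f"
  unfolding approximable_def
proof (intro conjI allI impI f)
  fix e :: real assume e: "0 < e"
  then obtain g where g: "approximable N G g" "msq N (\<lambda>x. g x - f x) \<le> ennreal (e / 4)"
    using *[of "e / 4"] by auto
  then obtain cs where cs: "snd ` set cs \<subseteq> G" "msq N (\<lambda>x. combination cs x - g x) \<le> ennreal (e / 4)"
    using approximableD[OF g(1), of "e / 4"] e by auto
  have [measurable]: "g \<in> borel_measurable N" "combination cs \<in> borel_measurable N"
    using approximable_measurable[OF g(1)] measurable_combination[OF order_trans[OF cs(1) G]] by auto
  have "msq N (\<lambda>x. combination cs x - f x) = msq N (\<lambda>x. (combination cs x - g x) + (g x - f x))"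
    by simp
  also have "\<dots> \<le> 2 * msq N (\<lambda>x. combination cs x - g x) + 2 * msq N (\<lambda>x. g x - f x)"
    by (rule nn_integral_square_add) auto
  also have "\<dots> \<le> 2 * ennreal (e / 4) + 2 * ennreal (e / 4)"
    by (intro add_mono mult_left_mono g cs) auto
  also have "\<dots> = ennreal e"
    using e by (simp add: ennreal_twice_add)
  finally show "\<exists>cs. snd ` set cs \<subseteq> G \<and> (msq N (\<lambda>x. combination cs x - f x)) \<le> ennreal e"
    using cs by blast
qed

lemma approximable_add:
  assumes G: "G \<subseteq> sets N" and f: "approximable N G f" and g: "approximable N G g"
  shows "approximable N G (\<lambda>x. f x + g x)"
  unfolding approximable_def
proof (intro conjI allI impI)
  have [measurable]: "f \<in> borel_measurable N" "g \<in> borel_measurable N"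
    using f g by (auto simp: approximable_def)
  show "(\<lambda>x. f x + g x) \<in> borel_measurable N" by simp
  fix e :: real assume e: "0 < e"
  then have e4: "0 < e / 4" by simp
  obtain cs where cs: "snd ` set cs \<subseteq> G" "msq N (\<lambda>x. combination cs x - f x) \<le> ennreal (e / 4)"
    using approximableD[OF f e4] by blast
  obtain ds where ds: "snd ` set ds \<subseteq> G" "msq N (\<lambda>x. combination ds x - g x) \<le> ennreal (e / 4)"
    using approximableD[OF g e4] by blast
  have [measurable]: "combination ds \<in> borel_measurable N" "combination cs \<in> borel_measurable N"
    using measurable_combination[OF order_trans[OF cs(1) G]] measurable_combination[OF order_trans[OF ds(1) G]] by auto
  have "msq N (\<lambda>x. combination (cs @ ds) x - (f x + g x)) = msq N (\<lambda>x. (combination cs x - f x) + (combination ds x - g x))"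
    by (simp add: algebra_simps)
  also have "\<dots> \<le> 2 * msq N (\<lambda>x. combination cs x - f x) + 2 * msq N (\<lambda>x. combination ds x - g x)"
    by (rule nn_integral_square_add) auto
  also have "\<dots> \<le> 2 * ennreal (e / 4) + 2 * ennreal (e / 4)"
    by (intro add_mono mult_left_mono ds cs) auto
  also have "\<dots> = ennreal e"
    using e by (simp add: ennreal_twice_add)
  finally show "\<exists>cs. snd ` set cs \<subseteq> G \<and> (msq N (\<lambda>x. combination cs x - (f x + g x))) \<le> ennreal e"
    using cs ds by (intro exI[of _ "cs @ ds"]) auto
qed

lemma approximable_cmult:
  assumes G: "G \<subseteq> sets N" and f: "approximable N G f"
  shows "approximable N G (\<lambda>x. k * f x)"
  unfolding approximable_def
proof (intro conjI allI impI)
  have [measurable]: "f \<in> borel_measurable N"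
    using f by (auto simp: approximable_def)
  show "(\<lambda>x. k * f x) \<in> borel_measurable N" by simp
  fix e :: real assume e: "0 < e"
  \<comment> \<open>Dividing by \<open>k^2 + 1\<close> covers k = 0 as well.\<close>
  have k: "0 < k\<^sup>2 + 1" by (simp add: add_nonneg_pos)
  then have "0 < e / (k\<^sup>2 + 1)" using e by simp
  then obtain cs where cs: "snd ` set cs \<subseteq> G" "msq N (\<lambda>x. combination cs x - f x) \<le> ennreal (e / (k\<^sup>2 + 1))"
    using approximableD[OF f] by blast
  have [measurable]: "combination cs \<in> borel_measurable N"
    using measurable_combination[OF order_trans[OF cs(1) G]] by auto
  let ?ds = "map (\<lambda>(c, g). (k * c, g)) cs"
  have "msq N (\<lambda>x. combination ?ds x - k * f x) = (\<integral>\<^sup>+x. ennreal (k\<^sup>2) * ennreal ((combination cs x - f x)\<^sup>2) \<partial>N)"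
    unfolding combination_map_cmult by (simp flip: ennreal_mult power_mult_distrib add: algebra_simps)
  also have "\<dots> = ennreal (k\<^sup>2) * msq N (\<lambda>x. combination cs x - f x)"
    by (rule nn_integral_cmult) simp
  also have "\<dots> \<le> ennreal (k\<^sup>2) * ennreal (e / (k\<^sup>2 + 1))"
    by (intro mult_left_mono cs) auto
  also have "\<dots> \<le> ennreal e"
  proof -
    have "k\<^sup>2 * e / (k\<^sup>2 + 1) \<le> e"
      using e pos_divide_le_eq[OF k, of "k\<^sup>2 * e" e] by (simp add: algebra_simps)
    then show ?thesis using e k by (simp flip: ennreal_mult add: ennreal_leI)
  qed
  finally show "\<exists>cs. snd ` set cs \<subseteq> G \<and> (msq N (\<lambda>x. combination cs x - k * f x)) \<le> ennreal e"
    using cs by (intro exI[of _ ?ds]) (auto simp: image_iff)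
qed

lemma approximable_zero: "approximable N G (\<lambda>x. 0)"
  unfolding approximable_def by (auto intro!: exI[of _ "[]"])

lemma approximable_generator: "G \<subseteq> sets N ==> g \<in> G ==> approximable N G (indicator g)"
  unfolding approximable_def by (auto intro!: exI[of _ "[(1, g)]"])

lemma approximable_sum:
  assumes "G \<subseteq> sets N" "\<And>i. i \<in> I ==> approximable N G (f i)" "finite I"
  shows "approximable N G (\<lambda>x. \<Sum>i\<in>I. f i x)"
  using assms(3,2)
proof (induction I rule: finite_induct)
  case (insert i I)
  then have "approximable N G (\<lambda>x. f i x + (\<Sum>i\<in>I. f i x))"
    by (intro approximable_add[OF assms(1)]) auto
  then show ?case using insert by simp
qed (simp add: approximable_zero)

text \<open>Dynkin's argument. Complements are \<Omega> minus A, which is why \<Omega> itself has to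
  be a generator; a disjoint union is approximated by finite partial unions, because N is finite and
  the remaining tails decrease to the empty set.\<close>

lemma approximable_indicator:
  assumes N: "finite_measure N" "sets N = sigma_sets \<Omega> G" and G: "Int_stable G" "G \<subseteq> Pow \<Omega>" "\<Omega> \<in> G"
    and A: "A \<in> sigma_sets \<Omega> G"
  shows "approximable N G (indicator A)"
proof -
  interpret N: finite_measure N by fact
  have GN: "G \<subseteq> sets N" using N(2) by auto

  show ?thesis
    using G(1,2) A
  proof (induction rule: sigma_sets_induct_disjoint)
    case (basic A)
    then show ?case using approximable_generator[OF GN] by blast
  next
    case empty
    show ?case using approximable_zero by simp
  next
    case (compl A)
    have "approximable N G (\<lambda>x. indicator \<Omega> x + (-1) * indicator A x)"
      by (intro approximable_add GN approximable_cmult approximable_generator G compl)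
    moreover have "A \<subseteq> \<Omega>" using compl(1) G(2) by (metis sigma_sets_into_sp)
    then have "(\<lambda>x. indicator \<Omega> x + (-1) * indicator A x) = (indicator (\<Omega> - A) :: _ => real)"
      by (auto simp: fun_eq_iff indicator_def)
    ultimately show ?case by simp
  next
    case (union A)
    have Am[measurable]: "A i \<in> sets N" for i using union N by auto
    show ?case
    proof (rule approximable_limit[OF GN])
      show "indicator (\<Union> (range A)) \<in> borel_measurable N" by measurable
      fix e :: real assume e: "0 < e"
      let ?R = "\<lambda>n. (\<Union>i. A i) - (\<Union>i<n. A i)"
      have "(\<lambda>n. emeasure N (?R n)) \<longlonglongrightarrow> emeasure N (\<Inter>n. ?R n)"
        by (rule Lim_emeasure_decseq) (auto simp: decseq_def)
      moreover have "(\<Inter>n. ?R n) = {}" by auto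
      ultimately have "(\<lambda>n. emeasure N (?R n)) \<longlonglongrightarrow> 0" by (simp only: emeasure_empty)
      then have "\<forall>\<^sub>F n in sequentially. emeasure N (?R n) < ennreal e"
        using e by (intro order_tendstoD) auto
      then obtain n where n: "emeasure N (?R n) < ennreal e" by (auto simp: eventually_sequentially)
      have *: "(\<Sum>i<n. indicator (A i) x) = (indicator (\<Union>i<n. A i) x :: real)" for x
        by (rule indicator_UN_disjoint[symmetric]) (use union in \<open>auto simp: disjoint_family_on_def\<close>)
      have "msq N (\<lambda>x. (\<Sum>i<n. indicator (A i) x) - indicator (\<Union> (range A)) x) = (\<integral>\<^sup>+x. indicator (?R n) x \<partial>N)"
        unfolding * by (intro nn_integral_cong) (auto simp: indicator_def)
      also have "\<dots> = emeasure N (?R n)" by simp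
      finally have "msq N (\<lambda>x. (\<Sum>i<n. indicator (A i) x) - indicator (\<Union> (range A)) x) \<le> ennreal e"
        using n by simp
      moreover have "approximable N G (\<lambda>x. \<Sum>i<n. indicator (A i) x)"
        by (rule approximable_sum[OF GN union(3)]) simp
      ultimately show "\<exists>g. approximable N G g \<and> (msq N (\<lambda>x. g x - indicator (\<Union> (range A)) x)) \<le> ennreal e"
        by blast
    qed
  qed
qed

text \<open>Induction over nonnegative measurable functions, then positive and negative parts. In
  the limit step the squared errors are dominated by f^2, so pointwise convergence becomes
  convergence in mean square. Finiteness of the norm belongs to the induction claim, since it passes
  down to the smaller functions from which f is built.\<close>

lemma approximable_square_integrable:
  assumes N: "finite_measure N" "sets N = sigma_sets \<Omega> G" and G: "Int_stable G" "G \<subseteq> Pow \<Omega>" "\<Omega> \<in> G"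
    and f: "f \<in> borel_measurable N" "msq N f < \<infinity>"
  shows "approximable N G f"
proof -
  have GN: "G \<subseteq> sets N" using N(2) by auto
  have nonneg: "msq N f < \<infinity> \<longrightarrow> approximable N G f"
    if "f \<in> borel_measurable N" "\<And>x. 0 \<le> f x" for f :: "'a => real"
    using that
  proof (induction rule: borel_measurable_induct_real)
    case (set A)
    then show ?case using approximable_indicator[OF N G] N(2) by simp
  next
    case (mult u c)
    show ?case
    proof (cases "c = 0")
      case False
      have "msq N (\<lambda>x. c * u x) = ennreal (c\<^sup>2) * msq N u"
        using mult by (simp add: power_mult_distrib ennreal_mult nn_integral_cmult)
      then show ?thesis using False mult
        by (auto simp: ennreal_mult_less_top intro!: approximable_cmult GN)
    qed (simp add: approximable_zero)
  next
    case (add u v)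
    have "msq N u \<le> msq N (\<lambda>x. v x + u x)"
         "msq N v \<le> msq N (\<lambda>x. v x + u x)"
      using add by (auto intro!: nn_integral_mono ennreal_leI power_mono)
    with add.IH have "msq N (\<lambda>x. v x + u x) < \<infinity> ==> approximable N G v \<and> approximable N G u"
      using le_less_trans by blast
    then show ?case using approximable_add[OF GN, of v u] by blast
  next
    case (seq V)
    have le: "V i x \<le> f x" if "x \<in> space N" for i x
    proof (rule incseq_le[OF _ seq(4)[OF that]])
      show "incseq (\<lambda>i. V i x)" using seq(3) by (auto simp: incseq_def le_fun_def)
    qed
    have Vm[measurable]: "\<And>i. V i \<in> borel_measurable N" and fm[measurable]: "f \<in> borel_measurable N"
      using seq(1) borel_measurable_LIMSEQ_real[OF seq(4) seq(1)] by blast+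
    show ?case
    proof
      assume fin: "msq N f < \<infinity>"
      have "msq N (\<lambda>x. V i x) \<le> msq N f" for i
        by (intro nn_integral_mono ennreal_leI power_mono le seq(2))
      then have V: "approximable N G (V i)" for i
        using seq(5)[of i] le_less_trans[OF _ fin] by blast
      have "(\<lambda>i. msq N (\<lambda>x. V i x - f x)) \<longlonglongrightarrow> (\<integral>\<^sup>+x. 0 \<partial>N)"
      proof (rule nn_integral_dominated_convergence[where w = "\<lambda>x. ennreal ((f x)\<^sup>2)"])
        show "AE x in N. ennreal ((V j x - f x)\<^sup>2) \<le> ennreal ((f x)\<^sup>2)" for j
        proof (rule AE_I2, rule ennreal_leI)
          fix x assume "x \<in> space N"
          then have "\<bar>V j x - f x\<bar> \<le> \<bar>f x\<bar>" using le[of x j] seq(2)[of j x] by auto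
          then show "(V j x - f x)\<^sup>2 \<le> (f x)\<^sup>2" by (simp add: abs_le_square_iff)
        qed
        show "AE x in N. (\<lambda>i. ennreal ((V i x - f x)\<^sup>2)) \<longlonglongrightarrow> 0"
        proof (rule AE_I2)
          fix x assume "x \<in> space N"
          then have "(\<lambda>i. (V i x - f x)\<^sup>2) \<longlonglongrightarrow> (f x - f x)\<^sup>2"
            by (intro tendsto_intros seq)
          then show "(\<lambda>i. ennreal ((V i x - f x)\<^sup>2)) \<longlonglongrightarrow> 0"
            using tendsto_ennrealI by fastforce
        qed
      qed (use fin in auto)
      then have lim: "(\<lambda>i. msq N (\<lambda>x. V i x - f x)) \<longlonglongrightarrow> 0" by simp
      show "approximable N G f"
      proof (rule approximable_limit[OF GN fm])
        fix e :: real assume "0 < e"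
        then have "\<forall>\<^sub>F i in sequentially. (msq N (\<lambda>x. V i x - f x)) < ennreal e"
          using lim by (intro order_tendstoD) auto
        then obtain i where "msq N (\<lambda>x. V i x - f x) < ennreal e"
          by (auto simp: eventually_sequentially)
        then show "\<exists>g. approximable N G g \<and> (msq N (\<lambda>x. g x - f x)) \<le> ennreal e"
          using V[of i] by (intro exI[of _ "V i"]) simp
      qed
    qed
  qed
  have "approximable N G (\<lambda>x. max (f x) 0)"
  proof (rule nonneg[THEN mp])
    have "msq N (\<lambda>x. max (f x) 0) \<le> msq N f"
      by (intro nn_integral_mono ennreal_leI) (auto simp: max_def)
    then show "msq N (\<lambda>x. max (f x) 0) < \<infinity>" using f(2) by (rule le_less_trans)
  qed (use f in auto)
  moreover have "approximable N G (\<lambda>x. max (- f x) 0)"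
  proof (rule nonneg[THEN mp])
    have "msq N (\<lambda>x. max (- f x) 0) \<le> msq N f"
      by (intro nn_integral_mono ennreal_leI) (auto simp: max_def)
    then show "msq N (\<lambda>x. max (- f x) 0) < \<infinity>" using f(2) by (rule le_less_trans)
  qed (use f in auto)
  ultimately have "approximable N G (\<lambda>x. max (f x) 0 + (-1) * max (- f x) 0)"
    by (intro approximable_add approximable_cmult GN)
  moreover have "(\<lambda>x. max (f x) 0 + (-1) * max (- f x) 0) = f"
    by (auto simp: max_def)
  ultimately show ?thesis by simp
qed

section \<open>The isometry for simple fields\<close>

definition strip :: "real => (real \<times> real) set" where
  "strip T = {0<..T} \<times> {0..1}"

lemma strip_sets [measurable]: "strip T \<in> sets borel"
  unfolding strip_def by (intro borel_Times) auto

lemma strip_finite: "emeasure lborel (strip T) < \<infinity>"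
proof -
  have "bounded (strip T)" unfolding strip_def
    by (intro bounded_Times) (auto intro: bounded_subset[of "{0..T}"])
  then show ?thesis using emeasure_bounded_finite by blast
qed

text \<open>Along a path this is the quadratic variation of the Walsh integral up to time T.\<close>

definition energy :: "real => (real => real => 'a => real) => 'a => ennreal" where
  "energy T H w = (\<integral>\<^sup>+p. ennreal ((H (fst p) (snd p) w)\<^sup>2) * indicator (strip T) p \<partial>lborel)"

lemma simple_value_Nil [simp]: "simple_value [] s y w = 0"
  and simple_value_Cons [simp]: "simple_value ((a, b, A, X) # hs) s y w = X w * indicator {a<..b} s * indicator A y + simple_value hs s y w"
  and simple_value_append [simp]: "simple_value (hs @ ks) s y w = simple_value hs s y w + simple_value ks s y w"
  and simple_integral_Nil [simp]: "simple_integral W [] w = 0"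
  and simple_integral_Cons [simp]: "simple_integral W ((a, b, A, X) # hs) w = X w * W ({a<..b} \<times> A) w + simple_integral W hs w"
  and simple_integral_append [simp]: "simple_integral W (hs @ ks) w = simple_integral W hs w + simple_integral W ks w"
  by (simp_all add: simple_value_def simple_integral_def)

definition simple_rect :: "'a simple_field => nat => (real \<times> real) set" where
  "simple_rect hs i = (case hs ! i of (a, b, A, X) => {a<..b} \<times> A)"

definition simple_coeff :: "'a simple_field => nat => 'a => real" where
  "simple_coeff hs i = (case hs ! i of (a, b, A, X) => X)"

lemma simple_value_eq_sum:
  "simple_value hs s y w = (\<Sum>i<length hs. simple_coeff hs i w * indicator (simple_rect hs i) (s, y))"
  unfolding simple_value_def sum_list_sum_nth atLeast0LessThan
  by (rule sum.cong)
    (auto simp: simple_coeff_def simple_rect_def indicator_def split: prod.splits)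

lemma simple_integral_eq_sum:
  "simple_integral W hs w = (\<Sum>i<length hs. simple_coeff hs i w * W (simple_rect hs i) w)"
  unfolding simple_integral_def sum_list_sum_nth atLeast0LessThan
  by (rule sum.cong)
    (auto simp: simple_coeff_def simple_rect_def split: prod.splits)

lemma integral_double_sum:
  fixes f :: "'i => 'j => 'a => real"
  assumes "\<And>i j. i \<in> I ==> j \<in> J ==> integrable N (f i j)"
  shows "(LINT x|N. (\<Sum>i\<in>I. \<Sum>j\<in>J. f i j x)) = (\<Sum>i\<in>I. \<Sum>j\<in>J. (LINT x|N. f i j x))"
    and "integrable N (\<lambda>x. \<Sum>i\<in>I. \<Sum>j\<in>J. f i j x)"
proof -
  have i: "integrable N (\<lambda>x. \<Sum>j\<in>J. f i j x)" if "i \<in> I" for i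
    using assms that by (intro Bochner_Integration.integrable_sum) auto
  show "integrable N (\<lambda>x. \<Sum>i\<in>I. \<Sum>j\<in>J. f i j x)"
    by (intro Bochner_Integration.integrable_sum i)
  have "(LINT x|N. (\<Sum>i\<in>I. \<Sum>j\<in>J. f i j x)) = (\<Sum>i\<in>I. (LINT x|N. (\<Sum>j\<in>J. f i j x)))"
    by (rule Bochner_Integration.integral_sum) (rule i)
  also have "\<dots> = (\<Sum>i\<in>I. \<Sum>j\<in>J. (LINT x|N. f i j x))"
    by (intro sum.cong refl Bochner_Integration.integral_sum assms)
  finally show "(LINT x|N. (\<Sum>i\<in>I. \<Sum>j\<in>J. f i j x)) = (\<Sum>i\<in>I. \<Sum>j\<in>J. (LINT x|N. f i j x))" .
qed

context white_noise_space
begin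

lemma indep_after_integral:
  fixes X Y :: "'a => real"
  assumes t: "0 \<le> t" and X: "X \<in> borel_measurable (F t)" "integrable M X"
    and Y: "Y \<in> borel_measurable (after t)" "integrable M Y"
  shows "(LINT w|M. X w * Y w) = (LINT w|M. X w) * (LINT w|M. Y w)"
  by (rule indep_var_lebesgue_integral[OF indep_var_after[OF t X(1) Y(1)] X(2) Y(2)])

lemma rect_split:
  assumes a: "0 \<le> a" "a \<le> c" and A: "A \<in> sets borel" "A \<subseteq> {0..1}"
  shows "AE w in M. W ({a<..b} \<times> A) w = W ({a<..min b c} \<times> A) w + W ({c<..b} \<times> A) w"
proof -
  have "{a<..b} \<times> A = ({a<..min b c} \<times> A) \<union> ({c<..b} \<times> A)" using a by auto
  moreover have "AE w in M. W (({a<..min b c} \<times> A) \<union> ({c<..b} \<times> A)) w = W ({a<..min b c} \<times> A) w + W ({c<..b} \<times> A) w"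
    using a by (intro W_additive rect_noise A) auto
  ultimately show ?thesis by simp
qed

text \<open>The earlier rectangle is cut at the later starting time c. Its piece before c is known
  at time c, so against the later noise it has mean 0; its piece after c is independent of both
  coefficients and contributes the covariance, that is, the area of the overlap.\<close>

lemma simple_pair_aux:
  assumes a: "0 \<le> a" "a \<le> c" and A: "A \<in> sets borel" "A \<subseteq> {0..1}" and B: "B \<in> sets borel" "B \<subseteq> {0..1}"
    and X: "X \<in> borel_measurable (F a)" "bounded (X ` space M)"
    and Y: "Y \<in> borel_measurable (F c)" "bounded (Y ` space M)"
  shows "integrable M (\<lambda>w. (X w * W ({a<..b} \<times> A) w) * (Y w * W ({c<..d} \<times> B) w))" (is "integrable M ?f")
    and "(LINT w|M. (X w * W ({a<..b} \<times> A) w) * (Y w * W ({c<..d} \<times> B) w))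
      = (LINT w|M. X w * Y w) * measure lborel (({a<..b} \<times> A) \<inter> ({c<..d} \<times> B))"
proof -
  let ?R = "{a<..b} \<times> A" and ?R1 = "{a<..min b c} \<times> A" and ?R2 = "{c<..b} \<times> A" and ?S = "{c<..d} \<times> B"
  have c: "0 \<le> c" using a by simp
  have n: "?R \<in> noise_sets" "?R1 \<in> noise_sets" "?R2 \<in> noise_sets" "?S \<in> noise_sets"
    using a c by (auto intro!: rect_noise A B)
  define Z where "Z w = X w * Y w" for w
  have Zc: "Z \<in> borel_measurable (F c)"
    unfolding Z_def using Y measurable_F_mono[OF a X(1)] by measurable
  have Zb: "bounded (Z ` space M)"
  proof -
    obtain C D where "\<And>x. x \<in> space M ==> \<bar>X x\<bar> \<le> C" "\<And>x. x \<in> space M ==> \<bar>Y x\<bar> \<le> D"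
      using X(2) Y(2) unfolding bounded_iff by auto
    then have "\<And>x. x \<in> space M ==> \<bar>Z x\<bar> \<le> C * D"
      unfolding Z_def abs_mult by (meson abs_ge_zero mult_mono order_trans)
    then show ?thesis unfolding bounded_iff by auto
  qed
  note [measurable] = W_measurable[OF n(1)] W_measurable[OF n(2)] W_measurable[OF n(3)] W_measurable[OF n(4)] measurable_F[OF c Zc]
  have ZW: "integrable M (\<lambda>w. Z w * (W R w * W S w))" if "R \<in> noise_sets" "S \<in> noise_sets" for R S
    using that by (intro integrable_bounded_mult Zb W_prod_integrable) auto
  have f: "?f = (\<lambda>w. Z w * (W ?R w * W ?S w))" by (auto simp: Z_def)
  show "integrable M ?f" unfolding f by (rule ZW n)+
  have W1: "W ?R1 \<in> borel_measurable (F c)"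
    by (rule W_adapted[OF c n(2)]) (use a A in auto)
  have "(LINT w|M. ?f w) = (LINT w|M. (Z w * W ?R1 w) * W ?S w + Z w * (W ?R2 w * W ?S w))"
    unfolding f
    by (rule integral_cong_AE) (use rect_split[OF a A, of b] in \<open>auto simp: algebra_simps\<close>)
  also have "\<dots> = (LINT w|M. (Z w * W ?R1 w) * W ?S w) + (LINT w|M. Z w * (W ?R2 w * W ?S w))"
    by (rule Bochner_Integration.integral_add) (use ZW[OF n(2) n(4)] ZW[OF n(3) n(4)] in \<open>simp_all add: mult.assoc\<close>)
  also have "(LINT w|M. (Z w * W ?R1 w) * W ?S w) = (LINT w|M. Z w * W ?R1 w) * (LINT w|M. W ?S w)"
    by (rule indep_after_integral[OF c]) (use Zc W1 B in \<open>auto intro!: W_after n integrable_bounded_mult Zb W_integrable\<close>)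
  also have "\<dots> = 0" by (simp add: W_mean n)
  also have "(LINT w|M. Z w * (W ?R2 w * W ?S w)) = (LINT w|M. Z w) * (LINT w|M. W ?R2 w * W ?S w)"
  proof (rule indep_after_integral[OF c Zc])
    show "integrable M Z"
      using integrable_bounded_mult[OF _ Zb, of "\<lambda>_. 1"] by simp
    show "(\<lambda>w. W ?R2 w * W ?S w) \<in> borel_measurable (after c)"
      by (intro borel_measurable_times W_after n) (use A B in auto)
  qed (intro W_prod_integrable n)
  also have "(LINT w|M. W ?R2 w * W ?S w) = measure lborel (?R2 \<inter> ?S)"
    by (rule W_cov[OF n(3,4)])
  also have "?R2 \<inter> ?S = ?R \<inter> ?S" using a by auto
  finally show "(LINT w|M. ?f w) = (LINT w|M. X w * Y w) * measure lborel (?R \<inter> ?S)"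
    by (simp add: Z_def)
qed

lemma simple_pair:
  assumes hs: "simple_field M F T hs" and i: "i < length hs" "j < length hs"
  shows "integrable M (\<lambda>w. (simple_coeff hs i w * W (simple_rect hs i) w) * (simple_coeff hs j w * W (simple_rect hs j) w))"
    and "(LINT w|M. (simple_coeff hs i w * W (simple_rect hs i) w) * (simple_coeff hs j w * W (simple_rect hs j) w))
      = (LINT w|M. simple_coeff hs i w * simple_coeff hs j w) * measure lborel (simple_rect hs i \<inter> simple_rect hs j)"
proof -
  obtain a b A X where hi: "hs ! i = (a, b, A, X)" by (metis prod_cases4)
  obtain c d B Y where hj: "hs ! j = (c, d, B, Y)" by (metis prod_cases4)
  have 1: "0 \<le> a" "A \<in> sets borel" "A \<subseteq> {0..1}" "X \<in> borel_measurable (F a)" "bounded (X ` space M)"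
    using hs hi nth_mem[OF i(1)] unfolding simple_field_def by auto
  have 2: "0 \<le> c" "B \<in> sets borel" "B \<subseteq> {0..1}" "Y \<in> borel_measurable (F c)" "bounded (Y ` space M)"
    using hs hj nth_mem[OF i(2)] unfolding simple_field_def by auto
  have e: "simple_coeff hs i = X" "simple_rect hs i = {a<..b} \<times> A" "simple_coeff hs j = Y" "simple_rect hs j = {c<..d} \<times> B"
    by (simp_all add: simple_coeff_def simple_rect_def hi hj)
  have "integrable M (\<lambda>w. (X w * W ({a<..b} \<times> A) w) * (Y w * W ({c<..d} \<times> B) w)) \<and>
    (LINT w|M. (X w * W ({a<..b} \<times> A) w) * (Y w * W ({c<..d} \<times> B) w))
      = (LINT w|M. X w * Y w) * measure lborel (({a<..b} \<times> A) \<inter> ({c<..d} \<times> B))"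
  proof (cases "a \<le> c")
    case True
    then show ?thesis
      using simple_pair_aux[OF 1(1) True 1(2,3) 2(2,3) 1(4,5) 2(4,5)] by blast
  next
    case False
    then have "c \<le> a" by simp
    from simple_pair_aux[OF 2(1) this 2(2,3) 1(2,3) 2(4,5) 1(4,5), of d b]
    show ?thesis by (simp only: mult.commute[of "Y _"] mult.commute[of "Y _ * _"] Int_commute[of "{c<..d} \<times> B"]) (simp add: mult_ac)
  qed
  then show "integrable M (\<lambda>w. (simple_coeff hs i w * W (simple_rect hs i) w) * (simple_coeff hs j w * W (simple_rect hs j) w))"
    "(LINT w|M. (simple_coeff hs i w * W (simple_rect hs i) w) * (simple_coeff hs j w * W (simple_rect hs j) w))
      = (LINT w|M. simple_coeff hs i w * simple_coeff hs j w) * measure lborel (simple_rect hs i \<inter> simple_rect hs j)"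
    unfolding e by blast+
qed

lemma simple_coeff_props:
  assumes hs: "simple_field M F T hs" and i: "i < length hs"
  shows "simple_coeff hs i \<in> borel_measurable M" "bounded (simple_coeff hs i ` space M)"
    "simple_rect hs i \<in> noise_sets" "simple_rect hs i \<subseteq> strip T"
proof -
  obtain a b A X where hi: "hs ! i = (a, b, A, X)" by (metis prod_cases4)
  have 1: "0 \<le> a" "a \<le> b" "b \<le> T" "A \<in> sets borel" "A \<subseteq> {0..1}" "X \<in> borel_measurable (F a)" "bounded (X ` space M)"
    using hs hi nth_mem[OF i(1)] unfolding simple_field_def by auto
  show "simple_coeff hs i \<in> borel_measurable M" "bounded (simple_coeff hs i ` space M)"
    "simple_rect hs i \<in> noise_sets" "simple_rect hs i \<subseteq> strip T"
    using 1 measurable_F[OF 1(1) 1(6)] rect_noise[OF 1(1) 1(4,5)]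
    unfolding simple_coeff_def simple_rect_def hi strip_def by auto
qed

text \<open>The square of a sum of indicators is a double sum over pairs of entries, so overlapping
  rectangles require no disjoint refinement. The quadratic form is nonnegative because it is the
  integral of a square.\<close>

lemma energy_simple:
  assumes hs: "simple_field M F T hs"
  shows "energy T (simple_value hs) w = ennreal (\<Sum>i<length hs. \<Sum>j<length hs.
      simple_coeff hs i w * simple_coeff hs j w * measure lborel (simple_rect hs i \<inter> simple_rect hs j))"
    and "0 \<le> (\<Sum>i<length hs. \<Sum>j<length hs.
      simple_coeff hs i w * simple_coeff hs j w * measure lborel (simple_rect hs i \<inter> simple_rect hs j))"
proof -
  let ?c = "\<lambda>i. simple_coeff hs i w" and ?R = "simple_rect hs"
  let ?n = "length hs"
  have R: "?R i \<in> sets lborel" "?R i \<subseteq> strip T" "emeasure lborel (?R i) < \<infinity>" if "i < ?n" for i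
    using simple_coeff_props[OF hs that] by (auto simp: noise_sets_def)
  have sq: "(simple_value hs (fst p) (snd p) w)\<^sup>2 = (\<Sum>i<?n. \<Sum>j<?n. ?c i * ?c j * indicator (?R i \<inter> ?R j) p)" for p
    unfolding simple_value_eq_sum power2_eq_square sum_product
    by (simp add: indicator_inter_arith mult_ac)
  have z: "simple_value hs (fst p) (snd p) w = 0" if "p \<notin> strip T" for p
    unfolding simple_value_eq_sum using that R by (intro sum.neutral) (auto simp: indicator_def)
  have RR: "emeasure lborel (?R i \<inter> ?R j) < \<infinity>" if "i < ?n" "j < ?n" for i j
    using emeasure_mono[of "?R i \<inter> ?R j" "?R i" lborel] R[OF that(1)] le_less_trans by auto
  have int: "integrable lborel (\<lambda>p. ?c i * ?c j * indicator (?R i \<inter> ?R j) p)" if "i < ?n" "j < ?n" for i j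
    using RR[OF that] R(1)[OF that(1)] R(1)[OF that(2)] by (intro integrable_mult_right integrable_real_indicator) auto
  have q: "(LINT p|lborel. (simple_value hs (fst p) (snd p) w)\<^sup>2) = (\<Sum>i<?n. \<Sum>j<?n. ?c i * ?c j * measure lborel (?R i \<inter> ?R j))"
    unfolding sq by (subst integral_double_sum(1)) (use int in auto)
  show "0 \<le> (\<Sum>i<?n. \<Sum>j<?n. ?c i * ?c j * measure lborel (?R i \<inter> ?R j))"
    unfolding q[symmetric] by (rule Bochner_Integration.integral_nonneg) simp
  have "energy T (simple_value hs) w = msq lborel (\<lambda>p. simple_value hs (fst p) (snd p) w)"
    unfolding energy_def by (intro nn_integral_cong) (auto simp: indicator_def z)
  also have "\<dots> = ennreal (LINT p|lborel. (simple_value hs (fst p) (snd p) w)\<^sup>2)"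
  proof (rule nn_integral_eq_integral)
    show "integrable lborel (\<lambda>p. (simple_value hs (fst p) (snd p) w)\<^sup>2)"
      unfolding sq by (rule integral_double_sum(2)) (use int in auto)
  qed simp
  finally show "energy T (simple_value hs) w = ennreal (\<Sum>i<?n. \<Sum>j<?n. ?c i * ?c j * measure lborel (?R i \<inter> ?R j))"
    unfolding q .
qed

text \<open>Both sides are expectations of double sums over pairs of entries, and
  \<open>simple_pair\<close> matches them term by term.\<close>

lemma simple_isometry:
  assumes hs: "simple_field M F T hs"
  shows "msq M (\<lambda>w. simple_integral W hs w) = (\<integral>\<^sup>+w. energy T (simple_value hs) w \<partial>M)"
proof -
  let ?c = "simple_coeff hs" and ?R = "simple_rect hs" and ?n = "length hs"
  note p = simple_coeff_props[OF hs]
  have sq: "(simple_integral W hs w)\<^sup>2 = (\<Sum>i<?n. \<Sum>j<?n. (?c i w * W (?R i) w) * (?c j w * W (?R j) w))" for w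
    unfolding simple_integral_eq_sum power2_eq_square sum_product ..
  have int: "integrable M (\<lambda>w. (simple_integral W hs w)\<^sup>2)"
    unfolding sq by (intro Bochner_Integration.integrable_sum simple_pair(1)[OF hs]) auto
  have cc: "integrable M (\<lambda>w. ?c i w * ?c j w)" if "i < ?n" "j < ?n" for i j
    using integrable_bounded_mult[OF p(1)[OF that(2)] p(2)[OF that(2)], of "\<lambda>_. 1"]
    by (intro integrable_bounded_mult p that) auto
  have int2: "integrable M (\<lambda>w. \<Sum>i<?n. \<Sum>j<?n. ?c i w * ?c j w * measure lborel (?R i \<inter> ?R j))"
    by (intro Bochner_Integration.integrable_sum integrable_mult_left cc) auto
  have "msq M (\<lambda>w. simple_integral W hs w) = ennreal (LINT w|M. (simple_integral W hs w)\<^sup>2)"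
    by (rule nn_integral_eq_integral[OF int]) simp
  also have "(LINT w|M. (simple_integral W hs w)\<^sup>2) = (\<Sum>i<?n. \<Sum>j<?n. (LINT w|M. (?c i w * W (?R i) w) * (?c j w * W (?R j) w)))"
    unfolding sq by (rule integral_double_sum(1)) (use simple_pair(1)[OF hs] in auto)
  also have "\<dots> = (\<Sum>i<?n. \<Sum>j<?n. (LINT w|M. ?c i w * ?c j w * measure lborel (?R i \<inter> ?R j)))"
    using simple_pair(2)[OF hs] by (intro sum.cong refl) simp
  also have "\<dots> = (LINT w|M. (\<Sum>i<?n. \<Sum>j<?n. ?c i w * ?c j w * measure lborel (?R i \<inter> ?R j)))"
    by (rule integral_double_sum(1)[symmetric]) (use cc in auto)
  also have "ennreal \<dots> = (\<integral>\<^sup>+w. ennreal (\<Sum>i<?n. \<Sum>j<?n. ?c i w * ?c j w * measure lborel (?R i \<inter> ?R j)) \<partial>M)"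
  proof (rule nn_integral_eq_integral[symmetric, OF int2], rule AE_I2)
    fix w assume "w \<in> space M"
    let ?g = "\<lambda>p. (\<Sum>i<?n. ?c i w * indicator (?R i) p)\<^sup>2"
    have R: "?R i \<in> sets lborel" "emeasure lborel (?R i) < \<infinity>" if "i < ?n" for i
      using p[OF that] by (auto simp: noise_sets_def)
    have RR: "emeasure lborel (?R i \<inter> ?R j) < \<infinity>" if "i < ?n" "j < ?n" for i j
      using emeasure_mono[of "?R i \<inter> ?R j" "?R i" lborel] R[OF that(1)] le_less_trans by auto
    have int: "integrable lborel (\<lambda>p. ?c i w * ?c j w * indicator (?R i \<inter> ?R j) p)" if "i < ?n" "j < ?n" for i j
      using RR[OF that] R(1)[OF that(1)] R(1)[OF that(2)] by (intro integrable_mult_right integrable_real_indicator) auto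
    have sq: "?g p = (\<Sum>i<?n. \<Sum>j<?n. ?c i w * ?c j w * indicator (?R i \<inter> ?R j) p)" for p
      unfolding power2_eq_square sum_product by (simp add: indicator_inter_arith mult_ac)
    have "(LINT p|lborel. ?g p) = (\<Sum>i<?n. \<Sum>j<?n. ?c i w * ?c j w * measure lborel (?R i \<inter> ?R j))"
    proof -
      have "(LINT p|lborel. ?g p) = (\<Sum>i<?n. \<Sum>j<?n. (LINT p|lborel. ?c i w * ?c j w * indicator (?R i \<inter> ?R j) p))"
        unfolding sq by (rule integral_double_sum(1)) (use int in auto)
      also have "\<dots> = (\<Sum>i<?n. \<Sum>j<?n. ?c i w * ?c j w * measure lborel (?R i \<inter> ?R j))"
        by (intro sum.cong refl) simp
      finally show ?thesis .
    qed
    moreover have "0 \<le> (LINT p|lborel. ?g p)" by simp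
    ultimately show "0 \<le> (\<Sum>i<?n. \<Sum>j<?n. ?c i w * ?c j w * measure lborel (?R i \<inter> ?R j))" by simp
  qed
  also have "\<dots> = (\<integral>\<^sup>+w. energy T (simple_value hs) w \<partial>M)"
    by (simp add: energy_simple[OF hs])
  finally show ?thesis .
qed

end

section \<open>Predictable fields\<close>

context white_noise_space
begin

abbreviation predictable :: "real => (real => real => 'a => real) => bool" where
  "predictable T H \<equiv> (\<lambda>(s, y, w). H s y w) \<in> borel_measurable (predictable_sigma M F T)"

definition predictable_rects :: "real => (real \<times> real \<times> 'a) set set" where
  "predictable_rects T = {{a<..b} \<times> A \<times> E | a b A E.
          0 \<le> a \<and> a \<le> b \<and> b \<le> T \<and> A \<in> sets borel \<and> A \<subseteq> {0..1} \<and> E \<in> sets (F a)}"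

lemma predictable_rectsI:
  assumes "0 \<le> a" "a \<le> b" "b \<le> T" "A \<in> sets borel" "A \<subseteq> {0..1}" "E \<in> sets (F a)"
  shows "{a<..b} \<times> A \<times> E \<in> predictable_rects T"
  unfolding predictable_rects_def mem_Collect_eq
  by (rule exI[of _ a], rule exI[of _ b], rule exI[of _ A], rule exI[of _ E]) (intro conjI refl assms)

lemma predictable_rectsE:
  assumes "R \<in> predictable_rects T"
  obtains a b A E where "R = {a<..b} \<times> A \<times> E" "0 \<le> a" "a \<le> b" "b \<le> T" "A \<in> sets borel" "A \<subseteq> {0..1}" "E \<in> sets (F a)"
  using assms unfolding predictable_rects_def mem_Collect_eq by (elim exE conjE)

lemma predictable_rects_Pow: "predictable_rects T \<subseteq> Pow ({0<..T} \<times> {0..1} \<times> space M)"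
proof
  fix R assume "R \<in> predictable_rects T"
  then obtain a b A E where R: "R = {a<..b} \<times> A \<times> E" "0 \<le> a" "a \<le> b" "b \<le> T" "A \<in> sets borel" "A \<subseteq> {0..1}" "E \<in> sets (F a)"
    by (rule predictable_rectsE)
  have "E \<subseteq> space M" using sets.sets_into_space[OF R(7)] R(2) by simp
  moreover have "{a<..b} \<subseteq> {0<..T}" using R by auto
  ultimately show "R \<in> Pow ({0<..T} \<times> {0..1} \<times> space M)"
    unfolding R(1) using R(6) by (intro PowI Sigma_mono) auto
qed

lemma predictable_sigma_eq: "predictable_sigma M F T = sigma ({0<..T} \<times> {0..1} \<times> space M) (predictable_rects T)"
  unfolding predictable_sigma_def predictable_rects_def ..

lemma space_predictable [simp]: "space (predictable_sigma M F T) = {0<..T} \<times> {0..1} \<times> space M"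
  unfolding predictable_sigma_eq by (rule space_measure_of[OF predictable_rects_Pow])

lemma sets_predictable: "sets (predictable_sigma M F T) = sigma_sets ({0<..T} \<times> {0..1} \<times> space M) (predictable_rects T)"
  unfolding predictable_sigma_eq by (rule sets_measure_of[OF predictable_rects_Pow])

lemma predictable_rect_sets:
  assumes "0 \<le> a" "a \<le> b" "b \<le> T" "A \<in> sets borel" "A \<subseteq> {0..1}" "E \<in> sets (F a)"
  shows "{a<..b} \<times> A \<times> E \<in> sets (predictable_sigma M F T)"
  unfolding sets_predictable using assms by (intro sigma_sets.Basic predictable_rectsI)

lemma Int_stable_predictable_rects: "Int_stable (predictable_rects T)"
proof (rule Int_stableI)
  fix R S assume "R \<in> predictable_rects T" "S \<in> predictable_rects T"
  obtain a b A E where R: "R = {a<..b} \<times> A \<times> E" "0 \<le> a" "a \<le> b" "b \<le> T" "A \<in> sets borel" "A \<subseteq> {0..1}" "E \<in> sets (F a)"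
    by (rule predictable_rectsE[OF \<open>R \<in> predictable_rects T\<close>])
  obtain c d B D where S: "S = {c<..d} \<times> B \<times> D" "0 \<le> c" "c \<le> d" "d \<le> T" "B \<in> sets borel" "B \<subseteq> {0..1}" "D \<in> sets (F c)"
    by (rule predictable_rectsE[OF \<open>S \<in> predictable_rects T\<close>])
  let ?b = "min b d"
  have "R \<inter> S = {max a c<..?b} \<times> (A \<inter> B) \<times> (E \<inter> D)" unfolding R S by auto
  show "R \<inter> S \<in> predictable_rects T"
  proof (cases "max a c \<le> min b d")
    case True
    have "E \<inter> D \<in> sets (F (max a c))"
      using R S sets_F_mono[of a "max a c"] sets_F_mono[of c "max a c"] by auto
    then show ?thesis
      unfolding \<open>R \<inter> S = _\<close> using True R S by (intro predictable_rectsI) auto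
  next
    case False
    \<comment> \<open>An empty intersection has to be a rectangle of the family too; (a,a] provides
      it.\<close>
    then have "R \<inter> S = {a<..a} \<times> A \<times> E" unfolding \<open>R \<inter> S = _\<close> by auto
    moreover have "{a<..a} \<times> A \<times> E \<in> predictable_rects T"
      using R by (intro predictable_rectsI) auto
    ultimately show ?thesis by simp
  qed
qed

section \<open>Joint measurability of predictable fields\<close>

definition strip_measure :: "real => (real \<times> real) measure" where
  "strip_measure T = restrict_space lborel (strip T)"

lemma space_strip_measure [simp]: "space (strip_measure T) = strip T"
  by (simp add: strip_measure_def space_restrict_space)

lemma finite_strip_measure: "finite_measure (strip_measure T)"
proof (rule finite_measureI)
  show "emeasure (strip_measure T) (space (strip_measure T)) \<noteq> \<infinity>"
    using strip_finite[of T] by (simp add: strip_measure_def emeasure_restrict_space space_restrict_space)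
qed

text \<open>N stands for M or for F T. With N = F T, predictability up to time T becomes joint
  measurability with respect to F T, so that integrals of predictable fields over the strip are
  known at time T.\<close>

lemma measurable_into_predictable_adapted:
  assumes N: "space N = space M" "\<And>a. 0 \<le> a ==> a \<le> T ==> sets (F a) \<subseteq> sets N"
  shows "(\<lambda>(p, w). (fst p, snd p, w)) \<in> measurable (strip_measure T \<Otimes>\<^sub>M N) (predictable_sigma M F T)"
  unfolding predictable_sigma_eq
proof (rule measurable_measure_of)
  show "predictable_rects T \<subseteq> Pow ({0<..T} \<times> {0..1} \<times> space M)"
    by (rule predictable_rects_Pow)
  show "(\<lambda>(p, w). (fst p, snd p, w)) \<in> space (strip_measure T \<Otimes>\<^sub>M N) \<rightarrow> {0<..T} \<times> {0..1} \<times> space M"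
    by (auto simp: space_pair_measure strip_def N(1))
  fix R assume "R \<in> predictable_rects T"
  then obtain a b A E where R: "R = {a<..b} \<times> A \<times> E" "0 \<le> a" "a \<le> b" "b \<le> T" "A \<in> sets borel" "A \<subseteq> {0..1}" "E \<in> sets (F a)"
    by (rule predictable_rectsE)
  have E: "E \<in> sets N" using N(2)[of a] R by auto
  have "{a<..b} \<times> A \<in> sets borel" using R by (intro borel_Times) auto
  moreover have "{a<..b} \<times> A \<subseteq> strip T" using R by (auto simp: strip_def)
  ultimately have 1: "{a<..b} \<times> A \<in> sets (strip_measure T)"
    by (simp add: strip_measure_def sets_restrict_space_iff)
  have "(\<lambda>(p, w). (fst p, snd p, w)) -` R \<inter> space (strip_measure T \<Otimes>\<^sub>M N) = ({a<..b} \<times> A) \<times> E"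
    using R sets.sets_into_space[OF E] by (auto simp: space_pair_measure strip_def)
  then show "(\<lambda>(p, w). (fst p, snd p, w)) -` R \<inter> space (strip_measure T \<Otimes>\<^sub>M N) \<in> sets (strip_measure T \<Otimes>\<^sub>M N)"
    using 1 E by simp
qed

lemma measurable_into_predictable:
  "(\<lambda>(p, w). (fst p, snd p, w)) \<in> measurable (strip_measure T \<Otimes>\<^sub>M M) (predictable_sigma M F T)"
  by (rule measurable_into_predictable_adapted) (auto dest: sets_F_sub)

text \<open>The path comes first and the field is cut off outside the strip, so that integrating
  over p in the whole plane falls under the measurability theorems for parametrized
  integrals.\<close>

definition jointly :: "real => (real => real => 'a => real) => bool" where
  "jointly T H \<longleftrightarrow> (\<lambda>(w, p). H (fst p) (snd p) w * indicator (strip T) p) \<in> borel_measurable (M \<Otimes>\<^sub>M lborel)"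

lemma predictable_jointly_adapted:
  assumes H: "predictable T H"
    and N: "space N = space M" "\<And>a. 0 \<le> a ==> a \<le> T ==> sets (F a) \<subseteq> sets N"
  shows "(\<lambda>(w, p). H (fst p) (snd p) w * indicator (strip T) p) \<in> borel_measurable (N \<Otimes>\<^sub>M lborel)"
proof (cases "0 < T")
  case False
  then have "strip T = {}" by (auto simp: strip_def)
  then show ?thesis by simp
next
  case True
  \<comment> \<open>Outside the strip any point inside it may stand in, since the indicator removes
    the value afterwards.\<close>
  define r where "r p = (if p \<in> strip T then p else (T, 0))" for p
  have r: "r \<in> measurable lborel (strip_measure T)"
    unfolding strip_measure_def
  proof (rule measurable_restrict_space2)
    show "r \<in> space lborel \<rightarrow> strip T" using True by (auto simp: r_def strip_def)
    show "r \<in> measurable lborel lborel" unfolding r_def by measurable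
  qed
  have 1: "(\<lambda>z. (r (snd z), fst z)) \<in> measurable (N \<Otimes>\<^sub>M lborel) (strip_measure T \<Otimes>\<^sub>M N)"
    using r by measurable
  have "(\<lambda>z. H (fst (r (snd z))) (snd (r (snd z))) (fst z)) \<in> borel_measurable (N \<Otimes>\<^sub>M lborel)"
    using measurable_compose[OF measurable_compose[OF 1 measurable_into_predictable_adapted[OF N]] H]
    by (simp add: case_prod_beta)
  then have "(\<lambda>z. H (fst (r (snd z))) (snd (r (snd z))) (fst z) * indicator (strip T) (snd z)) \<in> borel_measurable (N \<Otimes>\<^sub>M lborel)"
    by measurable
  also have "(\<lambda>z. H (fst (r (snd z))) (snd (r (snd z))) (fst z) * indicator (strip T) (snd z)) = (\<lambda>z. H (fst (snd z)) (snd (snd z)) (fst z) * indicator (strip T) (snd z))"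
    by (auto simp: r_def fun_eq_iff indicator_def)
  finally show ?thesis by (simp add: case_prod_beta)
qed

lemma predictable_jointly:
  assumes H: "predictable T H"
  shows "jointly T H"
  unfolding jointly_def by (rule predictable_jointly_adapted[OF H]) (auto dest: sets_F_sub)

lemma energy_alt: "energy T H w = msq lborel (\<lambda>p. H (fst p) (snd p) w * indicator (strip T) p)"
  unfolding energy_def by (intro nn_integral_cong) (auto simp: indicator_def)

lemma measurable_energy:
  assumes "jointly T H" shows "energy T H \<in> borel_measurable M"
proof -
  have "(\<lambda>(w, p). ennreal ((H (fst p) (snd p) w * indicator (strip T) p)\<^sup>2)) \<in> borel_measurable (M \<Otimes>\<^sub>M lborel)"
    using assms unfolding jointly_def by (simp add: case_prod_beta)
  then show ?thesis unfolding energy_alt[abs_def] by (rule lborel.borel_measurable_nn_integral)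
qed

lemma measurable_energy_adapted:
  assumes H: "predictable T H" and T: "0 \<le> T"
  shows "energy T H \<in> borel_measurable (F T)"
proof -
  have "(\<lambda>(w, p). H (fst p) (snd p) w * indicator (strip T) p) \<in> borel_measurable (F T \<Otimes>\<^sub>M lborel)"
    by (rule predictable_jointly_adapted[OF H]) (use T sets_F_mono in auto)
  then have "(\<lambda>(w, p). ennreal ((H (fst p) (snd p) w * indicator (strip T) p)\<^sup>2)) \<in> borel_measurable (F T \<Otimes>\<^sub>M lborel)"
    by (simp add: case_prod_beta)
  then show ?thesis unfolding energy_alt[abs_def] by (rule lborel.borel_measurable_nn_integral)
qed

lemma jointly_section:
  assumes "jointly T H" "w \<in> space M"
  shows "(\<lambda>p. H (fst p) (snd p) w * indicator (strip T) p) \<in> borel_measurable lborel"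
  using measurable_Pair2[OF assms(1)[unfolded jointly_def] assms(2)] by simp

lemma jointly_add: "jointly T H ==> jointly T K ==> jointly T (\<lambda>s y w. H s y w + K s y w)"
  unfolding jointly_def by (simp add: case_prod_beta distrib_right)

lemma jointly_diff: "jointly T H ==> jointly T K ==> jointly T (\<lambda>s y w. H s y w - K s y w)"
  unfolding jointly_def by (simp add: case_prod_beta left_diff_distrib)

lemma energy_add:
  assumes "jointly T H" "jointly T K" "w \<in> space M"
  shows "energy T (\<lambda>s y w. H s y w + K s y w) w \<le> 2 * energy T H w + 2 * energy T K w"
  unfolding energy_alt distrib_right
  by (rule nn_integral_square_add) (rule jointly_section assms)+

lemma energy_minus: "energy T (\<lambda>s y w. H s y w - K s y w) w = energy T (\<lambda>s y w. K s y w - H s y w) w"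
  unfolding energy_def by (simp add: power2_commute)

section \<open>The mean square norm of a field\<close>

definition sqnorm :: "real => (real => real => 'a => real) => ennreal" where
  "sqnorm T H = (\<integral>\<^sup>+w. energy T H w \<partial>M)"

lemma sqnorm_add:
  assumes "jointly T H" "jointly T K"
  shows "sqnorm T (\<lambda>s y w. H s y w + K s y w) \<le> 2 * sqnorm T H + 2 * sqnorm T K"
proof -
  note [measurable] = measurable_energy[OF assms(1)] measurable_energy[OF assms(2)]
  have "sqnorm T (\<lambda>s y w. H s y w + K s y w) \<le> (\<integral>\<^sup>+w. 2 * energy T H w + 2 * energy T K w \<partial>M)"
    unfolding sqnorm_def by (intro nn_integral_mono energy_add assms)
  also have "\<dots> = 2 * sqnorm T H + 2 * sqnorm T K"
    unfolding sqnorm_def by (simp add: nn_integral_add nn_integral_cmult)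
  finally show ?thesis .
qed

lemma sqnorm_minus: "sqnorm T (\<lambda>s y w. H s y w - K s y w) = sqnorm T (\<lambda>s y w. K s y w - H s y w)"
  unfolding sqnorm_def energy_minus[of T H] ..

lemma sqnorm_triangle:
  assumes "jointly T H" "jointly T K" "jointly T L"
  shows "sqnorm T (\<lambda>s y w. H s y w - L s y w) \<le> 2 * sqnorm T (\<lambda>s y w. H s y w - K s y w) + 2 * sqnorm T (\<lambda>s y w. K s y w - L s y w)"
  using sqnorm_add[OF jointly_diff[OF assms(1,2)] jointly_diff[OF assms(2,3)]] by simp

lemma sqnorm_Fubini:
  assumes "jointly T H"
  shows "sqnorm T H = (\<integral>\<^sup>+p. (msq M (\<lambda>w. H (fst p) (snd p) w)) * indicator (strip T) p \<partial>lborel)"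
proof -
  interpret P: pair_sigma_finite M lborel ..
  have m: "(\<lambda>(w, p). ennreal ((H (fst p) (snd p) w * indicator (strip T) p)\<^sup>2)) \<in> borel_measurable (M \<Otimes>\<^sub>M lborel)"
    using assms unfolding jointly_def by (simp add: case_prod_beta)
  have "sqnorm T H = (\<integral>\<^sup>+p. (msq M (\<lambda>w. H (fst p) (snd p) w * indicator (strip T) p)) \<partial>lborel)"
    unfolding sqnorm_def energy_alt using P.Fubini[OF m] by simp
  also have "\<dots> = (\<integral>\<^sup>+p. (msq M (\<lambda>w. H (fst p) (snd p) w)) * indicator (strip T) p \<partial>lborel)"
    by (intro nn_integral_cong) (auto simp: indicator_def)
  finally show ?thesis .
qed

lemma predictable_section:
  assumes "predictable T H" "0 < s" "s \<le> T" "y \<in> {0..1}"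
  shows "H s y \<in> borel_measurable M"
proof -
  from measurable_Pair1[OF predictable_jointly[OF assms(1), unfolded jointly_def], of "(s, y)"]
  have "(\<lambda>w. H s y w * indicator (strip T) (s, y)) \<in> borel_measurable M" by simp
  then show ?thesis using assms by (simp add: strip_def)
qed

lemma measurable_slice_norm:
  assumes "jointly T H"
  shows "(\<lambda>p. (msq M (\<lambda>w. H (fst p) (snd p) w)) * indicator (strip T) p) \<in> borel_measurable lborel"
proof -
  have "(\<lambda>(w, p). ennreal ((H (fst p) (snd p) w * indicator (strip T) p)\<^sup>2)) \<in> borel_measurable (M \<Otimes>\<^sub>M lborel)"
    using assms unfolding jointly_def by (simp add: case_prod_beta)
  from measurable_pair_swap[OF this]
  have "(\<lambda>(p, w). ennreal ((H (fst p) (snd p) w * indicator (strip T) p)\<^sup>2)) \<in> borel_measurable (lborel \<Otimes>\<^sub>M M)"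
    by (simp add: case_prod_beta)
  then have "(\<lambda>p. msq M (\<lambda>w. H (fst p) (snd p) w * indicator (strip T) p)) \<in> borel_measurable lborel"
    by (rule borel_measurable_nn_integral)
  also have "(\<lambda>p. msq M (\<lambda>w. H (fst p) (snd p) w * indicator (strip T) p)) =
    (\<lambda>p. (msq M (\<lambda>w. H (fst p) (snd p) w)) * indicator (strip T) p)"
    by (auto simp: fun_eq_iff indicator_def)
  finally show ?thesis .
qed

text \<open>Area times probability, pushed to the predictable \<sigma>-algebra. Predictable fields
  with finite \<open>sqnorm\<close> are exactly its square integrable functions, to which the
  abstract approximation theorem applies.\<close>

definition predictable_measure :: "real => (real \<times> real \<times> 'a) measure" where
  "predictable_measure T = distr (strip_measure T \<Otimes>\<^sub>M M) (predictable_sigma M F T) (\<lambda>(p, w). (fst p, snd p, w))"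

lemma finite_predictable_measure: "finite_measure (predictable_measure T)"
proof -
  interpret B: finite_measure "strip_measure T" by (rule finite_strip_measure)
  interpret P: pair_sigma_finite "strip_measure T" M ..
  have "finite_measure (strip_measure T \<Otimes>\<^sub>M M)"
    by (rule finite_measure_pair_measure) (rule finite_measure_axioms, rule finite_strip_measure)
  then show ?thesis unfolding predictable_measure_def
    by (rule finite_measure.finite_measure_distr[OF _ measurable_into_predictable])
qed

lemma sets_predictable_measure: "sets (predictable_measure T) = sigma_sets ({0<..T} \<times> {0..1} \<times> space M) (predictable_rects T)"
  by (simp add: predictable_measure_def sets_predictable)

lemma nn_integral_predictable_measure:
  assumes "predictable T H"
  shows "(\<integral>\<^sup>+z. ennreal ((case z of (s, y, w) => H s y w)\<^sup>2) \<partial>predictable_measure T) = sqnorm T H"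
proof -
  interpret B: finite_measure "strip_measure T" by (rule finite_strip_measure)
  interpret P: pair_sigma_finite "strip_measure T" M ..
  note [measurable] = assms
  have m: "(\<lambda>z. ennreal ((case z of (s, y, w) => H s y w)\<^sup>2)) \<in> borel_measurable (predictable_sigma M F T)"
    by simp
  then have m': "(\<lambda>z. ennreal ((case z of (s, y, w) => H s y w)\<^sup>2)) \<in> borel_measurable (predictable_measure T)"
    by (simp add: predictable_measure_def)
  have "(\<integral>\<^sup>+z. ennreal ((case z of (s, y, w) => H s y w)\<^sup>2) \<partial>predictable_measure T) =
     (\<integral>\<^sup>+z. ennreal ((case (case z of (p, w) => (fst p, snd p, w)) of (s, y, w) => H s y w)\<^sup>2) \<partial>(strip_measure T \<Otimes>\<^sub>M M))"
    unfolding predictable_measure_def by (rule nn_integral_distr[OF measurable_into_predictable m'[unfolded predictable_measure_def]])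
  also have "\<dots> = (\<integral>\<^sup>+w. (\<integral>\<^sup>+p. ennreal ((H (fst p) (snd p) w)\<^sup>2) \<partial>strip_measure T) \<partial>M)"
    by (subst P.nn_integral_snd[symmetric])
      (use measurable_compose[OF measurable_into_predictable m] in \<open>simp_all add: case_prod_beta\<close>)
  also have "\<dots> = sqnorm T H"
    unfolding sqnorm_def energy_def strip_measure_def by (simp add: nn_integral_restrict_space)
  finally show ?thesis .
qed

section \<open>Simple fields are predictable and dense\<close>

lemma predictable_elementary:
  assumes p: "0 \<le> a" "a \<le> b" "b \<le> T" "A \<in> sets borel" "A \<subseteq> {0..1}" "X \<in> borel_measurable (F a)"
  shows "predictable T (\<lambda>s y w. X w * indicator {a<..b} s * indicator A y)"
proof (rule measurableI)
  fix B :: "real set" assume B: "B \<in> sets borel"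
  have XB: "X -` B \<inter> space M \<in> sets (F a)" using measurable_sets[OF p(6) B] p(1) by simp
  have top: "space M \<in> sets (F a)" using sets.top[of "F a"] p(1) by simp
  \<comment> \<open>Off the rectangle the field is 0, so the complement belongs to the preimage
    exactly when 0 belongs to B.\<close>
  have "(\<lambda>(s, y, w). X w * indicator {a<..b} s * indicator A y) -` B \<inter> space (predictable_sigma M F T) =
    ({a<..b} \<times> A \<times> (X -` B \<inter> space M)) \<union> (if 0 \<in> B then space (predictable_sigma M F T) - {a<..b} \<times> A \<times> space M else {})"
    using p by (auto simp: indicator_def of_bool_def split: if_splits)
  also have "\<dots> \<in> sets (predictable_sigma M F T)"
    using predictable_rect_sets[OF p(1-5) XB] predictable_rect_sets[OF p(1-5) top]
    by (cases "0 \<in> B") (simp_all del: space_predictable add: sets.Un sets.compl_sets)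
  finally show "(\<lambda>(s, y, w). X w * indicator {a<..b} s * indicator A y) -` B \<inter> space (predictable_sigma M F T) \<in> sets (predictable_sigma M F T)" .
qed simp

lemma predictable_simple:
  "simple_field M F T hs ==> predictable T (simple_value hs)"
proof (induction hs)
  case Nil
  then show ?case by simp
next
  case (Cons h hs)
  obtain a b A X where h: "h = (a, b, A, X)" by (metis prod_cases4)
  have p: "0 \<le> a" "a \<le> b" "b \<le> T" "A \<in> sets borel" "A \<subseteq> {0..1}" "X \<in> borel_measurable (F a)"
    and hs: "simple_field M F T hs"
    using Cons.prems unfolding simple_field_def h by auto
  have "(\<lambda>(s, y, w). X w * indicator {a<..b} s * indicator A y) \<in> borel_measurable (predictable_sigma M F T)"
    by (rule predictable_elementary[OF p])
  from borel_measurable_add[OF this Cons.IH[OF hs]] show ?case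
    unfolding h by (simp add: case_prod_beta)
qed

lemma jointly_simple: "simple_field M F T hs ==> jointly T (simple_value hs)"
  by (intro predictable_jointly predictable_simple)

lemma simple_field_Nil [simp]: "simple_field M F T []"
  and simple_field_Cons: "simple_field M F T ((a, b, A, X) # hs) \<longleftrightarrow> 0 \<le> a \<and> a \<le> b \<and> b \<le> T \<and> A \<in> sets borel \<and> A \<subseteq> {0..1} \<and>
        X \<in> borel_measurable (F a) \<and> bounded (X ` space M) \<and> simple_field M F T hs"
  and simple_field_append [simp]: "simple_field M F T (hs @ ks) \<longleftrightarrow> simple_field M F T hs \<and> simple_field M F T ks"
  by (simp_all add: simple_field_def ball_Un)

lemma simple_field_mono: "simple_field M F T hs ==> T \<le> T' ==> simple_field M F T' hs"
  by (auto simp: simple_field_def)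

lemma measurable_simple_integral:
  "simple_field M F T hs ==> 0 \<le> T ==> simple_integral W hs \<in> borel_measurable (F T)"
proof (induction hs)
  case Nil
  then show ?case by simp
next
  case (Cons h hs)
  obtain a b A X where h: "h = (a, b, A, X)" by (metis prod_cases4)
  have p: "0 \<le> a" "a \<le> b" "b \<le> T" "A \<in> sets borel" "A \<subseteq> {0..1}" "X \<in> borel_measurable (F a)"
    and hs: "simple_field M F T hs"
    using Cons.prems unfolding simple_field_def h by auto
  have "X \<in> borel_measurable (F T)" using p by (intro measurable_F_mono[of a T]) auto
  moreover have "W ({a<..b} \<times> A) \<in> borel_measurable (F T)"
    using p by (intro W_adapted rect_noise) auto
  ultimately show ?case using Cons.IH[OF hs Cons.prems(2)] unfolding h by simp
qed

lemma combination_simple: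
  assumes "snd ` set cs \<subseteq> predictable_rects T"
  shows "\<exists>hs. simple_field M F T hs \<and> (\<forall>s y. \<forall>w\<in>space M. simple_value hs s y w = combination cs (s, y, w))"
  using assms
proof (induction cs)
  case Nil
  then show ?case by (intro exI[of _ "[]"]) simp
next
  case (Cons cg cs)
  obtain c g where cg: "cg = (c, g)" by force
  obtain hs where hs: "simple_field M F T hs" "\<forall>s y. \<forall>w\<in>space M. simple_value hs s y w = combination cs (s, y, w)"
    using Cons by auto
  have "g \<in> predictable_rects T" using Cons.prems cg by simp
  then obtain a b A E where g: "g = {a<..b} \<times> A \<times> E" "0 \<le> a" "a \<le> b" "b \<le> T" "A \<in> sets borel" "A \<subseteq> {0..1}" "E \<in> sets (F a)"
    by (rule predictable_rectsE)
  have "bounded ((\<lambda>w. c * indicator E w) ` space M)"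
    unfolding bounded_iff by (rule exI[of _ "\<bar>c\<bar>"]) (auto simp: indicator_def)
  then have "simple_field M F T ((a, b, A, \<lambda>w. c * indicator E w) # hs)"
    unfolding simple_field_Cons using g hs by auto
  moreover have "\<forall>s y. \<forall>w\<in>space M. simple_value ((a, b, A, \<lambda>w. c * indicator E w) # hs) s y w = combination (cg # cs) (s, y, w)"
    using hs(2) unfolding cg g by (auto simp: indicator_def)
  ultimately show ?case by blast
qed

text \<open>Predictable rectangles form an intersection stable generator that contains the whole
  space, and linear combinations of their indicators are simple fields; so density is an instance of
  the abstract approximation.\<close>

lemma simple_dense:
  assumes T: "0 \<le> T" and H: "predictable T H" "sqnorm T H < \<infinity>" and e: "0 < e"
  shows "\<exists>hs. simple_field M F T hs \<and> sqnorm T (defect hs H) \<le> ennreal e"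
proof -
  have top: "space M \<in> sets (F 0)" using sets.top[of "F 0"] by simp
  have Om: "{0<..T} \<times> {0..1} \<times> space M \<in> predictable_rects T"
    using T top by (intro predictable_rectsI) auto
  have "approximable (predictable_measure T) (predictable_rects T) (\<lambda>(s, y, w). H s y w)"
  proof (rule approximable_square_integrable[OF finite_predictable_measure sets_predictable_measure Int_stable_predictable_rects predictable_rects_Pow Om])
    show "(\<lambda>(s, y, w). H s y w) \<in> borel_measurable (predictable_measure T)"
      using H(1) by (simp add: predictable_measure_def)
    show "(\<integral>\<^sup>+z. ennreal ((case z of (s, y, w) => H s y w)\<^sup>2) \<partial>predictable_measure T) < \<infinity>"
      unfolding nn_integral_predictable_measure[OF H(1)] by (rule H(2))
  qed
  from approximableD[OF this e] obtain cs where cs: "snd ` set cs \<subseteq> predictable_rects T"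
    "(\<integral>\<^sup>+z. ennreal ((combination cs z - (case z of (s, y, w) => H s y w))\<^sup>2) \<partial>predictable_measure T) \<le> ennreal e"
    by blast
  obtain hs where hs: "simple_field M F T hs" "\<forall>s y. \<forall>w\<in>space M. simple_value hs s y w = combination cs (s, y, w)"
    using combination_simple[OF cs(1)] by blast
  have pr: "predictable T (defect hs H)"
    using borel_measurable_diff[OF predictable_simple[OF hs(1)] H(1)] by (simp add: case_prod_beta)
  have "sqnorm T (defect hs H) =
      (\<integral>\<^sup>+z. ennreal ((combination cs z - (case z of (s, y, w) => H s y w))\<^sup>2) \<partial>predictable_measure T)"
    unfolding nn_integral_predictable_measure[OF pr, symmetric]
    using hs(2) by (intro nn_integral_cong) (auto simp: predictable_measure_def)
  then show ?thesis using hs(1) cs(2) by auto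
qed

end

section \<open>A truncation inequality\<close>

lemma consecutive_pairs:
  fixes ts :: "real list"
  assumes "sorted_wrt (<) ts" "(p, q) \<in> set (zip ts (tl ts))"
  shows "p \<in> set ts" "q \<in> set ts" "p < q" "a \<in> set ts ==> a \<le> p \<or> q \<le> a"
proof -
  have "p \<in> set ts \<and> q \<in> set ts \<and> p < q \<and> (\<forall>a\<in>set ts. a \<le> p \<or> q \<le> a)"
    using assms
  proof (induction ts rule: induct_list012)
    case (3 x y zs)
    show ?case
    proof (cases "(p, q) = (x, y)")
      case True
      then show ?thesis using 3(3) by auto
    next
      case False
      then have "(p, q) \<in> set (zip (y # zs) zs)" using 3(4) by auto
      then have "p \<in> set (y # zs) \<and> q \<in> set (y # zs) \<and> p < q \<and> (\<forall>a\<in>set (y # zs). a \<le> p \<or> q \<le> a)"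
        using 3(2,3) by simp
      then show ?thesis using 3(3) by auto
    qed
  qed auto
  then show "p \<in> set ts" "q \<in> set ts" "p < q" "a \<in> set ts ==> a \<le> p \<or> q \<le> a" by auto
qed

lemma sum_list_zeroI: "(\<And>x. x \<in> set xs ==> f x = (0::real)) ==> (\<Sum>x\<leftarrow>xs. f x) = 0"
  by (induction xs) auto

lemma sum_list_congI: "(\<And>x. x \<in> set xs ==> f x = (g x :: real)) ==> (\<Sum>x\<leftarrow>xs. f x) = (\<Sum>x\<leftarrow>xs. g x)"
  by (induction xs) auto

text \<open>Collapses sums over refined intervals. It is used with G q = 1 for s \<le> q, else 0, to
  recover the values of a field, and with G q = W((0,q] x A) to recover its integral.\<close>

lemma telescope_consecutive:
  fixes ts :: "real list" and G :: "real => real"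
  assumes "sorted_wrt (<) ts" "a \<in> set ts" "b \<in> set ts" "a \<le> b"
  shows "(\<Sum>(p, q)\<leftarrow>zip ts (tl ts). of_bool (a \<le> p \<and> q \<le> b) * (G q - G p)) = G b - G a"
  using assms
proof (induction ts arbitrary: a rule: induct_list012)
  case (3 x y zs)
  have s: "sorted_wrt (<) (y # zs)" and x: "\<And>z. z \<in> set (y # zs) ==> x < z" using 3(3) by auto
  have pq: "p \<in> set (y # zs)" "q \<in> set (y # zs)" if "(p, q) \<in> set (zip (y # zs) zs)" for p q
    using consecutive_pairs(1,2)[OF s, of p q] that by auto
  show ?case
  proof (cases "a = x")
    case False
    then have a: "a \<in> set (y # zs)" "x < a" using 3(4) x by auto
    moreover have "b \<in> set (y # zs)" using 3(5,6) a by auto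
    ultimately show ?thesis using 3(2)[OF s, of a] 3(6) by simp
  next
    case True
    show ?thesis
    proof (cases "b = x")
      case True
      have "(\<Sum>(p, q)\<leftarrow>zip (y # zs) zs. of_bool (a \<le> p \<and> q \<le> b) * (G q - G p)) = 0"
        by (rule sum_list_zeroI) (use pq x True in force)
      then show ?thesis using True \<open>a = x\<close> x[of y] by simp
    next
      case False
      then have b: "b \<in> set (y # zs)" using 3(5) by auto
      then have yb: "y \<le> b" using s by auto
      have yz: "y \<le> p" if "p \<in> set (y # zs)" for p using that s by auto
      have "(\<Sum>(p, q)\<leftarrow>zip (y # zs) zs. of_bool (a \<le> p \<and> q \<le> b) * (G q - G p)) =
        (\<Sum>(p, q)\<leftarrow>zip (y # zs) zs. of_bool (y \<le> p \<and> q \<le> b) * (G q - G p))"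
        by (rule sum_list_congI) (use pq(1) x True yz in \<open>auto simp: less_imp_le\<close>)
      then show ?thesis using 3(2)[OF s _ b yb] yb True x[of y] by simp
    qed
  qed
qed auto

text \<open>The quantifier over f sits inside the disjunction: the same pair (p, q) has to serve the
  original and the truncated field at time s.\<close>

lemma select_consecutive:
  fixes ts :: "real list"
  assumes "sorted_wrt (<) ts"
  shows "(\<forall>f. (\<Sum>(p, q)\<leftarrow>zip ts (tl ts). indicator {p<..q} s * f p q) = (0::real)) \<or>
    (\<exists>p q. (p, q) \<in> set (zip ts (tl ts)) \<and> p < s \<and> s \<le> q \<and> (\<forall>f. (\<Sum>(p, q)\<leftarrow>zip ts (tl ts). indicator {p<..q} s * f p q) = (f p q :: real)))"
  using assms
proof (induction ts rule: induct_list012)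
  case (3 x y zs)
  have so: "sorted_wrt (<) (y # zs)" using 3(3) by auto
  show ?case
  proof (cases "s \<in> {x<..y}")
    case True
    have "(\<Sum>(p, q)\<leftarrow>zip (y # zs) zs. indicator {p<..q} s * f p q) = (0::real)" for f :: "real => real => real"
    proof (rule sum_list_zeroI)
      fix z assume z: "z \<in> set (zip (y # zs) zs)"
      obtain p q where pq: "z = (p, q)" by force
      have "p \<in> set (y # zs)" using consecutive_pairs(1)[OF so, of p q] z pq by auto
      then have "y \<le> p" using so by auto
      then show "(case z of (p, q) => indicator {p<..q} s * f p q) = 0" using True by (auto simp: pq indicator_def)
    qed
    then show ?thesis using True by (intro disjI2 exI[of _ x] exI[of _ y]) auto
  next
    case False
    then have *: "(\<Sum>(p, q)\<leftarrow>zip (x # y # zs) (tl (x # y # zs)). indicator {p<..q} s * f p q) =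
      (\<Sum>(p, q)\<leftarrow>zip (y # zs) (tl (y # zs)). indicator {p<..q} s * f p q)" for f :: "real => real => real" by simp
    show ?thesis unfolding * using 3(2)[OF so] by auto
  qed
qed auto

lemma simple_value_concat: "simple_value (concat (map f xs)) s y w = (\<Sum>x\<leftarrow>xs. simple_value (f x) s y w)"
  by (induction xs) auto

lemma simple_integral_concat: "simple_integral W (concat (map f xs)) w = (\<Sum>x\<leftarrow>xs. simple_integral W (f x) w)"
  by (induction xs) auto

lemma energy_mono_time:
  assumes "S \<le> T" shows "energy S H w \<le> energy T H w"
  unfolding energy_def using assms
  by (intro nn_integral_mono mult_left_mono) (auto simp: indicator_def strip_def)

context white_noise_space
begin

lemma simple_fieldD:
  assumes "simple_field M F T hs" "(a, b, A, X) \<in> set hs"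
  shows "0 \<le> a" "a \<le> b" "b \<le> T" "A \<in> sets borel" "A \<subseteq> {0..1}" "X \<in> borel_measurable (F a)" "bounded (X ` space M)"
  using assms unfolding simple_field_def by auto

abbreviation keep :: "real => 'a simple_field => real => real => real => real => 'a => real" where
  "keep \<beta> hs p q a b w \<equiv> of_bool (a \<le> p \<and> q \<le> b) * of_bool (energy q (simple_value hs) w \<le> ennreal \<beta>)"

text \<open>Stopping for simple fields: every entry is cut at the partition points, and its piece on
  (p, q] survives if the energy up to the right end q is still at most \<beta>. Looking ahead to q
  is what keeps the energy of the result below \<beta>; it is permitted because the field does not
  change in time within (p, q].\<close>

definition truncate :: "real list => real => 'a simple_field => 'a simple_field" where
  "truncate ts \<beta> hs = concat (map (\<lambda>(p, q). map (\<lambda>(a, b, A, X). (p, q, A,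
     \<lambda>w. keep \<beta> hs p q a b w * X w)) hs) (zip ts (tl ts)))"

lemma simple_value_map_entry:
  "simple_value (map (\<lambda>(a, b, A, X). (p, q, A, \<lambda>w. c a b w * X w)) hs) s y w =
    (\<Sum>(a, b, A, X)\<leftarrow>hs. c a b w * X w * indicator {p<..q} s * indicator A y)"
  by (induction hs) auto

lemma simple_integral_map_entry:
  "simple_integral W (map (\<lambda>(a, b, A, X). (p, q, A, \<lambda>w. c a b w * X w)) hs) w =
    (\<Sum>(a, b, A, X)\<leftarrow>hs. c a b w * X w * W ({p<..q} \<times> A) w)"
  by (induction hs) auto

lemma sum_list_swap:
  fixes f :: "'x => 'y => real"
  shows "(\<Sum>x\<leftarrow>xs. \<Sum>y\<leftarrow>ys. f x y) = (\<Sum>y\<leftarrow>ys. \<Sum>x\<leftarrow>xs. f x y)"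
  by (induction xs) (auto simp: sum_list_addf)

lemma simple_value_partition:
  assumes ts: "sorted_wrt (<) ts"
    and hs: "\<And>a b A X. (a, b, A, X) \<in> set hs ==> a \<le> b \<and> a \<in> set ts \<and> b \<in> set ts"
  shows "simple_value hs s y w =
    (\<Sum>(p, q)\<leftarrow>zip ts (tl ts). indicator {p<..q} s * (\<Sum>(a, b, A, X)\<leftarrow>hs. of_bool (a \<le> p \<and> q \<le> b) * X w * indicator A y))"
proof -
  have "(\<Sum>(p, q)\<leftarrow>zip ts (tl ts). indicator {p<..q} s * (\<Sum>(a, b, A, X)\<leftarrow>hs. of_bool (a \<le> p \<and> q \<le> b) * X w * indicator A y))
    = (\<Sum>z\<leftarrow>zip ts (tl ts). \<Sum>(a, b, A, X)\<leftarrow>hs. X w * indicator A y * (of_bool (a \<le> fst z \<and> snd z \<le> b) * indicator {fst z<..snd z} s))"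
    by (rule sum_list_congI) (simp add: case_prod_unfold sum_list_const_mult[symmetric] mult_ac)
  also have "\<dots> = (\<Sum>(a, b, A, X)\<leftarrow>hs. X w * indicator A y * (\<Sum>z\<leftarrow>zip ts (tl ts). of_bool (a \<le> fst z \<and> snd z \<le> b) * indicator {fst z<..snd z} s))"
    by (subst sum_list_swap) (simp add: case_prod_unfold sum_list_const_mult)
  also have "\<dots> = (\<Sum>(a, b, A, X)\<leftarrow>hs. X w * indicator A y * indicator {a<..b} s)"
  proof (rule sum_list_congI)
    fix h assume h: "h \<in> set hs"
    obtain a b A X where e: "h = (a, b, A, X)" by (metis prod_cases4)
    have ab: "a \<le> b" "a \<in> set ts" "b \<in> set ts" using hs h e by auto
    have "(\<Sum>z\<leftarrow>zip ts (tl ts). of_bool (a \<le> fst z \<and> snd z \<le> b) * indicator {fst z<..snd z} s :: real) =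
      (\<Sum>(p, q)\<leftarrow>zip ts (tl ts). of_bool (a \<le> p \<and> q \<le> b) * (of_bool (s \<le> q) - of_bool (s \<le> p)))"
    proof (rule sum_list_congI)
      fix z assume "z \<in> set (zip ts (tl ts))"
      then have "fst z < snd z" using consecutive_pairs(3)[OF ts, of "fst z" "snd z"] by simp
      then show "of_bool (a \<le> fst z \<and> snd z \<le> b) * indicator {fst z<..snd z} s =
        (case z of (p, q) => of_bool (a \<le> p \<and> q \<le> b) * (of_bool (s \<le> q) - of_bool (s \<le> p) :: real))"
        by (auto simp: indicator_def case_prod_beta)
    qed
    also have "\<dots> = of_bool (s \<le> b) - of_bool (s \<le> a)"
      by (rule telescope_consecutive[OF ts ab(2,3,1)])
    also have "\<dots> = indicator {a<..b} s" using ab by (auto simp: indicator_def)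
    finally show "(case h of (a, b, A, X) => X w * indicator A y * (\<Sum>z\<leftarrow>zip ts (tl ts). of_bool (a \<le> fst z \<and> snd z \<le> b) * indicator {fst z<..snd z} s)) =
      (case h of (a, b, A, X) => X w * indicator A y * indicator {a<..b} s)" by (simp add: e)
  qed
  also have "\<dots> = simple_value hs s y w" unfolding simple_value_def by (simp add: mult_ac)
  finally show ?thesis by simp
qed

lemma simple_value_truncate:
  "simple_value (truncate ts \<beta> hs) s y w =
    (\<Sum>(p, q)\<leftarrow>zip ts (tl ts). indicator {p<..q} s * (of_bool (energy q (simple_value hs) w \<le> ennreal \<beta>) *
      (\<Sum>(a, b, A, X)\<leftarrow>hs. of_bool (a \<le> p \<and> q \<le> b) * X w * indicator A y)))"
  unfolding truncate_def simple_value_concat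
proof (rule sum_list_congI)
  fix z :: "real \<times> real"
  obtain p q where z: "z = (p, q)" by force
  let ?c = "\<lambda>a b w. keep \<beta> hs p q a b w :: real"
  have "simple_value (map (\<lambda>(a, b, A, X). (p, q, A, \<lambda>w. ?c a b w * X w)) hs) s y w =
    (\<Sum>(a, b, A, X)\<leftarrow>hs. ?c a b w * X w * indicator {p<..q} s * indicator A y)"
    by (rule simple_value_map_entry[where c = ?c])
  also have "\<dots> = indicator {p<..q} s * (of_bool (energy q (simple_value hs) w \<le> ennreal \<beta>) *
      (\<Sum>(a, b, A, X)\<leftarrow>hs. of_bool (a \<le> p \<and> q \<le> b) * X w * indicator A y))"
    by (simp add: sum_list_const_mult[symmetric] case_prod_unfold mult_ac)
  finally show "simple_value (case z of (p, q) => map (\<lambda>(a, b, A, X). (p, q, A, \<lambda>w. keep \<beta> hs p q a b w * X w)) hs) s y w =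
    (case z of (p, q) => indicator {p<..q} s * (of_bool (energy q (simple_value hs) w \<le> ennreal \<beta>) *
      (\<Sum>(a, b, A, X)\<leftarrow>hs. of_bool (a \<le> p \<and> q \<le> b) * X w * indicator A y)))"
    by (simp add: z)
qed

lemma simple_integral_truncate:
  "simple_integral W (truncate ts \<beta> hs) w =
    (\<Sum>(p, q)\<leftarrow>zip ts (tl ts). of_bool (energy q (simple_value hs) w \<le> ennreal \<beta>) *
      (\<Sum>(a, b, A, X)\<leftarrow>hs. of_bool (a \<le> p \<and> q \<le> b) * X w * W ({p<..q} \<times> A) w))"
  unfolding truncate_def simple_integral_concat
proof (rule sum_list_congI)
  fix z :: "real \<times> real"
  obtain p q where z: "z = (p, q)" by force
  let ?c = "\<lambda>a b w. keep \<beta> hs p q a b w :: real"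
  have "simple_integral W (map (\<lambda>(a, b, A, X). (p, q, A, \<lambda>w. ?c a b w * X w)) hs) w =
    (\<Sum>(a, b, A, X)\<leftarrow>hs. ?c a b w * X w * W ({p<..q} \<times> A) w)"
    by (rule simple_integral_map_entry[where c = ?c])
  also have "\<dots> = of_bool (energy q (simple_value hs) w \<le> ennreal \<beta>) *
      (\<Sum>(a, b, A, X)\<leftarrow>hs. of_bool (a \<le> p \<and> q \<le> b) * X w * W ({p<..q} \<times> A) w)"
    by (simp add: sum_list_const_mult[symmetric] case_prod_unfold mult_ac)
  finally show "simple_integral W (case z of (p, q) => map (\<lambda>(a, b, A, X). (p, q, A, \<lambda>w. keep \<beta> hs p q a b w * X w)) hs) w =
    (case z of (p, q) => of_bool (energy q (simple_value hs) w \<le> ennreal \<beta>) *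
      (\<Sum>(a, b, A, X)\<leftarrow>hs. of_bool (a \<le> p \<and> q \<le> b) * X w * W ({p<..q} \<times> A) w))"
    by (simp add: z)
qed

text \<open>Wherever the truncated field is nonzero it equals the original one, at a time before
  some partition point with energy at most \<beta>. The largest such point therefore bounds the
  whole energy.\<close>

lemma energy_truncate:
  assumes ts: "sorted_wrt (<) ts"
    and hs: "\<And>a b A X. (a, b, A, X) \<in> set hs ==> a \<le> b \<and> a \<in> set ts \<and> b \<in> set ts"
  shows "energy T (simple_value (truncate ts \<beta> hs)) w \<le> ennreal \<beta>"
proof -
  let ?Q = "{q \<in> set ts. energy q (simple_value hs) w \<le> ennreal \<beta>}"
  let ?c = "\<lambda>y p q. \<Sum>(a, b, A, X)\<leftarrow>hs. of_bool (a \<le> p \<and> q \<le> b) * X w * indicator A y"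
  have cases: "simple_value (truncate ts \<beta> hs) s y w = 0 \<or>
     (\<exists>q\<in>?Q. s \<le> q \<and> simple_value (truncate ts \<beta> hs) s y w = simple_value hs s y w)" for s y
    using select_consecutive[OF ts, of s]
  proof (elim disjE exE conjE)
    assume f: "\<forall>f. (\<Sum>(p, q)\<leftarrow>zip ts (tl ts). indicator {p<..q} s * f p q) = (0::real)"
    show ?thesis unfolding simple_value_truncate by (rule disjI1, rule f[rule_format])
  next
    fix p q assume pq: "(p, q) \<in> set (zip ts (tl ts))" "s \<le> q"
      and f: "\<forall>f. (\<Sum>(p, q)\<leftarrow>zip ts (tl ts). indicator {p<..q} s * f p q) = (f p q :: real)"
    have 1: "simple_value (truncate ts \<beta> hs) s y w = of_bool (energy q (simple_value hs) w \<le> ennreal \<beta>) * ?c y p q"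
      unfolding simple_value_truncate by (rule f[rule_format])
    have 2: "simple_value hs s y w = ?c y p q"
      by (rule trans[OF simple_value_partition[OF ts hs] f[rule_format]])
    show ?thesis
      using 1 2 pq(2) consecutive_pairs(2)[OF ts pq(1)]
      by (cases "energy q (simple_value hs) w \<le> ennreal \<beta>") auto
  qed
  show ?thesis
  proof (cases "?Q = {}")
    case True
    then have "simple_value (truncate ts \<beta> hs) s y w = 0" for s y using cases by blast
    then show ?thesis by (simp add: energy_def)
  next
    case False
    let ?q = "Max ?Q"
    have q: "?q \<in> ?Q" using False by (intro Max_in) auto
    have "(simple_value (truncate ts \<beta> hs) s y w)\<^sup>2 * indicator (strip T) (s, y) \<le> (simple_value hs s y w)\<^sup>2 * indicator (strip ?q) (s, y)" for s y
    proof (cases "simple_value (truncate ts \<beta> hs) s y w = 0")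
      case False
      then obtain q where q': "q \<in> ?Q" "s \<le> q" and e: "simple_value (truncate ts \<beta> hs) s y w = simple_value hs s y w"
        using cases by blast
      have "q \<le> ?q" by (rule Max_ge[OF _ q'(1)]) simp
      then have "s \<le> ?q" using q'(2) by (rule order_trans[rotated])
      then show ?thesis unfolding e by (auto simp: indicator_def strip_def)
    qed simp
    then have "energy T (simple_value (truncate ts \<beta> hs)) w \<le> energy ?q (simple_value hs) w"
      unfolding energy_def
      by (intro nn_integral_mono) (auto simp: ennreal_indicator[symmetric] ennreal_mult''[symmetric] intro!: ennreal_leI)
    then show ?thesis using q by auto
  qed
qed

text \<open>If the total energy is at most \<beta>, no piece is dropped. Reassembling the pieces
  uses additivity of the noise at this very w, which holds only almost surely and is therefore a
  hypothesis.\<close>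

lemma energy_truncate_full:
  assumes ts: "sorted_wrt (<) ts" "\<And>q. q \<in> set ts ==> q \<le> T" and E: "energy T (simple_value hs) w \<le> ennreal \<beta>"
    and hs: "\<And>a b A X. (a, b, A, X) \<in> set hs ==> a \<le> b \<and> a \<in> set ts \<and> b \<in> set ts"
    and add: "\<And>a b A X p q. (a, b, A, X) \<in> set hs ==> p \<in> set ts ==> q \<in> set ts ==> p \<le> q ==>
       W ({0<..q} \<times> A) w = W ({0<..p} \<times> A) w + W ({p<..q} \<times> A) w"
  shows "simple_integral W (truncate ts \<beta> hs) w = simple_integral W hs w"
proof -
  have "simple_integral W (truncate ts \<beta> hs) w =
    (\<Sum>z\<leftarrow>zip ts (tl ts). \<Sum>(a, b, A, X)\<leftarrow>hs. X w * (of_bool (a \<le> fst z \<and> snd z \<le> b) * W ({fst z<..snd z} \<times> A) w))"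
    unfolding simple_integral_truncate
  proof (rule sum_list_congI)
    fix z assume z: "z \<in> set (zip ts (tl ts))"
    obtain p q where e: "z = (p, q)" by force
    have qT: "q \<le> T" using ts(2) consecutive_pairs(2)[OF ts(1), of p q] z e by auto
    have "energy q (simple_value hs) w \<le> ennreal \<beta>" by (rule order_trans[OF energy_mono_time[OF qT] E])
    then show "(case z of (p, q) => of_bool (energy q (simple_value hs) w \<le> ennreal \<beta>) *
      (\<Sum>(a, b, A, X)\<leftarrow>hs. of_bool (a \<le> p \<and> q \<le> b) * X w * W ({p<..q} \<times> A) w)) =
      (\<Sum>(a, b, A, X)\<leftarrow>hs. X w * (of_bool (a \<le> fst z \<and> snd z \<le> b) * W ({fst z<..snd z} \<times> A) w))"
      by (simp add: e mult_ac)
  qed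
  also have "\<dots> = (\<Sum>(a, b, A, X)\<leftarrow>hs. X w * (\<Sum>z\<leftarrow>zip ts (tl ts). of_bool (a \<le> fst z \<and> snd z \<le> b) * W ({fst z<..snd z} \<times> A) w))"
    by (subst sum_list_swap) (simp add: case_prod_unfold sum_list_const_mult)
  also have "\<dots> = (\<Sum>(a, b, A, X)\<leftarrow>hs. X w * W ({a<..b} \<times> A) w)"
  proof (rule sum_list_congI)
    fix h assume h: "h \<in> set hs"
    obtain a b A X where e: "h = (a, b, A, X)" by (metis prod_cases4)
    have ab: "a \<le> b" "a \<in> set ts" "b \<in> set ts" using hs h e by auto
    have "(\<Sum>z\<leftarrow>zip ts (tl ts). of_bool (a \<le> fst z \<and> snd z \<le> b) * W ({fst z<..snd z} \<times> A) w) =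
      (\<Sum>(p, q)\<leftarrow>zip ts (tl ts). of_bool (a \<le> p \<and> q \<le> b) * (W ({0<..q} \<times> A) w - W ({0<..p} \<times> A) w))"
    proof (rule sum_list_congI)
      fix z assume z: "z \<in> set (zip ts (tl ts))"
      then have "fst z \<in> set ts" "snd z \<in> set ts" "fst z \<le> snd z"
        using consecutive_pairs(1-3)[OF ts(1), of "fst z" "snd z"] by simp_all
      then have "W ({0<..snd z} \<times> A) w = W ({0<..fst z} \<times> A) w + W ({fst z<..snd z} \<times> A) w"
        using add h e by blast
      then show "of_bool (a \<le> fst z \<and> snd z \<le> b) * W ({fst z<..snd z} \<times> A) w =
        (case z of (p, q) => of_bool (a \<le> p \<and> q \<le> b) * (W ({0<..q} \<times> A) w - W ({0<..p} \<times> A) w))"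
        by (simp add: case_prod_beta)
    qed
    also have "\<dots> = W ({0<..b} \<times> A) w - W ({0<..a} \<times> A) w"
      by (rule telescope_consecutive[OF ts(1) ab(2,3,1)])
    also have "\<dots> = W ({a<..b} \<times> A) w" using add[of a b A X a b] h e ab by simp
    finally show "(case h of (a, b, A, X) => X w * (\<Sum>z\<leftarrow>zip ts (tl ts). of_bool (a \<le> fst z \<and> snd z \<le> b) * W ({fst z<..snd z} \<times> A) w)) =
      (case h of (a, b, A, X) => X w * W ({a<..b} \<times> A) w)" by (simp add: e)
  qed
  also have "\<dots> = simple_integral W hs w" unfolding simple_integral_def ..
  finally show ?thesis .
qed

text \<open>This makes the truncation adapted although it looks ahead from p to q: an entry either
  has a coefficient known at p or contributes nothing before q.\<close>

lemma measurable_energy_simple_early: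
  assumes p: "0 \<le> p" and hs: "\<And>a b A X. (a, b, A, X) \<in> set hs ==> A \<in> sets borel \<and> (a \<le> p \<and> X \<in> borel_measurable (F p) \<or> q \<le> a)"
  shows "energy q (simple_value hs) \<in> borel_measurable (F p)"
proof -
  have "(\<lambda>(w, x). simple_value hs (fst x) (snd x) w * indicator (strip q) x) \<in> borel_measurable (F p \<Otimes>\<^sub>M lborel)"
    using hs
  proof (induction hs)
    case (Cons h hs)
    obtain a b A X where h: "h = (a, b, A, X)" by (metis prod_cases4)
    have IH: "(\<lambda>(w, x). simple_value hs (fst x) (snd x) w * indicator (strip q) x) \<in> borel_measurable (F p \<Otimes>\<^sub>M lborel)"
      using Cons.prems by (intro Cons.IH) auto
    have [measurable]: "A \<in> sets borel" using Cons.prems[of a b A X] h by auto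
    have ind: "(\<lambda>x. indicator {a<..b} (fst x) * indicator A (snd x) * indicator (strip q) x :: real) \<in> borel_measurable lborel"
    proof -
      have "{a<..b} \<times> A \<in> sets borel" by (intro borel_Times) auto
      then have "(\<lambda>x. indicator ({a<..b} \<times> A) x * indicator (strip q) x :: real) \<in> borel_measurable lborel" by measurable
      also have "(\<lambda>x. indicator ({a<..b} \<times> A) x * indicator (strip q) x :: real) = (\<lambda>x. indicator {a<..b} (fst x) * indicator A (snd x) * indicator (strip q) x)"
        by (auto simp: fun_eq_iff indicator_def)
      finally show ?thesis .
    qed
    have "(\<lambda>(w, x). X w * (indicator {a<..b} (fst x) * indicator A (snd x) * indicator (strip q) x)) \<in> borel_measurable (F p \<Otimes>\<^sub>M lborel)"
    proof (cases "q \<le> a")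
      case True
      then have "(\<lambda>(w, x). X w * (indicator {a<..b} (fst x) * indicator A (snd x) * indicator (strip q) x)) = (\<lambda>_. 0)"
        by (auto simp: fun_eq_iff indicator_def strip_def)
      then show ?thesis by simp
    next
      case False
      then have [measurable]: "X \<in> borel_measurable (F p)" using Cons.prems[of a b A X] h by auto
      show ?thesis using ind by (simp add: case_prod_beta)
    qed
    from borel_measurable_add[OF this IH] show ?case
      unfolding h by (simp add: case_prod_beta algebra_simps)
  qed simp
  then have "(\<lambda>(w, x). ennreal ((simple_value hs (fst x) (snd x) w * indicator (strip q) x)\<^sup>2)) \<in> borel_measurable (F p \<Otimes>\<^sub>M lborel)"
    by (simp add: case_prod_beta)
  then show ?thesis unfolding energy_alt[abs_def] by (rule lborel.borel_measurable_nn_integral)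
qed

lemma simple_field_truncate:
  assumes hs: "simple_field M F T hs" and ts: "sorted_wrt (<) ts" "\<And>q. q \<in> set ts ==> 0 \<le> q \<and> q \<le> T"
    and in_ts: "\<And>a b A X. (a, b, A, X) \<in> set hs ==> a \<le> b \<and> a \<in> set ts \<and> b \<in> set ts"
  shows "simple_field M F T (truncate ts \<beta> hs)"
proof -
  have *: "0 \<le> p \<and> p \<le> q \<and> q \<le> T \<and> A \<in> sets borel \<and> A \<subseteq> {0..1} \<and>
      (\<lambda>w. keep \<beta> hs p q a b w * X w) \<in> borel_measurable (F p) \<and>
      bounded ((\<lambda>w. keep \<beta> hs p q a b w * X w) ` space M)"
    if pq: "(p, q) \<in> set (zip ts (tl ts))" and h: "(a, b, A, X) \<in> set hs" for p q a b A X
  proof -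
    note c = consecutive_pairs[OF ts(1) pq]
    have p: "0 \<le> p" "p \<le> q" "q \<le> T" using c ts(2) by auto
    have h': "A \<in> sets borel" "A \<subseteq> {0..1}" "bounded (X ` space M)"
      using hs h unfolding simple_field_def by auto
    have X: "X \<in> borel_measurable (F p)" if "(a, b, A, X) \<in> set hs" "a \<le> p" for a b A X
      using hs that unfolding simple_field_def by (auto intro: measurable_F_mono[of a p])
    have [measurable]: "energy q (simple_value hs) \<in> borel_measurable (F p)"
    proof (rule measurable_energy_simple_early[OF p(1)])
      fix a b A X assume h: "(a, b, A, X) \<in> set hs"
      then have "a \<le> p \<or> q \<le> a" using c(4)[of a] in_ts by auto
      moreover have "A \<in> sets borel" using hs h unfolding simple_field_def by auto
      ultimately show "A \<in> sets borel \<and> (a \<le> p \<and> X \<in> borel_measurable (F p) \<or> q \<le> a)"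
        using X[OF h] by blast
    qed
    have "(\<lambda>w. keep \<beta> hs p q a b w * X w) \<in> borel_measurable (F p)"
    proof (cases "a \<le> p")
      case True
      note [measurable] = X[OF h True]
      show ?thesis by measurable
    qed simp
    moreover have "bounded ((\<lambda>w. keep \<beta> hs p q a b w * X w) ` space M)"
    proof -
      obtain C where C: "\<And>w. w \<in> space M ==> \<bar>X w\<bar> \<le> C" using h'(3) unfolding bounded_iff by auto
      show ?thesis unfolding bounded_iff
        by (rule exI[of _ "\<bar>C\<bar>"]) (auto simp: of_bool_def dest: C intro: order_trans[OF _ abs_ge_self])
    qed
    ultimately show ?thesis using p h' by blast
  qed
  show ?thesis unfolding simple_field_def
  proof (rule ballI)
    fix e assume "e \<in> set (truncate ts \<beta> hs)"
    then obtain p q a b A X where pq: "(p, q) \<in> set (zip ts (tl ts))" and h: "(a, b, A, X) \<in> set hs"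
      and e: "e = (p, q, A, \<lambda>w. keep \<beta> hs p q a b w * X w)"
      unfolding truncate_def set_concat set_map by (elim UN_E imageE) (auto split: prod.splits)
    show "case e of (a, b, A, X) => 0 \<le> a \<and> a \<le> b \<and> b \<le> T \<and> A \<in> sets borel \<and> A \<subseteq> {0..1} \<and>
        X \<in> borel_measurable (F a) \<and> bounded (X ` space M)"
      unfolding e prod.case by (rule *[OF pq h])
  qed
qed

text \<open>On the event in question the truncated field has the same integral, and its energy is at
  most \<beta> on every path; the isometry and Markov's inequality for the square finish. In this
  form the bound involves no moment of the energy of the original field, so it applies to
  convergence in probability.\<close>

lemma simple_Lenglart:
  assumes hs: "simple_field M F T hs" and T: "0 \<le> T" and a: "0 < a" and \<beta>: "0 \<le> \<beta>"
  shows "emeasure M {w \<in> space M. a < \<bar>simple_integral W hs w\<bar> \<and> energy T (simple_value hs) w \<le> ennreal \<beta>} \<le> ennreal (\<beta> / a\<^sup>2)"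
proof -
  \<comment> \<open>With all end points in S, no entry starts or ends strictly between consecutive
    partition points.\<close>
  define S where "S = {0, T} \<union> fst ` set hs \<union> (\<lambda>h. fst (snd h)) ` set hs"
  define ts where "ts = sorted_list_of_set S"
  have "finite S" unfolding S_def by auto
  then have ts: "sorted_wrt (<) ts" "set ts = S"
    by (auto simp: ts_def strict_sorted_list_of_set)
  have S: "0 \<le> q \<and> q \<le> T" if qS: "q \<in> S" for q
  proof -
    have h: "0 \<le> fst h \<and> fst h \<le> fst (snd h) \<and> fst (snd h) \<le> T" if "h \<in> set hs" for h
    proof -
      obtain a b A X where e: "h = (a, b, A, X)" by (metis prod_cases4)
      show ?thesis using simple_fieldD[OF hs] that unfolding e by auto
    qed
    consider "q = 0" | "q = T" | h where "h \<in> set hs" "q = fst h" | h where "h \<in> set hs" "q = fst (snd h)"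
      using qS unfolding S_def by blast
    then show ?thesis
      by cases (use T h in force)+
  qed
  have in_ts: "a \<le> b \<and> a \<in> set ts \<and> b \<in> set ts" if "(a, b, A, X) \<in> set hs" for a b A X
  proof -
    have "a \<le> b" using that hs unfolding simple_field_def by auto
    moreover have "a \<in> S" "b \<in> S" using that unfolding S_def by force+
    ultimately show ?thesis by (simp add: ts(2))
  qed
  define ks where "ks = truncate ts \<beta> hs"
  have ks: "simple_field M F T ks" unfolding ks_def
    by (rule simple_field_truncate[OF hs ts(1) _ in_ts]) (use S ts in auto)
  have meas[measurable]: "simple_integral W hs \<in> borel_measurable M" "simple_integral W ks \<in> borel_measurable M"
    "energy T (simple_value hs) \<in> borel_measurable M"
    using measurable_F[OF T measurable_simple_integral[OF hs T]] measurable_F[OF T measurable_simple_integral[OF ks T]]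
      measurable_energy[OF jointly_simple[OF hs]] by auto
  have "AE w in M. \<forall>h\<in>set hs. \<forall>p\<in>S. \<forall>q\<in>S. p \<le> q \<longrightarrow>
      W ({0<..q} \<times> fst (snd (snd h))) w = W ({0<..p} \<times> fst (snd (snd h))) w + W ({p<..q} \<times> fst (snd (snd h))) w"
  proof (intro AE_finite_allI finite_set \<open>finite S\<close>)
    fix h p q assume h: "h \<in> set hs" and pq: "p \<in> S" "q \<in> S"
    obtain a b A X where e: "h = (a, b, A, X)" by (metis prod_cases4)
    have A: "fst (snd (snd h)) \<in> sets borel" "fst (snd (snd h)) \<subseteq> {0..1}"
      using simple_fieldD(4,5)[OF hs, of a b A X] h unfolding e by auto
    show "AE w in M. p \<le> q \<longrightarrow>
      W ({0<..q} \<times> fst (snd (snd h))) w = W ({0<..p} \<times> fst (snd (snd h))) w + W ({p<..q} \<times> fst (snd (snd h))) w"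
      using rect_split[of 0 p "fst (snd (snd h))" q, OF _ _ A] S[OF pq(1)]
      by (cases "p \<le> q") (auto simp: min_def)
  qed
  then have eq: "AE w in M. energy T (simple_value hs) w \<le> ennreal \<beta> \<longrightarrow> simple_integral W ks w = simple_integral W hs w"
  proof eventually_elim
    case (elim w)
    show ?case
    proof
      assume "energy T (simple_value hs) w \<le> ennreal \<beta>"
      note E = this
      show "simple_integral W ks w = simple_integral W hs w" unfolding ks_def
      proof (rule energy_truncate_full[OF ts(1) _ E in_ts])
        fix a b A X p q assume "(a, b, A, X) \<in> set hs" "p \<in> set ts" "q \<in> set ts" "p \<le> q"
        from elim[rule_format, OF this[unfolded ts(2)]]
        show "W ({0<..q} \<times> A) w = W ({0<..p} \<times> A) w + W ({p<..q} \<times> A) w" by simp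
      qed (simp_all add: S ts(2))
    qed
  qed
  have "emeasure M {w \<in> space M. a < \<bar>simple_integral W hs w\<bar> \<and> energy T (simple_value hs) w \<le> ennreal \<beta>}
    \<le> emeasure M {w \<in> space M. 1 \<le> ennreal (1 / a\<^sup>2) * ennreal ((simple_integral W ks w)\<^sup>2)}"
  proof (rule emeasure_mono_AE)
    show "AE w in M. w \<in> {w \<in> space M. a < \<bar>simple_integral W hs w\<bar> \<and> energy T (simple_value hs) w \<le> ennreal \<beta>}
      \<longrightarrow> w \<in> {w \<in> space M. 1 \<le> ennreal (1 / a\<^sup>2) * ennreal ((simple_integral W ks w)\<^sup>2)}"
      using eq
    proof eventually_elim
      case (elim w)
      have "1 \<le> ennreal (1 / a\<^sup>2) * ennreal ((simple_integral W hs w)\<^sup>2)" if "a < \<bar>simple_integral W hs w\<bar>"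
      proof -
        have "a\<^sup>2 \<le> (simple_integral W hs w)\<^sup>2" using that a by (metis abs_le_square_iff abs_of_pos less_imp_le)
        then have "1 \<le> 1 / a\<^sup>2 * (simple_integral W hs w)\<^sup>2" using a by (simp add: field_simps)
        then show ?thesis using a by (simp flip: ennreal_mult ennreal_1 add: ennreal_leI)
      qed
      then show ?case using elim by auto
    qed
  qed measurable
  also have "\<dots> \<le> ennreal (1 / a\<^sup>2) * (\<integral>\<^sup>+w. ennreal ((simple_integral W ks w)\<^sup>2) * indicator (space M) w \<partial>M)"
    by (rule nn_integral_Markov_inequality) auto
  also have "(\<integral>\<^sup>+w. ennreal ((simple_integral W ks w)\<^sup>2) * indicator (space M) w \<partial>M) = msq M (\<lambda>w. simple_integral W ks w)"
    by (intro nn_integral_cong) auto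
  also have "\<dots> = (\<integral>\<^sup>+w. energy T (simple_value ks) w \<partial>M)" by (rule simple_isometry[OF ks])
  also have "\<dots> \<le> (\<integral>\<^sup>+w. ennreal \<beta> \<partial>M)"
    unfolding ks_def by (intro nn_integral_mono energy_truncate ts(1) in_ts)
  also have "\<dots> = ennreal \<beta>" by (simp add: emeasure_space_1)
  also have "ennreal (1 / a\<^sup>2) * ennreal \<beta> = ennreal (\<beta> / a\<^sup>2)"
    using a \<beta> by (simp flip: ennreal_mult)
  finally show ?thesis by (simp add: mult_left_mono)
qed

end

section \<open>The Walsh integral of square integrable fields\<close>

lemma tendsto_zero_ennreal_le:
  fixes u v :: "nat => ennreal"
  assumes "v \<longlonglongrightarrow> 0" "\<And>n. u n \<le> ennreal c * v n"
  shows "u \<longlonglongrightarrow> 0"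
proof (rule tendsto_sandwich[of "\<lambda>_. 0" u sequentially "\<lambda>n. ennreal c * v n"])
  show "(\<lambda>n. ennreal c * v n) \<longlonglongrightarrow> 0"
    using ennreal_tendsto_cmult[OF ennreal_less_top assms(1), of c] by simp
qed (use assms in auto)

lemma (in finite_measure) tends_to_0_in_prob_I:
  assumes [measurable]: "\<And>n. D n \<in> borel_measurable M"
    and lim: "(\<lambda>n. \<integral>\<^sup>+w. D n w \<partial>M) \<longlonglongrightarrow> 0"
  shows "tends_to_0_in_prob M D"
  unfolding tends_to_0_in_prob_def
proof (intro allI impI)
  fix \<epsilon> :: real assume e: "0 < \<epsilon>"
  have "(\<lambda>n. emeasure M {w \<in> space M. ennreal \<epsilon> < D n w}) \<longlonglongrightarrow> 0"
  proof (rule tendsto_zero_ennreal_le[OF lim])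
    fix n
    have "emeasure M {w \<in> space M. ennreal \<epsilon> < D n w} \<le> emeasure M {w \<in> space M. 1 \<le> ennreal (1 / \<epsilon>) * D n w}"
    proof (intro emeasure_mono subsetI)
      fix w assume "w \<in> {w \<in> space M. ennreal \<epsilon> < D n w}"
      then have w: "w \<in> space M" "ennreal \<epsilon> \<le> D n w" by auto
      have "1 = ennreal (1 / \<epsilon>) * ennreal \<epsilon>" using e by (simp flip: ennreal_mult)
      also have "\<dots> \<le> ennreal (1 / \<epsilon>) * D n w" by (intro mult_left_mono w) simp
      finally show "w \<in> {w \<in> space M. 1 \<le> ennreal (1 / \<epsilon>) * D n w}" using w by simp
    qed measurable
    also have "\<dots> \<le> ennreal (1 / \<epsilon>) * (\<integral>\<^sup>+w. D n w * indicator (space M) w \<partial>M)"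
      by (rule nn_integral_Markov_inequality) auto
    also have "(\<integral>\<^sup>+w. D n w * indicator (space M) w \<partial>M) = (\<integral>\<^sup>+w. D n w \<partial>M)"
      by (intro nn_integral_cong) auto
    finally show "emeasure M {w \<in> space M. ennreal \<epsilon> < D n w} \<le> ennreal (1 / \<epsilon>) * (\<integral>\<^sup>+w. D n w \<partial>M)"
      by (simp add: mult_left_mono)
  qed
  then show "(\<lambda>n. measure M {w \<in> space M. ennreal \<epsilon> < D n w}) \<longlonglongrightarrow> 0"
    unfolding emeasure_eq_measure using tendsto_ennrealD[of _ 0] by fastforce
qed

lemma nn_integral_square_triangle:
  fixes f g h :: "'a => real"
  assumes [measurable]: "f \<in> borel_measurable N" "g \<in> borel_measurable N" "h \<in> borel_measurable N"
  shows "msq N (\<lambda>x. f x - h x) \<le> 2 * msq N (\<lambda>x. f x - g x) + 2 * msq N (\<lambda>x. g x - h x)"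
  using nn_integral_square_add[of "\<lambda>x. f x - g x" N "\<lambda>x. g x - h x"] by simp

text \<open>The limit is taken pointwise with \<open>lim\<close>, so it is measurable for N itself
  and not merely for a completion. The geometric rate makes the increments almost surely summable,
  which gives convergence of the paths; Fatou then yields the mean square limit.\<close>

lemma (in finite_measure) L2_complete:
  fixes X :: "nat => 'a => real"
  assumes N: "subalgebra M N" and XN: "\<And>n. X n \<in> borel_measurable N"
    and bound: "\<And>n. (msq M (\<lambda>w. X n w - X (Suc n) w)) \<le> ennreal ((1/4)^n)"
  shows "\<exists>Y\<in>borel_measurable N. (\<lambda>n. msq M (\<lambda>w. X n w - Y w)) \<longlonglongrightarrow> 0"
proof -
  have [measurable]: "X n \<in> borel_measurable M" for n
    by (rule measurable_from_subalg[OF N XN])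
  define Y where "Y w = lim (\<lambda>n. X n w)" for w
  have YN: "Y \<in> borel_measurable N"
    unfolding Y_def[abs_def] by (rule borel_measurable_lim_metric[OF XN])
  have [measurable]: "Y \<in> borel_measurable M"
    by (rule measurable_from_subalg[OF N YN])
  define C where "C = measure M (space M) + 1"
  have C: "0 < C" "emeasure M (space M) \<le> ennreal C"
    unfolding C_def emeasure_eq_measure by (auto simp: add_nonneg_pos intro!: ennreal_leI)
  have L1: "(\<integral>\<^sup>+w. ennreal \<bar>X n w - X (Suc n) w\<bar> \<partial>M) \<le> ennreal ((C + 1) * (1/2)^n)" for n
  proof -
    \<comment> \<open>A crude form of Young's inequality: a mean square of 4^-n becomes an absolute
      mean of order 2^-n.\<close>
    have "\<bar>d\<bar> \<le> (1/2)^n + 2^n * d\<^sup>2" for d :: real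
    proof (cases "\<bar>d\<bar> \<le> (1/2)^n")
      case True
      then show ?thesis by (simp add: add_increasing2)
    next
      case False
      then have "1 \<le> 2^n * \<bar>d\<bar>" by (simp add: field_simps power_one_over)
      then have "\<bar>d\<bar> * 1 \<le> \<bar>d\<bar> * (2^n * \<bar>d\<bar>)" by (intro mult_left_mono) auto
      also have "\<dots> = 2^n * d\<^sup>2" by (simp add: power2_eq_square)
      finally show ?thesis by (simp add: add_increasing)
    qed
    then have "(\<integral>\<^sup>+w. ennreal \<bar>X n w - X (Suc n) w\<bar> \<partial>M) \<le> (\<integral>\<^sup>+w. ennreal ((1/2)^n) + ennreal (2^n) * ennreal ((X n w - X (Suc n) w)\<^sup>2) \<partial>M)"
      by (intro nn_integral_mono) (simp flip: ennreal_mult ennreal_plus add: ennreal_leI)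
    also have "\<dots> = ennreal ((1/2)^n) * emeasure M (space M) + ennreal (2^n) * msq M (\<lambda>w. X n w - X (Suc n) w)"
      by (simp add: nn_integral_add nn_integral_cmult)
    also have "\<dots> \<le> ennreal ((1/2)^n) * ennreal C + ennreal (2^n) * ennreal ((1/4)^n)"
      by (intro add_mono mult_left_mono C bound) auto
    also have "\<dots> = ennreal ((1/2)^n * C + 2^n * (1/4)^n)"
      using C by (simp flip: ennreal_mult ennreal_plus)
    also have "(1/2)^n * C + 2^n * (1/4)^n = (C + 1) * (1/2::real)^n"
      by (simp add: algebra_simps power_mult_distrib[symmetric])
    finally show ?thesis .
  qed
  have "(\<integral>\<^sup>+w. (\<Sum>n. ennreal \<bar>X n w - X (Suc n) w\<bar>) \<partial>M) = (\<Sum>n. \<integral>\<^sup>+w. ennreal \<bar>X n w - X (Suc n) w\<bar> \<partial>M)"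
    by (rule nn_integral_suminf) simp
  also have "\<dots> \<le> (\<Sum>n. ennreal ((C + 1) * (1/2)^n))"
    by (intro suminf_le L1) auto
  also have "\<dots> = ennreal (\<Sum>n. (C + 1) * (1/2)^n)"
    using C by (intro suminf_ennreal2 summable_mult summable_geometric) auto
  also have "\<dots> < \<infinity>" by simp
  finally have "AE w in M. (\<Sum>n. ennreal \<bar>X n w - X (Suc n) w\<bar>) \<noteq> \<infinity>"
    by (intro nn_integral_PInf_AE) auto
  then have conv: "AE w in M. (\<lambda>n. X n w) \<longlonglongrightarrow> Y w"
  proof eventually_elim
    case (elim w)
    have "summable (\<lambda>n. \<bar>X n w - X (Suc n) w\<bar>)"
      by (rule summable_suminf_not_top) (use elim in auto)
    then have "summable (\<lambda>n. X n w - X (Suc n) w)"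
      by (rule summable_rabs_cancel)
    then have "(\<lambda>n. \<Sum>i<n. X i w - X (Suc i) w) \<longlonglongrightarrow> (\<Sum>n. X n w - X (Suc n) w)"
      by (rule summable_LIMSEQ)
    moreover have "(\<Sum>i<n. X i w - X (Suc i) w) = X 0 w - X n w" for n
      by (induction n) auto
    ultimately have "(\<lambda>n. X 0 w - X n w) \<longlonglongrightarrow> (\<Sum>n. X n w - X (Suc n) w)"
      by (simp only:)
    then have "(\<lambda>n. X 0 w - (X 0 w - X n w)) \<longlonglongrightarrow> X 0 w - (\<Sum>n. X n w - X (Suc n) w)"
      by (intro tendsto_diff tendsto_const)
    then have "convergent (\<lambda>n. X n w)" by (auto simp: convergent_def)
    then show ?case unfolding Y_def by (simp add: convergent_LIMSEQ_iff)
  qed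
  \<comment> \<open>The constant 4 reproduces itself: 2 * 4^-n + 2 * (4 * 4^-(n+1)) = 4 *
    4^-n.\<close>
  have far: "msq M (\<lambda>w. X n w - X (n + k) w) \<le> ennreal (4 * (1/4)^n)" for n k
  proof (induction k arbitrary: n)
    case 0
    then show ?case by simp
  next
    case (Suc k)
    have "msq M (\<lambda>w. X n w - X (n + Suc k) w) \<le>
      2 * msq M (\<lambda>w. X n w - X (Suc n) w) + 2 * msq M (\<lambda>w. X (Suc n) w - X (Suc n + k) w)"
      using nn_integral_square_triangle[of "X n" M "X (Suc n)" "X (Suc n + k)"] by simp
    also have "\<dots> \<le> 2 * ennreal ((1/4)^n) + 2 * ennreal (4 * (1/4)^Suc n)"
      by (intro add_mono mult_left_mono bound Suc.IH) auto
    also have "\<dots> = ennreal (4 * (1/4)^n)"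
      by (subst ennreal_twice_add) auto
    finally show ?case .
  qed
  have le: "msq M (\<lambda>w. X n w - Y w) \<le> ennreal 4 * ennreal ((1/4)^n)" for n
  proof -
    have "msq M (\<lambda>w. X n w - Y w) = (\<integral>\<^sup>+w. liminf (\<lambda>k. ennreal ((X n w - X (n + k) w)\<^sup>2)) \<partial>M)"
    proof (rule nn_integral_cong_AE)
      show "AE w in M. ennreal ((X n w - Y w)\<^sup>2) = liminf (\<lambda>k. ennreal ((X n w - X (n + k) w)\<^sup>2))"
        using conv
      proof eventually_elim
        case (elim w)
        then have "(\<lambda>k. X (n + k) w) \<longlonglongrightarrow> Y w"
          using LIMSEQ_ignore_initial_segment[OF elim, of n] by (simp add: add.commute)
        then have "(\<lambda>k. ennreal ((X n w - X (n + k) w)\<^sup>2)) \<longlonglongrightarrow> ennreal ((X n w - Y w)\<^sup>2)"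
          by (intro tendsto_ennrealI tendsto_power tendsto_diff tendsto_const)
        then show ?case by (rule lim_imp_Liminf[OF sequentially_bot, symmetric])
      qed
    qed
    also have "\<dots> \<le> liminf (\<lambda>k. msq M (\<lambda>w. X n w - X (n + k) w))"
      by (rule nn_integral_liminf) simp
    also have "\<dots> \<le> liminf (\<lambda>k::nat. ennreal (4 * (1/4)^n))"
      by (intro Liminf_mono always_eventually allI far)
    also have "\<dots> = ennreal (4 * (1/4)^n)" by (simp add: Liminf_const)
    finally show ?thesis by (simp add: ennreal_mult)
  qed
  have "(\<lambda>n. ennreal ((1/4)^n)) \<longlonglongrightarrow> 0"
    using tendsto_ennrealI[OF LIMSEQ_power_zero[of "1/4::real"]] by simp
  then have "(\<lambda>n. msq M (\<lambda>w. X n w - Y w)) \<longlonglongrightarrow> 0"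
    using le by (rule tendsto_zero_ennreal_le)
  then show ?thesis using YN by blast
qed

section \<open>The Walsh integral as a mean square limit\<close>

definition uminus_simple :: "'a simple_field => 'a simple_field" where
  "uminus_simple hs = map (\<lambda>(a, b, A, X). (a, b, A, \<lambda>w. - X w)) hs"

lemma simple_value_uminus [simp]: "simple_value (uminus_simple hs) s y w = - simple_value hs s y w"
  unfolding uminus_simple_def by (induction hs) auto

lemma simple_integral_uminus [simp]: "simple_integral W (uminus_simple hs) w = - simple_integral W hs w"
  unfolding uminus_simple_def by (induction hs) auto

context white_noise_space
begin

lemma simple_field_uminus [simp]: "simple_field M F T hs ==> simple_field M F T (uminus_simple hs)"
proof (induction hs)
  case (Cons h hs)
  obtain a b A X where h: "h = (a, b, A, X)" by (metis prod_cases4)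
  have "bounded ((\<lambda>w. - X w) ` space M)" if "bounded (X ` space M)"
    using that unfolding bounded_iff by auto
  then show ?case using Cons unfolding h simple_field_Cons uminus_simple_def by (simp add: simple_field_Cons)
qed (simp add: uminus_simple_def)

lemma simple_isometry_diff:
  assumes "simple_field M F T hs" "simple_field M F T ks"
  shows "msq M (\<lambda>w. simple_integral W hs w - simple_integral W ks w) =
    sqnorm T (\<lambda>s y w. simple_value hs s y w - simple_value ks s y w)"
proof -
  have 1: "simple_field M F T (hs @ uminus_simple ks)" using assms by simp
  have "simple_value (hs @ uminus_simple ks) = (\<lambda>s y w. simple_value hs s y w - simple_value ks s y w)"
    by (intro ext) simp
  then show ?thesis using simple_isometry[OF 1] by (simp add: sqnorm_def)
qed

text \<open>Stronger than \<open>walsh_integral\<close>: convergence is in mean square, and the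
  value is known at time T. The latter makes the part of the solution up to an intermediate time
  measurable there.\<close>

definition L2_walsh :: "real => (real => real => 'a => real) => ('a => real) => bool" where
  "L2_walsh T H I \<longleftrightarrow> 0 \<le> T \<and> predictable T H \<and> I \<in> borel_measurable (F T) \<and>
     (\<exists>hs. (\<forall>n. simple_field M F T (hs n)) \<and>
        (\<lambda>n. sqnorm T (defect (hs n) H)) \<longlonglongrightarrow> 0 \<and>
        (\<lambda>n. msq M (\<lambda>w. simple_integral W (hs n) w - I w)) \<longlonglongrightarrow> 0)"

lemma L2_walsh_exists:
  assumes T: "0 \<le> T" and H: "predictable T H" "sqnorm T H < \<infinity>"
  shows "\<exists>I. L2_walsh T H I"
proof -
  have "\<forall>n::nat. \<exists>hs. simple_field M F T hs \<and> sqnorm T (defect hs H) \<le> ennreal ((1/4)^n / 4)"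
    by (intro allI simple_dense[OF T H]) simp
  from choice[OF this] obtain hs where hs: "\<And>n. simple_field M F T (hs n)"
    and lim: "\<And>n. sqnorm T (defect (hs n) H) \<le> ennreal ((1/4)^n / 4)"
    by blast
  note j = jointly_simple[OF hs] predictable_jointly[OF H(1)]
  have "msq M (\<lambda>w. simple_integral W (hs n) w - simple_integral W (hs (Suc n)) w) \<le> ennreal ((1/4)^n)" for n
  proof -
    have "msq M (\<lambda>w. simple_integral W (hs n) w - simple_integral W (hs (Suc n)) w) =
      sqnorm T (\<lambda>s y w. simple_value (hs n) s y w - simple_value (hs (Suc n)) s y w)"
      by (rule simple_isometry_diff[OF hs hs])
    also have "\<dots> \<le> 2 * sqnorm T (defect (hs n) H) + 2 * sqnorm T (\<lambda>s y w. H s y w - simple_value (hs (Suc n)) s y w)"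
      by (rule sqnorm_triangle[OF j(1) j(2) j(1)])
    also have "\<dots> \<le> 2 * ennreal ((1/4)^n / 4) + 2 * ennreal ((1/4)^Suc n / 4)"
      unfolding sqnorm_minus[of T H] by (intro add_mono mult_left_mono lim) auto
    also have "\<dots> \<le> ennreal ((1/4)^n)"
      by (subst ennreal_twice_add) (auto intro!: ennreal_leI)
    finally show ?thesis .
  qed
  from L2_complete[OF subalg[OF T] measurable_simple_integral[OF hs T] this]
  obtain I where I: "I \<in> borel_measurable (F T)" "(\<lambda>n. msq M (\<lambda>w. simple_integral W (hs n) w - I w)) \<longlonglongrightarrow> 0"
    by blast
  have "(\<lambda>n. sqnorm T (defect (hs n) H)) \<longlonglongrightarrow> 0"
  proof (rule tendsto_zero_ennreal_le[where c = "1/4"])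
    show "(\<lambda>n. ennreal ((1/4)^n)) \<longlonglongrightarrow> 0"
      using tendsto_ennrealI[OF LIMSEQ_power_zero[of "1/4::real"]] by simp
    show "sqnorm T (defect (hs n) H) \<le> ennreal (1/4) * ennreal ((1/4)^n)" for n
      using lim[of n] by (simp add: ennreal_mult[symmetric] mult.commute)
  qed
  then show ?thesis unfolding L2_walsh_def using T H I hs by blast
qed

text \<open>The isometry up to the factor 16 = 2^4, one factor 2 for each of four triangle
  inequalities; the order of magnitude is what matters later. For H = K it gives uniqueness, for K =
  0 a norm bound.\<close>

lemma L2_walsh_bound:
  assumes HI: "L2_walsh T H I" and KJ: "L2_walsh T K J"
  shows "msq M (\<lambda>w. I w - J w) \<le> 16 * sqnorm T (\<lambda>s y w. H s y w - K s y w)"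
proof -
  from HI obtain hs where T: "0 \<le> T" and pH: "predictable T H" and I: "I \<in> borel_measurable (F T)"
    and hs: "\<And>n. simple_field M F T (hs n)"
    and hH: "(\<lambda>n. sqnorm T (defect (hs n) H)) \<longlonglongrightarrow> 0"
    and hI: "(\<lambda>n. msq M (\<lambda>w. simple_integral W (hs n) w - I w)) \<longlonglongrightarrow> 0"
    unfolding L2_walsh_def by blast
  from KJ obtain ks where pK: "predictable T K" and J: "J \<in> borel_measurable (F T)"
    and ks: "\<And>n. simple_field M F T (ks n)"
    and kK: "(\<lambda>n. sqnorm T (defect (ks n) K)) \<longlonglongrightarrow> 0"
    and kJ: "(\<lambda>n. msq M (\<lambda>w. simple_integral W (ks n) w - J w)) \<longlonglongrightarrow> 0"
    unfolding L2_walsh_def by blast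
  note [measurable] = measurable_F[OF T I] measurable_F[OF T J]
    measurable_F[OF T measurable_simple_integral[OF hs T]] measurable_F[OF T measurable_simple_integral[OF ks T]]
  note j = jointly_simple[OF hs] jointly_simple[OF ks] predictable_jointly[OF pH] predictable_jointly[OF pK]
  let ?S = "sqnorm T (\<lambda>s y w. H s y w - K s y w)"
  let ?a = "\<lambda>n. sqnorm T (defect (hs n) H)"
  let ?b = "\<lambda>n. sqnorm T (defect (ks n) K)"
  let ?c = "\<lambda>n. msq M (\<lambda>w. simple_integral W (hs n) w - I w)"
  let ?d = "\<lambda>n. msq M (\<lambda>w. simple_integral W (ks n) w - J w)"
  have le: "msq M (\<lambda>w. I w - J w) \<le> 2 * ?c n + 2 * (2 * (2 * ?a n + 2 * (2 * ?S + 2 * ?b n)) + 2 * ?d n)" for n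
  proof -
    have c: "msq M (\<lambda>w. I w - simple_integral W (hs n) w) = ?c n"
      by (simp add: power2_commute)
    have "sqnorm T (\<lambda>s y w. simple_value (hs n) s y w - simple_value (ks n) s y w) \<le> 2 * ?a n + 2 * sqnorm T (\<lambda>s y w. H s y w - simple_value (ks n) s y w)"
      by (rule sqnorm_triangle[OF j(1) j(3) j(2)])
    also have "\<dots> \<le> 2 * ?a n + 2 * (2 * ?S + 2 * ?b n)"
      using sqnorm_triangle[OF j(3) j(4) j(2), of n] unfolding sqnorm_minus[of T K "simple_value (ks n)"]
      by (intro add_mono mult_left_mono) auto
    finally have "msq M (\<lambda>w. simple_integral W (hs n) w - simple_integral W (ks n) w) \<le> 2 * ?a n + 2 * (2 * ?S + 2 * ?b n)"
      unfolding simple_isometry_diff[OF hs ks] .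
    moreover have "msq M (\<lambda>w. simple_integral W (hs n) w - J w) \<le>
      2 * msq M (\<lambda>w. simple_integral W (hs n) w - simple_integral W (ks n) w) + 2 * ?d n"
      by (rule nn_integral_square_triangle) auto
    ultimately have "msq M (\<lambda>w. simple_integral W (hs n) w - J w) \<le> 2 * (2 * ?a n + 2 * (2 * ?S + 2 * ?b n)) + 2 * ?d n"
      by (elim order_trans) (intro add_mono mult_left_mono, auto)
    moreover have "msq M (\<lambda>w. I w - J w) \<le> 2 * ?c n + 2 * msq M (\<lambda>w. simple_integral W (hs n) w - J w)"
      unfolding c[symmetric] by (rule nn_integral_square_triangle) auto
    ultimately show ?thesis
      by (elim order_trans) (intro add_mono mult_left_mono, auto)
  qed
  have lim: "(\<lambda>n. 2 * u n) \<longlonglongrightarrow> 2 * l" if "u \<longlonglongrightarrow> l" for u :: "nat => ennreal" and l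
    using ennreal_tendsto_cmult[OF _ that, of 2] by simp
  have "(\<lambda>n. 2 * ?c n + 2 * (2 * (2 * ?a n + 2 * (2 * ?S + 2 * ?b n)) + 2 * ?d n)) \<longlonglongrightarrow> 2 * 0 + 2 * (2 * (2 * 0 + 2 * (2 * ?S + 2 * 0)) + 2 * 0)"
    by (intro tendsto_add lim hH hI kK kJ tendsto_const)
  then have "msq M (\<lambda>w. I w - J w) \<le> 2 * 0 + 2 * (2 * (2 * 0 + 2 * (2 * ?S + 2 * 0)) + 2 * 0)"
    by (rule LIMSEQ_le_const) (use le in blast)
  then show ?thesis by (simp add: mult.assoc[symmetric])
qed

lemma L2_walsh_zero: "0 \<le> T ==> L2_walsh T (\<lambda>s y w. 0) (\<lambda>w. 0)"
  unfolding L2_walsh_def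
  by (intro conjI exI[of _ "\<lambda>n. []"]) (auto simp: sqnorm_def energy_def)

lemma L2_walsh_bound0:
  "L2_walsh T H I ==> (msq M I) \<le> 16 * sqnorm T H"
  using L2_walsh_bound[OF _ L2_walsh_zero, of T H I] by (simp add: L2_walsh_def)

lemma L2_walsh_simple: "0 \<le> T ==> simple_field M F T hs ==> L2_walsh T (simple_value hs) (simple_integral W hs)"
  unfolding L2_walsh_def
  by (intro conjI exI[of _ "\<lambda>n. hs"] measurable_simple_integral predictable_simple)
    (auto simp: sqnorm_def energy_def)

lemma L2_walsh_add:
  assumes HI: "L2_walsh T H I" and KJ: "L2_walsh T K J"
  shows "L2_walsh T (\<lambda>s y w. H s y w + K s y w) (\<lambda>w. I w + J w)"
proof -
  from HI obtain hs where T: "0 \<le> T" and pH: "predictable T H" and I: "I \<in> borel_measurable (F T)"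
    and hs: "\<And>n. simple_field M F T (hs n)"
    and hH: "(\<lambda>n. sqnorm T (defect (hs n) H)) \<longlonglongrightarrow> 0"
    and hI: "(\<lambda>n. msq M (\<lambda>w. simple_integral W (hs n) w - I w)) \<longlonglongrightarrow> 0"
    unfolding L2_walsh_def by blast
  from KJ obtain ks where pK: "predictable T K" and J: "J \<in> borel_measurable (F T)"
    and ks: "\<And>n. simple_field M F T (ks n)"
    and kK: "(\<lambda>n. sqnorm T (defect (ks n) K)) \<longlonglongrightarrow> 0"
    and kJ: "(\<lambda>n. msq M (\<lambda>w. simple_integral W (ks n) w - J w)) \<longlonglongrightarrow> 0"
    unfolding L2_walsh_def by blast
  note [measurable] = measurable_F[OF T I] measurable_F[OF T J]
    measurable_F[OF T measurable_simple_integral[OF hs T]] measurable_F[OF T measurable_simple_integral[OF ks T]]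
  have lim: "(\<lambda>n. 2 * u n + 2 * v n) \<longlonglongrightarrow> 0" if "u \<longlonglongrightarrow> 0" "v \<longlonglongrightarrow> 0" for u v :: "nat => ennreal"
    using tendsto_add[OF ennreal_tendsto_cmult[OF _ that(1), of 2] ennreal_tendsto_cmult[OF _ that(2), of 2]] by simp
  show ?thesis unfolding L2_walsh_def
  proof (intro conjI exI[of _ "\<lambda>n. hs n @ ks n"] allI)
    show "predictable T (\<lambda>s y w. H s y w + K s y w)"
      using borel_measurable_add[OF pH pK] by (simp add: case_prod_beta)
    show "(\<lambda>w. I w + J w) \<in> borel_measurable (F T)" using I J by simp
    show "(\<lambda>n. sqnorm T (\<lambda>s y w. simple_value (hs n @ ks n) s y w - (H s y w + K s y w))) \<longlonglongrightarrow> 0"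
    proof (rule tendsto_sandwich[OF _ _ tendsto_const lim[OF hH kK]])
      show "\<forall>\<^sub>F n in sequentially. sqnorm T (\<lambda>s y w. simple_value (hs n @ ks n) s y w - (H s y w + K s y w)) \<le>
        2 * sqnorm T (defect (hs n) H) + 2 * sqnorm T (defect (ks n) K)"
      proof (intro always_eventually allI)
        fix n
        have "sqnorm T (\<lambda>s y w. (simple_value (hs n) s y w - H s y w) + (simple_value (ks n) s y w - K s y w)) \<le>
          2 * sqnorm T (defect (hs n) H) + 2 * sqnorm T (defect (ks n) K)"
          by (intro sqnorm_add jointly_diff jointly_simple hs ks predictable_jointly pH pK)
        then show "sqnorm T (\<lambda>s y w. simple_value (hs n @ ks n) s y w - (H s y w + K s y w)) \<le>
        2 * sqnorm T (defect (hs n) H) + 2 * sqnorm T (defect (ks n) K)"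
          by (simp add: algebra_simps)
      qed
    qed simp
    show "(\<lambda>n. msq M (\<lambda>w. simple_integral W (hs n @ ks n) w - (I w + J w))) \<longlonglongrightarrow> 0"
    proof (rule tendsto_sandwich[OF _ _ tendsto_const lim[OF hI kJ]])
      show "\<forall>\<^sub>F n in sequentially. (msq M (\<lambda>w. simple_integral W (hs n @ ks n) w - (I w + J w))) \<le>
        2 * msq M (\<lambda>w. simple_integral W (hs n) w - I w) + 2 * msq M (\<lambda>w. simple_integral W (ks n) w - J w)"
      proof (intro always_eventually allI)
        fix n
        have "msq M (\<lambda>w. (simple_integral W (hs n) w - I w) + (simple_integral W (ks n) w - J w)) \<le>
          2 * msq M (\<lambda>w. simple_integral W (hs n) w - I w) + 2 * msq M (\<lambda>w. simple_integral W (ks n) w - J w)"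
          by (rule nn_integral_square_add) auto
        then show "msq M (\<lambda>w. simple_integral W (hs n @ ks n) w - (I w + J w)) \<le>
          2 * msq M (\<lambda>w. simple_integral W (hs n) w - I w) + 2 * msq M (\<lambda>w. simple_integral W (ks n) w - J w)"
          by (simp add: algebra_simps)
      qed
    qed simp
  qed (use T hs ks in auto)
qed

text \<open>Simple fields on (0,S] vanish after S, so the approximants of H approximate its
  extension by 0 with the same errors and the same integrals.\<close>

lemma L2_walsh_extend:
  assumes HI: "L2_walsh S H I" and T: "S \<le> T" and K: "predictable T K"
    and eq: "\<And>s y w. 0 < s ==> s \<le> S ==> K s y w = H s y w" and zero: "\<And>s y w. S < s ==> s \<le> T ==> K s y w = 0"
  shows "L2_walsh T K I"
proof -
  from HI obtain hs where S: "0 \<le> S" and I: "I \<in> borel_measurable (F S)"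
    and hs: "\<And>n. simple_field M F S (hs n)"
    and hH: "(\<lambda>n. sqnorm S (defect (hs n) H)) \<longlonglongrightarrow> 0"
    and hI: "(\<lambda>n. msq M (\<lambda>w. simple_integral W (hs n) w - I w)) \<longlonglongrightarrow> 0"
    unfolding L2_walsh_def by blast
  have z: "simple_value (hs n) s y w = 0" if "S < s" for n s y w
    unfolding simple_value_eq_sum
  proof (rule sum.neutral, rule ballI)
    fix i assume "i \<in> {..<length (hs n)}"
    then have "simple_rect (hs n) i \<subseteq> strip S" using simple_coeff_props(4)[OF hs] by blast
    then have "(s, y) \<notin> simple_rect (hs n) i" using that by (auto simp: strip_def)
    then show "simple_coeff (hs n) i w * indicator (simple_rect (hs n) i) (s, y) = 0" by simp
  qed
  have "energy T (defect (hs n) K) w = energy S (defect (hs n) H) w" for n w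
    unfolding energy_def
  proof (rule nn_integral_cong)
    fix p :: "real \<times> real"
    show "ennreal ((simple_value (hs n) (fst p) (snd p) w - K (fst p) (snd p) w)\<^sup>2) * indicator (strip T) p =
      ennreal ((simple_value (hs n) (fst p) (snd p) w - H (fst p) (snd p) w)\<^sup>2) * indicator (strip S) p"
      using T S eq[of "fst p" "snd p" w] zero[of "fst p" "snd p" w] z[of "fst p" n "snd p" w]
      by (cases "fst p \<le> S") (auto simp: indicator_def strip_def)
  qed
  then have "sqnorm T (defect (hs n) K) = sqnorm S (defect (hs n) H)" for n
    by (simp add: sqnorm_def)
  then show ?thesis unfolding L2_walsh_def
    using S T K hH hI hs measurable_F_mono[OF S T I]
    by (intro conjI exI[of _ hs] allI) (auto intro: simple_field_mono)
qed

section \<open>Comparison with the integral defined in probability\<close>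

lemma walsh_integral_energy:
  "walsh_integral M F W T H I \<longleftrightarrow> predictable T H \<and> I \<in> borel_measurable M \<and>
     (\<exists>hs. (\<forall>n. simple_field M F T (hs n)) \<and>
        tends_to_0_in_prob M (\<lambda>n. energy T (defect (hs n) H)) \<and>
        tends_to_0_in_prob M (\<lambda>n w. ennreal \<bar>simple_integral W (hs n) w - I w\<bar>))"
  unfolding walsh_integral_def energy_def strip_def by (simp add: case_prod_beta)

lemma L2_walsh_walsh_integral:
  assumes "L2_walsh T H I"
  shows "walsh_integral M F W T H I"
proof -
  from assms obtain hs where T: "0 \<le> T" and pH: "predictable T H" and I: "I \<in> borel_measurable (F T)"
    and hs: "\<And>n. simple_field M F T (hs n)"
    and hH: "(\<lambda>n. sqnorm T (defect (hs n) H)) \<longlonglongrightarrow> 0"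
    and hI: "(\<lambda>n. msq M (\<lambda>w. simple_integral W (hs n) w - I w)) \<longlonglongrightarrow> 0"
    unfolding L2_walsh_def by blast
  note [measurable] = measurable_F[OF T I] measurable_F[OF T measurable_simple_integral[OF hs T]]
  have "tends_to_0_in_prob M (\<lambda>n w. ennreal ((simple_integral W (hs n) w - I w)\<^sup>2))"
    by (rule tends_to_0_in_prob_I) (use hI in auto)
  have 2: "tends_to_0_in_prob M (\<lambda>n w. ennreal \<bar>simple_integral W (hs n) w - I w\<bar>)"
    unfolding tends_to_0_in_prob_def
  proof (intro allI impI)
    fix e :: real assume e: "0 < e"
    have "e < \<bar>d\<bar> \<longleftrightarrow> e\<^sup>2 < d\<^sup>2" for d
      using abs_le_square_iff[of d e] e by auto
    then have "{w \<in> space M. ennreal e < ennreal \<bar>simple_integral W (hs n) w - I w\<bar>} = {w \<in> space M. ennreal (e\<^sup>2) < ennreal ((simple_integral W (hs n) w - I w)\<^sup>2)}" for n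
      using e by (simp add: ennreal_less_iff)
    then show "(\<lambda>n. measure M {w \<in> space M. ennreal e < ennreal \<bar>simple_integral W (hs n) w - I w\<bar>}) \<longlonglongrightarrow> 0"
      using \<open>tends_to_0_in_prob M (\<lambda>n w. ennreal ((simple_integral W (hs n) w - I w)\<^sup>2))\<close> e
      unfolding tends_to_0_in_prob_def by simp
  qed
  have 1: "tends_to_0_in_prob M (\<lambda>n. energy T (defect (hs n) H))"
    using hH unfolding sqnorm_def
    by (intro tends_to_0_in_prob_I measurable_energy jointly_diff jointly_simple hs predictable_jointly pH)
  have "I \<in> borel_measurable M" by simp
  then show ?thesis unfolding walsh_integral_energy using pH hs 1 2 by blast
qed

text \<open>Along a path on which H and K agree, the difference of their approximants has small
  energy and hence, by the truncation inequality, a small integral up to a small exceptional event.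
  A fast subsequence and the Borel-Cantelli lemma make this almost sure.\<close>

lemma walsh_integral_local:
  assumes T: "0 \<le> T" and HI: "walsh_integral M F W T H I" and KJ: "walsh_integral M F W T K J"
  shows "AE w in M. (\<forall>s\<in>{0<..T}. \<forall>y\<in>{0..1}. H s y w = K s y w) \<longrightarrow> I w = J w"
proof -
  from HI obtain hs where pH: "predictable T H" and Im[measurable]: "I \<in> borel_measurable M"
    and hs: "\<And>n. simple_field M F T (hs n)"
    and hH: "tends_to_0_in_prob M (\<lambda>n. energy T (defect (hs n) H))"
    and hI: "tends_to_0_in_prob M (\<lambda>n w. ennreal \<bar>simple_integral W (hs n) w - I w\<bar>)"
    unfolding walsh_integral_energy by blast
  from KJ obtain ks where pK: "predictable T K" and Jm[measurable]: "J \<in> borel_measurable M"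
    and ks: "\<And>n. simple_field M F T (ks n)"
    and kK: "tends_to_0_in_prob M (\<lambda>n. energy T (defect (ks n) K))"
    and kJ: "tends_to_0_in_prob M (\<lambda>n w. ennreal \<bar>simple_integral W (ks n) w - J w\<bar>)"
    unfolding walsh_integral_energy by blast
  let ?DH = "\<lambda>n. energy T (defect (hs n) H)"
  let ?DK = "\<lambda>n. energy T (defect (ks n) K)"
  let ?EI = "\<lambda>n w. ennreal \<bar>simple_integral W (hs n) w - I w\<bar>"
  let ?EJ = "\<lambda>n w. ennreal \<bar>simple_integral W (ks n) w - J w\<bar>"
  have js: "jointly T (defect (hs n) H)" "jointly T (defect (ks n) K)" for n
    by (intro jointly_diff jointly_simple hs ks predictable_jointly pH pK)+
  note [measurable] = measurable_energy[OF js(1)] measurable_energy[OF js(2)]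
    measurable_F[OF T measurable_simple_integral[OF hs T]] measurable_F[OF T measurable_simple_integral[OF ks T]]
  \<comment> \<open>Energy threshold 8^-k against integral threshold 2^-k: the truncation inequality
    gives probability 8^-k / 4^-k = 2^-k, which is summable. The quarter pays for adding two energy
    errors.\<close>
  have "\<forall>k::nat. \<exists>n. measure M {w \<in> space M. ennreal ((1/8)^k / 4) < ?DH n w} < (1/2)^k \<and>
    measure M {w \<in> space M. ennreal ((1/8)^k / 4) < ?DK n w} < (1/2)^k \<and>
    measure M {w \<in> space M. ennreal ((1/2)^k) < ?EI n w} < (1/2)^k \<and>
    measure M {w \<in> space M. ennreal ((1/2)^k) < ?EJ n w} < (1/2)^k"
  proof (rule allI)
    fix k :: nat
    have ev: "\<forall>\<^sub>F n in sequentially. measure M {w \<in> space M. ennreal e < D n w} < (1/2)^k"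
      if "tends_to_0_in_prob M D" "0 < e" for D e
      using that unfolding tends_to_0_in_prob_def by (intro order_tendstoD(2)[where y = 0]) auto
    have "\<forall>\<^sub>F n in sequentially. measure M {w \<in> space M. ennreal ((1/8)^k / 4) < ?DH n w} < (1/2)^k \<and>
      measure M {w \<in> space M. ennreal ((1/8)^k / 4) < ?DK n w} < (1/2)^k \<and>
      measure M {w \<in> space M. ennreal ((1/2)^k) < ?EI n w} < (1/2)^k \<and>
      measure M {w \<in> space M. ennreal ((1/2)^k) < ?EJ n w} < (1/2)^k"
      by (intro eventually_conj ev hH hI kK kJ) auto
    then show "\<exists>n. measure M {w \<in> space M. ennreal ((1/8)^k / 4) < ?DH n w} < (1/2)^k \<and>
      measure M {w \<in> space M. ennreal ((1/8)^k / 4) < ?DK n w} < (1/2)^k \<and>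
      measure M {w \<in> space M. ennreal ((1/2)^k) < ?EI n w} < (1/2)^k \<and>
      measure M {w \<in> space M. ennreal ((1/2)^k) < ?EJ n w} < (1/2)^k"
      by (rule eventually_happens'[OF sequentially_bot])
  qed
  from choice[OF this] obtain n where n: "\<And>k. measure M {w \<in> space M. ennreal ((1/8)^k / 4) < ?DH (n k) w} < (1/2)^k"
    "\<And>k. measure M {w \<in> space M. ennreal ((1/8)^k / 4) < ?DK (n k) w} < (1/2)^k"
    "\<And>k. measure M {w \<in> space M. ennreal ((1/2)^k) < ?EI (n k) w} < (1/2)^k"
    "\<And>k. measure M {w \<in> space M. ennreal ((1/2)^k) < ?EJ (n k) w} < (1/2)^k"
    by blast
  define gs where "gs k = hs (n k) @ uminus_simple (ks (n k))" for k
  have gs: "simple_field M F T (gs k)" for k unfolding gs_def using hs ks by simp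
  note [measurable] = measurable_energy[OF jointly_simple[OF gs]] measurable_F[OF T measurable_simple_integral[OF gs T]]
  define A where "A k = {w \<in> space M. ennreal ((1/8)^k / 4) < ?DH (n k) w}" for k
  define B where "B k = {w \<in> space M. ennreal ((1/8)^k / 4) < ?DK (n k) w}" for k
  define C where "C k = {w \<in> space M. ennreal ((1/2)^k) < ?EI (n k) w}" for k
  define D where "D k = {w \<in> space M. ennreal ((1/2)^k) < ?EJ (n k) w}" for k
  define E where "E k = {w \<in> space M. (1/2)^k < \<bar>simple_integral W (gs k) w\<bar> \<and> energy T (simple_value (gs k)) w \<le> ennreal ((1/8)^k)}" for k
  have ABm: "A k \<in> sets M" "B k \<in> sets M" "C k \<in> sets M" "D k \<in> sets M" "E k \<in> sets M" for k
    unfolding A_def B_def C_def D_def E_def by measurable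
  have mE: "measure M (E k) \<le> (1/2)^k" for k
  proof -
    have "emeasure M (E k) \<le> ennreal ((1/8)^k / ((1/2)^k)\<^sup>2)"
      unfolding E_def by (rule simple_Lenglart[OF gs T]) auto
    also have "(1/8)^k / ((1/2::real)^k)\<^sup>2 = (1/2)^k"
      by (simp add: power_mult_distrib[symmetric] power_divide[symmetric] power2_eq_square)
    finally show ?thesis by (simp add: emeasure_eq_measure)
  qed
  let ?bad = "\<lambda>k. A k \<union> B k \<union> C k \<union> D k \<union> E k"
  have "AE w in M. \<forall>\<^sub>F k in sequentially. w \<in> space M - ?bad k"
  proof (rule borel_cantelli_AE1)
    show "?bad k \<in> sets M" for k using ABm by auto
    show "emeasure M (?bad k) < \<infinity>" for k by (simp add: emeasure_eq_measure)
    show "summable (\<lambda>k. measure M (?bad k))"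
    proof (rule summable_comparison_test'[of "\<lambda>k. 5 * (1/2::real)^k" 0])
      show "summable (\<lambda>k. 5 * (1/2::real)^k)" by (intro summable_mult summable_geometric) simp
      fix k
      have "measure M (?bad k) \<le> measure M (A k) + measure M (B k) + measure M (C k) + measure M (D k) + measure M (E k)"
      proof -
        have "measure M (?bad k) \<le> measure M (A k \<union> B k \<union> C k \<union> D k) + measure M (E k)"
          by (rule measure_Un_le) (use ABm in auto)
        moreover have "measure M (A k \<union> B k \<union> C k \<union> D k) \<le> measure M (A k \<union> B k \<union> C k) + measure M (D k)"
          by (rule measure_Un_le) (use ABm in auto)
        moreover have "measure M (A k \<union> B k \<union> C k) \<le> measure M (A k \<union> B k) + measure M (C k)"
          by (rule measure_Un_le) (use ABm in auto)
        moreover have "measure M (A k \<union> B k) \<le> measure M (A k) + measure M (B k)"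
          by (rule measure_Un_le) (use ABm in auto)
        ultimately show ?thesis by linarith
      qed
      also have "\<dots> \<le> 5 * (1/2)^k"
        using n[of k] mE[of k] unfolding A_def[symmetric] B_def[symmetric] C_def[symmetric] D_def[symmetric] by linarith
      finally show "norm (measure M (?bad k)) \<le> 5 * (1/2)^k" by simp
    qed
  qed
  then show ?thesis
  proof eventually_elim
    case (elim w)
    show ?case
    proof
      assume eq: "\<forall>s\<in>{0<..T}. \<forall>y\<in>{0..1}. H s y w = K s y w"
      have "\<forall>\<^sub>F k in sequentially. \<bar>I w - J w\<bar> \<le> 3 * (1/2)^k"
        using elim
      proof eventually_elim
        case (elim k)
        have w: "w \<in> space M" using elim by auto
        have 1: "?DH (n k) w \<le> ennreal ((1/8)^k / 4)" "?DK (n k) w \<le> ennreal ((1/8)^k / 4)"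
          using elim unfolding A_def B_def by auto
        have 2: "\<bar>simple_integral W (hs (n k)) w - I w\<bar> \<le> (1/2)^k" "\<bar>simple_integral W (ks (n k)) w - J w\<bar> \<le> (1/2)^k"
          using elim unfolding C_def D_def by (auto simp: ennreal_less_iff)
        have "energy T (simple_value (gs k)) w = energy T (\<lambda>s y w. (simple_value (hs (n k)) s y w - H s y w) + (K s y w - simple_value (ks (n k)) s y w)) w"
          unfolding energy_def gs_def
        proof (rule nn_integral_cong)
          fix p :: "real \<times> real"
          show "ennreal ((simple_value (hs (n k) @ uminus_simple (ks (n k))) (fst p) (snd p) w)\<^sup>2) * indicator (strip T) p =
            ennreal ((simple_value (hs (n k)) (fst p) (snd p) w - H (fst p) (snd p) w + (K (fst p) (snd p) w - simple_value (ks (n k)) (fst p) (snd p) w))\<^sup>2) * indicator (strip T) p"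
          proof (cases "p \<in> strip T")
            case True
            then have "H (fst p) (snd p) w = K (fst p) (snd p) w" using eq by (auto simp: strip_def)
            then show ?thesis by simp
          qed simp
        qed
        also have "\<dots> \<le> 2 * ?DH (n k) w + 2 * energy T (\<lambda>s y w. K s y w - simple_value (ks (n k)) s y w) w"
          by (intro energy_add js jointly_diff predictable_jointly pK jointly_simple ks w)
        also have "\<dots> \<le> 2 * ennreal ((1/8)^k / 4) + 2 * ennreal ((1/8)^k / 4)"
          unfolding energy_minus[of T K] by (intro add_mono mult_left_mono 1) auto
        also have "\<dots> = ennreal ((1/8)^k)" by (subst ennreal_twice_add) auto
        finally have "energy T (simple_value (gs k)) w \<le> ennreal ((1/8)^k)" .
        then have "\<bar>simple_integral W (gs k) w\<bar> \<le> (1/2)^k"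
          using elim unfolding E_def by auto
        then show "\<bar>I w - J w\<bar> \<le> 3 * (1/2)^k" using 2 unfolding gs_def by simp
      qed
      moreover have "(\<lambda>k. 3 * (1/2::real)^k) \<longlonglongrightarrow> 3 * 0"
        by (intro tendsto_mult tendsto_const LIMSEQ_power_zero) simp
      ultimately have "\<bar>I w - J w\<bar> \<le> 3 * 0"
        by (intro tendsto_lowerbound[of "\<lambda>k. 3 * (1/2::real)^k" _ sequentially]) auto
      then show "I w = J w" by simp
    qed
  qed
qed

end

section \<open>Conditional characteristic functions\<close>

context white_noise_space
begin

text \<open>Gaussian laws are given for sums over finite sets of regions, whereas the regions R i
  may coincide; the coefficients of equal regions are first collected in \<open>d\<close>. The
  variance is then read off from the covariance.\<close>

lemma gaussian_combination:
  fixes n :: nat and c :: "nat => real"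
  assumes R: "\<And>i. i < n ==> R i \<in> noise_sets"
  shows "(LINT w|M. iexp (\<xi> * (\<Sum>i<n. c i * W (R i) w))) =
    of_real (exp (- (\<xi>\<^sup>2 * (\<Sum>i<n. \<Sum>j<n. c i * c j * measure lborel (R i \<inter> R j)) / 2)))"
proof -
  let ?S = "R ` {..<n}"
  define d where "d A = (\<Sum>i\<in>{i\<in>{..<n}. R i = A}. c i)" for A
  have eq: "(\<Sum>A\<in>?S. d A * W A w) = (\<Sum>i<n. c i * W (R i) w)" for w
  proof -
    have "(\<Sum>i<n. c i * W (R i) w) = (\<Sum>A\<in>?S. \<Sum>i\<in>{i\<in>{..<n}. R i = A}. c i * W (R i) w)"
      by (rule sum.image_gen) simp
    also have "\<dots> = (\<Sum>A\<in>?S. d A * W A w)"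
      unfolding d_def sum_distrib_right by (intro sum.cong) auto
    finally show ?thesis by simp
  qed
  obtain v where v: "centered_gaussian M (\<lambda>w. \<Sum>A\<in>?S. d A * W A w) v"
    using W_gaussian[of ?S d] R by auto
  note G = centered_gaussian_moments[OF prob_space_axioms v[unfolded eq]]
  have "v = (LINT w|M. (\<Sum>i<n. \<Sum>j<n. c i * c j * (W (R i) w * W (R j) w)))"
    unfolding G(4)[symmetric] power2_eq_square sum_product by (simp add: mult_ac)
  also have "\<dots> = (\<Sum>i<n. \<Sum>j<n. (LINT w|M. c i * c j * (W (R i) w * W (R j) w)))"
    by (rule integral_double_sum(1)) (use R in \<open>auto intro!: integrable_mult_right W_prod_integrable\<close>)
  also have "\<dots> = (\<Sum>i<n. \<Sum>j<n. c i * c j * measure lborel (R i \<inter> R j))"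
    by (intro sum.cong refl) (simp add: W_cov R)
  finally show ?thesis using G(5)[of \<xi>] by simp
qed

text \<open>F t is independent of the noise after t, so the second argument may be replaced by an
  independent copy. This stands in for conditioning on F t.\<close>

lemma indep_after_Fubini:
  fixes f :: "'a \<times> 'a => complex"
  assumes t: "0 \<le> t" and f: "f \<in> borel_measurable (F t \<Otimes>\<^sub>M after t)" and bd: "\<And>z. norm (f z) \<le> B"
  shows "(LINT w|M. f (w, w)) = (LINT w|M. (LINT w'|M. f (w, w')))"
proof -
  have id: "(\<lambda>w. w) \<in> measurable M (F t)" "(\<lambda>w. w) \<in> measurable M (after t)"
    using measurable_F[OF t measurable_ident] measurable_after[OF t measurable_ident] by (auto simp: id_def)
  have "indep_var (F t) (\<lambda>w. w) (after t) (\<lambda>w. w)"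
    using indep_var_after[OF t measurable_ident measurable_ident] by (simp add: id_def)
  then have D: "distr M (F t) (\<lambda>w. w) \<Otimes>\<^sub>M distr M (after t) (\<lambda>w. w) = distr M (F t \<Otimes>\<^sub>M after t) (\<lambda>w. (w, w))"
    by (simp add: indep_var_distribution_eq)
  interpret P1: prob_space "distr M (F t) (\<lambda>w. w)" by (rule prob_space_distr[OF id(1)])
  interpret P2: prob_space "distr M (after t) (\<lambda>w. w)" by (rule prob_space_distr[OF id(2)])
  interpret P: pair_prob_space "distr M (F t) (\<lambda>w. w)" "distr M (after t) (\<lambda>w. w)" ..
  have f': "f \<in> borel_measurable (distr M (F t) (\<lambda>w. w) \<Otimes>\<^sub>M distr M (after t) (\<lambda>w. w))"
    using f by (simp cong: measurable_cong_sets add: D)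
  have int: "integrable (distr M (F t) (\<lambda>w. w) \<Otimes>\<^sub>M distr M (after t) (\<lambda>w. w)) f"
    by (rule P.P.integrable_const_bound[where B = B]) (use f' bd in auto)
  have sec: "(\<lambda>w'. f (w, w')) \<in> borel_measurable (after t)" if "w \<in> space M" for w
    using measurable_Pair2[OF f] that t by simp
  have "(LINT w|M. f (w, w)) = (LINT z|distr M (F t \<Otimes>\<^sub>M after t) (\<lambda>w. (w, w)). f z)"
    by (rule integral_distr[symmetric]) (use id f in auto)
  also have "\<dots> = (LINT w|distr M (F t) (\<lambda>w. w). (LINT w'|distr M (after t) (\<lambda>w. w). f (w, w')))"
    unfolding D[symmetric] by (rule P.integral_fst'[OF int, symmetric])
  also have "\<dots> = (LINT w|M. (LINT w'|distr M (after t) (\<lambda>w. w). f (w, w')))"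
  proof (rule integral_distr[OF id(1)])
    have "(\<lambda>w. LINT w'|distr M (after t) (\<lambda>w. w). f (w, w')) \<in> borel_measurable (distr M (F t) (\<lambda>w. w))"
      using f' by (intro P2.borel_measurable_lebesgue_integral) (simp add: case_prod_beta)
    then show "(\<lambda>w. LINT w'|distr M (after t) (\<lambda>w. w). f (w, w')) \<in> borel_measurable (F t)" by simp
  qed
  also have "\<dots> = (LINT w|M. (LINT w'|M. f (w, w')))"
    by (intro Bochner_Integration.integral_cong refl integral_distr[OF id(2)] sec) auto
  finally show ?thesis .
qed

text \<open>With the coefficients fixed by the past, the integral is a Gaussian combination of
  future noise whose variance is the energy of the simple field. Z only turns the phase and
  disappears in the norm; V will be the indicator of an event known at time t.\<close>

lemma conditional_gaussian:
  assumes t: "0 \<le> t" and V: "V \<in> borel_measurable (F t)" "\<And>w. 0 \<le> V w \<and> V w \<le> 1" and Z: "Z \<in> borel_measurable (F t)"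
    and hs: "\<And>a b A X. (a, b, A, X) \<in> set hs ==> t \<le> a \<and> A \<in> sets borel \<and> A \<subseteq> {0..1} \<and> X \<in> borel_measurable (F t)"
  shows "norm (LINT w|M. V w * iexp (\<xi> * (Z w + simple_integral W hs w))) \<le>
    (LINT w|M. V w * exp (- (\<xi>\<^sup>2 * (\<Sum>i<length hs. \<Sum>j<length hs.
      simple_coeff hs i w * simple_coeff hs j w * measure lborel (simple_rect hs i \<inter> simple_rect hs j)) / 2)))"
proof -
  let ?c = "simple_coeff hs" and ?R = "simple_rect hs" and ?n = "length hs"
  have R: "?R i \<in> noise_sets" "?R i \<subseteq> {t<..} \<times> {0..1}" and c: "?c i \<in> borel_measurable (F t)" if i: "i < ?n" for i
  proof -
    obtain a b A X where h: "hs ! i = (a, b, A, X)" by (metis prod_cases4)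
    have "(a, b, A, X) \<in> set hs" using nth_mem[OF i] h by simp
    note p = hs[OF this]
    show "?R i \<in> noise_sets" "?R i \<subseteq> {t<..} \<times> {0..1}" "?c i \<in> borel_measurable (F t)"
      using p t by (auto simp: simple_rect_def simple_coeff_def h intro!: rect_noise)
  qed
  define f where "f z = complex_of_real (V (fst z)) * iexp (\<xi> * (Z (fst z) + (\<Sum>i<?n. ?c i (fst z) * W (?R i) (snd z))))" for z
  have fm: "f \<in> borel_measurable (F t \<Otimes>\<^sub>M after t)"
  proof -
    have [measurable]: "(\<lambda>z. V (fst z)) \<in> borel_measurable (F t \<Otimes>\<^sub>M after t)" "(\<lambda>z. Z (fst z)) \<in> borel_measurable (F t \<Otimes>\<^sub>M after t)"
      using V(1) Z by measurable
    have [measurable]: "(\<lambda>z. \<Sum>i<?n. ?c i (fst z) * W (?R i) (snd z)) \<in> borel_measurable (F t \<Otimes>\<^sub>M after t)"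
    proof (rule borel_measurable_sum)
      fix i assume "i \<in> {..<?n}"
      then have i: "i < ?n" by simp
      note [measurable] = c[OF i] W_after[OF R[OF i]]
      show "(\<lambda>z. ?c i (fst z) * W (?R i) (snd z)) \<in> borel_measurable (F t \<Otimes>\<^sub>M after t)" by measurable
    qed
    show ?thesis unfolding f_def by measurable
  qed
  have fb: "norm (f z) \<le> 1" for z
    unfolding f_def norm_mult using V(2)[of "fst z"] by simp
  let ?Q = "\<lambda>w. \<Sum>i<?n. \<Sum>j<?n. ?c i w * ?c j w * measure lborel (?R i \<inter> ?R j)"
  have inner: "(LINT w'|M. f (w, w')) = V w * iexp (\<xi> * Z w) * of_real (exp (- (\<xi>\<^sup>2 * ?Q w / 2)))" for w
  proof -
    have "(LINT w'|M. f (w, w')) = (LINT w'|M. V w * iexp (\<xi> * Z w) * iexp (\<xi> * (\<Sum>i<?n. ?c i w * W (?R i) w')))"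
      unfolding f_def by (simp add: distrib_left exp_add mult_ac)
    also have "\<dots> = V w * iexp (\<xi> * Z w) * (LINT w'|M. iexp (\<xi> * (\<Sum>i<?n. ?c i w * W (?R i) w')))"
      by (rule integral_mult_right_zero)
    finally show ?thesis using gaussian_combination[of ?n ?R \<xi> "\<lambda>i. ?c i w", OF R(1)] by simp
  qed
  have "(LINT w|M. V w * iexp (\<xi> * (Z w + simple_integral W hs w))) = (LINT w|M. f (w, w))"
    unfolding f_def simple_integral_eq_sum by simp
  also have "\<dots> = (LINT w|M. V w * iexp (\<xi> * Z w) * of_real (exp (- (\<xi>\<^sup>2 * ?Q w / 2))))"
    unfolding indep_after_Fubini[OF t fm fb] inner ..
  finally have "norm (LINT w|M. V w * iexp (\<xi> * (Z w + simple_integral W hs w))) \<le>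
    (LINT w|M. norm (V w * iexp (\<xi> * Z w) * of_real (exp (- (\<xi>\<^sup>2 * ?Q w / 2)))))"
    using integral_norm_bound by simp
  also have "\<dots> = (LINT w|M. V w * exp (- (\<xi>\<^sup>2 * ?Q w / 2)))"
    using V(2) by (simp add: norm_mult)
  finally show ?thesis .
qed

end

section \<open>Square integrable characteristic functions\<close>

text \<open>Duality of Gaussians: variance 2 s^2 on one side, 1 / (2 s^2) on the other.\<close>

lemma normal_density_as_char:
  assumes "0 < s"
  shows "normal_density 0 (sqrt (s\<^sup>2 + s\<^sup>2)) d =
    1 / (2 * s * sqrt pi) * Re (char (density lborel (\<lambda>x. ennreal (normal_density 0 (1 / (sqrt 2 * s)) x))) d)"
proof -
  have "char (density lborel (\<lambda>x. ennreal (normal_density 0 (1 / (sqrt 2 * s)) x))) d = of_real (exp (- (d\<^sup>2 * (1 / (sqrt 2 * s))\<^sup>2 / 2)))"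
    by (rule char_normal_density) (use assms in simp)
  moreover have "(sqrt (s\<^sup>2 + s\<^sup>2))\<^sup>2 = 2 * s\<^sup>2" by simp
  moreover have "sqrt (2 * pi * (2 * s\<^sup>2)) = 2 * s * sqrt pi"
  proof -
    have "2 * pi * (2 * s\<^sup>2) = (2 * s)\<^sup>2 * pi" by (simp add: power2_eq_square)
    then have "sqrt (2 * pi * (2 * s\<^sup>2)) = \<bar>2 * s\<bar> * sqrt pi"
      by (simp only: real_sqrt_mult real_sqrt_abs)
    then show ?thesis using assms by simp
  qed
  ultimately show ?thesis
    using assms unfolding normal_density_def by (simp add: power_mult_distrib power_divide field_simps)
qed

lemma normal_density_le_char:
  assumes "0 < s"
  shows "1 / (2 * s * sqrt pi) * normal_density 0 (1 / (sqrt 2 * s)) x \<le> 1"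
proof -
  have "normal_density 0 (1 / (sqrt 2 * s)) x \<le> 1 / sqrt (2 * pi * (1 / (sqrt 2 * s))\<^sup>2)"
    unfolding normal_density_def by (rule mult_left_le) auto
  also have "2 * pi * (1 / (sqrt 2 * s))\<^sup>2 = pi / s\<^sup>2"
    by (simp add: power_divide power_mult_distrib)
  also have "1 / sqrt (pi / s\<^sup>2) = s / sqrt pi"
    using assms by (simp add: real_sqrt_divide)
  finally have "1 / (2 * s * sqrt pi) * normal_density 0 (1 / (sqrt 2 * s)) x \<le> 1 / (2 * s * sqrt pi) * (s / sqrt pi)"
    using assms by (intro mult_left_mono) auto
  also have "\<dots> = 1 / (2 * pi)" using assms by (simp add: field_simps)
  also have "\<dots> \<le> 1" using pi_gt3 by simp
  finally show ?thesis .
qed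

text \<open>The kernel is written as a characteristic function; exchanging the integrals turns the
  left side into a Gaussian average of the squared modulus of \<open>char \<nu>\<close>. The
  resulting bound does not depend on s.\<close>

lemma energy_char:
  assumes nu: "finite_measure \<nu>" "sets \<nu> = sets borel" and s: "0 < s"
  shows "(\<integral>\<^sup>+y. (\<integral>\<^sup>+y'. ennreal (normal_density 0 (sqrt (s\<^sup>2 + s\<^sup>2)) (y - y')) \<partial>\<nu>) \<partial>\<nu>) \<le> msq lborel (\<lambda>\<xi>. cmod (char \<nu> \<xi>))"
proof -
  interpret nu: finite_measure \<nu> by fact
  note nu(2)[measurable_cong]
  define \<tau> where "\<tau> = 1 / (sqrt 2 * s)"
  have tau: "0 < \<tau>" using s by (simp add: \<tau>_def)
  define N where "N = density lborel (\<lambda>x. ennreal (normal_density 0 \<tau> x))"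
  have setsN[measurable_cong]: "sets N = sets borel" by (simp add: N_def)
  interpret N: prob_space N unfolding N_def by (rule prob_space_normal_density[OF tau])
  let ?P = "\<nu> \<Otimes>\<^sub>M \<nu>"
  have fP: "finite_measure ?P" by (rule finite_measure_pair_measure) (rule nu(1))+
  interpret P: finite_measure ?P by (rule fP)
  interpret PP: pair_sigma_finite \<nu> \<nu> ..
  interpret PN: pair_sigma_finite ?P N ..
  define c where "c = 1 / (2 * s * sqrt pi)"
  have c: "0 \<le> c" using s by (simp add: c_def)
  let ?k = "\<lambda>d. normal_density 0 (sqrt (s\<^sup>2 + s\<^sup>2)) d"
  have k: "?k d = c * Re (char N d)" for d
    unfolding c_def N_def \<tau>_def by (rule normal_density_as_char[OF s])
  have km[measurable]: "(\<lambda>z. ?k (fst z - snd z)) \<in> borel_measurable ?P" by measurable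
  have fN: "finite_measure (?P \<Otimes>\<^sub>M N)" by (rule finite_measure_pair_measure) (rule fP N.finite_measure_axioms)+
  interpret T: finite_measure "?P \<Otimes>\<^sub>M N" by (rule fN)
  have int3: "integrable (?P \<Otimes>\<^sub>M N) (\<lambda>(z, \<xi>). iexp ((fst z - snd z) * \<xi>))"
    by (rule T.integrable_const_bound[where B = 1]) (auto simp: case_prod_beta)
  have inner: "(LINT z|?P. iexp ((fst z - snd z) * \<xi>)) = of_real ((cmod (char \<nu> \<xi>))\<^sup>2)" for \<xi>
  proof -
    have "integrable ?P (\<lambda>z. iexp ((fst z - snd z) * \<xi>))"
      by (rule P.integrable_const_bound[where B = 1]) auto
    then have "(LINT z|?P. iexp ((fst z - snd z) * \<xi>)) = (LINT y|\<nu>. (LINT y'|\<nu>. iexp ((y - y') * \<xi>)))"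
      by (subst PP.integral_fst'[symmetric]) auto
    also have "\<dots> = (LINT y|\<nu>. (LINT y'|\<nu>. iexp (\<xi> * y) * cnj (iexp (\<xi> * y'))))"
      by (intro Bochner_Integration.integral_cong refl) (simp add: exp_cnj exp_add[symmetric] algebra_simps)
    also have "\<dots> = (LINT y|\<nu>. iexp (\<xi> * y) * cnj (char \<nu> \<xi>))"
    proof -
      have "(LINT y'|\<nu>. cnj (iexp (\<xi> * y'))) = cnj (char \<nu> \<xi>)"
        unfolding char_def by (rule Bochner_Integration.integral_cnj)
      then show ?thesis by (simp only: integral_mult_right_zero)
    qed
    also have "\<dots> = char \<nu> \<xi> * cnj (char \<nu> \<xi>)"
      unfolding char_def by (rule integral_mult_left_zero)
    also have "\<dots> = of_real ((cmod (char \<nu> \<xi>))\<^sup>2)" by (rule complex_norm_square[symmetric])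
    finally show ?thesis .
  qed
  have "(LINT z|?P. char N (fst z - snd z)) = (LINT \<xi>|N. (LINT z|?P. iexp ((fst z - snd z) * \<xi>)))"
    unfolding char_def using PN.Fubini_integral[OF int3] by (simp add: case_prod_beta)
  also have "\<dots> = (LINT \<xi>|N. of_real ((cmod (char \<nu> \<xi>))\<^sup>2))" unfolding inner ..
  finally have "(LINT z|?P. char N (fst z - snd z)) = of_real (LINT \<xi>|N. (cmod (char \<nu> \<xi>))\<^sup>2)"
    by (simp only: integral_complex_of_real)
  moreover have intc: "integrable ?P (\<lambda>z. char N (fst z - snd z))"
  proof (rule P.integrable_const_bound[where B = 1])
    show "(\<lambda>z. char N (fst z - snd z)) \<in> borel_measurable ?P"
    proof -
      have "char N \<in> borel_measurable borel" unfolding char_def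
        by (rule N.borel_measurable_lebesgue_integral) (simp add: case_prod_beta)
      then show ?thesis by measurable
    qed
    have "real_distribution N" by unfold_locales (simp_all add: setsN sets_eq_imp_space_eq[OF setsN])
    then show "AE z in ?P. norm (char N (fst z - snd z)) \<le> 1"
      by (simp add: real_distribution.cmod_char_le_1)
  qed
  ultimately have re: "(LINT z|?P. Re (char N (fst z - snd z))) = (LINT \<xi>|N. (cmod (char \<nu> \<xi>))\<^sup>2)"
    by (simp add: integral_Re)
  have "(\<integral>\<^sup>+y. (\<integral>\<^sup>+y'. ennreal (?k (y - y')) \<partial>\<nu>) \<partial>\<nu>) = (\<integral>\<^sup>+z. ennreal (?k (fst z - snd z)) \<partial>?P)"
    by (subst nu.nn_integral_fst[symmetric]) auto
  also have "\<dots> = ennreal (LINT z|?P. ?k (fst z - snd z))"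
  proof (rule nn_integral_eq_integral)
    show "integrable ?P (\<lambda>z. ?k (fst z - snd z))"
      unfolding k using intc by (intro integrable_mult_right integrable_Re)
  qed simp
  also have "(LINT z|?P. ?k (fst z - snd z)) = c * (LINT \<xi>|N. (cmod (char \<nu> \<xi>))\<^sup>2)"
    unfolding k by (simp add: re)
  also have "ennreal \<dots> \<le> ennreal c * msq N (\<lambda>\<xi>. cmod (char \<nu> \<xi>))"
  proof -
    have "integrable N (\<lambda>\<xi>. (cmod (char \<nu> \<xi>))\<^sup>2)"
    proof (rule N.integrable_const_bound[where B = "(measure \<nu> (space \<nu>))\<^sup>2"])
      have cb: "cmod (char \<nu> \<xi>) \<le> measure \<nu> (space \<nu>)" for \<xi>
      proof -
        have "cmod (char \<nu> \<xi>) \<le> (LINT x|\<nu>. cmod (iexp (\<xi> * x)))"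
          unfolding char_def by (rule integral_norm_bound)
        then show ?thesis by simp
      qed
      show "AE \<xi> in N. norm ((cmod (char \<nu> \<xi>))\<^sup>2) \<le> (measure \<nu> (space \<nu>))\<^sup>2"
        by (simp add: power_mono cb)
      have "char \<nu> \<in> borel_measurable borel" unfolding char_def
        by (rule nu.borel_measurable_lebesgue_integral) (simp add: case_prod_beta)
      then show "(\<lambda>\<xi>. (cmod (char \<nu> \<xi>))\<^sup>2) \<in> borel_measurable N" by measurable
    qed
    then show ?thesis using c by (subst nn_integral_eq_integral) (auto simp: ennreal_mult)
  qed
  also have "\<dots> = (\<integral>\<^sup>+\<xi>. ennreal (c * normal_density 0 \<tau> \<xi>) * ennreal ((cmod (char \<nu> \<xi>))\<^sup>2) \<partial>lborel)"
  proof -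
    have "char \<nu> \<in> borel_measurable borel" unfolding char_def
      by (rule nu.borel_measurable_lebesgue_integral) (simp add: case_prod_beta)
    then show ?thesis unfolding N_def using c
      by (subst nn_integral_density) (auto simp: nn_integral_cmult[symmetric] ennreal_mult mult.assoc)
  qed
  also have "\<dots> \<le> (\<integral>\<^sup>+\<xi>. 1 * ennreal ((cmod (char \<nu> \<xi>))\<^sup>2) \<partial>lborel)"
    using normal_density_le_char[OF s] unfolding c_def \<tau>_def
    by (intro nn_integral_mono mult_right_mono) (auto simp: ennreal_le_1)
  finally show ?thesis by simp
qed

text \<open>The convolution of the Gaussian kernel with itself has variance 2 s^2. Together with
  \<open>energy_char\<close> this bounds the smoothed densities of \<nu> in L2, uniformly in
  s.\<close>

lemma smoothed_square:
  assumes nu: "finite_measure \<nu>" "sets \<nu> = sets borel" and s: "0 < s"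
  shows "(\<integral>\<^sup>+x. (\<integral>\<^sup>+y. ennreal (normal_density 0 s (x - y)) \<partial>\<nu>)\<^sup>2 \<partial>lborel) =
    (\<integral>\<^sup>+y. (\<integral>\<^sup>+y'. ennreal (normal_density 0 (sqrt (s\<^sup>2 + s\<^sup>2)) (y - y')) \<partial>\<nu>) \<partial>\<nu>)"
proof -
  interpret nu: finite_measure \<nu> by fact
  note nu(2)[measurable_cong]
  interpret L: pair_sigma_finite \<nu> lborel ..
  let ?g = "\<lambda>x. ennreal (normal_density 0 s x)"
  have "(\<integral>\<^sup>+x. (\<integral>\<^sup>+y. ?g (x - y) \<partial>\<nu>)\<^sup>2 \<partial>lborel) = (\<integral>\<^sup>+x. (\<integral>\<^sup>+y. (\<integral>\<^sup>+y'. ?g (x - y) * ?g (x - y') \<partial>\<nu>) \<partial>\<nu>) \<partial>lborel)"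
    unfolding power2_eq_square by (simp add: nn_integral_cmult nn_integral_multc)
  also have "\<dots> = (\<integral>\<^sup>+y. (\<integral>\<^sup>+x. (\<integral>\<^sup>+y'. ?g (x - y) * ?g (x - y') \<partial>\<nu>) \<partial>lborel) \<partial>\<nu>)"
    by (rule L.Fubini') measurable
  also have "\<dots> = (\<integral>\<^sup>+y. (\<integral>\<^sup>+y'. (\<integral>\<^sup>+x. ?g (x - y) * ?g (x - y') \<partial>lborel) \<partial>\<nu>) \<partial>\<nu>)"
  proof (rule nn_integral_cong)
    fix y show "(\<integral>\<^sup>+x. (\<integral>\<^sup>+y'. ?g (x - y) * ?g (x - y') \<partial>\<nu>) \<partial>lborel) = (\<integral>\<^sup>+y'. (\<integral>\<^sup>+x. ?g (x - y) * ?g (x - y') \<partial>lborel) \<partial>\<nu>)"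
      by (rule L.Fubini') measurable
  qed
  also have "\<dots> = (\<integral>\<^sup>+y. (\<integral>\<^sup>+y'. ennreal (normal_density 0 (sqrt (s\<^sup>2 + s\<^sup>2)) (y - y')) \<partial>\<nu>) \<partial>\<nu>)"
  proof (intro nn_integral_cong)
    fix y y'
    have sym: "normal_density 0 s (- z) = normal_density 0 s z" for z by (simp add: normal_density_def)
    have "(\<integral>\<^sup>+x. ?g (x - y) * ?g (x - y') \<partial>lborel) = (\<integral>\<^sup>+x. ?g (y' + 1 * x - y) * ?g (y' + 1 * x - y') \<partial>lborel)"
      using nn_integral_real_affine[of "\<lambda>x. ?g (x - y) * ?g (x - y')" 1 y'] by simp
    also have "\<dots> = (\<integral>\<^sup>+x. ennreal (normal_density 0 s ((y - y') - x) * normal_density 0 s x) \<partial>lborel)"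
    proof (rule nn_integral_cong)
      fix x
      have "normal_density 0 s (y' + 1 * x - y) = normal_density 0 s ((y - y') - x)"
        using sym[of "(y - y') - x"] by (simp add: algebra_simps)
      then show "?g (y' + 1 * x - y) * ?g (y' + 1 * x - y') = ennreal (normal_density 0 s ((y - y') - x) * normal_density 0 s x)"
        by (simp add: ennreal_mult)
    qed
    also have "\<dots> = normal_density 0 (sqrt (s\<^sup>2 + s\<^sup>2)) (y - y')"
      using fun_cong[OF conv_normal_density_zero_mean[OF s s], of "y - y'"] by simp
    finally show "(\<integral>\<^sup>+x. ?g (x - y) * ?g (x - y') \<partial>lborel) = ennreal (normal_density 0 (sqrt (s\<^sup>2 + s\<^sup>2)) (y - y'))" .
  qed
  finally show ?thesis .
qed

text \<open>Chebyshev: at most s^2 / r^2 \<le> 1/2 of the mass lies outside.\<close>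

lemma normal_mass_near:
  assumes s: "0 < s" and r: "0 < r" "2 * s\<^sup>2 \<le> r\<^sup>2"
  shows "ennreal (1 / 2) \<le> (\<integral>\<^sup>+x. ennreal (normal_density 0 s x) * indicator {- r<..<r} x \<partial>lborel)"
proof -
  let ?g = "normal_density 0 s"
  have 1: "(\<integral>\<^sup>+x. ennreal (?g x) \<partial>lborel) = 1"
    using s by (simp add: nn_integral_eq_integral integral_normal_density)
  have "has_bochner_integral lborel (\<lambda>x. ?g x * x\<^sup>2) (s\<^sup>2)"
    using normal_moment_even[OF s, of 0 1] s by (simp add: mult.commute)
  then have 2: "(\<integral>\<^sup>+x. ennreal (?g x * x\<^sup>2) \<partial>lborel) = ennreal (s\<^sup>2)"
    by (simp add: has_bochner_integral_iff nn_integral_eq_integral)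
  have "1 \<le> (\<integral>\<^sup>+x. ennreal (?g x) * indicator {- r<..<r} x + ennreal (1 / r\<^sup>2) * ennreal (?g x * x\<^sup>2) \<partial>lborel)"
    unfolding 1[symmetric]
  proof (rule nn_integral_mono)
    fix x :: real
    show "ennreal (?g x) \<le> ennreal (?g x) * indicator {- r<..<r} x + ennreal (1 / r\<^sup>2) * ennreal (?g x * x\<^sup>2)"
    proof (cases "\<bar>x\<bar> < r")
      case False
      then have "r\<^sup>2 \<le> x\<^sup>2" using r by (metis abs_le_square_iff abs_of_pos linorder_not_less)
      then have "?g x * 1 \<le> ?g x * (x\<^sup>2 / r\<^sup>2)" using r by (intro mult_left_mono) (auto simp: field_simps)
      then have "ennreal (?g x) \<le> ennreal (1 / r\<^sup>2) * ennreal (?g x * x\<^sup>2)"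
        by (simp flip: ennreal_mult add: ennreal_leI)
      then show ?thesis by (simp add: add_increasing)
    next
      case True
      then have "x \<in> {- r<..<r}" by auto
      then show ?thesis by (simp add: add_increasing2)
    qed
  qed
  also have "\<dots> = (\<integral>\<^sup>+x. ennreal (?g x) * indicator {- r<..<r} x \<partial>lborel) + ennreal (1 / r\<^sup>2) * ennreal (s\<^sup>2)"
    by (simp add: nn_integral_add nn_integral_cmult 2)
  also have "ennreal (1 / r\<^sup>2) * ennreal (s\<^sup>2) \<le> ennreal (1 / 2)"
  proof -
    have "ennreal (1 / r\<^sup>2) * ennreal (s\<^sup>2) = ennreal (s\<^sup>2 / r\<^sup>2)" by (simp flip: ennreal_mult)
    also have "\<dots> \<le> ennreal (1 / 2)" using r by (intro ennreal_leI) (simp add: field_simps)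
    finally show ?thesis .
  qed
  finally have *: "1 \<le> (\<integral>\<^sup>+x. ennreal (?g x) * indicator {- r<..<r} x \<partial>lborel) + ennreal (1 / 2)"
    by (simp add: add_left_mono)
  have "ennreal 1 = ennreal (1/2) + ennreal (1/2)"
    by (subst ennreal_plus[symmetric]) simp_all
  then have "ennreal (1/2) + ennreal (1/2) \<le> ennreal (1/2) + (\<integral>\<^sup>+x. ennreal (?g x) * indicator {- r<..<r} x \<partial>lborel)"
    using * by (simp add: add.commute)
  then have "ennreal (1/2) \<le> (\<integral>\<^sup>+x. ennreal (?g x) * indicator {- r<..<r} x \<partial>lborel)"
    by (subst (asm) ennreal_add_left_cancel_le) auto
  then show ?thesis .
qed

text \<open>The Gaussian smoothings of \<nu> are bounded in L2 by the norm of the characteristic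
  function. Hence open sets of small area have small \<nu>-measure, with a quantitative bound that
  survives the removal of the smoothing, and outer regularity passes to null sets.\<close>

theorem null_set_of_square_integrable_char:
  assumes nu: "finite_measure \<nu>" "sets \<nu> = sets borel"
    and fin: "msq lborel (\<lambda>\<xi>. cmod (char \<nu> \<xi>)) < \<infinity>"
    and A: "A \<in> null_sets lborel"
  shows "emeasure \<nu> A = 0"
proof -
  interpret nu: finite_measure \<nu> by fact
  note nu(2)[measurable_cong]
  interpret L: pair_sigma_finite \<nu> lborel ..
  define K where "K = msq lborel (\<lambda>\<xi>. cmod (char \<nu> \<xi>))"
  define f where "f n x = (\<integral>\<^sup>+y. ennreal (normal_density 0 (1 / Suc n) (x - y)) \<partial>\<nu>)" for n x
  have fm[measurable]: "f n \<in> borel_measurable borel" for n unfolding f_def by measurable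
  have f2: "(\<integral>\<^sup>+x. (f n x)\<^sup>2 \<partial>lborel) \<le> K" for n
    unfolding f_def K_def smoothed_square[OF nu, of "1 / Suc n", simplified of_nat_Suc, simplified]
    using smoothed_square[OF nu, of "1 / Suc n"] energy_char[OF nu, of "1 / Suc n"] by simp
  have open_bound: "emeasure \<nu> U \<le> 2 * (ennreal c * K + ennreal (1 / c) * emeasure lborel U)"
    if U: "open U" and l: "0 < c" for U c
  proof -
    have [measurable]: "U \<in> sets borel" using U by simp
    define h where "h n y = (\<integral>\<^sup>+x. ennreal (normal_density 0 (1 / Suc n) (x - y)) * indicator U x \<partial>lborel)" for n y
    have hm[measurable]: "h n \<in> borel_measurable borel" for n unfolding h_def by measurable
    have hf: "(\<integral>\<^sup>+y. h n y \<partial>\<nu>) = (\<integral>\<^sup>+x. f n x * indicator U x \<partial>lborel)" for n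
    proof -
      have "(\<integral>\<^sup>+y. h n y \<partial>\<nu>) = (\<integral>\<^sup>+x. (\<integral>\<^sup>+y. ennreal (normal_density 0 (1 / Suc n) (x - y)) * indicator U x \<partial>\<nu>) \<partial>lborel)"
        unfolding h_def by (rule L.Fubini'[symmetric]) measurable
      also have "\<dots> = (\<integral>\<^sup>+x. f n x * indicator U x \<partial>lborel)"
        unfolding f_def by (intro nn_integral_cong nn_integral_multc) measurable
      finally show ?thesis .
    qed
    have fU: "(\<integral>\<^sup>+x. f n x * indicator U x \<partial>lborel) \<le> ennreal c * K + ennreal (1 / c) * emeasure lborel U" for n
    proof -
      \<comment> \<open>A weighted replacement for Cauchy-Schwarz. At the end c = e and area below
        e^2 make both terms of order e.\<close>
      have amgm: "z \<le> ennreal c * z\<^sup>2 + ennreal (1 / c)" for z :: ennreal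
      proof (cases z)
        case (real r)
        have "r \<le> c * r\<^sup>2 + 1 / c"
        proof -
          have "0 \<le> (c * r - 1)\<^sup>2" by simp
          then have "c * r * 2 \<le> (c * r)\<^sup>2 + 1" by (simp add: power2_diff)
          then have "c * r \<le> (c * r)\<^sup>2 + 1" using mult_nonneg_nonneg[of c r] l real by linarith
          then have "c * r \<le> c * (c * r\<^sup>2 + 1 / c)" using l by (simp add: power2_eq_square algebra_simps)
          then show ?thesis using l by simp
        qed
        then show ?thesis using real l by (simp add: ennreal_power flip: ennreal_mult ennreal_plus)
      qed (use l in \<open>simp add: ennreal_mult_top power2_eq_square\<close>)
      have "(\<integral>\<^sup>+x. f n x * indicator U x \<partial>lborel) \<le> (\<integral>\<^sup>+x. ennreal c * (f n x)\<^sup>2 + ennreal (1 / c) * indicator U x \<partial>lborel)"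
      proof (rule nn_integral_mono)
        fix x show "f n x * indicator U x \<le> ennreal c * (f n x)\<^sup>2 + ennreal (1 / c) * indicator U x"
          using amgm[of "f n x"] by (cases "x \<in> U") auto
      qed
      also have "\<dots> = ennreal c * (\<integral>\<^sup>+x. (f n x)\<^sup>2 \<partial>lborel) + ennreal (1 / c) * emeasure lborel U"
        by (simp add: nn_integral_add nn_integral_cmult)
      also have "\<dots> \<le> ennreal c * K + ennreal (1 / c) * emeasure lborel U"
        by (intro add_mono mult_left_mono f2) auto
      finally show ?thesis .
    qed
    \<comment> \<open>The factor 2: a narrow Gaussian centred at a point of the open set U puts at
      least half of its mass into U.\<close>
    have lim: "indicator U y \<le> 2 * liminf (\<lambda>n. h n y)" for y
    proof (cases "y \<in> U")
      case True
      then obtain r where r: "0 < r" "ball y r \<subseteq> U" using U open_contains_ball by blast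
      have "\<forall>\<^sub>F n in sequentially. ennreal (1 / 2) \<le> h n y"
      proof -
        obtain N where N: "2 / r < real N" using reals_Archimedean2 by blast
        have "ennreal (1 / 2) \<le> h n y" if "N \<le> n" for n
        proof -
          have n: "2 / r < real (Suc n)" using N that by linarith
          then have "2 * (1 / real (Suc n)) \<le> r" using r by (simp add: field_simps)
          then have "(2 * (1 / real (Suc n)))\<^sup>2 \<le> r\<^sup>2" by (intro power_mono) auto
          moreover have "(2 * (1 / real (Suc n)))\<^sup>2 = 4 * (1 / real (Suc n))\<^sup>2"
            by (simp add: power2_eq_square)
          ultimately have "2 * (1 / real (Suc n))\<^sup>2 \<le> r\<^sup>2"
            using zero_le_power2[of "1 / real (Suc n)"] by linarith
          then have "ennreal (1 / 2) \<le> (\<integral>\<^sup>+x. ennreal (normal_density 0 (1 / Suc n) x) * indicator {- r<..<r} x \<partial>lborel)"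
            by (intro normal_mass_near r) auto
          also have "\<dots> \<le> (\<integral>\<^sup>+x. ennreal (normal_density 0 (1 / Suc n) x) * indicator U (y + x) \<partial>lborel)"
            using r(2) by (intro nn_integral_mono mult_left_mono) (auto simp: indicator_def subset_iff dist_real_def)
          also have "\<dots> = h n y"
            unfolding h_def using nn_integral_real_affine[of "\<lambda>x. ennreal (normal_density 0 (1 / Suc n) (x - y)) * indicator U x" 1 y] by simp
          finally show ?thesis .
        qed
        then show ?thesis unfolding eventually_sequentially by blast
      qed
      then have "ennreal (1 / 2) \<le> liminf (\<lambda>n. h n y)" by (rule Liminf_bounded)
      then have "2 * ennreal (1 / 2) \<le> 2 * liminf (\<lambda>n. h n y)" by (intro mult_left_mono) auto
      moreover have "2 * ennreal (1 / 2) = 1"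
        using ennreal_mult'[of 2 "1 / 2"] by simp
      ultimately show ?thesis using True by simp
    qed simp
    have "emeasure \<nu> U = (\<integral>\<^sup>+y. indicator U y \<partial>\<nu>)" by simp
    also have "\<dots> \<le> (\<integral>\<^sup>+y. 2 * liminf (\<lambda>n. h n y) \<partial>\<nu>)" by (intro nn_integral_mono lim)
    also have "\<dots> = 2 * (\<integral>\<^sup>+y. liminf (\<lambda>n. h n y) \<partial>\<nu>)" by (intro nn_integral_cmult) measurable
    also have "\<dots> \<le> 2 * liminf (\<lambda>n. \<integral>\<^sup>+y. h n y \<partial>\<nu>)" by (intro mult_left_mono nn_integral_liminf) auto
    also have "\<dots> \<le> 2 * liminf (\<lambda>n::nat. ennreal c * K + ennreal (1 / c) * emeasure lborel U)"
      unfolding hf by (intro mult_left_mono Liminf_mono always_eventually allI fU) auto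
    also have "\<dots> = 2 * (ennreal c * K + ennreal (1 / c) * emeasure lborel U)"
      by (simp add: Liminf_const)
    finally show ?thesis .
  qed
  have As: "A \<in> sets lborel" and A0: "emeasure lborel A = 0" using A by auto
  have "emeasure \<nu> A \<le> ennreal e * (2 * (K + 1))" if e: "0 < e" for e
  proof -
    obtain U where U: "open U" "A \<subseteq> U" "emeasure lborel (U - A) < ennreal (e\<^sup>2)"
      using outer_regular_lborel[of A "e\<^sup>2"] As e by auto
    have [measurable]: "U \<in> sets borel" using U by simp
    have "emeasure lborel U \<le> emeasure lborel (U - A) + emeasure lborel A"
      using emeasure_subadditive[of "U - A" lborel A] As U(2) by (simp add: Un_absorb2)
    then have Ue: "emeasure lborel U \<le> ennreal (e\<^sup>2)" using U(3) A0 by (simp add: less_imp_le order_trans)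
    have "emeasure \<nu> A \<le> emeasure \<nu> U" using U(2) nu(2) by (intro emeasure_mono) auto
    also have "\<dots> \<le> 2 * (ennreal e * K + ennreal (1 / e) * emeasure lborel U)" by (rule open_bound[OF U(1) e])
    also have "\<dots> \<le> 2 * (ennreal e * K + ennreal (1 / e) * ennreal (e\<^sup>2))"
      by (intro mult_left_mono add_mono Ue order_refl) auto
    also have "ennreal (1 / e) * ennreal (e\<^sup>2) = ennreal e"
      using e by (simp flip: ennreal_mult add: power2_eq_square)
    finally show ?thesis by (simp add: algebra_simps)
  qed
  note bound = this
  have eps: "emeasure \<nu> A \<le> 0 + ennreal e" if e: "0 < e" for e
  proof -
    have "2 * (K + 1) < \<top>" using fin unfolding K_def[symmetric] by (simp add: ennreal_mult_less_top less_top)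
    then obtain c where c: "2 * (K + 1) = ennreal c" "0 \<le> c" by (cases "2 * (K + 1)") auto
    have "emeasure \<nu> A \<le> ennreal (e / (c + 1)) * ennreal c"
      using bound[of "e / (c + 1)"] e c by simp
    also have "\<dots> = ennreal (e / (c + 1) * c)" using e c by (simp flip: ennreal_mult)
    also have "\<dots> \<le> ennreal e" using e c by (intro ennreal_leI) (simp add: field_simps)
    finally show ?thesis by simp
  qed
  have "emeasure \<nu> A \<le> 0" by (rule ennreal_le_epsilon) (rule eps)
  then show ?thesis by simp
qed

section \<open>The Neumann heat kernel\<close>

lemma summable_on_geometric_int:
  assumes "0 \<le> q" "q < (1::real)"
  shows "(\<lambda>n::int. q ^ nat \<bar>n\<bar>) summable_on UNIV"
proof -
  have g: "(\<lambda>n::nat. q ^ n) summable_on UNIV"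
    using assms by (intro norm_summable_imp_summable_on) (simp add: summable_geometric)
  have "((\<lambda>n::int. q ^ nat \<bar>n\<bar>) \<circ> int) summable_on UNIV"
    using g by (simp add: o_def)
  then have 1: "(\<lambda>n::int. q ^ nat \<bar>n\<bar>) summable_on range int"
    by (subst summable_on_reindex) auto
  have "((\<lambda>n::int. q ^ nat \<bar>n\<bar>) \<circ> (\<lambda>n. - int n)) summable_on UNIV"
    using g by (simp add: o_def)
  then have 2: "(\<lambda>n::int. q ^ nat \<bar>n\<bar>) summable_on range (\<lambda>n. - int n)"
    by (subst summable_on_reindex) (auto simp: inj_on_def)
  have "(\<lambda>n::int. q ^ nat \<bar>n\<bar>) summable_on (range int \<union> range (\<lambda>n. - int n))"
    by (rule summable_on_union[OF 1 2])
  moreover have "range int \<union> range (\<lambda>n. - int n) = UNIV"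
  proof -
    have "k \<in> range int \<union> range (\<lambda>n. - int n)" for k :: int
      by (cases "0 \<le> k") (auto simp: image_iff intro: exI[of _ "nat k"] exI[of _ "nat (- k)"])
    then show ?thesis by blast
  qed
  ultimately show ?thesis by simp
qed

definition image_sum :: "real => real => real => int => real" where
  "image_sum t x y n = exp (- (y - x - 2 * real_of_int n)\<^sup>2 / (4 * t)) + exp (- (y + x - 2 * real_of_int n)\<^sup>2 / (4 * t))"

lemma neumann_kernel_eq: "neumann_kernel t x y = 1 / sqrt (4 * pi * t) * (\<Sum>\<^sub>\<infinity>n. image_sum t x y n)"
  by (simp add: neumann_kernel_def image_sum_def)

text \<open>The exponent is split into halves: one keeps the decay in space, hence 8 t in place of 4
  t, and the other yields geometric decay in n, uniformly for t \<le> T.\<close>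

lemma gaussian_term_bound:
  assumes t: "0 < t" "t \<le> T" and d: "0 \<le> d" "d \<le> \<bar>a - 2 * real_of_int n\<bar>" and a: "\<bar>a\<bar> \<le> 2"
  shows "exp (- (a - 2 * real_of_int n)\<^sup>2 / (4 * t)) \<le> exp (- d\<^sup>2 / (8 * t)) * (exp (5 / (8 * T)) * exp (- 1 / (2 * T)) ^ nat \<bar>n\<bar>)"
proof -
  let ?z = "a - 2 * real_of_int n"
  have z: "d\<^sup>2 \<le> ?z\<^sup>2" using power_mono[OF d(2,1), of 2] by simp
  \<comment> \<open>Linear growth in n is enough: (|z| - 1)^2 \<ge> 0 and |z| \<ge> 2 |n| - 2 give
    z^2 \<ge> 4 |n| - 5.\<close>
  have "2 * \<bar>?z\<bar> - 1 \<le> ?z\<^sup>2"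
    using zero_le_power2[of "\<bar>?z\<bar> - 1"] by (simp add: power2_diff)
  moreover have "2 * \<bar>real_of_int n\<bar> - 2 \<le> \<bar>?z\<bar>" using a by linarith
  moreover have "4 * u - 5 \<le> q" if "2 * w - 1 \<le> q" "2 * u - 2 \<le> w" for u w q :: real
    using that by linarith
  ultimately have z2: "4 * \<bar>real_of_int n\<bar> - 5 \<le> ?z\<^sup>2" by blast
  have "(4 * \<bar>real_of_int n\<bar> - 5) / (8 * T) \<le> ?z\<^sup>2 / (8 * t)"
  proof -
    have "(4 * \<bar>real_of_int n\<bar> - 5) / (8 * T) \<le> ?z\<^sup>2 / (8 * T)" using z2 t by (intro divide_right_mono) auto
    also have "\<dots> \<le> ?z\<^sup>2 / (8 * t)" using t by (intro divide_left_mono) auto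
    finally show ?thesis .
  qed
  moreover have "d\<^sup>2 / (8 * t) \<le> ?z\<^sup>2 / (8 * t)" using z t by (intro divide_right_mono) auto
  moreover have "?z\<^sup>2 / (4 * t) = ?z\<^sup>2 / (8 * t) + ?z\<^sup>2 / (8 * t)" by (simp add: field_simps)
  moreover have "(4 * \<bar>real_of_int n\<bar> - 5) / (8 * T) = \<bar>real_of_int n\<bar> / (2 * T) - 5 / (8 * T)"
    using t by (simp add: field_simps)
  ultimately have "- ?z\<^sup>2 / (4 * t) \<le> - d\<^sup>2 / (8 * t) + (5 / (8 * T) - \<bar>real_of_int n\<bar> / (2 * T))" by simp
  then have "exp (- ?z\<^sup>2 / (4 * t)) \<le> exp (- d\<^sup>2 / (8 * t) + (5 / (8 * T) + \<bar>real_of_int n\<bar> * (- 1 / (2 * T))))" by simp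
  also have "\<dots> = exp (- d\<^sup>2 / (8 * t)) * (exp (5 / (8 * T)) * exp (- 1 / (2 * T)) ^ nat \<bar>n\<bar>)"
    by (simp only: exp_add exp_of_nat_mult[symmetric]) simp
  finally show ?thesis .
qed

lemma image_sum_nonneg: "0 \<le> image_sum t x y n"
  by (simp add: image_sum_def)

text \<open>For x and y in [0,1] no reflected or shifted image of the source is closer than the
  source itself, so the whole sum inherits the Gaussian factor of the direct term.\<close>

lemma image_sum_bound:
  assumes t: "0 < t" "t \<le> T" and x: "x \<in> {0..1}" "y \<in> {0..1}"
  shows "image_sum t x y n \<le> exp (- (y - x)\<^sup>2 / (8 * t)) * (2 * exp (5 / (8 * T))) * exp (- 1 / (2 * T)) ^ nat \<bar>n\<bar>"
proof -
  have 1: "\<bar>y - x\<bar> \<le> \<bar>(y - x) - 2 * real_of_int n\<bar>"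
  proof (cases "n = 0")
    case False
    then have "1 \<le> \<bar>real_of_int n\<bar>" by linarith
    then show ?thesis using x by auto
  qed simp
  have 2: "\<bar>y - x\<bar> \<le> \<bar>(y + x) - 2 * real_of_int n\<bar>"
  proof -
    consider "n \<le> 0" | "n \<ge> 1" by linarith
    then show ?thesis
    proof cases
      case 1
      then have "real_of_int n \<le> 0" by simp
      then show ?thesis using x by auto
    next
      case 2
      then have "1 \<le> real_of_int n" by simp
      then show ?thesis using x by auto
    qed
  qed
  have ab: "\<bar>y - x\<bar> \<le> 2" "\<bar>y + x\<bar> \<le> 2" using x by auto
  have "image_sum t x y n \<le> exp (- \<bar>y - x\<bar>\<^sup>2 / (8 * t)) * (exp (5 / (8 * T)) * exp (- 1 / (2 * T)) ^ nat \<bar>n\<bar>) +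
    exp (- \<bar>y - x\<bar>\<^sup>2 / (8 * t)) * (exp (5 / (8 * T)) * exp (- 1 / (2 * T)) ^ nat \<bar>n\<bar>)"
    unfolding image_sum_def
    by (intro add_mono gaussian_term_bound[OF t abs_ge_zero 1 ab(1)] gaussian_term_bound[OF t abs_ge_zero 2 ab(2)])
  then show ?thesis by (simp add: mult_ac)
qed

lemma image_sum_summable:
  assumes "0 < t" "x \<in> {0..1}" "y \<in> {0..1}"
  shows "image_sum t x y summable_on UNIV"
proof (rule summable_on_comparison_test)
  show "(\<lambda>n. exp (- (y - x)\<^sup>2 / (8 * t)) * (2 * exp (5 / (8 * t))) * exp (- 1 / (2 * t)) ^ nat \<bar>n\<bar>) summable_on UNIV"
    using assms by (intro summable_on_cmult_right summable_on_geometric_int) auto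
qed (use image_sum_bound[OF assms(1) order_refl assms(2,3)] image_sum_nonneg in auto)

lemma neumann_kernel_upper:
  assumes T: "0 < T"
  obtains C where "0 < C"
    "\<And>t x y. 0 < t ==> t \<le> T ==> x \<in> {0..1} ==> y \<in> {0..1} ==>
      neumann_kernel t x y \<le> C / sqrt t * exp (- (y - x)\<^sup>2 / (8 * t))"
proof -
  define S where "S = (\<Sum>\<^sub>\<infinity>n::int. exp (- 1 / (2 * T)) ^ nat \<bar>n\<bar>)"
  have sum: "(\<lambda>n::int. exp (- 1 / (2 * T)) ^ nat \<bar>n\<bar>) summable_on UNIV"
    using T by (intro summable_on_geometric_int) auto
  have S0: "0 \<le> S" unfolding S_def by (intro infsum_nonneg) auto
  \<comment> \<open>The added 1 makes the constant positive.\<close>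
  let ?C = "2 * exp (5 / (8 * T)) * S / sqrt (4 * pi) + 1"
  have "neumann_kernel t x y \<le> ?C / sqrt t * exp (- (y - x)\<^sup>2 / (8 * t))"
    if t: "0 < t" "t \<le> T" and x: "x \<in> {0..1}" "y \<in> {0..1}" for t x y
  proof -
    let ?e = "exp (- (y - x)\<^sup>2 / (8 * t))"
    have "(\<Sum>\<^sub>\<infinity>n. image_sum t x y n) \<le> (\<Sum>\<^sub>\<infinity>n::int. ?e * (2 * exp (5 / (8 * T))) * exp (- 1 / (2 * T)) ^ nat \<bar>n\<bar>)"
      by (intro infsum_mono image_sum_summable summable_on_cmult_right sum t x image_sum_bound)
    also have "\<dots> = ?e * (2 * exp (5 / (8 * T))) * S"
      unfolding S_def by (rule infsum_cmult_right) (use sum in simp)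
    finally have "neumann_kernel t x y \<le> 1 / sqrt (4 * pi * t) * (?e * (2 * exp (5 / (8 * T))) * S)"
      unfolding neumann_kernel_eq using t by (intro mult_left_mono) auto
    also have "\<dots> = (2 * exp (5 / (8 * T)) * S / sqrt (4 * pi)) / sqrt t * ?e"
      by (simp add: real_sqrt_mult)
    also have "\<dots> \<le> ?C / sqrt t * ?e"
      using t by (intro mult_right_mono divide_right_mono) auto
    finally show ?thesis .
  qed
  moreover have "0 < ?C" using S0 by (intro add_nonneg_pos divide_nonneg_nonneg mult_nonneg_nonneg) auto
  ultimately show ?thesis using that by blast
qed

lemma neumann_kernel_lower:
  assumes t: "0 < t" and x: "x \<in> {0..1}" "y \<in> {0..1}"
  shows "1 / sqrt (4 * pi * t) * exp (- (y - x)\<^sup>2 / (4 * t)) \<le> neumann_kernel t x y"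
proof -
  have "sum (image_sum t x y) {0} \<le> (\<Sum>\<^sub>\<infinity>n. image_sum t x y n)"
    by (rule finite_sum_le_infsum) (use image_sum_summable[OF t x] image_sum_nonneg in auto)
  then have "exp (- (y - x)\<^sup>2 / (4 * t)) \<le> (\<Sum>\<^sub>\<infinity>n. image_sum t x y n)"
    by (simp add: image_sum_def) (smt (verit) exp_gt_zero)
  then show ?thesis unfolding neumann_kernel_eq using t by (intro mult_left_mono) auto
qed

lemma neumann_kernel_pos: "0 < t ==> x \<in> {0..1} ==> y \<in> {0..1} ==> 0 < neumann_kernel t x y"
  by (rule less_le_trans[OF _ neumann_kernel_lower]) auto

text \<open>The default value of division by 0 makes the kernel vanish at its singular time, so
  intervals (a,t] closed on the right can be used throughout.\<close>

lemma neumann_kernel_0 [simp]: "neumann_kernel 0 x y = 0"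
  by (simp add: neumann_kernel_def)

lemma neumann_kernel_nonneg: "0 \<le> t ==> x \<in> {0..1} ==> y \<in> {0..1} ==> 0 \<le> neumann_kernel t x y"
  using neumann_kernel_pos[of t x y] by (cases "t = 0") auto

lemma filterlim_symmetric_interval: "filterlim (\<lambda>N. {- int N..int N}) (finite_subsets_at_top UNIV) sequentially"
  unfolding filterlim_finite_subsets_at_top
proof (intro allI impI)
  fix X :: "int set" assume X: "finite X \<and> X \<subseteq> UNIV"
  have "bdd_above (abs ` X)" using X by (intro bdd_above_finite) auto
  then obtain B where B: "\<And>k. k \<in> X ==> \<bar>k\<bar> \<le> B"
    unfolding bdd_above_def by auto
  show "\<forall>\<^sub>F N in sequentially. finite {- int N..int N} \<and> X \<subseteq> {- int N..int N} \<and> {- int N..int N} \<subseteq> UNIV"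
    unfolding eventually_sequentially
  proof (intro exI[of _ "nat B"] allI impI)
    fix N assume "nat B \<le> N"
    then show "finite {- int N..int N} \<and> X \<subseteq> {- int N..int N} \<and> {- int N..int N} \<subseteq> UNIV"
      using B by force
  qed
qed

text \<open>The unordered sum over the integers is the limit of the sums over symmetric intervals,
  each of which is measurable.\<close>

lemma measurable_neumann_kernel:
  assumes x: "x \<in> {0..1}"
  shows "(\<lambda>p. neumann_kernel (t - fst p) x (snd p) * indicator ({..t} \<times> {0..1}) p) \<in> borel_measurable borel"
proof -
  let ?K = "\<lambda>N p. if fst p < t \<and> snd p \<in> {0..1} then 1 / sqrt (4 * pi * (t - fst p)) * (\<Sum>n\<in>{- int N..int N}. image_sum (t - fst p) x (snd p) n) else 0 :: real"
  show ?thesis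
  proof (rule borel_measurable_LIMSEQ_real[where u = ?K])
    fix N
    have "(\<lambda>p. ?K N p) \<in> borel_measurable (borel \<Otimes>\<^sub>M borel)"
      unfolding image_sum_def by measurable
    then show "?K N \<in> borel_measurable borel" by (simp add: borel_prod)
  next
    fix p :: "real \<times> real"
    show "(\<lambda>N. ?K N p) \<longlonglongrightarrow> neumann_kernel (t - fst p) x (snd p) * indicator ({..t} \<times> {0..1}) p"
    proof (cases "fst p < t \<and> snd p \<in> {0..1}")
      case True
      have "(image_sum (t - fst p) x (snd p) has_sum (\<Sum>\<^sub>\<infinity>n. image_sum (t - fst p) x (snd p) n)) UNIV"
        using image_sum_summable[of "t - fst p" x "snd p"] True x by (intro has_sum_infsum) auto
      then have "(\<lambda>N. \<Sum>n\<in>{- int N..int N}. image_sum (t - fst p) x (snd p) n) \<longlonglongrightarrow> (\<Sum>\<^sub>\<infinity>n. image_sum (t - fst p) x (snd p) n)"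
        unfolding has_sum_def by (rule filterlim_compose[OF _ filterlim_symmetric_interval])
      then have "(\<lambda>N. 1 / sqrt (4 * pi * (t - fst p)) * (\<Sum>n\<in>{- int N..int N}. image_sum (t - fst p) x (snd p) n)) \<longlonglongrightarrow> neumann_kernel (t - fst p) x (snd p)"
        unfolding neumann_kernel_eq by (intro tendsto_mult tendsto_const)
      moreover have "indicator ({..t} \<times> {0..1}) p = (1::real)" using True by (cases p) (auto simp: indicator_def)
      ultimately show ?thesis using True by simp
    next
      case False
      then have zero: "neumann_kernel (t - fst p) x (snd p) * indicator ({..t} \<times> {0..1}) p = 0"
        by (cases p) (auto simp: indicator_def)
      have "(\<lambda>N. ?K N p) = (\<lambda>N. 0)" using False by (intro ext) (rule if_not_P)
      then show ?thesis unfolding zero by (simp only: tendsto_const)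
    qed
  qed
qed

section \<open>Square integrals of the kernel\<close>

lemma nn_integral_inverse_sqrt:
  assumes "a \<le> s"
  shows "(\<integral>\<^sup>+r. ennreal (1 / sqrt (s - r)) * indicator {a<..s} r \<partial>lborel) = ennreal (2 * sqrt (s - a))"
proof -
  let ?f = "\<lambda>r. if r \<le> s then 1 / sqrt (s - r) else 0"
  have "((\<lambda>r. 1 / sqrt (s - r)) has_integral (- 2 * sqrt (s - s)) - (- 2 * sqrt (s - a))) {a..s}"
  proof (rule fundamental_theorem_of_calculus_interior[OF assms])
    show "continuous_on {a..s} (\<lambda>r. - 2 * sqrt (s - r))" by (intro continuous_intros)
    fix r assume "r \<in> {a<..<s}"
    then have "((\<lambda>r. - 2 * sqrt (s - r)) has_real_derivative 1 / sqrt (s - r)) (at r)"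
      by (auto intro!: derivative_eq_intros simp: field_simps)
    then show "((\<lambda>r. - 2 * sqrt (s - r)) has_vector_derivative 1 / sqrt (s - r)) (at r)"
      by (simp add: has_real_derivative_iff_has_vector_derivative)
  qed
  then have "((\<lambda>r. 1 / sqrt (s - r)) has_integral (2 * sqrt (s - a))) {a..s}" by simp
  then have "(?f has_integral (2 * sqrt (s - a))) {a..s}"
    by (rule has_integral_eq[rotated]) auto
  then have "((\<lambda>r. if r \<in> {a..s} then ?f r else 0) has_integral (2 * sqrt (s - a))) UNIV"
    by (simp only: has_integral_restrict_UNIV)
  then have "(\<integral>\<^sup>+r. ennreal (if r \<in> {a..s} then ?f r else 0) \<partial>lborel) = ennreal (2 * sqrt (s - a))"
    by (intro nn_integral_has_integral_lborel) auto
  also have "(\<integral>\<^sup>+r. ennreal (if r \<in> {a..s} then ?f r else 0) \<partial>lborel) = (\<integral>\<^sup>+r. ennreal (1 / sqrt (s - r)) * indicator {a<..s} r \<partial>lborel)"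
    by (intro nn_integral_cong_AE AE_I[where N = "{a}"]) (auto simp: indicator_def)
  finally show ?thesis .
qed

lemma nn_integral_gaussian:
  assumes "0 < t"
  shows "(\<integral>\<^sup>+y. ennreal (exp (- (y - x)\<^sup>2 / (4 * t))) \<partial>lborel) = ennreal (sqrt (4 * pi * t))"
proof -
  let ?s = "sqrt (2 * t)"
  have s: "0 < ?s" "?s\<^sup>2 = 2 * t" using assms by auto
  have "exp (- (y - x)\<^sup>2 / (4 * t)) = sqrt (4 * pi * t) * normal_density x ?s y" for y
  proof -
    have "2 * pi * (2 * t) = 4 * pi * t" "2 * (2 * t) = 4 * t" by simp_all
    then have "normal_density x ?s y = 1 / sqrt (4 * pi * t) * exp (- (y - x)\<^sup>2 / (4 * t))"
      unfolding normal_density_def s(2) by (simp only:)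
    moreover have "sqrt (4 * pi * t) \<noteq> 0" using assms by simp
    ultimately show ?thesis by (simp only: mult.assoc[symmetric]) simp
  qed
  then have "(\<integral>\<^sup>+y. ennreal (exp (- (y - x)\<^sup>2 / (4 * t))) \<partial>lborel) = (\<integral>\<^sup>+y. ennreal (sqrt (4 * pi * t)) * ennreal (normal_density x ?s y) \<partial>lborel)"
    using assms by (simp add: ennreal_mult)
  also have "\<dots> = ennreal (sqrt (4 * pi * t)) * (\<integral>\<^sup>+y. ennreal (normal_density x ?s y) \<partial>lborel)"
    by (rule nn_integral_cmult) simp
  also have "(\<integral>\<^sup>+y. ennreal (normal_density x ?s y) \<partial>lborel) = 1"
    using s by (subst nn_integral_eq_integral) auto
  finally show ?thesis by simp
qed

text \<open>Squaring turns exp(-d^2 / (8 r)) into exp(-d^2 / (4 r)), whose integral over space is of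
  order sqrt r. Against the prefactor 1 / r there remains 1 / sqrt r in time, which integrates to
  the square root of the elapsed time.\<close>

lemma kernel_square_integral:
  assumes T: "0 < T"
  obtains C where "0 < C"
    "\<And>a s x. a \<le> s ==> s - a \<le> T ==> x \<in> {0..1} ==>
      (\<integral>\<^sup>+p. kernel_sq s x a s p \<partial>lborel) \<le> ennreal (C * sqrt (s - a))"
proof -
  obtain C where C: "0 < C" "\<And>t x y. 0 < t ==> t \<le> T ==> x \<in> {0..1} ==> y \<in> {0..1} ==>
      neumann_kernel t x y \<le> C / sqrt t * exp (- (y - x)\<^sup>2 / (8 * t))"
    using neumann_kernel_upper[OF T] by blast
  define D where "D = C\<^sup>2 * sqrt (4 * pi)"
  have D: "0 < D" using C by (simp add: D_def)
  have "(\<integral>\<^sup>+p. kernel_sq s x a s p \<partial>lborel) \<le> ennreal (2 * D * sqrt (s - a))"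
    if a: "a \<le> s" "s - a \<le> T" and x: "x \<in> {0..1}" for a s x
  proof -
    let ?g = "\<lambda>p. ennreal (C\<^sup>2 / (s - fst p) * exp (- (snd p - x)\<^sup>2 / (4 * (s - fst p)))) * indicator {a<..s} (fst p)"
    have "(\<integral>\<^sup>+p. kernel_sq s x a s p \<partial>lborel) \<le> (\<integral>\<^sup>+p. ?g p \<partial>lborel)"
    proof (rule nn_integral_mono)
      fix p :: "real \<times> real"
      obtain r y where p: "p = (r, y)" by force
      show "kernel_sq s x a s p \<le> ?g p"
      proof (cases "r \<in> {a<..<s} \<and> y \<in> {0..1}")
        case True
        have "(neumann_kernel (s - r) x y)\<^sup>2 \<le> (C / sqrt (s - r) * exp (- (y - x)\<^sup>2 / (8 * (s - r))))\<^sup>2"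
          using True x a by (intro power_mono C(2) neumann_kernel_nonneg) auto
        also have "\<dots> = C\<^sup>2 / (s - r) * exp (- (y - x)\<^sup>2 / (4 * (s - r)))"
        proof -
          have "(exp (- (y - x)\<^sup>2 / (8 * (s - r))))\<^sup>2 = exp (- (y - x)\<^sup>2 / (4 * (s - r)))"
          proof -
            have "2 * (- q / (8 * d)) = - q / (4 * d)" for q d :: real by simp
            then have "2 * (- (y - x)\<^sup>2 / (8 * (s - r))) = - (y - x)\<^sup>2 / (4 * (s - r))" .
            then show ?thesis using exp_double[of "- (y - x)\<^sup>2 / (8 * (s - r))"] by (simp only:)
          qed
          then show ?thesis using True by (simp add: power_mult_distrib power_divide)
        qed
        finally show ?thesis using True by (simp add: p ennreal_leI)
      next
        case False
        then have "neumann_kernel (s - r) x y = 0 \<or> indicator ({a<..s} \<times> {0..1}) (r, y) = (0::ennreal)"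
          by (cases "r = s") (auto simp: indicator_def)
        then show ?thesis by (auto simp: p)
      qed
    qed
    also have "\<dots> = (\<integral>\<^sup>+r. (\<integral>\<^sup>+y. ?g (r, y) \<partial>lborel) \<partial>lborel)"
      unfolding lborel_prod[symmetric] by (rule lborel.nn_integral_fst[symmetric]) measurable
    also have "\<dots> \<le> (\<integral>\<^sup>+r. ennreal D * (ennreal (1 / sqrt (s - r)) * indicator {a<..s} r) \<partial>lborel)"
    proof (rule nn_integral_mono)
      fix r
      show "(\<integral>\<^sup>+y. ?g (r, y) \<partial>lborel) \<le> ennreal D * (ennreal (1 / sqrt (s - r)) * indicator {a<..s} r)"
      proof (cases "r \<in> {a<..<s}")
        case True
        have "(\<integral>\<^sup>+y. ?g (r, y) \<partial>lborel) = (\<integral>\<^sup>+y. ennreal (C\<^sup>2 / (s - r)) * ennreal (exp (- (y - x)\<^sup>2 / (4 * (s - r)))) \<partial>lborel)"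
          using True by (intro nn_integral_cong) (simp flip: ennreal_mult)
        also have "\<dots> = ennreal (C\<^sup>2 / (s - r)) * (\<integral>\<^sup>+y. ennreal (exp (- (y - x)\<^sup>2 / (4 * (s - r)))) \<partial>lborel)"
          by (rule nn_integral_cmult) simp
        also have "(\<integral>\<^sup>+y. ennreal (exp (- (y - x)\<^sup>2 / (4 * (s - r)))) \<partial>lborel) = ennreal (sqrt (4 * pi * (s - r)))"
          by (rule nn_integral_gaussian) (use True in simp)
        also have "ennreal (C\<^sup>2 / (s - r)) * ennreal (sqrt (4 * pi * (s - r))) = ennreal (D * (1 / sqrt (s - r)))"
        proof -
          have "C\<^sup>2 / (s - r) * sqrt (4 * pi * (s - r)) = D * (sqrt (s - r) / (s - r))"
            by (simp add: D_def real_sqrt_mult)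
          also have "sqrt (s - r) / (s - r) = 1 / sqrt (s - r)"
            using True by (simp add: sqrt_divide_self_eq inverse_eq_divide)
          finally show ?thesis using True by (simp flip: ennreal_mult)
        qed
        also have "\<dots> = ennreal D * (ennreal (1 / sqrt (s - r)) * indicator {a<..s} r)"
          using True D by (simp flip: ennreal_mult)
        finally show ?thesis by simp
      next
        case False
        then show ?thesis by (cases "r = s") auto
      qed
    qed
    also have "\<dots> = ennreal D * ennreal (2 * sqrt (s - a))"
      by (subst nn_integral_cmult) (auto simp: nn_integral_inverse_sqrt[OF a(1)])
    also have "\<dots> = ennreal (2 * D * sqrt (s - a))" using D a by (simp add: ennreal_mult[symmetric] mult_ac)
    finally show ?thesis .
  qed
  then show ?thesis using that[of "2 * D"] D by simp
qed

text \<open>Only points within distance sqrt (t - r) of x are used, where the kernel is at least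
  exp(-1/4) / sqrt (4 pi (t - r)). Its square times the length sqrt (t - r) gives c / sqrt (t - r),
  and integration in time yields 2 c sqrt \<epsilon>. So the lower bound has the same order as the
  upper one, even near x only.\<close>

lemma kernel_square_integral_lower:
  assumes x: "x \<in> {0..1}" and \<epsilon>: "0 < \<epsilon>" "\<epsilon> \<le> 1 / 4" "\<epsilon> \<le> \<rho>\<^sup>2" "0 < \<rho>"
  shows "ennreal (exp (- 1 / 2) / (2 * pi) * sqrt \<epsilon>) \<le>
    (\<integral>\<^sup>+p. ennreal ((neumann_kernel (t - fst p) x (snd p))\<^sup>2) * indicator ({t - \<epsilon><..t} \<times> ({0..1} \<inter> {x - \<rho>..x + \<rho>})) p \<partial>lborel)"
proof -
  define c where "c = exp (- 1 / 2) / (4 * pi)"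
  have c: "0 < c" by (simp add: c_def)
  \<comment> \<open>The interval extends from x towards the farther end point; with length at most
    1/2 it stays inside [0,1], also when x is an end point itself.\<close>
  let ?J = "\<lambda>r. if x \<le> 1 / 2 then {x..x + sqrt (t - r)} else {x - sqrt (t - r)..x}"
  let ?h = "\<lambda>p. ennreal (c / (t - fst p)) * indicator {t - \<epsilon><..t} (fst p) * indicator (?J (fst p)) (snd p)"
  have sq: "sqrt (t - r) \<le> 1 / 2 \<and> sqrt (t - r) \<le> \<rho> \<and> 0 < sqrt (t - r)" if "r \<in> {t - \<epsilon><..<t}" for r
  proof -
    have "sqrt (t - r) \<le> sqrt ((1 / 2)\<^sup>2)" using that \<epsilon> by (intro real_sqrt_le_mono) (auto simp: power2_eq_square)
    moreover have "sqrt (t - r) \<le> sqrt (\<rho>\<^sup>2)" using that \<epsilon> by (intro real_sqrt_le_mono) auto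
    ultimately show ?thesis using that \<epsilon> by simp
  qed
  have "ennreal (exp (- 1 / 2) / (2 * pi) * sqrt \<epsilon>) = ennreal c * ennreal (2 * sqrt (t - (t - \<epsilon>)))"
    using \<epsilon> by (simp add: c_def ennreal_mult[symmetric])
  also have "\<dots> = (\<integral>\<^sup>+r. ennreal c * (ennreal (1 / sqrt (t - r)) * indicator {t - \<epsilon><..t} r) \<partial>lborel)"
    using \<epsilon> by (subst nn_integral_cmult) (auto simp: nn_integral_inverse_sqrt)
  also have "\<dots> \<le> (\<integral>\<^sup>+r. (\<integral>\<^sup>+y. ?h (r, y) \<partial>lborel) \<partial>lborel)"
  proof (rule nn_integral_mono)
    fix r
    show "ennreal c * (ennreal (1 / sqrt (t - r)) * indicator {t - \<epsilon><..t} r) \<le> (\<integral>\<^sup>+y. ?h (r, y) \<partial>lborel)"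
    proof (cases "r \<in> {t - \<epsilon><..<t}")
      case True
      have "(\<integral>\<^sup>+y. ?h (r, y) \<partial>lborel) = ennreal (c / (t - r)) * emeasure lborel (?J r)"
        using True by (simp add: nn_integral_cmult)
      also have "emeasure lborel (?J r) = ennreal (sqrt (t - r))"
        using sq[OF True] by auto
      also have "ennreal (c / (t - r)) * ennreal (sqrt (t - r)) = ennreal (c * (sqrt (t - r) / (t - r)))"
        using True c by (simp flip: ennreal_mult)
      also have "sqrt (t - r) / (t - r) = 1 / sqrt (t - r)"
        using True by (simp add: sqrt_divide_self_eq inverse_eq_divide)
      finally show ?thesis using True c by (simp flip: ennreal_mult)
    next
      case False
      then show ?thesis by (cases "r = t") auto
    qed
  qed
  also have "\<dots> = (\<integral>\<^sup>+p. ?h p \<partial>lborel)"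
  proof -
    have J: "indicator (?J (fst p)) (snd p) = (if (if x \<le> 1 / 2 then x \<le> snd p \<and> snd p \<le> x + sqrt (t - fst p) else x - sqrt (t - fst p) \<le> snd p \<and> snd p \<le> x) then 1 else 0 :: ennreal)" for p
      by (auto simp: indicator_def)
    show ?thesis unfolding lborel_prod[symmetric] J
      by (rule lborel.nn_integral_fst) measurable
  qed
  also have "\<dots> \<le> (\<integral>\<^sup>+p. ennreal ((neumann_kernel (t - fst p) x (snd p))\<^sup>2) * indicator ({t - \<epsilon><..t} \<times> ({0..1} \<inter> {x - \<rho>..x + \<rho>})) p \<partial>lborel)"
  proof (rule nn_integral_mono)
    fix p :: "real \<times> real"
    obtain r y where p: "p = (r, y)" by force
    show "?h p \<le> ennreal ((neumann_kernel (t - fst p) x (snd p))\<^sup>2) * indicator ({t - \<epsilon><..t} \<times> ({0..1} \<inter> {x - \<rho>..x + \<rho>})) p"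
    proof (cases "r \<in> {t - \<epsilon><..<t} \<and> y \<in> ?J r")
      case True
      note s = sq[OF conjunct1[OF True]]
      have y: "y \<in> {0..1}" "y \<in> {x - \<rho>..x + \<rho>}" "\<bar>y - x\<bar> \<le> sqrt (t - r)"
        using True s x by (auto split: if_splits)
      have "(y - x)\<^sup>2 \<le> t - r" using y(3) True by (metis abs_le_square_iff abs_of_pos s real_sqrt_pow2 less_imp_le atLeastAtMost_iff diff_ge_0_iff_ge greaterThanLessThan_iff)
      then have "(y - x)\<^sup>2 / (4 * (t - r)) \<le> 1 / 4" using True by (simp add: field_simps)
      then have e: "exp (- 1 / 4) \<le> exp (- (y - x)\<^sup>2 / (4 * (t - r)))" by simp
      have "c / (t - r) = (1 / sqrt (4 * pi * (t - r)) * exp (- 1 / 4))\<^sup>2"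
        using True by (simp add: c_def power_mult_distrib power_divide exp_double[symmetric])
      also have "\<dots> \<le> (1 / sqrt (4 * pi * (t - r)) * exp (- (y - x)\<^sup>2 / (4 * (t - r))))\<^sup>2"
        using True e by (intro power_mono mult_left_mono) auto
      also have "\<dots> \<le> (neumann_kernel (t - r) x y)\<^sup>2"
        using True x y by (intro power_mono neumann_kernel_lower) auto
      finally show ?thesis using True y by (auto simp: p ennreal_leI indicator_def split: if_splits)
    next
      case False
      then have "?h p = 0" by (cases "r = t") (auto simp: p indicator_def)
      then show ?thesis by (simp only: zero_le)
    qed
  qed
  finally show ?thesis .
qed

section \<open>Predictability and conditional expectations\<close>

lemma sum_indicator_select:
  assumes "finite I" "i0 \<in> I" "s \<in> A i0" "\<And>i. i \<in> I ==> i \<noteq> i0 ==> s \<notin> A i"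
  shows "(\<Sum>i\<in>I. f i * indicator (A i) s) = (f i0 :: real)"
proof -
  have "(\<Sum>i\<in>I. f i * indicator (A i) s) = f i0 * indicator (A i0) s + (\<Sum>i\<in>I - {i0}. f i * indicator (A i) s)"
    by (rule sum.remove[OF assms(1,2)])
  also have "(\<Sum>i\<in>I - {i0}. f i * indicator (A i) s) = 0"
    by (rule sum.neutral) (use assms(4) in auto)
  finally show ?thesis using assms(3) by simp
qed

context white_noise_space
begin

lemma predictable_elementary':
  assumes p: "0 \<le> a" "a \<le> b" "A \<in> sets borel" "X \<in> borel_measurable (F a)"
  shows "predictable T (\<lambda>s y w. X w * indicator {a<..b} s * indicator A y)"
proof (cases "a \<le> T")
  case True
  have "predictable T (\<lambda>s y w. X w * indicator {a<..min b T} s * indicator (A \<inter> {0..1}) y)"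
    by (rule predictable_elementary) (use p True in auto)
  then show ?thesis
    by (subst measurable_cong[where g = "\<lambda>(s, y, w). X w * indicator {a<..min b T} s * indicator (A \<inter> {0..1}) y"])
      (auto simp: indicator_def)
next
  case False
  have "(\<lambda>(s, y, w). 0 :: real) \<in> borel_measurable (predictable_sigma M F T)" by simp
  then show ?thesis
    by (subst measurable_cong[where g = "\<lambda>(s, y, w). 0"]) (use False in \<open>auto simp: indicator_def\<close>)
qed

text \<open>Approximation by step fields that use the value at the grid time strictly before s, so
  that the coefficient on a cell is known where the cell begins; continuity gives convergence. The
  time index starts at 1 because the field lives on positive times.\<close>

lemma predictable_continuous:
  assumes cont: "continuous_field M U" and ad: "adapted_field F U"
  shows "predictable T (U :: real => real => 'a => real)"
proof -
  define I where "I k = {1..nat \<lceil>T * real (Suc k)\<rceil>}" for k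
  define J where "J k = {0..Suc k}" for k
  define a where "a k i = real i / real (Suc k)" for k i :: nat
  define V where "V k s y w = (\<Sum>i\<in>I k. (\<Sum>j\<in>J k. U (a k i) (a k j) w * indicator {a k j..<a k (Suc j)} y) * indicator {a k i<..a k (Suc i)} s)" for k s y w
  have a1: "a k j \<in> {0..1}" if "j \<in> J k" for k j using that by (auto simp: a_def J_def field_simps)
  have a0: "0 < a k i" if "i \<in> I k" for k i using that by (auto simp: a_def I_def)
  have aS: "a k i \<le> a k (Suc i)" for k i by (simp add: a_def divide_right_mono)
  have "predictable T (V k)" for k
  proof -
    have *: "(\<lambda>z. case z of (s, y, w) => V k s y w) = (\<lambda>z. \<Sum>i\<in>I k. \<Sum>j\<in>J k. (case z of (s, y, w) => U (a k i) (a k j) w * indicator {a k i<..a k (Suc i)} s * indicator {a k j..<a k (Suc j)} y))"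
      unfolding V_def by (intro ext) (simp add: sum_distrib_left case_prod_beta mult_ac)
    have "U (a k i) (a k j) \<in> borel_measurable (F (a k i))" if "i \<in> I k" "j \<in> J k" for i j
      using ad a0[OF that(1)] a1[OF that(2)] unfolding adapted_field_def by blast
    then show ?thesis unfolding *
      using a0 aS by (intro borel_measurable_sum predictable_elementary') (auto simp: less_imp_le)
  qed
  then have Vm: "(\<lambda>z. case z of (s, y, w) => V k s y w) \<in> borel_measurable (predictable_sigma M F T)" for k .
  show ?thesis
  proof (rule borel_measurable_LIMSEQ_real[OF _ Vm])
    fix z assume "z \<in> space (predictable_sigma M F T)"
    then obtain s y w where z: "z = (s, y, w)" and s: "0 < s" "s \<le> T" and y: "y \<in> {0..1}" and w: "w \<in> space M"
      by (auto simp del: atLeastAtMost_iff)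
    \<comment> \<open>The largest grid index strictly below s, matching time cells that are open on
      the left.\<close>
    define i where "i k = nat (\<lceil>s * real (Suc k)\<rceil> - 1)" for k
    define j where "j k = nat \<lfloor>y * real (Suc k)\<rfloor>" for k
    \<comment> \<open>From k0 on the first grid time lies before s, so the index is at least
      1.\<close>
    obtain k0 :: nat where k0: "1 / s < real k0" using reals_Archimedean2 by blast
    have ev: "V k s y w = U (a k (i k)) (a k (j k)) w \<and> (a k (i k), a k (j k)) \<in> {0<..} \<times> {0..1} \<and>
      \<bar>a k (i k) - s\<bar> \<le> 1 / real (Suc k) \<and> \<bar>a k (j k) - y\<bar> \<le> 1 / real (Suc k)" if k: "k0 \<le> k" for k
    proof -
      let ?n = "real (Suc k)"
      have n: "0 < ?n" by simp
      have "1 / s < ?n" using k k0 by linarith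
      then have sn: "1 < s * ?n" using s by (simp add: field_simps)
      then have c: "2 \<le> \<lceil>s * ?n\<rceil>" by linarith
      have ir: "real (i k) = real_of_int \<lceil>s * ?n\<rceil> - 1" unfolding i_def using c by simp
      have i1: "real (i k) < s * ?n" "s * ?n \<le> real (i k) + 1" using ir by linarith+
      have iI: "i k \<in> I k"
      proof -
        have "1 \<le> i k" unfolding i_def using c by linarith
        moreover have "\<lceil>s * ?n\<rceil> \<le> \<lceil>T * ?n\<rceil>" using s n by (intro ceiling_mono mult_right_mono) auto
        then have "i k \<le> nat \<lceil>T * ?n\<rceil>" unfolding i_def by linarith
        ultimately show ?thesis by (simp add: I_def)
      qed
      have jr: "real (j k) = real_of_int \<lfloor>y * ?n\<rfloor>" unfolding j_def using y by simp
      have j1: "real (j k) \<le> y * ?n" "y * ?n < real (j k) + 1" using jr by linarith+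
      have "y * ?n \<le> 1 * ?n" using y n by (intro mult_right_mono) auto
      from order_trans[OF j1(1) this] have "real (j k) \<le> ?n" by simp
      then have jI: "j k \<in> J k" by (simp add: J_def)
      have ai: "a k (i k) < s" "s \<le> a k (Suc (i k))" using i1 n by (simp_all add: a_def field_simps)
      have aj: "a k (j k) \<le> y" "y < a k (Suc (j k))" using j1 n by (simp_all add: a_def field_simps)
      have mono: "a k p \<le> a k q" if "p \<le> q" for p q using that by (simp add: a_def divide_right_mono)
      have "V k s y w = (\<Sum>j\<in>J k. U (a k (i k)) (a k j) w * indicator {a k j..<a k (Suc j)} y)"
        unfolding V_def
      proof (rule sum_indicator_select)
        fix p assume "p \<noteq> i k"
        then consider "Suc p \<le> i k" | "Suc (i k) \<le> p" by linarith
        then show "s \<notin> {a k p<..a k (Suc p)}"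
          by cases (use ai mono[of "Suc p" "i k"] mono[of "Suc (i k)" p] in auto)
      qed (use iI ai in \<open>auto simp: I_def\<close>)
      also have "\<dots> = U (a k (i k)) (a k (j k)) w"
      proof (rule sum_indicator_select)
        fix p assume "p \<noteq> j k"
        then consider "Suc p \<le> j k" | "Suc (j k) \<le> p" by linarith
        then show "y \<notin> {a k p..<a k (Suc p)}"
          by cases (use aj mono[of "Suc p" "j k"] mono[of "Suc (j k)" p] in auto)
      qed (use jI aj in \<open>auto simp: J_def\<close>)
      finally have 1: "V k s y w = U (a k (i k)) (a k (j k)) w" .
      have "a k (Suc (i k)) = a k (i k) + 1 / ?n" "a k (Suc (j k)) = a k (j k) + 1 / ?n"
        by (simp_all add: a_def add_divide_distrib)
      then show ?thesis using 1 a0[OF iI] a1[OF jI] ai aj by auto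
    qed
    have lim1: "(\<lambda>k. 1 / real (Suc k)) \<longlonglongrightarrow> 0" by (rule LIMSEQ_inverse_real_of_nat[unfolded inverse_eq_divide])
    have evk: "\<forall>\<^sub>F k in sequentially. k0 \<le> k" by (rule eventually_ge_at_top)
    have "(\<lambda>k. a k (i k) - s) \<longlonglongrightarrow> 0"
      by (rule Lim_null_comparison[OF _ lim1]) (use evk in \<open>eventually_elim, use ev in auto\<close>)
    then have l1: "(\<lambda>k. a k (i k)) \<longlonglongrightarrow> s" by (simp add: LIM_zero_iff)
    have "(\<lambda>k. a k (j k) - y) \<longlonglongrightarrow> 0"
      by (rule Lim_null_comparison[OF _ lim1]) (use evk in \<open>eventually_elim, use ev in auto\<close>)
    then have l2: "(\<lambda>k. a k (j k)) \<longlonglongrightarrow> y" by (simp add: LIM_zero_iff)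
    have "continuous_on ({0<..} \<times> {0..1}) (\<lambda>(t, x). U t x w)"
      using cont w unfolding continuous_field_def by blast
    then have "(\<lambda>k. (\<lambda>(t, x). U t x w) (a k (i k), a k (j k))) \<longlonglongrightarrow> (\<lambda>(t, x). U t x w) (s, y)"
    proof (rule continuous_on_tendsto_compose)
      show "(\<lambda>k. (a k (i k), a k (j k))) \<longlonglongrightarrow> (s, y)" by (rule tendsto_Pair[OF l1 l2])
      show "(s, y) \<in> {0<..} \<times> {0..1}" using s y by auto
      show "\<forall>\<^sub>F k in sequentially. (a k (i k), a k (j k)) \<in> {0<..} \<times> {0..1}"
        using evk by eventually_elim (use ev in blast)
    qed
    then have "(\<lambda>k. U (a k (i k)) (a k (j k)) w) \<longlonglongrightarrow> U s y w" by simp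
    then have "(\<lambda>k. V k s y w) \<longlonglongrightarrow> U s y w"
      by (rule Lim_transform_eventually) (use evk in \<open>eventually_elim, use ev in auto\<close>)
    then show "(\<lambda>k. case z of (s, y, w) => V k s y w) \<longlonglongrightarrow> (case z of (s, y, w) => U s y w)"
      by (simp add: z)
  qed
qed

lemma predictable_mult: "predictable T H ==> predictable T K ==> predictable T (\<lambda>s y w. H s y w * K s y w)"
  using borel_measurable_times[of "\<lambda>(s, y, w). H s y w" _ "\<lambda>(s, y, w). K s y w"]
  by (simp add: case_prod_beta)

text \<open>The coordinates s and y are themselves continuous adapted fields.\<close>

lemma measurable_time_space: "(\<lambda>(s, y, w). (s, y)) \<in> measurable (predictable_sigma M F T) borel"
proof -
  have "predictable T (\<lambda>s y w. s)"
    by (rule predictable_continuous) (auto simp: continuous_field_def adapted_field_def case_prod_beta intro!: continuous_intros)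
  moreover have "predictable T (\<lambda>s y w. y)"
    by (rule predictable_continuous) (auto simp: continuous_field_def adapted_field_def case_prod_beta intro!: continuous_intros)
  ultimately have "(\<lambda>z. (case z of (s, y, w) => s, case z of (s, y, w) => y)) \<in> measurable (predictable_sigma M F T) (borel \<Otimes>\<^sub>M borel)"
    by (rule measurable_Pair)
  then show ?thesis by (simp add: case_prod_beta borel_prod)
qed

lemma predictable_deterministic:
  assumes g: "(\<lambda>p. g (fst p) (snd p) * indicator ({..T} \<times> {0..1}) p) \<in> borel_measurable borel"
  shows "predictable T (\<lambda>s y w. g s y)"
proof -
  have "(\<lambda>z. g (fst (case z of (s, y, w) => (s, y))) (snd (case z of (s, y, w) => (s, y))) * indicator ({..T} \<times> {0..1}) (case z of (s, y, w) => (s, y)))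
    \<in> borel_measurable (predictable_sigma M F T)"
    by (rule measurable_compose[OF measurable_time_space g])
  then show ?thesis
    by (rule measurable_cong[THEN iffD1, rotated]) (auto simp: indicator_def)
qed

lemma predictable_kernel: "x \<in> {0..1} ==> T \<le> t ==> predictable T (\<lambda>s y w. neumann_kernel (t - s) x y)"
proof (rule predictable_deterministic)
  assume x: "x \<in> {0..1}" and T: "T \<le> t"
  have "(\<lambda>p. (neumann_kernel (t - fst p) x (snd p) * indicator ({..t} \<times> {0..1}) p) * indicator ({..T} \<times> {0..1}) p) \<in> borel_measurable borel"
  proof -
    have [measurable]: "({..T} \<times> {0..1} :: (real \<times> real) set) \<in> sets borel" by (intro borel_Times) auto
    show ?thesis using measurable_neumann_kernel[OF x, of t] by measurable
  qed
  also have "(\<lambda>p. (neumann_kernel (t - fst p) x (snd p) * indicator ({..t} \<times> {0..1}) p) * indicator ({..T} \<times> {0..1}) p) =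
    (\<lambda>p. neumann_kernel (t - fst p) x (snd p) * indicator ({..T} \<times> {0..1}) p)"
    using T by (auto simp: fun_eq_iff indicator_def)
  finally show "(\<lambda>p. neumann_kernel (t - fst p) x (snd p) * indicator ({..T} \<times> {0..1}) p) \<in> borel_measurable borel" .
qed

lemma predictable_subinterval:
  assumes H: "predictable T H" and S: "S \<le> T"
  shows "predictable S H"
proof -
  have "(\<lambda>z. z) \<in> measurable (predictable_sigma M F S) (predictable_sigma M F T)"
    unfolding predictable_sigma_eq[of T]
  proof (rule measurable_measure_of[OF predictable_rects_Pow])
    show "(\<lambda>z. z) \<in> space (predictable_sigma M F S) \<rightarrow> {0<..T} \<times> {0..1} \<times> space M" using S by auto
    fix R assume "R \<in> predictable_rects T"
    then obtain a b A E where R: "R = {a<..b} \<times> A \<times> E" "0 \<le> a" "a \<le> b" "b \<le> T" "A \<in> sets borel" "A \<subseteq> {0..1}" "E \<in> sets (F a)"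
      by (rule predictable_rectsE)
    have E: "E \<subseteq> space M" using sets.sets_into_space[OF R(7)] R(2) by simp
    have "(\<lambda>z. z) -` R \<inter> space (predictable_sigma M F S) = {a<..min b S} \<times> A \<times> E" using R(1,2,6) E by auto
    also have "\<dots> \<in> sets (predictable_sigma M F S)"
    proof (cases "a \<le> S")
      case True
      then show ?thesis using R by (intro predictable_rect_sets) auto
    next
      case False
      then have "{a<..min b S} \<times> A \<times> E = {}" by auto
      then show ?thesis by (simp only: sets.empty_sets)
    qed
    finally show "(\<lambda>z. z) -` R \<inter> space (predictable_sigma M F S) \<in> sets (predictable_sigma M F S)" .
  qed
  from measurable_compose[OF this H] show ?thesis .
qed

lemma predictable_compose:
  assumes H: "predictable T H" and g: "g \<in> borel_measurable borel"
  shows "predictable T (\<lambda>s y w. g (H s y w))"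
  using measurable_compose[OF H g] by (simp add: case_prod_beta)

text \<open>f - E(f|N) = (f - v) - E(f - v|N), and conditional expectation does not increase second
  moments; 4 = 2 + 2. Up to a constant, conditioning is as good as any approximation known to N,
  which spares choosing v measurably in a parameter.\<close>

lemma cond_exp_contraction:
  assumes sub: "subalgebra M N" and fm: "f \<in> borel_measurable M" and f2: "integrable M (\<lambda>w. (f w)\<^sup>2)"
    and v: "v \<in> borel_measurable N"
  shows "msq M (\<lambda>w. f w - real_cond_exp M N f w) \<le> 4 * msq M (\<lambda>w. f w - v w)"
proof (cases "msq M (\<lambda>w. f w - v w) = \<infinity>")
  \<comment> \<open>If the distance is finite, v is square integrable because f is, and Jensen's
    inequality applies to f - v.\<close>
  case False
  interpret S: finite_measure_subalgebra M N by unfold_locales (rule sub)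
  note [measurable] = fm measurable_from_subalg[OF sub v] borel_measurable_cond_exp2
  have "msq M (\<lambda>w. v w - 0) \<le> 2 * msq M (\<lambda>w. v w - f w) + 2 * msq M (\<lambda>w. f w - 0)"
    by (rule nn_integral_square_triangle) auto
  also have "\<dots> < \<infinity>"
  proof -
    have "msq M (\<lambda>w. f w - 0) < \<infinity>" using f2 by (subst (asm) integrable_iff_bounded) simp
    then show ?thesis using False by (simp add: ennreal_mult_less_top less_top power2_commute)
  qed
  finally have v2: "integrable M (\<lambda>w. (v w)\<^sup>2)" by (intro integrableI_bounded) auto
  have fi: "integrable M f" by (rule square_integrable_imp_integrable[OF fm f2])
  have vi: "integrable M v" by (rule square_integrable_imp_integrable[OF measurable_from_subalg[OF sub v] v2])
  define g where "g w = f w - v w" for w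
  have gi: "integrable M g" unfolding g_def using fi vi by simp
  have [measurable]: "g \<in> borel_measurable M" unfolding g_def by simp
  have g2: "integrable M (\<lambda>w. (g w)\<^sup>2)"
  proof -
    have "integrable M (\<lambda>w. (f w)\<^sup>2 + (v w)\<^sup>2 - 2 * (f w * v w))"
      by (intro Bochner_Integration.integrable_diff Bochner_Integration.integrable_add f2 v2 integrable_mult_right integrable_mult_of_squares) auto
    then show ?thesis unfolding g_def power2_diff by (simp add: mult.assoc)
  qed
  have jensen: "AE w in M. (real_cond_exp M N g w)\<^sup>2 \<le> real_cond_exp M N (\<lambda>w. (g w)\<^sup>2) w"
  proof (rule S.real_cond_exp_jensens_inequality(2)[OF gi, where I = UNIV])
    show "convex_on UNIV (\<lambda>x::real. x\<^sup>2)" by (rule convex_power2)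
  qed (use g2 in auto)
  have Eg: "msq M (\<lambda>w. real_cond_exp M N g w) \<le> msq M g"
  proof -
    have "msq M (\<lambda>w. real_cond_exp M N g w) \<le> (\<integral>\<^sup>+w. ennreal (real_cond_exp M N (\<lambda>w. (g w)\<^sup>2) w) \<partial>M)"
      using jensen by (intro nn_integral_mono_AE) (auto elim!: eventually_mono intro!: ennreal_leI)
    also have "\<dots> = ennreal (LINT w|M. real_cond_exp M N (\<lambda>w. (g w)\<^sup>2) w)"
    proof (rule nn_integral_eq_integral[OF S.real_cond_exp_int(1)[OF g2]])
      show "AE w in M. 0 \<le> real_cond_exp M N (\<lambda>w. (g w)\<^sup>2) w" by (rule S.real_cond_exp_pos) auto
    qed
    also have "\<dots> = ennreal (LINT w|M. (g w)\<^sup>2)" by (simp only: S.real_cond_exp_int(2)[OF g2])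
    also have "\<dots> = msq M g" by (rule nn_integral_eq_integral[OF g2, symmetric]) simp
    finally show ?thesis .
  qed
  have "AE w in M. f w - real_cond_exp M N f w = g w + (- real_cond_exp M N g w)"
    using S.real_cond_exp_diff[OF fi vi] S.real_cond_exp_F_meas[OF vi v]
    unfolding g_def by eventually_elim simp
  then have "msq M (\<lambda>w. f w - real_cond_exp M N f w) = msq M (\<lambda>w. g w + (- real_cond_exp M N g w))"
    by (intro nn_integral_cong_AE) (auto elim!: eventually_mono)
  also have "\<dots> \<le> 2 * msq M g + 2 * msq M (\<lambda>w. - real_cond_exp M N g w)"
    by (rule nn_integral_square_add) auto
  also have "\<dots> \<le> 2 * msq M g + 2 * msq M g"
    using Eg by (intro add_left_mono mult_left_mono) auto
  also have "\<dots> = (2 + 2) * msq M g" by (rule distrib_right[symmetric])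
  finally show ?thesis unfolding g_def by simp
qed (simp add: ennreal_mult_top)

end

section \<open>Localization\<close>

text \<open>Simple fields have finite energy on every path. Where H has infinite energy, all
  approximation errors are infinite, which contradicts convergence in probability unless this
  happens on a null set.\<close>

lemma (in white_noise_space) walsh_integral_energy_finite:
  assumes "walsh_integral M F W T H I"
  shows "AE w in M. energy T H w < \<infinity>"
proof -
  from assms obtain hs where pH: "predictable T H" and hs: "\<And>n. simple_field M F T (hs n)"
    and hH: "tends_to_0_in_prob M (\<lambda>n. energy T (defect (hs n) H))"
    unfolding walsh_integral_energy by blast
  let ?D = "\<lambda>n. energy T (defect (hs n) H)"
  have j: "jointly T (defect (hs n) H)" for n
    by (intro jointly_diff jointly_simple hs predictable_jointly pH)
  note [measurable] = measurable_energy[OF predictable_jointly[OF pH]] measurable_energy[OF j]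
  let ?B = "{w \<in> space M. energy T H w = \<infinity>}"
  have le: "measure M ?B \<le> measure M {w \<in> space M. ennreal 1 < ?D n w}" for n
  proof (rule finite_measure_mono)
    show "?B \<subseteq> {w \<in> space M. ennreal 1 < ?D n w}"
    proof
      fix w assume wB: "w \<in> ?B"
      then have w: "w \<in> space M" by simp
      have "energy T H w = energy T (\<lambda>s y w. simple_value (hs n) s y w + (H s y w - simple_value (hs n) s y w)) w"
        by (simp add: energy_def)
      also have "\<dots> \<le> 2 * energy T (simple_value (hs n)) w + 2 * energy T (\<lambda>s y w. H s y w - simple_value (hs n) s y w) w"
        by (intro energy_add jointly_simple hs jointly_diff predictable_jointly pH w)
      finally have "2 * energy T (simple_value (hs n)) w + 2 * ?D n w = \<infinity>"
        using wB unfolding energy_minus[of T H] by (simp add: top_unique)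
      moreover have "energy T (simple_value (hs n)) w < \<infinity>" unfolding energy_simple(1)[OF hs] by simp
      ultimately have "?D n w = \<infinity>" by (auto simp: ennreal_mult_eq_top_iff ennreal_add_eq_top)
      then show "w \<in> {w \<in> space M. ennreal 1 < ?D n w}" using w by simp
    qed
  qed measurable
  have "(\<lambda>n. measure M {w \<in> space M. ennreal 1 < ?D n w}) \<longlonglongrightarrow> 0"
    using hH[unfolded tends_to_0_in_prob_def, rule_format, of 1] by simp
  then have "measure M ?B \<le> 0" by (rule LIMSEQ_le_const) (use le in blast)
  then have "emeasure M ?B = 0" by (simp add: emeasure_eq_measure measure_le_0_iff)
  then have "AE w in M. energy T H w \<noteq> \<infinity>" by (intro AE_I[where N = ?B]) auto
  then show ?thesis by eventually_elim (simp add: less_top)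
qed

lemma sets_countable_Ball:
  assumes X: "countable X" and P: "\<And>i. i \<in> X ==> {x \<in> space N. P i x} \<in> sets N"
  shows "{x \<in> space N. \<forall>i\<in>X. P i x} \<in> sets N"
proof -
  have "{x \<in> space N. \<forall>i\<in>X. P i x} = space N - (\<Union>i\<in>X. space N - {x \<in> space N. P i x})" by auto
  also have "\<dots> \<in> sets N" using P by (intro sets.Diff sets.top sets.countable_UN'' X)
  finally show ?thesis .
qed

text \<open>\<open>I\<close> is the field of versions of the stochastic integral. \<open>J0\<close>
  is the contribution of the initial value, of which boundedness away from time 0 is kept.\<close>

locale spde = white_noise_space M F W
  for M :: "'a measure" and F W +
  fixes \<sigma> b :: "real => real" and U I :: "real => real => 'a => real" and J0 :: "real => real => real" and \<theta> CH CG :: real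
  assumes U_cont: "continuous_field M U" and U_adapted: "adapted_field F U"
    and U_walsh: "\<And>t x. 0 < t ==> x \<in> {0..1} ==> walsh_integral M F W t (\<lambda>s y w. neumann_kernel (t - s) x y * \<sigma> (U s y w)) (I t x)"
    and U_eq: "AE w in M. \<forall>t>0. \<forall>x\<in>{0..1}.
           set_integrable lborel ({0<..<t} \<times> {0..1}) (\<lambda>(s, y). neumann_kernel (t - s) x y * b (U s y w)) \<and>
           U t x w = J0 t x + set_lebesgue_integral lborel ({0<..<t} \<times> {0..1}) (\<lambda>(s, y). neumann_kernel (t - s) x y * b (U s y w)) + I t x w"
    and b_measurable [measurable]: "b \<in> borel_measurable borel"
    and \<theta>: "1 / 2 < \<theta>" "\<theta> \<le> 1"
    and holder: "0 < CH" "\<And>u v. \<bar>\<sigma> u - \<sigma> v\<bar> \<le> CH * \<bar>u - v\<bar> powr \<theta>"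
    and growth: "0 < CG" "\<And>u. \<bar>\<sigma> u\<bar> \<le> CG * (1 + \<bar>u\<bar>)" "\<And>u. \<bar>b u\<bar> \<le> CG * (1 + \<bar>u\<bar>)"
    and J0_bound: "\<And>t T. 0 < t ==> \<exists>B. \<forall>s\<in>{t..T}. \<forall>x\<in>{0..1}. \<bar>J0 s x\<bar> \<le> B"
begin

lemma \<sigma>_continuous: "continuous_on UNIV \<sigma>"
  unfolding continuous_on_eq_continuous_at[OF open_UNIV]
proof (intro ballI)
  fix v
  have "((\<lambda>u. CH * \<bar>u - v\<bar> powr \<theta>) \<longlongrightarrow> CH * \<bar>v - v\<bar> powr \<theta>) (at v)"
    using \<theta> by (intro tendsto_intros) auto
  then have lim: "((\<lambda>u. CH * \<bar>u - v\<bar> powr \<theta>) \<longlongrightarrow> 0) (at v)" by simp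
  have "((\<lambda>u. \<sigma> u - \<sigma> v) \<longlongrightarrow> 0) (at v)"
    by (rule Lim_null_comparison[OF _ lim]) (simp add: holder)
  then show "isCont \<sigma> v" unfolding isCont_def by (simp add: LIM_zero_iff)
qed

lemma \<sigma>_measurable [measurable]: "\<sigma> \<in> borel_measurable borel"
  by (rule borel_measurable_continuous_onI[OF \<sigma>_continuous])

abbreviation bU :: "real => real => 'a => real" where "bU r z w \<equiv> b (U r z w)"
abbreviation \<sigma>U :: "real => real => 'a => real" where "\<sigma>U r z w \<equiv> \<sigma> (U r z w)"

lemma predictable_U: "predictable T U"
  by (rule predictable_continuous[OF U_cont U_adapted])

lemma U_path: "w \<in> space M ==> continuous_on ({0<..} \<times> {0..1}) (\<lambda>(t, x). U t x w)"
  using U_cont by (simp add: continuous_field_def)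

lemma U_measurable: "0 < r ==> y \<in> {0..1} ==> U r y \<in> borel_measurable (F r)"
  using U_adapted by (simp add: adapted_field_def)

lemma U_measurable_M: "0 < r ==> y \<in> {0..1} ==> U r y \<in> borel_measurable M"
  by (rule measurable_F[OF _ U_measurable]) auto

text \<open>By continuity. That the rational time is strictly earlier lets a switch which has seen
  only the times before s control the field at time s itself.\<close>

lemma U_rational_approx:
  assumes w: "w \<in> space M" and r: "0 \<le> a" "a < r" and y: "y \<in> {0..1}" and c: "c < \<bar>U r y w\<bar>"
  shows "\<exists>r'\<in>\<rat>. a < r' \<and> r' < r \<and> (\<exists>y'\<in>\<rat> \<inter> {0..1}. c < \<bar>U r' y' w\<bar>)"
proof -
  let ?f = "\<lambda>p. \<bar>(\<lambda>(t, x). U t x w) p\<bar>"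
  have "continuous_on ({0<..} \<times> {0..1}) ?f" by (intro continuous_intros U_path w)
  then have "\<forall>q\<in>{0<..} \<times> {0..1}. \<forall>e>0. \<exists>d>0. \<forall>p\<in>{0<..} \<times> {0..1}. dist p q < d \<longrightarrow> dist (?f p) (?f q) < e"
    unfolding continuous_on_iff .
  from this[rule_format, of "(r, y)" "\<bar>U r y w\<bar> - c"] r y c
  obtain d where d0: "0 < d" and d': "\<forall>p\<in>{0<..} \<times> {0..1}. dist p (r, y) < d \<longrightarrow> dist (?f p) (?f (r, y)) < \<bar>U r y w\<bar> - c"
    by auto
  note d = d0 d'[rule_format]
  obtain r' where r': "r' \<in> \<rat>" "max a (r - d / 2) < r'" "r' < r"
    using Rats_dense_in_real[of "max a (r - d / 2)" r] r d by auto
  obtain y' where y': "y' \<in> \<rat>" "max 0 (y - d / 2) < y'" "y' < min 1 (y + d / 2)"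
    using Rats_dense_in_real[of "max 0 (y - d / 2)" "min 1 (y + d / 2)"] y d by auto
  have "dist (r', y') (r, y) \<le> dist r' r + dist y' y"
    unfolding dist_Pair_Pair by (rule order_trans[OF sqrt_sum_squares_le_sum_abs]) (simp add: dist_real_def)
  also have "\<dots> < d" using r' y' by (auto simp: dist_real_def)
  finally have "dist (?f (r', y')) (?f (r, y)) < \<bar>U r y w\<bar> - c"
    using r' y' r by (intro d) auto
  then have "c < \<bar>U r' y' w\<bar>" by (simp add: dist_real_def)
  then show ?thesis using r' y' by (intro bexI[of _ r'] conjI bexI[of _ y']) auto
qed

lemma bounded_path:
  assumes w: "w \<in> space M" and t: "0 < t0"
  shows "\<exists>B. \<forall>r\<in>{t0..t1}. \<forall>y\<in>{0..1}. \<bar>U r y w\<bar> \<le> B"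
proof -
  have "compact ((\<lambda>(t, x). U t x w) ` ({t0..t1} \<times> {0..1}))"
  proof (intro compact_continuous_image compact_Times)
    show "continuous_on ({t0..t1} \<times> {0..1}) (\<lambda>(t, x). U t x w)"
      by (rule continuous_on_subset[OF U_path[OF w]]) (use t in auto)
  qed auto
  then have "bounded ((\<lambda>(t, x). U t x w) ` ({t0..t1} \<times> {0..1}))" by (rule compact_imp_bounded)
  then obtain B where Bz: "\<forall>z\<in>(\<lambda>(t, x). U t x w) ` ({t0..t1} \<times> {0..1}). norm z \<le> B"
    unfolding bounded_iff ..
  have "\<bar>U r y w\<bar> \<le> B" if "r \<in> {t0..t1}" "y \<in> {0..1}" for r y
  proof -
    have "U r y w \<in> (\<lambda>(t, x). U t x w) ` ({t0..t1} \<times> {0..1})"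
      by (rule image_eqI[of _ _ "(r, y)"]) (use that in auto)
    from bspec[OF Bz this] show ?thesis by simp
  qed
  then show ?thesis by blast
qed

text \<open>One field whose energy is the integral of squared diffusion plus absolute drift. Near
  time 0 these integrals are all that the equation makes finite.\<close>

definition intensity :: "real => real => 'a => real" where
  "intensity s y w = sqrt ((\<sigma> (U s y w))\<^sup>2 + \<bar>b (U s y w)\<bar>)"

lemma predictable_intensity: "predictable T intensity"
  unfolding intensity_def by (rule predictable_compose[OF predictable_U]) measurable

lemma intensity_sq: "(intensity s y w)\<^sup>2 = (\<sigma> (U s y w))\<^sup>2 + \<bar>b (U s y w)\<bar>"
  by (simp add: intensity_def)

end

text \<open>The coefficients are switched off as soon as the solution leaves a prescribed region: before
  \<open>t0\<close> the region is given by the accumulated intensity (the field may explode at time 0), on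
  \<open>(t0, t1]\<close> by the sup-norm level \<open>K\<close> and after \<open>t1\<close> by the level \<open>L\<close>.\<close>

locale spde_window = spde M F W \<sigma> b U I J0 \<theta> CH CG
  for M :: "'a measure" and F W \<sigma> b U I J0 \<theta> CH CG +
  fixes t0 t1 K :: real
  assumes window: "0 < t0" "t0 < t1" "0 \<le> K"
begin

definition alive :: "ereal => real => 'a => bool" where
  "alive L r w \<longleftrightarrow> (r \<le> t0 \<longrightarrow> energy r intensity w \<le> ennreal K) \<and>
     (t0 < r \<and> r \<le> t1 \<longrightarrow> (\<forall>y\<in>\<rat> \<inter> {0..1}. \<bar>U r y w\<bar> \<le> K)) \<and>
     (t1 < r \<longrightarrow> (\<forall>y\<in>\<rat> \<inter> {0..1}. ereal \<bar>U r y w\<bar> \<le> L))"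

text \<open>Inspecting only rational times strictly before s makes the switch predictable without
  completeness or right continuity of the filtration.\<close>

definition kill :: "ereal => real => 'a => real" where
  "kill L s w = of_bool (\<forall>r\<in>\<rat> \<inter> {0<..<s}. alive L r w)"

text \<open>Everything inspected happens up to t1, so the event is known at time t1 and can serve as
  a weight in the conditional Gaussian computation.\<close>

definition good :: "'a set" where
  "good = {w \<in> space M. \<forall>r\<in>\<rat> \<inter> {0<..t1}. alive \<infinity> r w}"

lemma countable_rats: "countable (\<rat> \<inter> A :: real set)"
  using countable_rat by (rule countable_subset[rotated]) auto

lemma dead_sets:
  assumes r: "0 < r" shows "{w \<in> space M. \<not> alive L r w} \<in> sets (F r)"
proof -
  have sp: "space M = space (F r)" using r by simp
  note [measurable] = measurable_energy_adapted[OF predictable_intensity less_imp_le[OF r]]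
  have 1: "{w \<in> space (F r). energy r intensity w \<le> ennreal K} \<in> sets (F r)" by measurable
  have "{w \<in> space (F r). \<bar>U r y w\<bar> \<le> K} \<in> sets (F r)" if "y \<in> \<rat> \<inter> {0..1}" for y
  proof -
    have [measurable]: "U r y \<in> borel_measurable (F r)" using that r by (intro U_measurable) auto
    show ?thesis by measurable
  qed
  then have 2: "{w \<in> space (F r). \<forall>y\<in>\<rat> \<inter> {0..1}. \<bar>U r y w\<bar> \<le> K} \<in> sets (F r)"
    by (intro sets_countable_Ball countable_rats)
  have "{w \<in> space (F r). ereal \<bar>U r y w\<bar> \<le> L} \<in> sets (F r)" if "y \<in> \<rat> \<inter> {0..1}" for y
  proof -
    have [measurable]: "U r y \<in> borel_measurable (F r)" using that r by (intro U_measurable) auto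
    show ?thesis by measurable
  qed
  then have 3: "{w \<in> space (F r). \<forall>y\<in>\<rat> \<inter> {0..1}. ereal \<bar>U r y w\<bar> \<le> L} \<in> sets (F r)"
    by (intro sets_countable_Ball countable_rats)
  show ?thesis unfolding sp alive_def
    by (intro sets.sets_Collect_neg sets.sets_Collect_conj sets.sets_Collect_imp sets.sets_Collect_const 1 2 3)
qed

lemma kill_cases: "kill L s w = 0 \<or> kill L s w = 1"
  by (simp add: kill_def of_bool_def)

lemma kill_mono: "kill L s w = 1 ==> r \<le> s ==> kill L r w = 1"
  by (auto simp: kill_def of_bool_def split: if_splits)

text \<open>The region where the switch is off is a countable union of rectangles (r,T] x [0,1] x E
  with E an event of F r.\<close>

lemma predictable_kill: "predictable T (\<lambda>s y w. kill L s w)"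
proof -
  define D :: "(real \<times> real \<times> 'a) set" where "D = (\<Union>r\<in>\<rat> \<inter> {0<..<T}. {r<..T} \<times> {0..1} \<times> {w \<in> space M. \<not> alive L r w})"
  have "D \<in> sets (predictable_sigma M F T)"
    unfolding D_def using dead_sets
    by (intro sets.countable_UN'' countable_rats predictable_rect_sets) auto
  then have "(\<lambda>z. 1 - indicator D z :: real) \<in> borel_measurable (predictable_sigma M F T)" by measurable
  then show ?thesis
  proof (rule measurable_cong[THEN iffD1, rotated])
    fix z assume "z \<in> space (predictable_sigma M F T)"
    then obtain s y w where z: "z = (s, y, w)" "0 < s" "s \<le> T" "y \<in> {0..1}" "w \<in> space M"
      by (auto simp del: atLeastAtMost_iff)
    have "z \<in> D \<longleftrightarrow> (\<exists>r\<in>\<rat> \<inter> {0<..<s}. \<not> alive L r w)"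
      using z unfolding D_def by force
    then show "1 - indicator D z = (case z of (s, y, w) => kill L s w)"
      by (auto simp: z(1) kill_def indicator_def)
  qed
qed

lemma alive_sets: "0 < r ==> {w \<in> space M. alive L r w} \<in> sets (F r)"
proof -
  assume r: "0 < r"
  have "{w \<in> space M. alive L r w} = space (F r) - {w \<in> space M. \<not> alive L r w}" using r by auto
  also have "\<dots> \<in> sets (F r)" by (intro sets.Diff sets.top dead_sets r)
  finally show ?thesis .
qed

lemma kill_measurable: "kill L s \<in> borel_measurable M"
proof -
  have "{w \<in> space M. alive L r w} \<in> sets M" if "r \<in> \<rat> \<inter> {0<..<s}" for r
    by (rule sets_F_sub[OF _ alive_sets]) (use that in auto)
  then have "{w \<in> space M. \<forall>r\<in>\<rat> \<inter> {0<..<s}. alive L r w} \<in> sets M"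
    by (rule sets_countable_Ball[OF countable_rats])
  then have "(indicator {w \<in> space M. \<forall>r\<in>\<rat> \<inter> {0<..<s}. alive L r w} :: 'a => real) \<in> borel_measurable M" by simp
  then show ?thesis
    by (rule measurable_cong[THEN iffD1, rotated]) (simp add: kill_def indicator_def)
qed

text \<open>A violation at time r \<le> s would show at a rational time before r, hence before s,
  where the switch has checked.\<close>

lemma kill_U_mid:
  assumes w: "w \<in> space M" and k: "kill L s w = 1" and r: "t0 < r" "r \<le> t1" "r \<le> s" and y: "y \<in> {0..1}"
  shows "\<bar>U r y w\<bar> \<le> K"
proof (rule ccontr)
  assume "\<not> \<bar>U r y w\<bar> \<le> K"
  then obtain r' y' where r': "r' \<in> \<rat>" "t0 < r'" "r' < r" and y': "y' \<in> \<rat> \<inter> {0..1}" "K < \<bar>U r' y' w\<bar>"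
    using U_rational_approx[OF w less_imp_le[OF window(1)] r(1) y, of K] by (auto simp only: not_le)
  have "r' \<in> \<rat> \<inter> {0<..<s}" using r' r window by auto
  then have "alive L r' w" using k unfolding kill_def by (auto simp: of_bool_def split: if_splits)
  then show False using r' r y' unfolding alive_def by force
qed

lemma kill_U_late:
  assumes w: "w \<in> space M" and k: "kill (ereal L) s w = 1" and r: "t1 < r" "r \<le> s" and y: "y \<in> {0..1}"
  shows "\<bar>U r y w\<bar> \<le> L"
proof (rule ccontr)
  assume "\<not> \<bar>U r y w\<bar> \<le> L"
  then obtain r' y' where r': "r' \<in> \<rat>" "t1 < r'" "r' < r" and y': "y' \<in> \<rat> \<inter> {0..1}" "L < \<bar>U r' y' w\<bar>"
  proof -
    assume *: "\<And>r' y'. r' \<in> \<rat> ==> t1 < r' ==> r' < r ==> y' \<in> \<rat> \<inter> {0..1} ==> L < \<bar>U r' y' w\<bar> ==> thesis"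
    assume "\<not> \<bar>U r y w\<bar> \<le> L"
    then have c: "L < \<bar>U r y w\<bar>" by simp
    have t1: "0 \<le> t1" using window by simp
    show thesis using U_rational_approx[OF w t1 r(1) y c] * by blast
  qed
  have "r' \<in> \<rat> \<inter> {0<..<s}" using r' r window by auto
  then have "alive (ereal L) r' w" using k unfolding kill_def by (auto simp: of_bool_def split: if_splits)
  then show False using r' r y' unfolding alive_def by force
qed

text \<open>The switch at time s has checked the energy only at rational times before s. With c the
  supremum of the survival times, the bound holds at times increasing to c and monotone convergence
  carries it to c.\<close>

lemma energy_kill_early:
  assumes w: "w \<in> space M"
  shows "energy t0 (\<lambda>s y w. kill L s w * intensity s y w) w \<le> ennreal K"
proof -
  define S where "S = {s. 0 < s \<and> s \<le> t0 \<and> kill L s w = 1}"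
  show ?thesis
  proof (cases "S = {}")
    case True
    have "energy t0 (\<lambda>s y w. kill L s w * intensity s y w) w = (\<integral>\<^sup>+p. 0 \<partial>(lborel :: (real \<times> real) measure))"
      unfolding energy_def
    proof (rule nn_integral_cong)
      fix p :: "real \<times> real"
      show "ennreal ((kill L (fst p) w * intensity (fst p) (snd p) w)\<^sup>2) * indicator (strip t0) p = 0"
        using True kill_cases[of L "fst p" w] by (cases p) (auto simp: S_def strip_def indicator_def)
    qed
    then show ?thesis by simp
  next
    case False
    define c where "c = Sup S"
    have bdd: "bdd_above S" by (rule bdd_aboveI[of _ t0]) (auto simp: S_def)
    define f where "f n p = ennreal ((intensity (fst p) (snd p) w * indicator (strip t0) p)\<^sup>2) * indicator (strip (c - 1 / real (Suc n))) p" for n p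
    have c0: "c \<le> t0" unfolding c_def using False by (intro cSup_least) (auto simp: S_def)
    have fm: "f n \<in> borel_measurable lborel" for n
    proof -
      note [measurable] = jointly_section[OF predictable_jointly[OF predictable_intensity[of t0]] w]
      show ?thesis unfolding f_def by measurable
    qed
    have inc: "incseq f"
      unfolding incseq_def le_fun_def
    proof (intro allI impI)
      fix m n p assume "m \<le> (n::nat)"
      then have "1 / real (Suc n) \<le> 1 / real (Suc m)" by (intro divide_left_mono) auto
      then show "f m p \<le> f n p" unfolding f_def
        by (intro mult_left_mono) (auto simp: indicator_def strip_def)
    qed
    have fle: "(\<integral>\<^sup>+p. f n p \<partial>lborel) \<le> ennreal K" for n
    proof -
      let ?u = "c - 1 / real (Suc n)"
      have uc: "?u < c" by simp
      show ?thesis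
      proof (cases "0 < ?u")
        case True
        obtain r where r: "r \<in> \<rat>" "?u < r" "r < c" using Rats_dense_in_real[OF uc] by blast
        obtain s where s: "s \<in> S" "r < s" using r(3) False bdd unfolding c_def by (auto simp: less_cSup_iff)
        have "r \<in> \<rat> \<inter> {0<..<s}" using r True s by auto
        then have "alive L r w" using s(1) unfolding S_def kill_def by (auto simp: of_bool_def split: if_splits)
        then have "energy r intensity w \<le> ennreal K" using r c0 unfolding alive_def by auto
        moreover have "(\<integral>\<^sup>+p. f n p \<partial>lborel) \<le> energy r intensity w"
          unfolding f_def energy_def
          by (intro nn_integral_mono) (use r in \<open>auto simp: indicator_def strip_def\<close>)
        ultimately show ?thesis by (rule order_trans[rotated])
      next
        case False
        then have "f n p = 0" for p unfolding f_def by (cases p) (auto simp: indicator_def strip_def)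
        then show ?thesis by simp
      qed
    qed
    \<comment> \<open>The exhaustion misses exactly the line at time c, which has area 0.\<close>
    have "AE p in (lborel :: (real \<times> real) measure). fst p \<noteq> c"
    proof -
      have "emeasure (lborel \<Otimes>\<^sub>M lborel) ({c} \<times> (UNIV :: real set)) = 0"
        by (subst lborel.emeasure_pair_measure_Times) auto
      then have "{c} \<times> (UNIV :: real set) \<in> null_sets lborel"
        unfolding lborel_prod by (intro null_setsI) (auto intro!: borel_Times)
      then show ?thesis by (rule AE_I') auto
    qed
    then have "energy t0 (\<lambda>s y w. kill L s w * intensity s y w) w \<le> (\<integral>\<^sup>+p. (SUP n. f n p) \<partial>lborel)"
      unfolding energy_def
    proof (intro nn_integral_mono_AE, eventually_elim)
      case (elim p)
      show "ennreal ((kill L (fst p) w * intensity (fst p) (snd p) w)\<^sup>2) * indicator (strip t0) p \<le> (SUP n. f n p)"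
      proof (cases "p \<in> strip t0 \<and> kill L (fst p) w = 1")
        case True
        then have "fst p \<in> S" by (auto simp: S_def strip_def)
        then have "fst p \<le> c" unfolding c_def using bdd by (intro cSup_upper)
        then have "0 < c - fst p" using elim by simp
        then obtain n where n: "1 / real (Suc n) < c - fst p" using nat_approx_posE by blast
        then have "p \<in> strip (c - 1 / real (Suc n))" using True by (auto simp: strip_def)
        then have "ennreal ((kill L (fst p) w * intensity (fst p) (snd p) w)\<^sup>2) * indicator (strip t0) p = f n p"
          using True by (simp add: f_def)
        also have "\<dots> \<le> (SUP n. f n p)" by (rule SUP_upper) simp
        finally show ?thesis .
      next
        case False
        then show ?thesis using kill_cases[of L "fst p" w] by (auto simp: indicator_def)
      qed
    qed
    also have "\<dots> = (SUP n. \<integral>\<^sup>+p. f n p \<partial>lborel)"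
      by (rule nn_integral_monotone_convergence_SUP[OF inc fm])
    also have "\<dots> \<le> ennreal K" by (rule SUP_least) (rule fle)
    finally show ?thesis .
  qed
qed

lemma good_sets: "good \<in> sets (F t1)"
proof -
  have sp: "space M = space (F t1)" using window by simp
  have "{w \<in> space (F t1). alive \<infinity> r w} \<in> sets (F t1)" if "r \<in> \<rat> \<inter> {0<..t1}" for r
    using alive_sets[of r \<infinity>] sets_F_mono[of r t1] that unfolding sp by auto
  then show ?thesis unfolding good_def sp by (rule sets_countable_Ball[OF countable_rats])
qed

text \<open>At level \<infinity> the switch no longer depends on the path after t1. This is why the
  conditional argument is run at that level.\<close>

lemma kill_infinity:
  assumes "t1 < s" "w \<in> space M" shows "kill \<infinity> s w = indicator good w"
proof -
  have "(\<forall>r\<in>\<rat> \<inter> {0<..<s}. alive \<infinity> r w) \<longleftrightarrow> (\<forall>r\<in>\<rat> \<inter> {0<..t1}. alive \<infinity> r w)"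
  proof (intro iffI ballI)
    fix r assume *: "\<forall>r\<in>\<rat> \<inter> {0<..t1}. alive \<infinity> r w" and r: "r \<in> \<rat> \<inter> {0<..<s}"
    show "alive \<infinity> r w"
    proof (cases "r \<le> t1")
      case True
      then show ?thesis using * r by auto
    next
      case False
      then show ?thesis using window by (simp add: alive_def)
    qed
  qed (use assms in auto)
  then show ?thesis using assms(2) by (simp add: kill_def good_def indicator_def)
qed

text \<open>The path is bounded on [t1, T], so high levels are never hit; with Fatou's lemma this
  lets the level tend to infinity.\<close>

lemma kill_good:
  assumes w: "w \<in> good"
  shows "\<exists>n0. \<forall>n\<ge>n0. kill (ereal (real n)) T w = 1"
proof -
  have sp: "w \<in> space M" using w by (simp add: good_def)
  have "0 < t1" using window by simp
  from bounded_path[OF sp this, of T] obtain B where B: "\<forall>r\<in>{t1..T}. \<forall>y\<in>{0..1}. \<bar>U r y w\<bar> \<le> B" ..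
  obtain n0 :: nat where n0: "B \<le> real n0" using real_arch_simple by blast
  have "kill (ereal (real n)) T w = 1" if n: "n0 \<le> n" for n
  proof -
    have "alive (ereal (real n)) r w" if r: "r \<in> \<rat> \<inter> {0<..<T}" for r
    proof (cases "r \<le> t1")
      case True
      then have "alive \<infinity> r w" using w r unfolding good_def by auto
      then show ?thesis using True by (simp add: alive_def)
    next
      case False
      have "\<bar>U r y w\<bar> \<le> real n" if "y \<in> \<rat> \<inter> {0..1}" for y
      proof -
        have "\<bar>U r y w\<bar> \<le> B" using B False r that by simp
        then show ?thesis using n0 n by linarith
      qed
      then show ?thesis using False window by (simp add: alive_def)
    qed
    then show ?thesis unfolding kill_def by simp
  qed
  then show ?thesis by blast
qed

end

section \<open>Moment bounds\<close>

definition seg :: "real => real => (real => real => 'a => real) => real => real => 'a => real" where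
  "seg a b H r z w = of_bool (a < r \<and> r \<le> b) * H r z w"

lemma (in white_noise_space) predictable_seg:
  assumes "predictable T H" shows "predictable T (seg a b H)"
proof -
  have "predictable T (\<lambda>s y w. of_bool (a < s \<and> s \<le> b))"
  proof (rule predictable_deterministic)
    have 1: "(\<lambda>p. of_bool (a < fst p \<and> fst p \<le> b) :: real) \<in> borel_measurable (borel :: (real \<times> real) measure)"
      unfolding borel_prod[symmetric] by measurable
    have [measurable]: "{..T} \<times> {0..1::real} \<in> sets borel" by (intro borel_Times) auto
    show "(\<lambda>p. of_bool (a < fst p \<and> fst p \<le> b) * indicator ({..T} \<times> {0..1::real}) p :: real) \<in> borel_measurable borel"
      using 1 by measurable
  qed
  from predictable_mult[OF this assms] show ?thesis unfolding seg_def .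
qed

text \<open>\<open>small\<close> makes the window (t1, T] so short that one pass through the
  equation halves the dependence on the second moment. CK is a parameter because it has to be fixed
  before the window is shortened: \<open>small\<close> involves it.\<close>

locale spde_estimates = spde_window M F W \<sigma> b U I J0 \<theta> CH CG t0 t1 K
  for M :: "'a measure" and F W \<sigma> b U I J0 \<theta> CH CG t0 t1 K +
  fixes T CK CU BJ :: real
  assumes t1T: "t1 < T"
    and CK: "0 < CK" "\<And>a s x. a \<le> s ==> s - a \<le> T ==> x \<in> {0..1} ==>
      (\<integral>\<^sup>+p. kernel_sq s x a s p \<partial>lborel) \<le> ennreal (CK * sqrt (s - a))"
    and CU: "0 < CU" "\<And>t x y. 0 < t ==> t \<le> T ==> x \<in> {0..1} ==> y \<in> {0..1} ==> neumann_kernel t x y \<le> CU / sqrt t"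
    and BJ: "0 \<le> BJ" "\<And>s x. s \<in> {t1..T} ==> x \<in> {0..1} ==> \<bar>J0 s x\<bar> \<le> BJ"
    and small: "8 * CK * CG\<^sup>2 * (sqrt T * (T - t1) + 64 * sqrt (T - t1)) \<le> 1 / 2"
begin

lemma times: "0 < t0" "0 < t1" "0 < T" "t0 < T"
  using window t1T by auto

definition moment :: "ereal => real => bool" where
  "moment L m \<longleftrightarrow> 0 \<le> m \<and> (\<forall>r\<in>{t1<..T}. \<forall>z\<in>{0..1}. (\<integral>\<^sup>+w. ennreal (kill L r w * (U r z w)\<^sup>2) \<partial>M) \<le> ennreal m)"

lemma kill_nonneg [simp]: "0 \<le> kill L s w"
  using kill_cases[of L s w] by auto

lemma moment_growth:
  assumes m: "moment L m" and r: "t1 < r" "r \<le> T" and z: "z \<in> {0..1}" and D: "0 \<le> D" and c: "\<And>w. \<bar>c w\<bar> \<le> D * (1 + \<bar>U r z w\<bar>)"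
  shows "(\<integral>\<^sup>+w. ennreal (kill L r w * (c w)\<^sup>2) \<partial>M) \<le> ennreal (2 * D\<^sup>2 * (1 + m))"
proof -
  have m0: "0 \<le> m" using m by (simp add: moment_def)
  have [measurable]: "U r z \<in> borel_measurable M" using times r z by (intro U_measurable_M) auto
  note [measurable] = kill_measurable[of L r]
  have "kill L r w * (c w)\<^sup>2 \<le> 2 * D\<^sup>2 + 2 * D\<^sup>2 * (kill L r w * (U r z w)\<^sup>2)" for w
  proof (cases "kill L r w = 0")
    case False
    then have k: "kill L r w = 1" using kill_cases by blast
    have "(c w)\<^sup>2 \<le> (D * (1 + \<bar>U r z w\<bar>))\<^sup>2" using power_mono[OF c[of w], of 2] by simp
    also have "\<dots> \<le> D\<^sup>2 * (2 * 1 + 2 * (U r z w)\<^sup>2)"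
    proof -
      have "(1 + \<bar>u\<bar>)\<^sup>2 \<le> 2 * 1 + 2 * u\<^sup>2" for u :: real
        using sum_squares_bound[of 1 "\<bar>u\<bar>"] by (simp add: power2_sum)
      then show ?thesis unfolding power_mult_distrib by (intro mult_left_mono) auto
    qed
    finally show ?thesis by (simp add: k algebra_simps)
  qed simp
  then have "(\<integral>\<^sup>+w. ennreal (kill L r w * (c w)\<^sup>2) \<partial>M) \<le> (\<integral>\<^sup>+w. ennreal (2 * D\<^sup>2) + ennreal (2 * D\<^sup>2) * ennreal (kill L r w * (U r z w)\<^sup>2) \<partial>M)"
    by (intro nn_integral_mono) (simp flip: ennreal_mult ennreal_plus add: ennreal_leI)
  also have "\<dots> = ennreal (2 * D\<^sup>2) + ennreal (2 * D\<^sup>2) * (\<integral>\<^sup>+w. ennreal (kill L r w * (U r z w)\<^sup>2) \<partial>M)"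
    by (simp add: nn_integral_add nn_integral_cmult emeasure_space_1)
  also have "\<dots> \<le> ennreal (2 * D\<^sup>2) + ennreal (2 * D\<^sup>2) * ennreal m"
    using m r z unfolding moment_def by (intro add_left_mono mult_left_mono) auto
  also have "\<dots> = ennreal (2 * D\<^sup>2 * (1 + m))"
    using m0 by (simp flip: ennreal_mult ennreal_plus add: algebra_simps)
  finally show ?thesis .
qed

lemma mid_growth:
  assumes r: "t0 < r" "r \<le> t1" and z: "z \<in> {0..1}" and D: "0 \<le> D" and c: "\<And>w. \<bar>c w\<bar> \<le> D * (1 + \<bar>U r z w\<bar>)"
  shows "(\<integral>\<^sup>+w. ennreal (kill L r w * (c w)\<^sup>2) \<partial>M) \<le> ennreal (D\<^sup>2 * (1 + K)\<^sup>2)"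
proof -
  have "(\<integral>\<^sup>+w. ennreal (kill L r w * (c w)\<^sup>2) \<partial>M) \<le> (\<integral>\<^sup>+w. ennreal (D\<^sup>2 * (1 + K)\<^sup>2) \<partial>M)"
  proof (intro nn_integral_mono ennreal_leI)
    fix w assume w: "w \<in> space M"
    show "kill L r w * (c w)\<^sup>2 \<le> D\<^sup>2 * (1 + K)\<^sup>2"
    proof (cases "kill L r w = 0")
      case False
      then have k: "kill L r w = 1" using kill_cases by blast
      have "\<bar>U r z w\<bar> \<le> K" by (rule kill_U_mid[OF w k r order_refl z])
      then have "\<bar>c w\<bar> \<le> D * (1 + K)" using D by (intro order_trans[OF c] mult_left_mono) auto
      from power_mono[OF this, of 2] show ?thesis by (simp add: k power_mult_distrib)
    qed simp
  qed
  then show ?thesis by (simp add: emeasure_space_1)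
qed

definition weighted :: "ereal => (real => real => 'a => real) => real => real => real => real => 'a => real" where
  "weighted L c s y r z w = kill L r w * (neumann_kernel (s - r) y z * c r z w)"

lemma predictable_weighted:
  assumes "predictable S c" "S \<le> s" "y \<in> {0..1}"
  shows "predictable S (weighted L c s y)"
  using predictable_mult[OF predictable_kill predictable_mult[OF predictable_kernel[OF assms(3,2)] assms(1)]]
  unfolding weighted_def .

lemma measurable_kernel_square:
  assumes "y \<in> {0..1}" "a' \<le> s"
  shows "(\<lambda>p. kernel_sq s y a a' p) \<in> borel_measurable lborel"
proof -
  have [measurable]: "{a<..a'} \<times> {0..1::real} \<in> sets borel" by (intro borel_Times) auto
  note [measurable] = measurable_neumann_kernel[OF assms(1), of s]
  have "(\<lambda>p. ennreal ((neumann_kernel (s - fst p) y (snd p) * indicator ({..s} \<times> {0..1}) p)\<^sup>2) * indicator ({a<..a'} \<times> {0..1}) p) \<in> borel_measurable lborel"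
    by measurable
  also have "(\<lambda>p. ennreal ((neumann_kernel (s - fst p) y (snd p) * indicator ({..s} \<times> {0..1}) p)\<^sup>2) * indicator ({a<..a'} \<times> {0..1}) p) =
    (\<lambda>p. kernel_sq s y a a' p)"
    using assms(2) by (auto simp: fun_eq_iff indicator_def)
  finally show ?thesis .
qed

text \<open>After exchanging the integrals, the second moment of the coefficient is at most B at
  each point, and the square integral of the kernel remains.\<close>

lemma sqnorm_seg_weighted:
  assumes c: "predictable s c" and y: "y \<in> {0..1}" and s: "s \<le> T" and a: "0 \<le> a" "a \<le> s" and B: "0 \<le> B"
    and bound: "\<And>r z. a < r ==> r \<le> a' ==> r \<le> s ==> z \<in> {0..1} ==> (\<integral>\<^sup>+w. ennreal (kill L r w * (c r z w)\<^sup>2) \<partial>M) \<le> ennreal B"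
  shows "sqnorm s (seg a a' (weighted L c s y)) \<le> ennreal (B * CK * sqrt (s - a))"
proof -
  have pr: "predictable s (seg a a' (weighted L c s y))"
    by (intro predictable_seg predictable_weighted c y order_refl)
  have "sqnorm s (seg a a' (weighted L c s y)) = (\<integral>\<^sup>+p. (msq M (\<lambda>w. seg a a' (weighted L c s y) (fst p) (snd p) w)) * indicator (strip s) p \<partial>lborel)"
    by (rule sqnorm_Fubini[OF predictable_jointly[OF pr]])
  also have "\<dots> \<le> (\<integral>\<^sup>+p. ennreal B * (kernel_sq s y a s p) \<partial>lborel)"
  proof (rule nn_integral_mono)
    fix p :: "real \<times> real"
    obtain r z where p: "p = (r, z)" by force
    show "msq M (\<lambda>w. seg a a' (weighted L c s y) (fst p) (snd p) w) * indicator (strip s) p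
      \<le> ennreal B * (kernel_sq s y a s p)"
    proof (cases "a < r \<and> r \<le> a' \<and> r \<le> s \<and> z \<in> {0..1}")
      case True
      note [measurable] = kill_measurable[of L r]
      have [measurable]: "(\<lambda>w. c r z w) \<in> borel_measurable M" using True a by (intro predictable_section[OF c]) auto
      have "(seg a a' (weighted L c s y) r z w)\<^sup>2 = (neumann_kernel (s - r) y z)\<^sup>2 * (kill L r w * (c r z w)\<^sup>2)" for w
        using True kill_cases[of L r w] by (auto simp: seg_def weighted_def power_mult_distrib)
      then have "msq M (\<lambda>w. seg a a' (weighted L c s y) r z w) = (\<integral>\<^sup>+w. ennreal ((neumann_kernel (s - r) y z)\<^sup>2) * ennreal (kill L r w * (c r z w)\<^sup>2) \<partial>M)"
        by (simp add: ennreal_mult)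
      also have "\<dots> = ennreal ((neumann_kernel (s - r) y z)\<^sup>2) * (\<integral>\<^sup>+w. ennreal (kill L r w * (c r z w)\<^sup>2) \<partial>M)"
        by (rule nn_integral_cmult) measurable
      also have "\<dots> \<le> ennreal ((neumann_kernel (s - r) y z)\<^sup>2) * ennreal B"
        using True by (intro mult_left_mono bound) auto
      finally show ?thesis using True a by (simp add: p strip_def mult.commute)
    next
      case False
      then have "seg a a' (weighted L c s y) r z w = 0 \<or> p \<notin> strip s" for w
        by (auto simp: seg_def p strip_def)
      then have "msq M (\<lambda>w. seg a a' (weighted L c s y) (fst p) (snd p) w) * indicator (strip s) p = 0"
        by (cases "p \<in> strip s") (auto simp: p)
      then show ?thesis by (simp only: zero_le)
    qed
  qed
  also have "\<dots> = ennreal B * (\<integral>\<^sup>+p. kernel_sq s y a s p \<partial>lborel)"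
    by (rule nn_integral_cmult[OF measurable_kernel_square[OF y order_refl]])
  also have "\<dots> \<le> ennreal B * ennreal (CK * sqrt (s - a))"
    using a s y by (intro mult_left_mono CK) auto
  also have "\<dots> = ennreal (B * CK * sqrt (s - a))"
    using B CK(1) a by (simp flip: ennreal_mult add: mult.assoc)
  finally show ?thesis .
qed

text \<open>Treats \<sigma>(U) and its elliptic modification by the same estimates. Both must agree
  up to t1, since up to t0 the energy of the original coefficients is the only control.\<close>

definition coefficient :: "real => (real => real => 'a => real) => bool" where
  "coefficient D c \<longleftrightarrow> CG \<le> D \<and> predictable T c \<and> (\<forall>r z w. r \<le> t1 \<longrightarrow> c r z w = \<sigma> (U r z w)) \<and>
     (\<forall>r z w. \<bar>c r z w\<bar> \<le> D * (1 + \<bar>U r z w\<bar>))"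

lemma coefficientD:
  assumes "coefficient D c"
  shows "0 \<le> D" "S \<le> T ==> predictable S c" "\<bar>c r z w\<bar> \<le> D * (1 + \<bar>U r z w\<bar>)"
    "r \<le> t1 ==> c r z w = \<sigma> (U r z w)"
proof -
  show "0 \<le> D" using assms growth(1) unfolding coefficient_def by linarith
  have "predictable T c" using assms unfolding coefficient_def by blast
  then show "S \<le> T ==> predictable S c" by (rule predictable_subinterval)
  show "\<bar>c r z w\<bar> \<le> D * (1 + \<bar>U r z w\<bar>)" "r \<le> t1 ==> c r z w = \<sigma> (U r z w)"
    using assms unfolding coefficient_def by blast+
qed

lemma coefficient_\<sigma>: "coefficient CG \<sigma>U"
  unfolding coefficient_def using growth predictable_compose[OF predictable_U \<sigma>_measurable] by auto

text \<open>The gap between t0 and t1 bounds the kernel by CU / sqrt (t1 - t0), so the pathwise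
  energy bound suffices where no moment bound is at hand.\<close>

lemma sqnorm_early:
  assumes c: "coefficient D c" and s: "t1 < s" "s \<le> T" and y: "y \<in> {0..1}"
  shows "sqnorm s (seg 0 t0 (weighted L c s y)) \<le> ennreal (CU\<^sup>2 / (t1 - t0) * K)"
proof -
  have "energy s (seg 0 t0 (weighted L c s y)) w \<le> ennreal (CU\<^sup>2 / (t1 - t0) * K)" if w: "w \<in> space M" for w
  proof -
    have "energy s (seg 0 t0 (weighted L c s y)) w \<le> (\<integral>\<^sup>+p. ennreal (CU\<^sup>2 / (t1 - t0)) * ennreal ((kill L (fst p) w * intensity (fst p) (snd p) w * indicator (strip t0) p)\<^sup>2) \<partial>lborel)"
      unfolding energy_def
    proof (rule nn_integral_mono)
      fix p :: "real \<times> real"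
      obtain r z where p: "p = (r, z)" by force
      show "ennreal ((seg 0 t0 (weighted L c s y) (fst p) (snd p) w)\<^sup>2) * indicator (strip s) p \<le>
        ennreal (CU\<^sup>2 / (t1 - t0)) * ennreal ((kill L (fst p) w * intensity (fst p) (snd p) w * indicator (strip t0) p)\<^sup>2)"
      proof (cases "0 < r \<and> r \<le> t0 \<and> z \<in> {0..1}")
        case True
        have "neumann_kernel (s - r) y z \<le> CU / sqrt (s - r)" using True s y window by (intro CU) auto
        also have "\<dots> \<le> CU / sqrt (t1 - t0)" using True s window CU(1) by (intro divide_left_mono) auto
        finally have "(neumann_kernel (s - r) y z)\<^sup>2 \<le> (CU / sqrt (t1 - t0))\<^sup>2"
          using True s y window by (intro power_mono neumann_kernel_nonneg) auto
        also have "\<dots> = CU\<^sup>2 / (t1 - t0)" using window by (simp add: power_divide)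
        finally have G: "(neumann_kernel (s - r) y z)\<^sup>2 \<le> CU\<^sup>2 / (t1 - t0)" .
        have "c r z w = \<sigma> (U r z w)" using c True window unfolding coefficient_def by auto
        then have "(c r z w)\<^sup>2 \<le> (intensity r z w)\<^sup>2" unfolding intensity_sq by simp
        then have "(kill L r w)\<^sup>2 * ((neumann_kernel (s - r) y z)\<^sup>2 * (c r z w)\<^sup>2) \<le> (kill L r w)\<^sup>2 * (CU\<^sup>2 / (t1 - t0) * (intensity r z w)\<^sup>2)"
          using G window by (intro mult_left_mono mult_mono) auto
        then have "(weighted L c s y r z w)\<^sup>2 \<le> CU\<^sup>2 / (t1 - t0) * (kill L r w * intensity r z w)\<^sup>2"
          unfolding weighted_def power_mult_distrib by (simp add: mult_ac)
        then have "ennreal ((weighted L c s y r z w)\<^sup>2) \<le> ennreal (CU\<^sup>2 / (t1 - t0)) * ennreal ((kill L r w * intensity r z w)\<^sup>2)"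
          using window by (simp flip: ennreal_mult add: ennreal_leI)
        then show ?thesis using True s window by (simp add: p seg_def strip_def)
      next
        case False
        then have "seg 0 t0 (weighted L c s y) (fst p) (snd p) w = 0 \<or> p \<notin> strip s" by (auto simp: p seg_def strip_def)
        then show ?thesis by auto
      qed
    qed
    also have "\<dots> = ennreal (CU\<^sup>2 / (t1 - t0)) * energy t0 (\<lambda>s y w. kill L s w * intensity s y w) w"
      unfolding energy_alt
    proof (rule nn_integral_cmult)
      have "predictable t0 (\<lambda>s y w. kill L s w * intensity s y w)"
        by (intro predictable_mult predictable_kill predictable_intensity)
      note [measurable] = jointly_section[OF predictable_jointly[OF this] w]
      show "(\<lambda>p. ennreal ((kill L (fst p) w * intensity (fst p) (snd p) w * indicator (strip t0) p)\<^sup>2)) \<in> borel_measurable lborel"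
        by measurable
    qed
    also have "\<dots> \<le> ennreal (CU\<^sup>2 / (t1 - t0)) * ennreal K"
      by (intro mult_left_mono energy_kill_early w) auto
    also have "\<dots> = ennreal (CU\<^sup>2 / (t1 - t0) * K)" using window by (simp flip: ennreal_mult)
    finally show ?thesis .
  qed
  then have "sqnorm s (seg 0 t0 (weighted L c s y)) \<le> (\<integral>\<^sup>+w. ennreal (CU\<^sup>2 / (t1 - t0) * K) \<partial>M)"
    unfolding sqnorm_def by (intro nn_integral_mono)
  then show ?thesis by (simp add: emeasure_space_1)
qed

lemma sqnorm_cong:
  assumes "\<And>r z w. 0 < r ==> r \<le> s ==> H r z w = H' r z w"
  shows "sqnorm s H = sqnorm s H'"
proof -
  have "ennreal ((H (fst p) (snd p) w)\<^sup>2) * indicator (strip s) p = ennreal ((H' (fst p) (snd p) w)\<^sup>2) * indicator (strip s) p" for p w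
    using assms[of "fst p" "snd p" w] by (cases "p \<in> strip s") (auto simp: strip_def)
  then show ?thesis unfolding sqnorm_def energy_def by simp
qed

text \<open>The stretches (0,t0], (t0,t1] and (t1,s] are controlled by energy, level K and second
  moments. Only the last one involves m, and it carries the small factor sqrt (T - t1).\<close>

lemma sqnorm_weighted:
  assumes c: "coefficient D c" and m: "moment L m" and s: "t1 < s" "s \<le> T" and y: "y \<in> {0..1}"
  shows "sqnorm s (weighted L c s y) \<le> ennreal (2 * (CU\<^sup>2 / (t1 - t0) * K) + 4 * (D\<^sup>2 * (1 + K)\<^sup>2 * CK * sqrt T) + 8 * (D\<^sup>2 * (1 + m) * CK * sqrt (T - t1)))"
proof -
  note D = coefficientD(1)[OF c] and cs = coefficientD(2)[OF c s(2)] and cg = coefficientD(3)[OF c]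
  have m0: "0 \<le> m" using m by (simp add: moment_def)
  let ?H = "weighted L c s y"
  have j: "jointly s (seg a a' ?H)" for a a'
    by (intro predictable_jointly predictable_seg predictable_weighted cs y order_refl)
  have 1: "sqnorm s (seg 0 t0 ?H) \<le> ennreal (CU\<^sup>2 / (t1 - t0) * K)" by (rule sqnorm_early[OF c s y])
  have "sqnorm s (seg t0 t1 ?H) \<le> ennreal (D\<^sup>2 * (1 + K)\<^sup>2 * CK * sqrt (s - t0))"
  proof (rule sqnorm_seg_weighted[OF cs y s(2)])
    fix r z :: real assume "t0 < r" "r \<le> t1" "z \<in> {0..1}"
    then show "(\<integral>\<^sup>+w. ennreal (kill L r w * (c r z w)\<^sup>2) \<partial>M) \<le> ennreal (D\<^sup>2 * (1 + K)\<^sup>2)"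
      by (rule mid_growth[OF _ _ _ D cg])
  qed (use times window s in auto)
  also have "\<dots> \<le> ennreal (D\<^sup>2 * (1 + K)\<^sup>2 * CK * sqrt T)"
    using times s CK(1) by (intro ennreal_leI mult_left_mono real_sqrt_le_mono) auto
  finally have 2: "sqnorm s (seg t0 t1 ?H) \<le> ennreal (D\<^sup>2 * (1 + K)\<^sup>2 * CK * sqrt T)" .
  have "sqnorm s (seg t1 s ?H) \<le> ennreal (2 * D\<^sup>2 * (1 + m) * CK * sqrt (s - t1))"
  proof (rule sqnorm_seg_weighted[OF cs y s(2)])
    fix r z :: real assume "t1 < r" "r \<le> s" "z \<in> {0..1}"
    then show "(\<integral>\<^sup>+w. ennreal (kill L r w * (c r z w)\<^sup>2) \<partial>M) \<le> ennreal (2 * D\<^sup>2 * (1 + m))"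
      using s by (intro moment_growth[OF m _ _ _ D cg]) auto
  qed (use times window s m0 in auto)
  also have "\<dots> \<le> ennreal (2 * (D\<^sup>2 * (1 + m) * CK * sqrt (T - t1)))"
    using times s CK(1) m0 by (simp add: mult.assoc) (intro ennreal_leI mult_left_mono real_sqrt_le_mono, auto)
  finally have 3: "sqnorm s (seg t1 s ?H) \<le> ennreal (2 * (D\<^sup>2 * (1 + m) * CK * sqrt (T - t1)))" .
  have "sqnorm s ?H = sqnorm s (\<lambda>r z w. seg 0 t0 ?H r z w + (seg t0 t1 ?H r z w + seg t1 s ?H r z w))"
  proof (rule sqnorm_cong)
    fix r z w assume "0 < r" "r \<le> s"
    then show "?H r z w = seg 0 t0 ?H r z w + (seg t0 t1 ?H r z w + seg t1 s ?H r z w)"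
      using window s by (auto simp: seg_def of_bool_def)
  qed
  also have "\<dots> \<le> 2 * sqnorm s (seg 0 t0 ?H) + 2 * sqnorm s (\<lambda>r z w. seg t0 t1 ?H r z w + seg t1 s ?H r z w)"
    by (intro sqnorm_add j jointly_add)
  also have "\<dots> \<le> 2 * sqnorm s (seg 0 t0 ?H) + 2 * (2 * sqnorm s (seg t0 t1 ?H) + 2 * sqnorm s (seg t1 s ?H))"
    by (intro add_left_mono mult_left_mono sqnorm_add j) auto
  also have "\<dots> \<le> 2 * ennreal (CU\<^sup>2 / (t1 - t0) * K) + 2 * (2 * ennreal (D\<^sup>2 * (1 + K)\<^sup>2 * CK * sqrt T) + 2 * ennreal (2 * (D\<^sup>2 * (1 + m) * CK * sqrt (T - t1))))"
    by (intro add_mono mult_left_mono 1 2 3) auto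
  also have "\<dots> = ennreal (2 * (CU\<^sup>2 / (t1 - t0) * K) + 2 * (2 * (D\<^sup>2 * (1 + K)\<^sup>2 * CK * sqrt T) + 2 * (2 * (D\<^sup>2 * (1 + m) * CK * sqrt (T - t1)))))"
    using window times CK(1) m0 t1T
    by (subst ennreal_twice_add, simp, simp, subst ennreal_twice_add) auto
  finally show ?thesis by (simp add: algebra_simps)
qed

text \<open>Extended and with absolute values, so that it can be estimated before the drift is known
  to be integrable.\<close>

definition drift_mass :: "ereal => real => real => real => real => 'a => ennreal" where
  "drift_mass L s y a a' w = (\<integral>\<^sup>+p. ennreal \<bar>seg a a' (weighted L bU s y) (fst p) (snd p) w\<bar> * indicator (strip s) p \<partial>lborel)"

lemma predictable_b: "predictable S bU"
  by (rule predictable_compose[OF predictable_U b_measurable])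

lemma measurable_drift_mass: "y \<in> {0..1} ==> drift_mass L s y a a' \<in> borel_measurable M"
proof -
  assume y: "y \<in> {0..1}"
  have "predictable s (seg a a' (weighted L bU s y))"
    by (intro predictable_seg predictable_weighted predictable_b y order_refl)
  from predictable_jointly[OF this] have [measurable]: "(\<lambda>z. seg a a' (weighted L bU s y) (fst (snd z)) (snd (snd z)) (fst z) * indicator (strip s) (snd z)) \<in> borel_measurable (M \<Otimes>\<^sub>M lborel)"
    unfolding jointly_def by (simp add: case_prod_beta)
  have "(\<lambda>(w, p). ennreal \<bar>seg a a' (weighted L bU s y) (fst p) (snd p) w * indicator (strip s) p\<bar>) \<in> borel_measurable (M \<Otimes>\<^sub>M lborel)"
    unfolding case_prod_beta by measurable
  then have "(\<lambda>w. \<integral>\<^sup>+p. ennreal \<bar>seg a a' (weighted L bU s y) (fst p) (snd p) w * indicator (strip s) p\<bar> \<partial>lborel) \<in> borel_measurable M"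
    by (rule lborel.borel_measurable_nn_integral)
  also have "(\<lambda>w. \<integral>\<^sup>+p. ennreal \<bar>seg a a' (weighted L bU s y) (fst p) (snd p) w * indicator (strip s) p\<bar> \<partial>lborel) = drift_mass L s y a a'"
    unfolding drift_mass_def by (intro ext nn_integral_cong) (auto simp: indicator_def)
  finally show ?thesis .
qed

lemma drift_mass_early:
  assumes s: "t1 < s" "s \<le> T" and y: "y \<in> {0..1}" and w: "w \<in> space M"
  shows "drift_mass L s y 0 t0 w \<le> ennreal (CU / sqrt (t1 - t0) * K)"
proof -
  have "drift_mass L s y 0 t0 w \<le> (\<integral>\<^sup>+p. ennreal (CU / sqrt (t1 - t0)) * ennreal ((kill L (fst p) w * intensity (fst p) (snd p) w * indicator (strip t0) p)\<^sup>2) \<partial>lborel)"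
    unfolding drift_mass_def
  proof (rule nn_integral_mono)
    fix p :: "real \<times> real"
    obtain r z where p: "p = (r, z)" by force
    show "ennreal \<bar>seg 0 t0 (weighted L bU s y) (fst p) (snd p) w\<bar> * indicator (strip s) p \<le>
      ennreal (CU / sqrt (t1 - t0)) * ennreal ((kill L (fst p) w * intensity (fst p) (snd p) w * indicator (strip t0) p)\<^sup>2)"
    proof (cases "0 < r \<and> r \<le> t0 \<and> z \<in> {0..1}")
      case True
      have "neumann_kernel (s - r) y z \<le> CU / sqrt (s - r)" using True s y window by (intro CU) auto
      also have "\<dots> \<le> CU / sqrt (t1 - t0)" using True s window CU(1) by (intro divide_left_mono) auto
      finally have G: "\<bar>neumann_kernel (s - r) y z\<bar> \<le> CU / sqrt (t1 - t0)"
        using neumann_kernel_nonneg[of "s - r" y z] True s y window by (simp only: abs_of_nonneg) auto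
      have "\<bar>b (U r z w)\<bar> \<le> (intensity r z w)\<^sup>2" unfolding intensity_sq by simp
      then have "kill L r w * (\<bar>neumann_kernel (s - r) y z\<bar> * \<bar>b (U r z w)\<bar>) \<le> kill L r w * (CU / sqrt (t1 - t0) * (intensity r z w)\<^sup>2)"
        using G window CU by (intro mult_left_mono mult_mono) auto
      then have "\<bar>weighted L bU s y r z w\<bar> \<le> CU / sqrt (t1 - t0) * (kill L r w * intensity r z w)\<^sup>2"
        using kill_cases[of L r w] unfolding weighted_def by (auto simp: abs_mult)
      then have "ennreal \<bar>weighted L bU s y r z w\<bar> \<le> ennreal (CU / sqrt (t1 - t0)) * ennreal ((kill L r w * intensity r z w)\<^sup>2)"
        using window CU by (simp flip: ennreal_mult add: ennreal_leI)
      then show ?thesis using True s window by (simp add: p seg_def strip_def)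
    next
      case False
      then have "seg 0 t0 (weighted L bU s y) (fst p) (snd p) w = 0 \<or> p \<notin> strip s" by (auto simp: p seg_def strip_def)
      then show ?thesis by auto
    qed
  qed
  also have "\<dots> = ennreal (CU / sqrt (t1 - t0)) * energy t0 (\<lambda>s y w. kill L s w * intensity s y w) w"
    unfolding energy_alt
  proof (rule nn_integral_cmult)
    have "predictable t0 (\<lambda>s y w. kill L s w * intensity s y w)"
      by (intro predictable_mult predictable_kill predictable_intensity)
    note [measurable] = jointly_section[OF predictable_jointly[OF this] w]
    show "(\<lambda>p. ennreal ((kill L (fst p) w * intensity (fst p) (snd p) w * indicator (strip t0) p)\<^sup>2)) \<in> borel_measurable lborel"
      by measurable
  qed
  also have "\<dots> \<le> ennreal (CU / sqrt (t1 - t0)) * ennreal K"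
    by (intro mult_left_mono energy_kill_early w) auto
  also have "\<dots> = ennreal (CU / sqrt (t1 - t0) * K)" using window CU by (simp flip: ennreal_mult)
  finally show ?thesis .
qed

text \<open>Cauchy-Schwarz over space and time: the kernel contributes sqrt (s - a), the coefficient
  the length a' - a. Over a last stretch of length \<epsilon> the drift thus has order
  \<epsilon>^(3/4), against \<epsilon>^(1/4) for the noise.\<close>

lemma drift_mass_square:
  assumes y: "y \<in> {0..1}" and s: "s \<le> T" and a: "0 \<le> a" "a \<le> a'" "a' \<le> s" and B: "0 \<le> B"
    and bound: "\<And>r z. a < r ==> r \<le> a' ==> z \<in> {0..1} ==> (\<integral>\<^sup>+w. ennreal (kill L r w * (b (U r z w))\<^sup>2) \<partial>M) \<le> ennreal B"
  shows "(\<integral>\<^sup>+w. (drift_mass L s y a a' w)\<^sup>2 \<partial>M) \<le> ennreal (CK * sqrt (s - a) * (B * (a' - a)))"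
proof -
  let ?c = "\<lambda>r z w. b (U r z w)"
  let ?k = "\<lambda>r z w. kill L r w * b (U r z w)"
  have prk: "predictable s (seg a a' ?k)"
    by (intro predictable_seg predictable_mult predictable_kill predictable_b)
  have CS: "(drift_mass L s y a a' w)\<^sup>2 \<le> ennreal (CK * sqrt (s - a)) * energy s (seg a a' ?k) w" if w: "w \<in> space M" for w
  proof -
    let ?f = "\<lambda>p. ennreal \<bar>neumann_kernel (s - fst p) y (snd p) * indicator ({..s} \<times> {0..1}) p * indicator ({a<..s} \<times> {0..1}) p\<bar>"
    let ?g = "\<lambda>p. ennreal \<bar>seg a a' ?k (fst p) (snd p) w * indicator (strip s) p\<bar>"
    have [measurable]: "{a<..s} \<times> {0..1::real} \<in> sets borel" by (intro borel_Times) auto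
    note [measurable] = measurable_neumann_kernel[OF y, of s] jointly_section[OF predictable_jointly[OF prk] w]
    have fm: "?f \<in> borel_measurable lborel" and gm: "?g \<in> borel_measurable lborel" by measurable
    have "drift_mass L s y a a' w = (\<integral>\<^sup>+p. ?f p * ?g p \<partial>lborel)"
      unfolding drift_mass_def
    proof (rule nn_integral_cong)
      fix p :: "real \<times> real"
      obtain r z where p: "p = (r, z)" by force
      show "ennreal \<bar>seg a a' (weighted L ?c s y) (fst p) (snd p) w\<bar> * indicator (strip s) p = ?f p * ?g p"
        using a by (auto simp: p seg_def weighted_def strip_def indicator_def of_bool_def ennreal_mult[symmetric] abs_mult mult_ac)
    qed
    then have "(drift_mass L s y a a' w)\<^sup>2 \<le> (\<integral>\<^sup>+p. (?f p)\<^sup>2 \<partial>lborel) * (\<integral>\<^sup>+p. (?g p)\<^sup>2 \<partial>lborel)"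
      using Cauchy_Schwarz_nn_integral[OF fm gm] by simp
    also have "(\<integral>\<^sup>+p. (?f p)\<^sup>2 \<partial>lborel) = (\<integral>\<^sup>+p. kernel_sq s y a s p \<partial>lborel)"
      by (intro nn_integral_cong) (auto simp: indicator_def ennreal_power)
    also have "(\<integral>\<^sup>+p. (?g p)\<^sup>2 \<partial>lborel) = energy s (seg a a' ?k) w"
      unfolding energy_alt by (simp add: ennreal_power)
    also have "(\<integral>\<^sup>+p. kernel_sq s y a s p \<partial>lborel) * energy s (seg a a' ?k) w \<le> ennreal (CK * sqrt (s - a)) * energy s (seg a a' ?k) w"
      using a s y by (intro mult_right_mono CK) auto
    finally show ?thesis .
  qed
  note [measurable] = measurable_energy[OF predictable_jointly[OF prk]]
  have "(\<integral>\<^sup>+w. (drift_mass L s y a a' w)\<^sup>2 \<partial>M) \<le> (\<integral>\<^sup>+w. ennreal (CK * sqrt (s - a)) * energy s (seg a a' ?k) w \<partial>M)"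
    by (intro nn_integral_mono CS)
  also have "\<dots> = ennreal (CK * sqrt (s - a)) * sqnorm s (seg a a' ?k)"
    unfolding sqnorm_def by (rule nn_integral_cmult) measurable
  also have "sqnorm s (seg a a' ?k) \<le> ennreal (B * (a' - a))"
  proof -
    have "sqnorm s (seg a a' ?k) = (\<integral>\<^sup>+p. (msq M (\<lambda>w. seg a a' ?k (fst p) (snd p) w)) * indicator (strip s) p \<partial>lborel)"
      by (rule sqnorm_Fubini[OF predictable_jointly[OF prk]])
    also have "\<dots> \<le> (\<integral>\<^sup>+p. ennreal B * indicator ({a<..a'} \<times> {0..1::real}) p \<partial>lborel)"
    proof (rule nn_integral_mono)
      fix p :: "real \<times> real"
      obtain r z where p: "p = (r, z)" by force
      show "msq M (\<lambda>w. seg a a' ?k (fst p) (snd p) w) * indicator (strip s) p \<le> ennreal B * indicator ({a<..a'} \<times> {0..1}) p"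
      proof (cases "a < r \<and> r \<le> a' \<and> z \<in> {0..1}")
        case True
        have "(seg a a' ?k r z w)\<^sup>2 = kill L r w * (b (U r z w))\<^sup>2" for w
          using True kill_cases[of L r w] by (auto simp: seg_def power_mult_distrib)
        then have "msq M (\<lambda>w. seg a a' ?k r z w) \<le> ennreal B" using bound True by simp
        then show ?thesis using True a by (simp add: p strip_def)
      next
        case False
        then have "(seg a a' ?k r z w)\<^sup>2 = 0 \<or> p \<notin> strip s" for w by (auto simp: seg_def p strip_def)
        then have "msq M (\<lambda>w. seg a a' ?k (fst p) (snd p) w) * indicator (strip s) p = 0"
          by (cases "p \<in> strip s") (auto simp: p)
        then show ?thesis by (simp only: zero_le)
      qed
    qed
    also have "\<dots> = ennreal B * emeasure lborel ({a<..a'} \<times> {0..1::real})"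
      by (rule nn_integral_cmult_indicator) (auto intro!: borel_Times)
    also have "emeasure lborel ({a<..a'} \<times> {0..1::real}) = ennreal (a' - a)"
      unfolding lborel_prod[symmetric] using a by (subst lborel.emeasure_pair_measure_Times) auto
    finally show ?thesis using a B by (simp flip: ennreal_mult)
  qed
  also have "ennreal (CK * sqrt (s - a)) * ennreal (B * (a' - a)) = ennreal (CK * sqrt (s - a) * (B * (a' - a)))"
    using a B CK(1) by (simp flip: ennreal_mult)
  finally show ?thesis by (simp add: mult_left_mono)
qed

end

lemma ennreal_square_add: "((a::ennreal) + b)\<^sup>2 \<le> 2 * a\<^sup>2 + 2 * b\<^sup>2"
proof (cases "a = \<top> \<or> b = \<top>")
  case True
  then show ?thesis by (auto simp: power2_eq_square ennreal_mult_top ennreal_top_mult)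
next
  case False
  then obtain x y where xy: "a = ennreal x" "0 \<le> x" "b = ennreal y" "0 \<le> y" by (cases a; cases b) auto
  have "(x + y)\<^sup>2 \<le> 2 * x\<^sup>2 + 2 * y\<^sup>2" using sum_squares_bound[of x y] by (simp add: power2_sum)
  then have "ennreal ((x + y)\<^sup>2) \<le> ennreal (2 * x\<^sup>2 + 2 * y\<^sup>2)" by (rule ennreal_leI)
  also have "\<dots> = 2 * ennreal (x\<^sup>2) + 2 * ennreal (y\<^sup>2)" by (rule ennreal_twice_add[symmetric]) auto
  finally show ?thesis using xy by (simp add: ennreal_power flip: ennreal_plus)
qed

lemma ennreal_abs_integral_le: "ennreal \<bar>LINT x|N. f x\<bar> \<le> (\<integral>\<^sup>+x. ennreal \<bar>f x\<bar> \<partial>N)"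
proof (cases "integrable N f")
  case True
  then show ?thesis using integral_norm_bound_ennreal[OF True] by simp
qed (simp add: not_integrable_integral_eq)

context spde_estimates
begin

definition drift :: "ereal => real => real => real => real => 'a => real" where
  "drift L s y a a' w = (LINT p|lborel. seg a a' (weighted L bU s y) (fst p) (snd p) w * indicator (strip s) p)"

text \<open>True on every path: if the integrand is not integrable, the left side is 0 by
  default.\<close>

lemma drift_le_mass: "ennreal \<bar>drift L s y a a' w\<bar> \<le> drift_mass L s y a a' w"
proof -
  have "drift_mass L s y a a' w = (\<integral>\<^sup>+p. ennreal \<bar>seg a a' (weighted L bU s y) (fst p) (snd p) w * indicator (strip s) p\<bar> \<partial>lborel)"
    unfolding drift_mass_def by (intro nn_integral_cong) (auto simp: indicator_def)
  then show ?thesis unfolding drift_def by (simp only: ennreal_abs_integral_le)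
qed

lemma drift_mass_split:
  assumes w: "w \<in> space M" and y: "y \<in> {0..1}" and a: "a \<le> a'" "a' \<le> a''"
  shows "drift_mass L s y a a'' w = drift_mass L s y a a' w + drift_mass L s y a' a'' w"
proof -
  let ?H = "weighted L bU s y"
  have pr: "predictable s (seg u v ?H)" for u v
    by (intro predictable_seg predictable_weighted predictable_b y order_refl)
  have m: "(\<lambda>p. ennreal \<bar>seg u v ?H (fst p) (snd p) w\<bar> * indicator (strip s) p) \<in> borel_measurable lborel" for u v
  proof -
    note [measurable] = jointly_section[OF predictable_jointly[OF pr] w]
    have "(\<lambda>p. ennreal \<bar>seg u v ?H (fst p) (snd p) w * indicator (strip s) p\<bar>) \<in> borel_measurable lborel" by measurable
    also have "(\<lambda>p. ennreal \<bar>seg u v ?H (fst p) (snd p) w * indicator (strip s) p\<bar>) = (\<lambda>p. ennreal \<bar>seg u v ?H (fst p) (snd p) w\<bar> * indicator (strip s) p)"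
      by (auto simp: fun_eq_iff indicator_def)
    finally show ?thesis .
  qed
  have "drift_mass L s y a a'' w = (\<integral>\<^sup>+p. ennreal \<bar>seg a a' ?H (fst p) (snd p) w\<bar> * indicator (strip s) p + ennreal \<bar>seg a' a'' ?H (fst p) (snd p) w\<bar> * indicator (strip s) p \<partial>lborel)"
    unfolding drift_mass_def using a by (intro nn_integral_cong) (auto simp: seg_def of_bool_def)
  also have "\<dots> = drift_mass L s y a a' w + drift_mass L s y a' a'' w"
    unfolding drift_mass_def by (rule nn_integral_add[OF m m])
  finally show ?thesis .
qed

lemma mid_b:
  assumes "t0 < r" "r \<le> t1" "z \<in> {0..1}"
  shows "(\<integral>\<^sup>+w. ennreal (kill L r w * (b (U r z w))\<^sup>2) \<partial>M) \<le> ennreal (CG\<^sup>2 * (1 + K)\<^sup>2)"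
  by (rule mid_growth[OF assms less_imp_le[OF growth(1)] growth(3)])

lemma late_b:
  assumes "moment L m" "t1 < r" "r \<le> T" "z \<in> {0..1}"
  shows "(\<integral>\<^sup>+w. ennreal (kill L r w * (b (U r z w))\<^sup>2) \<partial>M) \<le> ennreal (2 * CG\<^sup>2 * (1 + m))"
  by (rule moment_growth[OF assms less_imp_le[OF growth(1)] growth(3)])

lemma drift_mass_late:
  assumes m: "moment L m" and s: "t1 \<le> a" "a \<le> s" "s \<le> T" and y: "y \<in> {0..1}"
  shows "(\<integral>\<^sup>+w. (drift_mass L s y a s w)\<^sup>2 \<partial>M) \<le> ennreal (CK * sqrt (s - a) * (2 * CG\<^sup>2 * (1 + m) * (s - a)))"
proof (rule drift_mass_square[OF y])
  fix r z :: real assume "a < r" "r \<le> s" "z \<in> {0..1}"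
  then show "(\<integral>\<^sup>+w. ennreal (kill L r w * (b (U r z w))\<^sup>2) \<partial>M) \<le> ennreal (2 * CG\<^sup>2 * (1 + m))"
    using s by (intro late_b[OF m]) auto
qed (use s times m in \<open>auto simp: moment_def\<close>)

text \<open>On a path that is still alive at s the killed integrands are the true ones up to s. The
  drift then agrees path by path, the stochastic integral by locality.\<close>

lemma representation:
  assumes s: "t1 < s" "s \<le> T" and y: "y \<in> {0..1}"
    and I': "L2_walsh s (weighted L \<sigma>U s y) I'"
  shows "AE w in M. kill L s w = 1 \<longrightarrow> U s y w = J0 s y + drift L s y 0 s w + I' w"
proof -
  have s0: "0 < s" using s times by simp
  have "AE w in M. (\<forall>r\<in>{0<..s}. \<forall>z\<in>{0..1}. neumann_kernel (s - r) y z * \<sigma> (U r z w) = weighted L \<sigma>U s y r z w) \<longrightarrow> I s y w = I' w"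
    by (rule walsh_integral_local[OF less_imp_le[OF s0] U_walsh[OF s0 y] L2_walsh_walsh_integral[OF I']])
  then show ?thesis
    using U_eq
  proof eventually_elim
    case (elim w)
    show ?case
    proof
      assume k: "kill L s w = 1"
      have kr: "kill L r w = 1" if "r \<le> s" for r by (rule kill_mono[OF k that])
      have "I s y w = I' w" using elim(1) kr by (simp add: weighted_def)
      moreover have "set_lebesgue_integral lborel ({0<..<s} \<times> {0..1}) (\<lambda>(r, z). neumann_kernel (s - r) y z * b (U r z w)) = drift L s y 0 s w"
        unfolding set_lebesgue_integral_def drift_def
      proof (rule Bochner_Integration.integral_cong[OF refl])
        fix p :: "real \<times> real"
        obtain r z where p: "p = (r, z)" by force
        show "indicat_real ({0<..<s} \<times> {0..1}) p *\<^sub>R (case p of (r, z) => neumann_kernel (s - r) y z * b (U r z w)) =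
          seg 0 s (weighted L bU s y) (fst p) (snd p) w * indicator (strip s) p"
          using kr[of r] by (cases "r = s") (auto simp: p seg_def weighted_def strip_def indicator_def)
      qed
      ultimately show "U s y w = J0 s y + drift L s y 0 s w + I' w"
        using elim(2) s0 y by auto
    qed
  qed
qed

section \<open>Uniform second moments on the last window\<close>

lemma coefficient_walsh:
  assumes c: "coefficient D c" and m: "moment L m" and s: "t1 < s" "s \<le> T" and y: "y \<in> {0..1}"
  obtains I' where "L2_walsh s (weighted L c s y) I'"
proof -
  have "sqnorm s (weighted L c s y) < \<infinity>"
    using sqnorm_weighted[OF assms] by (rule le_less_trans) simp
  then show ?thesis
    using L2_walsh_exists[of s "weighted L c s y"] predictable_weighted[OF coefficientD(2)[OF c s(2)] order_refl y] s times that by auto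
qed

text \<open>Collects the contributions to the second moment in which m does not occur.\<close>

definition early_const :: real where
  "early_const = 32 * (2 * (CU\<^sup>2 / (t1 - t0) * K) + 4 * (CG\<^sup>2 * (1 + K)\<^sup>2 * CK * sqrt T))
     + 8 * (CK * sqrt T * (CG\<^sup>2 * (1 + K)\<^sup>2 * T)) + 16 * (CU / sqrt (t1 - t0) * K)\<^sup>2 + 16 * BJ\<^sup>2"

lemma early_const_nonneg: "0 \<le> early_const"
  unfolding early_const_def using window times CK(1) CU(1)
  by (intro add_nonneg_nonneg mult_nonneg_nonneg divide_nonneg_nonneg zero_le_power2) auto

text \<open>One pass through the equation. The weights 2, 4, 8, 16, 16 come from splitting off one
  term at a time from the square of a sum of five: noise, late drift, middle drift, early drift and
  initial term. \<open>small\<close> bounds the two terms that involve m by (1 + m) / 2.\<close>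

lemma moment_step:
  assumes m: "moment L m"
  shows "moment L (early_const + (1 + m) / 2)"
  unfolding moment_def
proof (intro conjI ballI)
  have m0: "0 \<le> m" using m by (simp add: moment_def)
  show "0 \<le> early_const + (1 + m) / 2" using early_const_nonneg m0 by simp
  fix s y assume "s \<in> {t1<..T}" and y: "y \<in> {0..1::real}"
  then have s: "t1 < s" "s \<le> T" by auto
  obtain I' where I': "L2_walsh s (weighted L \<sigma>U s y) I'"
    by (rule coefficient_walsh[OF coefficient_\<sigma> m s y])
  have I'm[measurable]: "I' \<in> borel_measurable M"
    using I' s times unfolding L2_walsh_def by (auto intro: measurable_F[of s])
  let ?d = "\<lambda>a a' w. drift_mass L s y a a' w"
  note [measurable] = measurable_drift_mass[OF y]
  have pw: "AE w in M. ennreal (kill L s w * (U s y w)\<^sup>2) \<le>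
    2 * ennreal ((I' w)\<^sup>2) + 4 * (?d t1 s w)\<^sup>2 + 8 * (?d t0 t1 w)\<^sup>2 + ennreal (16 * (CU / sqrt (t1 - t0) * K)\<^sup>2) + ennreal (16 * BJ\<^sup>2)"
    using representation[OF s y I'] AE_space
  proof eventually_elim
    case (elim w)
    show ?case
    proof (cases "kill L s w = 1")
      case False
      then have "kill L s w = 0" using kill_cases by blast
      then show ?thesis by simp
    next
      case True
      then have U: "U s y w = J0 s y + drift L s y 0 s w + I' w" using elim by simp
      have d: "?d 0 s w = ?d t1 s w + (?d t0 t1 w + ?d 0 t0 w)"
        using drift_mass_split[OF elim(2) y, of 0 t0 s] drift_mass_split[OF elim(2) y, of t0 t1 s] window s
        by (simp add: add_ac)
      have "ennreal \<bar>U s y w\<bar> \<le> ennreal (\<bar>I' w\<bar> + (\<bar>drift L s y 0 s w\<bar> + \<bar>J0 s y\<bar>))"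
        unfolding U by (intro ennreal_leI) auto
      also have "\<dots> = ennreal \<bar>I' w\<bar> + (ennreal \<bar>drift L s y 0 s w\<bar> + ennreal \<bar>J0 s y\<bar>)" by simp
      also have "\<dots> \<le> ennreal \<bar>I' w\<bar> + (?d 0 s w + ennreal BJ)"
        using s y by (intro add_left_mono add_mono drift_le_mass ennreal_leI BJ) auto
      also have "\<dots> = ennreal \<bar>I' w\<bar> + (?d t1 s w + (?d t0 t1 w + (?d 0 t0 w + ennreal BJ)))"
        unfolding d by (simp add: add_ac)
      also have "\<dots> \<le> ennreal \<bar>I' w\<bar> + (?d t1 s w + (?d t0 t1 w + (ennreal (CU / sqrt (t1 - t0) * K) + ennreal BJ)))"
        by (intro add_left_mono add_right_mono drift_mass_early s y elim(2))
      finally have "(ennreal \<bar>U s y w\<bar>)\<^sup>2 \<le> (ennreal \<bar>I' w\<bar> + (?d t1 s w + (?d t0 t1 w + (ennreal (CU / sqrt (t1 - t0) * K) + ennreal BJ))))\<^sup>2"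
        by (intro power_mono) auto
      also have "\<dots> \<le> 2 * (ennreal \<bar>I' w\<bar>)\<^sup>2 + 2 * (2 * (?d t1 s w)\<^sup>2 + 2 * (2 * (?d t0 t1 w)\<^sup>2 + 2 * (2 * (ennreal (CU / sqrt (t1 - t0) * K))\<^sup>2 + 2 * (ennreal BJ)\<^sup>2)))"
        by (intro order_trans[OF ennreal_square_add] add_left_mono mult_left_mono) auto
      also have "\<dots> = 2 * (ennreal \<bar>I' w\<bar>)\<^sup>2 + 4 * (?d t1 s w)\<^sup>2 + 8 * (?d t0 t1 w)\<^sup>2 + 16 * (ennreal (CU / sqrt (t1 - t0) * K))\<^sup>2 + 16 * (ennreal BJ)\<^sup>2"
        by (simp add: distrib_left mult.assoc[symmetric] add.assoc)
      finally show ?thesis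
        using True window CU(1) BJ(1) by (simp add: ennreal_power ennreal_mult')
    qed
  qed
  have "(\<integral>\<^sup>+w. ennreal (kill L s w * (U s y w)\<^sup>2) \<partial>M) \<le>
    (\<integral>\<^sup>+w. 2 * ennreal ((I' w)\<^sup>2) + 4 * (?d t1 s w)\<^sup>2 + 8 * (?d t0 t1 w)\<^sup>2 + ennreal (16 * (CU / sqrt (t1 - t0) * K)\<^sup>2) + ennreal (16 * BJ\<^sup>2) \<partial>M)"
    by (rule nn_integral_mono_AE[OF pw])
  also have "\<dots> = 2 * msq M I' + 4 * (\<integral>\<^sup>+w. (?d t1 s w)\<^sup>2 \<partial>M) + 8 * (\<integral>\<^sup>+w. (?d t0 t1 w)\<^sup>2 \<partial>M)
     + ennreal (16 * (CU / sqrt (t1 - t0) * K)\<^sup>2) + ennreal (16 * BJ\<^sup>2)"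
    by (simp add: nn_integral_add nn_integral_cmult emeasure_space_1)
  also have "\<dots> \<le> 2 * (16 * ennreal (2 * (CU\<^sup>2 / (t1 - t0) * K) + 4 * (CG\<^sup>2 * (1 + K)\<^sup>2 * CK * sqrt T) + 8 * (CG\<^sup>2 * (1 + m) * CK * sqrt (T - t1))))
     + 4 * ennreal (CK * sqrt T * (2 * CG\<^sup>2 * (1 + m) * (T - t1))) + 8 * ennreal (CK * sqrt T * (CG\<^sup>2 * (1 + K)\<^sup>2 * T))
     + ennreal (16 * (CU / sqrt (t1 - t0) * K)\<^sup>2) + ennreal (16 * BJ\<^sup>2)"
  proof (intro add_mono mult_left_mono order_refl)
    show "msq M I' \<le> 16 * ennreal (2 * (CU\<^sup>2 / (t1 - t0) * K) + 4 * (CG\<^sup>2 * (1 + K)\<^sup>2 * CK * sqrt T) + 8 * (CG\<^sup>2 * (1 + m) * CK * sqrt (T - t1)))"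
      by (rule order_trans[OF L2_walsh_bound0[OF I']]) (intro mult_left_mono sqnorm_weighted[OF coefficient_\<sigma> m s y], simp)
    have "(\<integral>\<^sup>+w. (?d t1 s w)\<^sup>2 \<partial>M) \<le> ennreal (CK * sqrt (s - t1) * (2 * CG\<^sup>2 * (1 + m) * (s - t1)))"
      using s by (intro drift_mass_late[OF m] y) auto
    also have "\<dots> \<le> ennreal (CK * sqrt T * (2 * CG\<^sup>2 * (1 + m) * (T - t1)))"
      using s times CK(1) m0 by (intro ennreal_leI mult_mono mult_nonneg_nonneg real_sqrt_le_mono) auto
    finally show "(\<integral>\<^sup>+w. (?d t1 s w)\<^sup>2 \<partial>M) \<le> ennreal (CK * sqrt T * (2 * CG\<^sup>2 * (1 + m) * (T - t1)))" .
    have "(\<integral>\<^sup>+w. (?d t0 t1 w)\<^sup>2 \<partial>M) \<le> ennreal (CK * sqrt (s - t0) * (CG\<^sup>2 * (1 + K)\<^sup>2 * (t1 - t0)))"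
      using s window by (intro drift_mass_square mid_b y) auto
    also have "\<dots> \<le> ennreal (CK * sqrt T * (CG\<^sup>2 * (1 + K)\<^sup>2 * T))"
      using s times CK(1) window by (intro ennreal_leI mult_mono mult_nonneg_nonneg real_sqrt_le_mono) auto
    finally show "(\<integral>\<^sup>+w. (?d t0 t1 w)\<^sup>2 \<partial>M) \<le> ennreal (CK * sqrt T * (CG\<^sup>2 * (1 + K)\<^sup>2 * T))" .
  qed auto
  also have "\<dots> = ennreal (32 * (2 * (CU\<^sup>2 / (t1 - t0) * K) + 4 * (CG\<^sup>2 * (1 + K)\<^sup>2 * CK * sqrt T) + 8 * (CG\<^sup>2 * (1 + m) * CK * sqrt (T - t1)))
     + 4 * (CK * sqrt T * (2 * CG\<^sup>2 * (1 + m) * (T - t1))) + 8 * (CK * sqrt T * (CG\<^sup>2 * (1 + K)\<^sup>2 * T))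
     + 16 * (CU / sqrt (t1 - t0) * K)\<^sup>2 + 16 * BJ\<^sup>2)"
  proof -
    have n: "0 \<le> 2 * (CU\<^sup>2 / (t1 - t0) * K) + 4 * (CG\<^sup>2 * (1 + K)\<^sup>2 * CK * sqrt T) + 8 * (CG\<^sup>2 * (1 + m) * CK * sqrt (T - t1))"
      "0 \<le> CK * sqrt T * (2 * CG\<^sup>2 * (1 + m) * (T - t1))" "0 \<le> CK * sqrt T * (CG\<^sup>2 * (1 + K)\<^sup>2 * T)"
      using window times CK(1) m0 t1T by (auto intro!: add_nonneg_nonneg mult_nonneg_nonneg divide_nonneg_nonneg)
    have num: "2 * (16 * ennreal x) = ennreal (32 * x)" "4 * ennreal x = ennreal (4 * x)" "8 * ennreal x = ennreal (8 * x)" if "0 \<le> x" for x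
      using that by (simp_all add: ennreal_mult' mult.assoc[symmetric])
    show ?thesis unfolding num(1)[OF n(1)] num(2)[OF n(2)] num(3)[OF n(3)]
      using n by (subst ennreal_plus[symmetric], simp, simp)+ simp
  qed
  also have "\<dots> \<le> ennreal (early_const + (1 + m) / 2)"
  proof (rule ennreal_leI)
    \<comment> \<open>The noise contributes 32 * 8 and the drift 4 * 2, which is 8 times (32 and 1);
      the 64 in \<open>small\<close> leaves a margin.\<close>
    have "8 * CK * CG\<^sup>2 * (sqrt T * (T - t1) + 32 * sqrt (T - t1)) \<le> 8 * CK * CG\<^sup>2 * (sqrt T * (T - t1) + 64 * sqrt (T - t1))"
      using CK(1) t1T by (intro mult_left_mono) auto
    then have a: "8 * CK * CG\<^sup>2 * (sqrt T * (T - t1) + 32 * sqrt (T - t1)) * (1 + m) \<le> 1 / 2 * (1 + m)"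
      using small m0 by (intro mult_right_mono) auto
    then show "32 * (2 * (CU\<^sup>2 / (t1 - t0) * K) + 4 * (CG\<^sup>2 * (1 + K)\<^sup>2 * CK * sqrt T) + 8 * (CG\<^sup>2 * (1 + m) * CK * sqrt (T - t1)))
     + 4 * (CK * sqrt T * (2 * CG\<^sup>2 * (1 + m) * (T - t1))) + 8 * (CK * sqrt T * (CG\<^sup>2 * (1 + K)\<^sup>2 * T))
     + 16 * (CU / sqrt (t1 - t0) * K)\<^sup>2 + 16 * BJ\<^sup>2 \<le> early_const + (1 + m) / 2"
    proof -
      have "32 * (8 * (CG\<^sup>2 * (1 + m) * CK * sqrt (T - t1))) + 4 * (CK * sqrt T * (2 * CG\<^sup>2 * (1 + m) * (T - t1)))
        = 8 * CK * CG\<^sup>2 * (sqrt T * (T - t1) + 32 * sqrt (T - t1)) * (1 + m)" by (simp add: algebra_simps)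
      with a show ?thesis unfolding early_const_def by argo
    qed
  qed
  finally show "(\<integral>\<^sup>+w. ennreal (kill L s w * (U s y w)\<^sup>2) \<partial>M) \<le> ennreal (early_const + (1 + m) / 2)" .
qed

text \<open>A cutoff at level n provides a finite bound, however bad, from which the iteration can
  start.\<close>

lemma moment_level: "moment (ereal (real n)) ((real n)\<^sup>2)"
  unfolding moment_def
proof (intro conjI ballI)
  fix r z assume r: "r \<in> {t1<..T}" and z: "z \<in> {0..1::real}"
  have "(\<integral>\<^sup>+w. ennreal (kill (ereal (real n)) r w * (U r z w)\<^sup>2) \<partial>M) \<le> msq M (\<lambda>w. real n)"
  proof (intro nn_integral_mono ennreal_leI)
    fix w assume w: "w \<in> space M"
    show "kill (ereal (real n)) r w * (U r z w)\<^sup>2 \<le> (real n)\<^sup>2"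
    proof (cases "kill (ereal (real n)) r w = 0")
      case False
      then have k: "kill (ereal (real n)) r w = 1" using kill_cases by blast
      have "\<bar>U r z w\<bar> \<le> real n" using r by (intro kill_U_late[OF w k _ _ z]) auto
      from power_mono[OF this, of 2] show ?thesis by (simp add: k)
    qed simp
  qed
  then show "(\<integral>\<^sup>+w. ennreal (kill (ereal (real n)) r w * (U r z w)\<^sup>2) \<partial>M) \<le> ennreal ((real n)\<^sup>2)"
    by (simp add: emeasure_space_1)
qed simp

text \<open>The fixed point of m = early_const + (1 + m) / 2.\<close>

definition mb :: real where "mb = 2 * early_const + 1"

text \<open>Each step halves the distance to the fixed point, so the level n drops out in the
  limit.\<close>

lemma moment_uniform: "moment (ereal (real n)) mb"
proof -
  have it: "moment (ereal (real n)) (mb + ((real n)\<^sup>2 - mb) * (1/2) ^ k)" for k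
  proof (induction k)
    case 0
    then show ?case using moment_level by simp
  next
    case (Suc k)
    from moment_step[OF Suc] show ?case by (simp add: mb_def field_simps)
  qed
  show ?thesis unfolding moment_def
  proof (intro conjI ballI)
    show "0 \<le> mb" using early_const_nonneg by (simp add: mb_def)
    fix r z assume r: "r \<in> {t1<..T}" and z: "z \<in> {0..1::real}"
    have "(\<lambda>k. mb + ((real n)\<^sup>2 - mb) * (1/2) ^ k) \<longlonglongrightarrow> mb + ((real n)\<^sup>2 - mb) * 0"
      by (intro tendsto_intros LIMSEQ_power_zero) simp
    then have "(\<lambda>k. ennreal (mb + ((real n)\<^sup>2 - mb) * (1/2) ^ k)) \<longlonglongrightarrow> ennreal mb"
      by (intro tendsto_ennrealI) simp
    then show "(\<integral>\<^sup>+w. ennreal (kill (ereal (real n)) r w * (U r z w)\<^sup>2) \<partial>M) \<le> ennreal mb"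
      by (rule LIMSEQ_le_const) (use it r z in \<open>auto simp: moment_def\<close>)
  qed
qed

text \<open>Fatou along the levels n. On \<open>good\<close> the level n is eventually not hit;
  elsewhere the switch at level \<infinity> is 0 after t1.\<close>

lemma moment_infinity: "moment \<infinity> mb"
  unfolding moment_def
proof (intro conjI ballI)
  show "0 \<le> mb" using moment_uniform[of 0] by (simp add: moment_def)
  fix r z assume r: "r \<in> {t1<..T}" and z: "z \<in> {0..1::real}"
  have Um[measurable]: "U r z \<in> borel_measurable M" using r z times by (intro U_measurable_M) auto
  note [measurable] = kill_measurable
  have "(\<integral>\<^sup>+w. ennreal (kill \<infinity> r w * (U r z w)\<^sup>2) \<partial>M) \<le> (\<integral>\<^sup>+w. liminf (\<lambda>n. ennreal (kill (ereal (real n)) r w * (U r z w)\<^sup>2)) \<partial>M)"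
  proof (rule nn_integral_mono)
    fix w assume w: "w \<in> space M"
    show "ennreal (kill \<infinity> r w * (U r z w)\<^sup>2) \<le> liminf (\<lambda>n. ennreal (kill (ereal (real n)) r w * (U r z w)\<^sup>2))"
    proof (cases "w \<in> good")
      case True
      then obtain n0 where n0: "\<And>n. n0 \<le> n ==> kill (ereal (real n)) r w = 1" using kill_good[of w r] by blast
      have "\<forall>\<^sub>F n in sequentially. ennreal (kill \<infinity> r w * (U r z w)\<^sup>2) \<le> ennreal (kill (ereal (real n)) r w * (U r z w)\<^sup>2)"
        unfolding eventually_sequentially
        using kill_cases[of \<infinity> r w] n0 by (intro exI[of _ n0] allI impI ennreal_leI mult_right_mono) auto
      then show ?thesis by (rule Liminf_bounded)
    next
      case False
      then have "kill \<infinity> r w = 0" using kill_infinity[of r w] r w by simp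
      then show ?thesis by simp
    qed
  qed
  also have "\<dots> \<le> liminf (\<lambda>n. \<integral>\<^sup>+w. ennreal (kill (ereal (real n)) r w * (U r z w)\<^sup>2) \<partial>M)"
    by (rule nn_integral_liminf) measurable
  also have "\<dots> \<le> liminf (\<lambda>n::nat. ennreal mb)"
  proof (intro Liminf_mono always_eventually allI)
    fix n show "(\<integral>\<^sup>+w. ennreal (kill (ereal (real n)) r w * (U r z w)\<^sup>2) \<partial>M) \<le> ennreal mb"
      using moment_uniform[of n] r z unfolding moment_def by blast
  qed
  also have "\<dots> = ennreal mb" by (simp add: Liminf_const)
  finally show "(\<integral>\<^sup>+w. ennreal (kill \<infinity> r w * (U r z w)\<^sup>2) \<partial>M) \<le> ennreal mb" .
qed

section \<open>Cutting the solution at an intermediate time\<close>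

lemma drift_mass_finite:
  assumes s: "t1 < s" "s \<le> T" and y: "y \<in> {0..1}"
  shows "AE w in M. drift_mass \<infinity> s y 0 s w < \<infinity>"
proof -
  note [measurable] = measurable_drift_mass[OF y]
  have fin: "AE w in M. f w < \<infinity>" if fm: "f \<in> borel_measurable M" and f: "(\<integral>\<^sup>+w. (f w)\<^sup>2 \<partial>M) \<le> ennreal B" for f B
  proof -
    have [measurable]: "f \<in> borel_measurable M" by fact
    have "(\<integral>\<^sup>+w. (f w)\<^sup>2 \<partial>M) \<noteq> \<infinity>" using f by (auto simp: top_unique)
    then have "AE w in M. (f w)\<^sup>2 \<noteq> \<infinity>" by (intro nn_integral_PInf_AE) auto
    then show ?thesis by eventually_elim (auto simp: less_top power2_eq_square ennreal_mult_eq_top_iff)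
  qed
  have "AE w in M. drift_mass \<infinity> s y t0 t1 w < \<infinity>"
    using s window by (intro fin[OF _ drift_mass_square[OF y _ _ _ _ _ mid_b]]) auto
  moreover have "AE w in M. drift_mass \<infinity> s y t1 s w < \<infinity>"
    using s by (intro fin[OF _ drift_mass_late[OF moment_infinity _ _ _ y]]) auto
  ultimately show ?thesis using AE_space
  proof eventually_elim
    case (elim w)
    have "drift_mass \<infinity> s y 0 t0 w < \<infinity>"
      using drift_mass_early[OF s y elim(3)] by (rule le_less_trans) simp
    moreover have "drift_mass \<infinity> s y 0 s w = drift_mass \<infinity> s y 0 t0 w + (drift_mass \<infinity> s y t0 t1 w + drift_mass \<infinity> s y t1 s w)"
      using drift_mass_split[OF elim(3) y, of 0 t0 s] drift_mass_split[OF elim(3) y, of t0 t1 s] window s by simp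
    ultimately show ?case using elim by (simp add: less_top ennreal_add_eq_top)
  qed
qed

lemma measurable_drift_early:
  assumes t': "0 \<le> t'" "t' \<le> s" and y: "y \<in> {0..1}"
  shows "drift L s y 0 t' \<in> borel_measurable (F t')"
proof -
  let ?H = "weighted L bU s y"
  have "predictable t' ?H" by (rule predictable_weighted[OF predictable_b t'(2) y])
  then have "(\<lambda>(w, p). ?H (fst p) (snd p) w * indicator (strip t') p) \<in> borel_measurable (F t' \<Otimes>\<^sub>M lborel)"
    by (rule predictable_jointly_adapted) (use t' sets_F_mono in auto)
  then have "(\<lambda>w. LINT p|lborel. ?H (fst p) (snd p) w * indicator (strip t') p) \<in> borel_measurable (F t')"
    by (rule lborel.borel_measurable_lebesgue_integral)
  also have "(\<lambda>w. LINT p|lborel. ?H (fst p) (snd p) w * indicator (strip t') p) = drift L s y 0 t'"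
    unfolding drift_def using t' by (intro ext Bochner_Integration.integral_cong) (auto simp: seg_def strip_def indicator_def)
  finally show ?thesis .
qed

text \<open>Drift and noise are both cut at t'. The earlier parts are known at t', the noise because
  a mean square integral over (0,t'] is chosen measurable for F t'. The two pieces add up to I'
  almost surely by \<open>L2_walsh_bound\<close>, applied to integrands that coincide on
  (0,s].\<close>

lemma split_at:
  assumes c: "coefficient D c" and t': "t1 \<le> t'" "t' \<le> s" and s: "t1 < s" "s \<le> T" and y: "y \<in> {0..1}"
    and I': "L2_walsh s (weighted \<infinity> c s y) I'"
  shows "\<exists>Z I2. Z \<in> borel_measurable (F t') \<and> L2_walsh s (seg t' s (weighted \<infinity> c s y)) I2 \<and>
    (AE w in M. J0 s y + drift \<infinity> s y 0 s w + I' w = Z w + drift \<infinity> s y t' s w + I2 w)"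
proof -
  let ?H = "weighted \<infinity> c s y"
  have t0': "0 \<le> t'" using t' times by simp
  have pH: "predictable s ?H" by (rule predictable_weighted[OF coefficientD(2)[OF c s(2)] order_refl y])
  have fin: "sqnorm s ?H < \<infinity>"
    using sqnorm_weighted[OF c moment_infinity s y] by (rule le_less_trans) simp
  have mono: "sqnorm u G \<le> sqnorm s ?H" if "u \<le> s" "\<And>r z w. r \<le> u ==> (G r z w)\<^sup>2 \<le> (?H r z w)\<^sup>2" for u G
    unfolding sqnorm_def energy_def
  proof (intro nn_integral_mono)
    fix w and p :: "real \<times> real"
    show "ennreal ((G (fst p) (snd p) w)\<^sup>2) * indicator (strip u) p \<le> ennreal ((?H (fst p) (snd p) w)\<^sup>2) * indicator (strip s) p"
    proof (cases "p \<in> strip u")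
      case True
      then have "fst p \<le> u" "p \<in> strip s" using that(1) by (auto simp: strip_def)
      then show ?thesis using that(2) True by (simp add: ennreal_leI)
    qed simp
  qed
  have "sqnorm t' ?H < \<infinity>" by (rule le_less_trans[OF mono fin]) (use t' in auto)
  then obtain I1 where I1: "L2_walsh t' ?H I1"
    using L2_walsh_exists[OF t0' predictable_subinterval[OF pH t'(2)]] by blast
  have p2: "predictable s (seg t' s ?H)" by (rule predictable_seg[OF pH])
  have "sqnorm s (seg t' s ?H) < \<infinity>"
    by (rule le_less_trans[OF mono fin]) (auto simp: seg_def)
  then obtain I2 where I2: "L2_walsh s (seg t' s ?H) I2"
    using L2_walsh_exists[OF _ p2] s times by auto
  have I1': "L2_walsh s (seg 0 t' ?H) I1"
    by (rule L2_walsh_extend[OF I1 t'(2) predictable_seg[OF pH]]) (auto simp: seg_def)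
  have I12: "L2_walsh s (\<lambda>r z w. seg 0 t' ?H r z w + seg t' s ?H r z w) (\<lambda>w. I1 w + I2 w)"
    by (rule L2_walsh_add[OF I1' I2])
  have "msq M (\<lambda>w. I' w - (I1 w + I2 w)) \<le> 16 * sqnorm s (\<lambda>r z w. ?H r z w - (seg 0 t' ?H r z w + seg t' s ?H r z w))"
    by (rule L2_walsh_bound[OF I' I12])
  also have "sqnorm s (\<lambda>r z w. ?H r z w - (seg 0 t' ?H r z w + seg t' s ?H r z w)) = sqnorm s (\<lambda>r z w. 0)"
    by (rule sqnorm_cong) (use t' in \<open>auto simp: seg_def of_bool_def\<close>)
  also have "16 * sqnorm s (\<lambda>r z w. 0) = 0" by (simp add: sqnorm_def energy_def)
  finally have z: "msq M (\<lambda>w. I' w - (I1 w + I2 w)) = 0" by simp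
  have s0: "0 \<le> s" using s times by simp
  have [measurable]: "I' \<in> borel_measurable M" "I1 \<in> borel_measurable M" "I2 \<in> borel_measurable M"
    using I' I1 I2 unfolding L2_walsh_def by (auto intro: measurable_F[OF s0] measurable_F[OF t0'])
  have eq: "AE w in M. I' w = I1 w + I2 w"
    using z by (subst (asm) nn_integral_0_iff_AE) (auto elim!: eventually_mono)
  have I1F: "I1 \<in> borel_measurable (F t')" using I1 unfolding L2_walsh_def by blast
  define Z where "Z w = J0 s y + drift \<infinity> s y 0 t' w + I1 w" for w
  have Z: "Z \<in> borel_measurable (F t')"
    unfolding Z_def using I1F measurable_drift_early[OF t0' t'(2) y] by measurable
  have "AE w in M. J0 s y + drift \<infinity> s y 0 s w + I' w = Z w + drift \<infinity> s y t' s w + I2 w"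
    using eq drift_mass_finite[OF s y] AE_space
  proof eventually_elim
    case (elim w)
    let ?B = "weighted \<infinity> bU s y"
    have int: "integrable lborel (\<lambda>p. seg u v ?B (fst p) (snd p) w * indicator (strip s) p)" if "0 \<le> u" "v \<le> s" for u v
    proof (rule integrableI_bounded)
      have "predictable s (seg u v ?B)" by (intro predictable_seg predictable_weighted predictable_b y order_refl)
      from jointly_section[OF predictable_jointly[OF this] elim(3)]
      show "(\<lambda>p. seg u v ?B (fst p) (snd p) w * indicator (strip s) p) \<in> borel_measurable lborel" .
      have "(\<integral>\<^sup>+p. ennreal (norm (seg u v ?B (fst p) (snd p) w * indicator (strip s) p)) \<partial>lborel) \<le> drift_mass \<infinity> s y 0 s w"
        unfolding drift_mass_def
        by (intro nn_integral_mono) (use that in \<open>auto simp: seg_def indicator_def strip_def of_bool_def\<close>)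
      then show "(\<integral>\<^sup>+p. ennreal (norm (seg u v ?B (fst p) (snd p) w * indicator (strip s) p)) \<partial>lborel) < \<infinity>"
        using elim(2) by (rule le_less_trans)
    qed
    have "drift \<infinity> s y 0 t' w + drift \<infinity> s y t' s w = (LINT p|lborel. seg 0 t' ?B (fst p) (snd p) w * indicator (strip s) p + seg t' s ?B (fst p) (snd p) w * indicator (strip s) p)"
      unfolding drift_def using t0' t'(2) by (intro Bochner_Integration.integral_add[symmetric] int) auto
    also have "\<dots> = drift \<infinity> s y 0 s w"
      unfolding drift_def using t0' t'(2)
      by (intro Bochner_Integration.integral_cong) (auto simp: seg_def strip_def indicator_def of_bool_def)
    finally show ?case using elim(1) by (simp add: Z_def)
  qed
  then show ?thesis using Z I2 by blast
qed

end

section \<open>Freezing the integrand\<close>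

lemma ennreal_square_le_cancel:
  fixes a :: ennreal
  assumes "a\<^sup>2 \<le> (ennreal e)\<^sup>2" "0 \<le> e" shows "a \<le> ennreal e"
proof (cases a)
  case (real r)
  then have "ennreal (r\<^sup>2) \<le> ennreal (e\<^sup>2)" using assms by (simp add: ennreal_power)
  then have "r\<^sup>2 \<le> e\<^sup>2" using assms(2) by simp
  then have "r \<le> e" using assms(2) by (rule power2_le_imp_le)
  then show ?thesis using real by (simp add: ennreal_leI)
next
  case top
  then show ?thesis using assms by (simp add: power2_eq_square top_unique ennreal_mult_top flip: ennreal_mult)
qed

lemma integral_norm_bound_integral_AE:
  fixes f :: "'a => 'b::{banach, second_countable_topology}"
  assumes f: "integrable N f" and g: "integrable N g" and le: "AE x in N. norm (f x) \<le> g x"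
  shows "norm (LINT x|N. f x) \<le> (LINT x|N. g x)"
proof -
  have "norm (LINT x|N. f x) \<le> (LINT x|N. norm (f x))" by (rule integral_norm_bound)
  also have "\<dots> \<le> (LINT x|N. g x)" using f g le by (intro integral_mono_AE) auto
  finally show ?thesis .
qed

lemma norm_iexp_diff: "norm (iexp a - iexp b) \<le> \<bar>a - b\<bar>"
proof -
  have "iexp a - iexp b = iexp b * (iexp (a - b) - 1)"
  proof -
    have "iexp a = iexp b * iexp (a - b)" unfolding exp_add[symmetric] by (simp add: algebra_simps)
    then show ?thesis by (simp add: right_diff_distrib)
  qed
  then have "norm (iexp a - iexp b) = norm (iexp (a - b) - 1)" by (simp add: norm_mult)
  also have "\<dots> \<le> \<bar>a - b\<bar>" using iexp_approx1[of "a - b" 0] by simp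
  finally show ?thesis .
qed

context white_noise_space
begin

lemma simple_field_bounded:
  assumes "simple_field M F T hs"
  shows "\<exists>B. \<forall>w\<in>space M. \<bar>simple_value hs s y w\<bar> \<le> B"
  using assms
proof (induction hs)
  case Nil
  then show ?case by (intro exI[of _ 0]) simp
next
  case (Cons h hs)
  obtain a b A X where h: "h = (a, b, A, X)" by (rule prod_cases4)
  note hs = Cons.prems[unfolded h simple_field_Cons]
  have "simple_field M F T hs" using hs by blast
  from Cons.IH[OF this] obtain B where B: "\<forall>w\<in>space M. \<bar>simple_value hs s y w\<bar> \<le> B" ..
  have "bounded (X ` space M)" using hs by blast
  then obtain C where "\<forall>z\<in>X ` space M. norm z \<le> C" unfolding bounded_iff ..
  then have C: "\<bar>X w\<bar> \<le> C" if "w \<in> space M" for w using that by simp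
  have "\<bar>simple_value (h # hs) s y w\<bar> \<le> C + B" if w: "w \<in> space M" for w
  proof -
    have "\<bar>simple_value (h # hs) s y w\<bar> \<le> \<bar>X w * indicator {a<..b} s * indicator A y\<bar> + \<bar>simple_value hs s y w\<bar>"
      unfolding h simple_value_Cons by (rule abs_triangle_ineq)
    also have "\<bar>X w * indicator {a<..b} s * indicator A y\<bar> \<le> C"
      using C[OF w] abs_ge_zero[of "X w"] by (auto simp: abs_mult indicator_def simp del: abs_ge_zero)
    also have "\<bar>simple_value hs s y w\<bar> \<le> B" using B w by blast
    finally show ?thesis by simp
  qed
  then show ?case by blast
qed

lemma simple_value_measurable:
  assumes "simple_field M F T hs"
  shows "(\<lambda>w. simple_value hs s y w) \<in> borel_measurable M"
  unfolding simple_value_eq_sum using simple_coeff_props(1)[OF assms]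
  by (intro borel_measurable_sum borel_measurable_times borel_measurable_const) auto

text \<open>Simple fields demand coefficients that are bounded everywhere, a conditional expectation
  is bounded almost surely; clamping changes it on a null set only.\<close>

lemma bounded_cond_exp:
  fixes X :: "'a => real"
  assumes N: "subalgebra M N" and X: "X \<in> borel_measurable M" "bounded (X ` space M)"
  shows "\<exists>Y. Y \<in> borel_measurable N \<and> bounded (Y ` space M) \<and> (AE w in M. Y w = real_cond_exp M N X w)"
proof -
  interpret S: finite_measure_subalgebra M N by unfold_locales (rule N)
  obtain C where "\<forall>z\<in>X ` space M. norm z \<le> C" using X(2) unfolding bounded_iff ..
  then have C: "\<bar>X w\<bar> \<le> C" if "w \<in> space M" for w using that by simp
  have Xi: "integrable M X"
    by (rule integrable_const_bound[where B = C]) (use C X(1) in \<open>auto intro!: AE_I2\<close>)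
  define Y where "Y w = max (- \<bar>C\<bar>) (min \<bar>C\<bar> (real_cond_exp M N X w))" for w
  have "AE w in M. - \<bar>C\<bar> \<le> X w" "AE w in M. X w \<le> \<bar>C\<bar>"
    using C by (auto intro!: AE_I2 simp: abs_le_iff) (smt (verit) C)+
  from S.real_cond_exp_ge_c[OF Xi this(1)] S.real_cond_exp_le_c[OF Xi this(2)]
  have "AE w in M. Y w = real_cond_exp M N X w"
    by eventually_elim (simp add: Y_def)
  moreover have "bounded (Y ` space M)" unfolding bounded_iff
  proof (intro exI[of _ "\<bar>C\<bar>"] ballI)
    fix z assume "z \<in> Y ` space M"
    then obtain w where z: "z = Y w" by (rule imageE)
    show "norm z \<le> \<bar>C\<bar>" unfolding z Y_def by simp
  qed
  moreover have "Y \<in> borel_measurable N" unfolding Y_def by measurable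
  ultimately show ?thesis by blast
qed

text \<open>Done entry by entry: the coefficient is conditioned on F t', and the interval is moved
  to start no earlier than t', becoming empty if it ended before. The claim is made for each point
  (s, y) separately, with its own null set.\<close>

lemma simple_freeze:
  assumes "simple_field M F T hs" and t': "0 \<le> t'" "t' \<le> T"
  shows "\<exists>gs. simple_field M F T gs \<and>
    (\<forall>a b A X. (a, b, A, X) \<in> set gs \<longrightarrow> t' \<le> a \<and> A \<in> sets borel \<and> A \<subseteq> {0..1} \<and> X \<in> borel_measurable (F t')) \<and>
    (\<forall>s y. AE w in M. simple_value gs s y w = real_cond_exp M (F t') (seg t' T (simple_value hs) s y) w)"
  using assms(1)
proof (induction hs)
  case Nil
  interpret S: finite_measure_subalgebra M "F t'" by unfold_locales (rule subalg[OF t'(1)])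
  have z: "AE w in M. real_cond_exp M (F t') (\<lambda>w. 0) w = 0" by (rule S.real_cond_exp_F_meas) auto
  have "AE w in M. simple_value [] s y w = real_cond_exp M (F t') (seg t' T (simple_value []) s y) w" for s y
  proof -
    have "seg t' T (simple_value []) s y = (\<lambda>w::'a. 0)" by (simp add: seg_def fun_eq_iff)
    then show ?thesis using z by simp
  qed
  note nil = this
  show ?case
  proof (intro exI[of _ "[]"] conjI simple_field_Nil allI impI)
    fix s y show "AE w in M. simple_value [] s y w = real_cond_exp M (F t') (seg t' T (simple_value []) s y) w" by (rule nil)
  qed auto
next
  case (Cons h hs)
  interpret S: finite_measure_subalgebra M "F t'" by unfold_locales (rule subalg[OF t'(1)])
  obtain a b A X where h: "h = (a, b, A, X)" by (rule prod_cases4)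
  have ab: "0 \<le> a" "a \<le> b" "b \<le> T" and A: "A \<in> sets borel" "A \<subseteq> {0..1}"
    and X: "X \<in> borel_measurable (F a)" "bounded (X ` space M)" and hs: "simple_field M F T hs"
    using Cons.prems unfolding h simple_field_Cons by blast+
  have XM: "X \<in> borel_measurable M" by (rule measurable_F[OF ab(1) X(1)])
  from Cons.IH[OF hs] obtain gs where gs: "simple_field M F T gs"
    and late: "\<And>a b A X. (a, b, A, X) \<in> set gs ==> t' \<le> a \<and> A \<in> sets borel \<and> A \<subseteq> {0..1} \<and> X \<in> borel_measurable (F t')"
    and eq: "\<And>s y. AE w in M. simple_value gs s y w = real_cond_exp M (F t') (seg t' T (simple_value hs) s y) w"
    by blast
  from bounded_cond_exp[OF subalg[OF t'(1)] XM X(2)] obtain Y where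
    Y: "Y \<in> borel_measurable (F t')" "bounded (Y ` space M)" "AE w in M. Y w = real_cond_exp M (F t') X w" by blast
  let ?g = "(max a t', max b t', A, Y)"
  have Ya: "Y \<in> borel_measurable (F (max a t'))" by (rule measurable_F_mono[OF t'(1) _ Y(1)]) simp
  have "simple_field M F T (?g # gs)"
    unfolding simple_field_Cons using ab A Ya Y(2) gs t' by auto
  moreover have "t' \<le> a' \<and> A' \<in> sets borel \<and> A' \<subseteq> {0..1} \<and> X' \<in> borel_measurable (F t')"
    if "(a', b', A', X') \<in> set (?g # gs)" for a' b' A' X'
  proof -
    from that consider "(a', b', A', X') = ?g" | "(a', b', A', X') \<in> set gs" unfolding list.set by blast
    then show ?thesis
    proof cases
      case 1
      then show ?thesis using A Y(1) by simp
    next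
      case 2
      then show ?thesis by (rule late)
    qed
  qed
  moreover have "AE w in M. simple_value (?g # gs) s y w = real_cond_exp M (F t') (\<lambda>w. seg t' T (simple_value (h # hs)) s y w) w" for s y
  proof -
    \<comment> \<open>Within (t', T] the original interval and the shifted one select the same
      times.\<close>
    define k :: real where "k = of_bool (t' < s \<and> s \<le> T) * (indicator {a<..b} s * indicator A y)"
    have k: "k = indicator {max a t'<..max b t'} s * indicator A y"
      using ab t' unfolding k_def by (auto simp: indicator_def max_def)
    have seg: "seg t' T (simple_value (h # hs)) s y w = k * X w + seg t' T (simple_value hs) s y w" for w
      unfolding h seg_def simple_value_Cons k_def by (simp add: algebra_simps)
    have Xi: "integrable M X"
      using integrable_bounded_mult[OF XM X(2), of "\<lambda>_. 1"] by simp
    have Si: "integrable M (seg t' T (simple_value hs) s y)"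
    proof -
      from simple_field_bounded[OF hs] obtain B where "\<forall>w\<in>space M. \<bar>simple_value hs s y w\<bar> \<le> B" ..
      then have "integrable M (\<lambda>w. simple_value hs s y w)"
        by (intro integrable_const_bound[where B = B] simple_value_measurable[OF hs] AE_I2) simp
      then show ?thesis unfolding seg_def by (rule integrable_mult_right)
    qed
    from S.real_cond_exp_add[OF integrable_mult_right[OF Xi, of k] Si] S.real_cond_exp_cmult[OF Xi, of k] Y(3) eq[of s y]
    show ?thesis unfolding seg simple_value_Cons
      by eventually_elim (simp add: k mult_ac)
  qed
  ultimately show ?case by blast
qed

text \<open>A predictable integrand which varies little over \<open>(t', T]\<close> is replaced by one that is known
  at time \<open>t'\<close>; conditioning the coefficients of a simple approximation on \<open>F t'\<close> avoids any
  joint measurability question for the fields \<open>v\<close>.\<close>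

lemma frozen_approximation:
  assumes t': "0 \<le> t'" "t' \<le> T" and H: "predictable T H" "sqnorm T H < \<infinity>"
    and zero: "\<And>s y w. s \<le> t' ==> H s y w = 0"
    and v: "\<And>s y. t' < s ==> s \<le> T ==> y \<in> {0..1} ==>
      \<exists>v\<in>borel_measurable (F t'). (msq M (\<lambda>w. H s y w - v w)) \<le> \<beta> (s, y)"
    and \<beta>: "(\<lambda>p. \<beta> p * indicator ({t'<..T} \<times> {0..1}) p) \<in> borel_measurable lborel"
      "(\<integral>\<^sup>+p. \<beta> p * indicator ({t'<..T} \<times> {0..1}) p \<partial>lborel) \<le> ennreal \<kappa>"
    and \<kappa>: "0 < \<kappa>"
  shows "\<exists>gs. simple_field M F T gs \<and>
    (\<forall>a b A X. (a, b, A, X) \<in> set gs \<longrightarrow> t' \<le> a \<and> A \<in> sets borel \<and> A \<subseteq> {0..1} \<and> X \<in> borel_measurable (F t')) \<and>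
    sqnorm T (\<lambda>s y w. H s y w - simple_value gs s y w) \<le> ennreal (34 * \<kappa>)"
proof -
  have T: "0 \<le> T" using t' by simp
  from simple_dense[OF T H \<kappa>] obtain hs where hs: "simple_field M F T hs"
    and hsH: "sqnorm T (defect hs H) \<le> ennreal \<kappa>" by blast
  from simple_freeze[OF hs t'] obtain gs where gs: "simple_field M F T gs"
    and late: "\<forall>a b A X. (a, b, A, X) \<in> set gs \<longrightarrow> t' \<le> a \<and> A \<in> sets borel \<and> A \<subseteq> {0..1} \<and> X \<in> borel_measurable (F t')"
    and eq: "\<And>s y. AE w in M. simple_value gs s y w = real_cond_exp M (F t') (seg t' T (simple_value hs) s y) w"
    by blast
  let ?K = "seg t' T (simple_value hs)"
  have pK: "predictable T ?K" by (rule predictable_seg[OF predictable_simple[OF hs]])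
  note jK = predictable_jointly[OF pK] and jH = predictable_jointly[OF H(1)] and jg = jointly_simple[OF gs]
  have KH: "sqnorm T (\<lambda>s y w. ?K s y w - H s y w) \<le> ennreal \<kappa>"
  proof (rule order_trans[OF _ hsH])
    show "sqnorm T (\<lambda>s y w. ?K s y w - H s y w) \<le> sqnorm T (defect hs H)"
      unfolding sqnorm_def energy_def
    proof (intro nn_integral_mono)
      fix w and p :: "real \<times> real"
      show "ennreal ((?K (fst p) (snd p) w - H (fst p) (snd p) w)\<^sup>2) * indicator (strip T) p
        \<le> ennreal ((simple_value hs (fst p) (snd p) w - H (fst p) (snd p) w)\<^sup>2) * indicator (strip T) p"
      proof (cases "p \<in> strip T")
        case True
        then have "fst p \<le> T" by (auto simp: strip_def)
        then have "(?K (fst p) (snd p) w - H (fst p) (snd p) w)\<^sup>2 \<le> (simple_value hs (fst p) (snd p) w - H (fst p) (snd p) w)\<^sup>2"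
          using zero[of "fst p" "snd p" w] by (cases "t' < fst p") (simp_all add: seg_def)
        then show ?thesis by (intro mult_right_mono ennreal_leI) auto
      qed simp
    qed
  qed
  \<comment> \<open>By \<open>cond_exp_contraction\<close> with v inserted at each point separately;
    8 = 4 * 2, the 2 from the triangle inequality through H.\<close>
  have pt: "msq M (\<lambda>w. ?K s y w - simple_value gs s y w)
    \<le> 8 * msq M (\<lambda>w. ?K s y w - H s y w) + 8 * (\<beta> (s, y) * indicator ({t'<..T} \<times> {0..1}) (s, y))"
    if s: "0 < s" "s \<le> T" and y: "y \<in> {0..1}" for s y
  proof -
    have Km: "?K s y \<in> borel_measurable M" by (rule predictable_section[OF pK s y])
    have Hm: "H s y \<in> borel_measurable M" by (rule predictable_section[OF H(1) s y])
    have K2: "integrable M (\<lambda>w. (?K s y w)\<^sup>2)"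
    proof -
      from simple_field_bounded[OF hs] obtain B where B: "\<forall>w\<in>space M. \<bar>simple_value hs s y w\<bar> \<le> B" ..
      show ?thesis
      proof (rule integrable_const_bound[where B = "B\<^sup>2"])
        show "(\<lambda>w. (?K s y w)\<^sup>2) \<in> borel_measurable M" using Km by simp
        have "(?K s y w)\<^sup>2 \<le> B\<^sup>2" if "w \<in> space M" for w
          using B[rule_format, OF that] power_mono[of "\<bar>simple_value hs s y w\<bar>" B 2] by (simp add: seg_def of_bool_def)
        then show "AE w in M. norm ((?K s y w)\<^sup>2) \<le> B\<^sup>2" by (intro AE_I2) simp
      qed
    qed
    have "msq M (\<lambda>w. ?K s y w - simple_value gs s y w) = msq M (\<lambda>w. ?K s y w - real_cond_exp M (F t') (?K s y) w)"
      using eq[of s y] by (intro nn_integral_cong_AE) (auto elim!: eventually_mono)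
    also have "\<dots> \<le> 8 * msq M (\<lambda>w. ?K s y w - H s y w) + 8 * (\<beta> (s, y) * indicator ({t'<..T} \<times> {0..1}) (s, y))"
    proof (cases "t' < s")
      case True
      from v[OF True s(2) y] obtain g where g: "g \<in> borel_measurable (F t')" and wb: "msq M (\<lambda>w. H s y w - g w) \<le> \<beta> (s, y)" ..
      have "msq M (\<lambda>w. ?K s y w - real_cond_exp M (F t') (?K s y) w) \<le> 4 * msq M (\<lambda>w. ?K s y w - g w)"
        by (rule cond_exp_contraction[OF subalg[OF t'(1)] Km K2 g])
      also have "\<dots> \<le> 4 * (2 * msq M (\<lambda>w. ?K s y w - H s y w) + 2 * msq M (\<lambda>w. H s y w - g w))"
        by (intro mult_left_mono nn_integral_square_triangle Km Hm measurable_F[OF t'(1) g]) simp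
      also have "\<dots> \<le> 4 * (2 * msq M (\<lambda>w. ?K s y w - H s y w) + 2 * \<beta> (s, y))"
        using wb by (intro mult_left_mono add_left_mono) auto
      also have "\<dots> = 8 * msq M (\<lambda>w. ?K s y w - H s y w) + 8 * \<beta> (s, y)"
        by (simp add: distrib_left mult.assoc[symmetric])
      finally show ?thesis using True s y by simp
    next
      case False
      then have K0: "?K s y w = 0" for w by (simp add: seg_def)
      have "msq M (\<lambda>w. ?K s y w - real_cond_exp M (F t') (?K s y) w) \<le> 4 * msq M (\<lambda>w. ?K s y w - 0)"
        by (rule cond_exp_contraction[OF subalg[OF t'(1)] Km K2]) simp
      also have "\<dots> = 0" by (simp add: K0)
      finally have z: "msq M (\<lambda>w. ?K s y w - real_cond_exp M (F t') (?K s y) w) \<le> 0" .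
      show ?thesis by (rule order_trans[OF z]) simp
    qed
    finally show ?thesis .
  qed
  have Kg: "sqnorm T (\<lambda>s y w. ?K s y w - simple_value gs s y w) \<le> ennreal (16 * \<kappa>)"
  proof -
    have "sqnorm T (\<lambda>s y w. ?K s y w - simple_value gs s y w) = (\<integral>\<^sup>+p. (msq M (\<lambda>w. ?K (fst p) (snd p) w - simple_value gs (fst p) (snd p) w)) * indicator (strip T) p \<partial>lborel)"
      by (rule sqnorm_Fubini[OF jointly_diff[OF jK jg]])
    also have "\<dots> \<le> (\<integral>\<^sup>+p. 8 * (msq M (\<lambda>w. ?K (fst p) (snd p) w - H (fst p) (snd p) w) * indicator (strip T) p)
       + 8 * (\<beta> p * indicator ({t'<..T} \<times> {0..1}) p) \<partial>lborel)"
    proof (rule nn_integral_mono)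
      fix p :: "real \<times> real"
      obtain s y where p: "p = (s, y)" by (rule prod.exhaust)
      show "msq M (\<lambda>w. ?K (fst p) (snd p) w - simple_value gs (fst p) (snd p) w) * indicator (strip T) p
        \<le> 8 * (msq M (\<lambda>w. ?K (fst p) (snd p) w - H (fst p) (snd p) w) * indicator (strip T) p)
         + 8 * (\<beta> p * indicator ({t'<..T} \<times> {0..1}) p)"
      proof (cases "p \<in> strip T")
        case True
        then have "0 < s" "s \<le> T" "y \<in> {0..1}" by (simp_all add: p strip_def)
        from pt[OF this] show ?thesis using True by (simp add: p)
      qed simp
    qed
    also have "\<dots> = 8 * sqnorm T (\<lambda>s y w. ?K s y w - H s y w) + 8 * (\<integral>\<^sup>+p. \<beta> p * indicator ({t'<..T} \<times> {0..1}) p \<partial>lborel)"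
    proof -
      note m1 = measurable_slice_norm[OF jointly_diff[OF jK jH]]
      show ?thesis unfolding sqnorm_Fubini[OF jointly_diff[OF jK jH]]
        using m1 \<beta>(1) by (simp add: nn_integral_add nn_integral_cmult)
    qed
    also have "\<dots> \<le> 8 * ennreal \<kappa> + 8 * ennreal \<kappa>"
      using KH \<beta>(2) by (intro add_mono mult_left_mono) auto
    also have "\<dots> = ennreal (16 * \<kappa>)"
    proof -
      have "8 * ennreal \<kappa> + 8 * ennreal \<kappa> = 16 * ennreal \<kappa>" unfolding distrib_right[symmetric] by simp
      then show ?thesis using \<kappa> by (simp add: ennreal_mult')
    qed
    finally show ?thesis .
  qed
  \<comment> \<open>34 = 2 * 1 for the simple approximation plus 2 * 16 for the freezing.\<close>
  have "sqnorm T (\<lambda>s y w. H s y w - simple_value gs s y w) \<le> 2 * sqnorm T (\<lambda>s y w. H s y w - ?K s y w) + 2 * sqnorm T (\<lambda>s y w. ?K s y w - simple_value gs s y w)"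
    by (rule sqnorm_triangle[OF jH jK jg])
  also have "\<dots> \<le> 2 * ennreal \<kappa> + 2 * ennreal (16 * \<kappa>)"
    using KH Kg sqnorm_minus[of T H ?K] by (intro add_mono mult_left_mono) auto
  also have "\<dots> = ennreal (34 * \<kappa>)" using \<kappa> by (subst ennreal_twice_add) auto
  finally show ?thesis using gs late by blast
qed

text \<open>The freezing estimate turned into a bound for the characteristic function: conditionally on
  \<open>F t'\<close> the frozen integral is Gaussian.\<close>

lemma char_bound:
  assumes t': "0 \<le> t'" "t' \<le> T" and H: "predictable T H" "sqnorm T H < \<infinity>"
    and zero: "\<And>s y w. s \<le> t' ==> H s y w = 0"
    and v: "\<And>s y. t' < s ==> s \<le> T ==> y \<in> {0..1} ==>
      \<exists>v\<in>borel_measurable (F t'). (msq M (\<lambda>w. H s y w - v w)) \<le> \<beta> (s, y)"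
    and \<beta>: "(\<lambda>p. \<beta> p * indicator ({t'<..T} \<times> {0..1}) p) \<in> borel_measurable lborel"
      "(\<integral>\<^sup>+p. \<beta> p * indicator ({t'<..T} \<times> {0..1}) p \<partial>lborel) \<le> ennreal \<kappa>"
    and \<kappa>: "0 < \<kappa>"
    and Z: "Z \<in> borel_measurable (F t')" and A: "A \<in> sets (F t')"
    and I: "L2_walsh T H I"
    and lower: "\<And>w. w \<in> A ==> ennreal l \<le> energy T H w" and l: "0 < l"
    and D: "D \<in> borel_measurable M" "msq M D \<le> ennreal (d\<^sup>2)" and d: "0 \<le> d"
    and X: "X \<in> borel_measurable M" "AE w in M. X w = Z w + D w + I w"
  shows "norm (LINT w|M. complex_of_real (indicator A w) * iexp (\<xi> * X w)) \<le> exp (- (\<xi>\<^sup>2 * l / 8)) + 136 * \<kappa> / l + \<bar>\<xi>\<bar> * (d + sqrt (544 * \<kappa>))"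
proof -
  have T: "0 \<le> T" using t' by simp
  from frozen_approximation[OF t' H zero v \<beta> \<kappa>] obtain gs where gs: "simple_field M F T gs"
    and late: "\<And>a b A X. (a, b, A, X) \<in> set gs ==> t' \<le> a \<and> A \<in> sets borel \<and> A \<subseteq> {0..1} \<and> X \<in> borel_measurable (F t')"
    and close: "sqnorm T (\<lambda>s y w. H s y w - simple_value gs s y w) \<le> ennreal (34 * \<kappa>)" by blast
  define J where "J = simple_integral W gs"
  define q where "q w = (\<Sum>i<length gs. \<Sum>j<length gs. simple_coeff gs i w * simple_coeff gs j w * measure lborel (simple_rect gs i \<inter> simple_rect gs j))" for w
  define R where "R = energy T (\<lambda>s y w. H s y w - simple_value gs s y w)"
  have jD: "jointly T (\<lambda>s y w. H s y w - simple_value gs s y w)"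
    by (intro jointly_diff predictable_jointly H jointly_simple gs)
  have Im: "I \<in> borel_measurable M" using I unfolding L2_walsh_def by (blast intro: measurable_F[OF T])
  have AM: "A \<in> sets M" by (rule sets_F_sub[OF t'(1) A])
  note [measurable] = measurable_energy[OF jD, folded R_def] Im AM X(1) D(1)
    measurable_F[OF t'(1) Z] measurable_F[OF T measurable_simple_integral[OF gs T, folded J_def]] simple_coeff_props(1)[OF gs]
  have qm [measurable]: "q \<in> borel_measurable M" unfolding q_def by measurable
  have q: "energy T (simple_value gs) w = ennreal (q w)" for w unfolding q_def by (rule energy_simple(1)[OF gs])
  have q0: "0 \<le> q w" for w unfolding q_def by (rule energy_simple(2)[OF gs])
  \<comment> \<open>544 = 16 * 34, the norm bound of the integral times the freezing error.\<close>
  have IJ: "msq M (\<lambda>w. I w - J w) \<le> ennreal ((sqrt (544 * \<kappa>))\<^sup>2)"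
  proof -
    have "msq M (\<lambda>w. I w - J w) \<le> 16 * sqnorm T (\<lambda>s y w. H s y w - simple_value gs s y w)"
      unfolding J_def by (rule L2_walsh_bound[OF I L2_walsh_simple[OF T gs]])
    also have "\<dots> \<le> 16 * ennreal (34 * \<kappa>)" by (intro mult_left_mono close) simp
    also have "\<dots> = ennreal ((sqrt (544 * \<kappa>))\<^sup>2)" using \<kappa> by (simp add: ennreal_mult')
    finally show ?thesis .
  qed
  have V: "indicator A \<in> borel_measurable (F t')" "0 \<le> (indicator A w :: real) \<and> (indicator A w :: real) \<le> 1" for w
    using A by (auto simp: indicator_def)
  have main: "norm (LINT w|M. complex_of_real (indicator A w) * iexp (\<xi> * (Z w + J w))) \<le> exp (- (\<xi>\<^sup>2 * l / 8)) + 136 * \<kappa> / l"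
  proof -
    have "norm (LINT w|M. complex_of_real (indicator A w) * iexp (\<xi> * (Z w + J w))) \<le> (LINT w|M. indicator A w * exp (- (\<xi>\<^sup>2 * q w / 2)))"
      unfolding J_def q_def by (rule conditional_gaussian[OF t'(1) V Z]) (rule late)
    also have "\<dots> \<le> (LINT w|M. exp (- (\<xi>\<^sup>2 * l / 8)) + indicator {w \<in> space M. ennreal (l / 4) < R w} w)"
    proof (rule integral_mono)
      show "integrable M (\<lambda>w. indicator A w * exp (- (\<xi>\<^sup>2 * q w / 2)))"
      proof (rule integrable_const_bound[where B = 1])
        show "AE w in M. norm (indicator A w * exp (- (\<xi>\<^sup>2 * q w / 2))) \<le> 1"
          using q0 by (intro AE_I2) (simp add: indicator_def)
      qed measurable
      show "integrable M (\<lambda>w. exp (- (\<xi>\<^sup>2 * l / 8)) + indicator {w \<in> space M. ennreal (l / 4) < R w} w)"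
        by (rule integrable_const_bound[where B = "exp (- (\<xi>\<^sup>2 * l / 8)) + 1"]) (auto intro!: AE_I2 simp: indicator_def)
      fix w assume w: "w \<in> space M"
      show "indicator A w * exp (- (\<xi>\<^sup>2 * q w / 2)) \<le> exp (- (\<xi>\<^sup>2 * l / 8)) + indicator {w \<in> space M. ennreal (l / 4) < R w} w"
      proof (cases "w \<in> A \<and> R w \<le> ennreal (l / 4)")
        case True
        have "ennreal l \<le> energy T H w" using lower True by blast
        also have "energy T H w = energy T (\<lambda>s y w. (H s y w - simple_value gs s y w) + simple_value gs s y w) w" by simp
        also have "\<dots> \<le> 2 * R w + 2 * energy T (simple_value gs) w"
          unfolding R_def by (rule energy_add[OF jD jointly_simple[OF gs] w])
        also have "\<dots> \<le> 2 * ennreal (l / 4) + 2 * ennreal (max 0 (q w))"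
          unfolding q using True by (intro add_mono mult_left_mono ennreal_leI) auto
        also have "\<dots> = ennreal (l / 2 + 2 * max 0 (q w))" using l by (subst ennreal_twice_add) auto
        finally have "l \<le> l / 2 + 2 * max 0 (q w)" using l by (subst (asm) ennreal_le_iff) auto
        then have "l / 4 \<le> q w" using l by (auto simp: max_def split: if_splits)
        then have "\<xi>\<^sup>2 * (l / 4) \<le> \<xi>\<^sup>2 * q w" by (intro mult_left_mono) auto
        then have e: "exp (- (\<xi>\<^sup>2 * q w / 2)) \<le> exp (- (\<xi>\<^sup>2 * l / 8))" by (simp add: mult.commute)
        have A1: "indicator A w = (1::real)" using True by simp
        show ?thesis unfolding A1 mult_1_left by (rule add_increasing2[OF _ e]) simp
      next
        case False
        note q0[of w]
        with False show ?thesis using w by (auto simp: indicator_def not_le intro: add_increasing)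
      qed
    qed
    also have "\<dots> = exp (- (\<xi>\<^sup>2 * l / 8)) + measure M {w \<in> space M. ennreal (l / 4) < R w}"
      by (subst Bochner_Integration.integral_add) (auto simp: prob_space less_top[symmetric] intro!: integrable_real_indicator)
    also have "measure M {w \<in> space M. ennreal (l / 4) < R w} \<le> 136 * \<kappa> / l"
    proof -
      have "emeasure M {w \<in> space M. ennreal (l / 4) < R w} = (\<integral>\<^sup>+w. indicator {w \<in> space M. ennreal (l / 4) < R w} w \<partial>M)" by simp
      also have "\<dots> \<le> (\<integral>\<^sup>+w. ennreal (4 / l) * R w \<partial>M)"
      proof (rule nn_integral_mono)
        fix w
        have "1 \<le> ennreal (4 / l) * R w" if "ennreal (l / 4) < R w"
        proof -
          have "1 = ennreal (4 / l) * ennreal (l / 4)" using l by (simp flip: ennreal_mult)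
          also have "\<dots> \<le> ennreal (4 / l) * R w" using that by (intro mult_left_mono) auto
          finally show ?thesis .
        qed
        then show "indicator {w \<in> space M. ennreal (l / 4) < R w} w \<le> ennreal (4 / l) * R w" by (simp add: indicator_def)
      qed
      also have "\<dots> = ennreal (4 / l) * sqnorm T (\<lambda>s y w. H s y w - simple_value gs s y w)"
        unfolding sqnorm_def R_def[symmetric] by (rule nn_integral_cmult) measurable
      also have "\<dots> \<le> ennreal (4 / l) * ennreal (34 * \<kappa>)" by (intro mult_left_mono close) simp
      also have "\<dots> = ennreal (136 * \<kappa> / l)" using \<kappa> l by (simp flip: ennreal_mult)
      finally show ?thesis using \<kappa> l by (simp add: emeasure_eq_measure)
    qed
    finally show ?thesis by simp
  qed
  \<comment> \<open>Cauchy-Schwarz on a probability space.\<close>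
  have mean: "integrable M Y \<and> (LINT w|M. \<bar>Y w\<bar>) \<le> e"
    if Y[measurable]: "Y \<in> borel_measurable M" and Y2: "msq M Y \<le> ennreal (e\<^sup>2)" and e: "0 \<le> e" for Y :: "'a => real" and e
  proof -
    have "(\<integral>\<^sup>+w. ennreal \<bar>Y w\<bar> * 1 \<partial>M)\<^sup>2 \<le> (\<integral>\<^sup>+w. (ennreal \<bar>Y w\<bar>)\<^sup>2 \<partial>M) * (\<integral>\<^sup>+w. 1\<^sup>2 \<partial>M)"
      by (rule Cauchy_Schwarz_nn_integral) measurable
    also have "\<dots> \<le> (ennreal e)\<^sup>2" using Y2 e by (simp add: ennreal_power emeasure_space_1)
    finally have *: "(\<integral>\<^sup>+w. ennreal (norm (Y w)) \<partial>M) \<le> ennreal e"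
      using e by (intro ennreal_square_le_cancel) simp_all
    then have i: "integrable M Y" by (intro integrableI_bounded) (auto intro: le_less_trans)
    then have "ennreal (LINT w|M. \<bar>Y w\<bar>) \<le> ennreal e" using * by (subst nn_integral_eq_integral[symmetric]) auto
    then show ?thesis using i e by simp
  qed
  note mD = mean[OF D d] and mI = mean[OF _ IJ]
  let ?f = "\<lambda>w. complex_of_real (indicator A w) * iexp (\<xi> * X w)" and ?g = "\<lambda>w. complex_of_real (indicator A w) * iexp (\<xi> * (Z w + J w))"
  have i1: "integrable M ?f" "integrable M ?g"
    by (intro integrable_const_bound[where B = 1] AE_I2, simp add: indicator_def norm_mult, measurable)+
  have mIJ: "integrable M (\<lambda>w. I w - J w)" "(LINT w|M. \<bar>I w - J w\<bar>) \<le> sqrt (544 * \<kappa>)"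
    using mI \<kappa> by simp_all
  have "norm (LINT w|M. ?f w - ?g w) \<le> (LINT w|M. \<bar>\<xi>\<bar> * (\<bar>D w\<bar> + \<bar>I w - J w\<bar>))"
  proof (rule integral_norm_bound_integral_AE)
    show "integrable M (\<lambda>w. ?f w - ?g w)" by (rule Bochner_Integration.integrable_diff[OF i1])
    show "integrable M (\<lambda>w. \<bar>\<xi>\<bar> * (\<bar>D w\<bar> + \<bar>I w - J w\<bar>))"
      using mD mIJ by (intro integrable_mult_right Bochner_Integration.integrable_add integrable_abs) blast+
    show "AE w in M. norm (?f w - ?g w) \<le> \<bar>\<xi>\<bar> * (\<bar>D w\<bar> + \<bar>I w - J w\<bar>)"
      using X(2)
    proof eventually_elim
      case (elim w)
      have "norm (?f w - ?g w) \<le> norm (iexp (\<xi> * X w) - iexp (\<xi> * (Z w + J w)))"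
        by (simp add: indicator_def)
      also have "\<dots> \<le> \<bar>\<xi> * X w - \<xi> * (Z w + J w)\<bar>" by (rule norm_iexp_diff)
      also have "\<xi> * X w - \<xi> * (Z w + J w) = \<xi> * (D w + (I w - J w))" unfolding elim by (simp add: algebra_simps)
      also have "\<bar>\<dots>\<bar> \<le> \<bar>\<xi>\<bar> * (\<bar>D w\<bar> + \<bar>I w - J w\<bar>)" unfolding abs_mult by (intro mult_left_mono abs_triangle_ineq) simp
      finally show ?case .
    qed
  qed
  also have "\<dots> = \<bar>\<xi>\<bar> * ((LINT w|M. \<bar>D w\<bar>) + (LINT w|M. \<bar>I w - J w\<bar>))"
  proof -
    have "integrable M (\<lambda>w. \<bar>D w\<bar>)" "integrable M (\<lambda>w. \<bar>I w - J w\<bar>)"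
      using mD mIJ by (intro integrable_abs; blast)+
    then show ?thesis by simp
  qed
  also have "\<dots> \<le> \<bar>\<xi>\<bar> * (d + sqrt (544 * \<kappa>))" using mD mIJ by (intro mult_left_mono add_mono) auto
  finally have "norm ((LINT w|M. ?f w) - (LINT w|M. ?g w)) \<le> \<bar>\<xi>\<bar> * (d + sqrt (544 * \<kappa>))"
    by (simp only: Bochner_Integration.integral_diff[OF i1])
  moreover have "norm (LINT w|M. ?f w) \<le> norm (LINT w|M. ?g w) + norm ((LINT w|M. ?f w) - (LINT w|M. ?g w))"
    by (rule norm_triangle_sub)
  moreover have "norm (LINT w|M. ?g w) \<le> exp (- (\<xi>\<^sup>2 * l / 8)) + 136 * \<kappa> / l"
    using main by simp
  ultimately show ?thesis by linarith
qed

end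

section \<open>Decay of the characteristic function\<close>

lemma nn_integral_powr_tail:
  fixes \<kappa> R :: real
  assumes \<kappa>: "0 < \<kappa>" and R: "0 < R"
  shows "(\<integral>\<^sup>+\<xi>. ennreal (\<xi> powr (- \<kappa> - 1)) * indicator {R..} \<xi> \<partial>lborel) < \<infinity>"
proof -
  let ?F = "\<lambda>\<xi>. - (\<xi> powr - \<kappa>) / \<kappa>"
  have "(?F \<longlongrightarrow> - 0 / \<kappa>) at_top"
    by (intro tendsto_intros tendsto_neg_powr filterlim_ident) (use \<kappa> in auto)
  then have lim: "(?F \<longlongrightarrow> 0) at_top" by simp
  have "(\<integral>\<^sup>+\<xi>. ennreal (\<xi> powr (- \<kappa> - 1)) * indicator {R..} \<xi> \<partial>lborel) = ennreal (0 - ?F R)"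
  proof (rule nn_integral_FTC_atLeast[OF _ _ _ lim])
    fix \<xi> assume "R \<le> \<xi>"
    then have "0 < \<xi>" using R by simp
    then show "DERIV ?F \<xi> :> \<xi> powr (- \<kappa> - 1)"
      using \<kappa> by (auto intro!: derivative_eq_intros simp: field_simps)
  qed auto
  then show ?thesis by simp
qed

text \<open>From v \<le> exp v at v = u / n, raised to the power n.\<close>

lemma exp_minus_le_power:
  fixes u :: real
  assumes u: "0 < u" and n: "0 < n"
  shows "exp (- u) \<le> (real n / u) ^ n"
proof -
  have "(u / real n) ^ n \<le> exp (u / real n) ^ n"
  proof (rule power_mono)
    show "u / real n \<le> exp (u / real n)" using exp_ge_add_one_self[of "u / real n"] by linarith
  qed (use u in simp)
  also have "\<dots> = exp u" using n by (simp flip: exp_of_nat_mult)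
  finally have "inverse (exp u) \<le> inverse ((u / real n) ^ n)" using u n by (intro le_imp_inverse_le) auto
  then show ?thesis by (simp add: exp_minus power_inverse[symmetric])
qed

text \<open>The choice is \<eta> = |\<xi>|^(-2+\<kappa>) with \<kappa> = (\<theta> - 1/2) / 2. The
  exponential term then decays faster than every power. The last term has exponent -\<theta> +
  \<kappa> (1 + \<theta>) / 2 \<le> -\<theta> + \<kappa> = -(1/2 + \<kappa>), and the middle one is
  smaller; so f has order |\<xi>|^(-p) with p > 1/2 exactly because \<theta> > 1/2.\<close>

lemma square_integrable_of_decay:
  fixes f :: "real => real"
  assumes \<theta>: "1 / 2 < \<theta>" "\<theta> \<le> 1" and c: "0 < c" "0 \<le> C" "0 < \<eta>0"
    and f0: "\<And>\<xi>. 0 \<le> f \<xi>" and f1: "\<And>\<xi>. f \<xi> \<le> 1"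
    and bound: "\<And>\<xi> \<eta>. 0 < \<eta> ==> \<eta> \<le> \<eta>0 ==>
      f \<xi> \<le> exp (- (c * \<xi>\<^sup>2 * \<eta>)) + C * \<eta> powr \<theta> + C * \<bar>\<xi>\<bar> * \<eta> powr ((1 + \<theta>) / 2)"
  shows "msq lborel f < \<infinity>"
proof -
  define \<kappa> where "\<kappa> = (\<theta> - 1 / 2) / 2"
  define p where "p = 1 / 2 + \<kappa>"
  \<comment> \<open>The exponential exp(-c |\<xi>|^\<kappa>) is traded for the power
    |\<xi>|^(-\<kappa> n), and \<kappa> n \<ge> p.\<close>
  define n where "n = nat \<lceil>p / \<kappa>\<rceil>"
  define A where "A = (real n / c) ^ n + 2 * C"
  \<comment> \<open>The exponent of \<eta> is negative, so large |\<xi>| makes \<eta> \<le>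
    \<eta>0.\<close>
  define R where "R = max 1 (\<eta>0 powr (1 / (- 2 + \<kappa>)))"
  have \<kappa>: "0 < \<kappa>" "\<kappa> \<le> 1 / 4" "\<theta> = 1 / 2 + 2 * \<kappa>" using \<theta> unfolding \<kappa>_def by (auto simp: field_simps)
  have p: "0 < p" unfolding p_def using \<kappa> by simp
  have n: "0 < n" "p \<le> \<kappa> * real n"
  proof -
    have pk: "p / \<kappa> \<le> real n" unfolding n_def using p \<kappa> by (simp add: real_nat_ceiling_ge)
    then show "p \<le> \<kappa> * real n" using \<kappa> by (simp add: field_simps)
    have "0 < p / \<kappa>" using p \<kappa> by simp
    then show "0 < n" using pk by (cases n) auto
  qed
  have R1: "1 \<le> R" unfolding R_def by simp
  have decay: "f \<xi> \<le> A * \<bar>\<xi>\<bar> powr (- p)" if \<xi>: "R \<le> \<bar>\<xi>\<bar>" for \<xi>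
  proof -
    let ?z = "\<bar>\<xi>\<bar>" and ?\<eta> = "\<bar>\<xi>\<bar> powr (- 2 + \<kappa>)"
    have z: "1 \<le> ?z" using \<xi> R1 by simp
    then have z0: "0 < ?z" by linarith
    have \<eta>: "0 < ?\<eta>" using z0 by simp
    have "?\<eta> \<le> (\<eta>0 powr (1 / (- 2 + \<kappa>))) powr (- 2 + \<kappa>)"
      using \<xi> \<kappa> c(3) unfolding R_def by (intro powr_mono2') auto
    also have "\<dots> = \<eta>0" using \<kappa> c(3) by (simp add: powr_powr)
    finally have \<eta>le: "?\<eta> \<le> \<eta>0" .
    have z2: "\<xi>\<^sup>2 = ?z powr 2" using z0 by (simp add: powr_numeral)
    have "\<xi>\<^sup>2 * ?\<eta> = ?z powr (2 + (- 2 + \<kappa>))" unfolding z2 by (simp only: powr_add)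
    then have e1: "\<xi>\<^sup>2 * ?\<eta> = ?z powr \<kappa>" by (simp only: add_uminus_conv_diff add.assoc[symmetric]) simp
    have "exp (- (c * \<xi>\<^sup>2 * ?\<eta>)) = exp (- (c * ?z powr \<kappa>))" by (simp only: mult.assoc e1)
    also have "\<dots> \<le> (real n / (c * ?z powr \<kappa>)) ^ n"
      using c z0 n by (intro exp_minus_le_power) auto
    also have "\<dots> = (real n / c) ^ n * (?z powr \<kappa>) powr (- real n)"
    proof -
      have "real n / (c * ?z powr \<kappa>) = real n / c * inverse (?z powr \<kappa>)" by (simp add: field_simps)
      then have "(real n / (c * ?z powr \<kappa>)) ^ n = (real n / c) ^ n * inverse (?z powr \<kappa>) ^ n" by (simp only: power_mult_distrib)
      also have "inverse (?z powr \<kappa>) ^ n = (?z powr \<kappa>) powr (- real n)"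
        using z0 by (simp only: powr_minus powr_realpow powr_gt_zero power_inverse)
      finally show ?thesis .
    qed
    also have "\<dots> \<le> (real n / c) ^ n * ?z powr (- p)"
      using z n c by (intro mult_left_mono) (auto simp: powr_powr intro!: powr_mono)
    finally have b1: "exp (- (c * \<xi>\<^sup>2 * ?\<eta>)) \<le> (real n / c) ^ n * ?z powr (- p)" .
    have "(- 2 + \<kappa>) * \<theta> \<le> - p"
    proof -
      have "\<kappa> * \<theta> \<le> \<kappa> * 1" using \<kappa>(1) \<theta> by (intro mult_left_mono) auto
      moreover have "(- 2 + \<kappa>) * \<theta> = \<kappa> * \<theta> - 2 * \<theta>" by (simp add: field_simps)
      ultimately show ?thesis unfolding p_def using \<kappa> by linarith
    qed
    then have "?\<eta> powr \<theta> \<le> ?z powr (- p)" unfolding powr_powr using z by (intro powr_mono) auto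
    then have b2: "C * ?\<eta> powr \<theta> \<le> C * ?z powr (- p)" using c by (intro mult_left_mono) auto
    have ex: "1 + (- 2 + \<kappa>) * ((1 + \<theta>) / 2) \<le> - p"
    proof -
      have "\<kappa> * ((1 + \<theta>) / 2) \<le> \<kappa> * 1" using \<kappa>(1) \<theta> by (intro mult_left_mono) auto
      moreover have "(- 2 + \<kappa>) * ((1 + \<theta>) / 2) = \<kappa> * ((1 + \<theta>) / 2) - (1 + \<theta>)" by (simp add: field_simps)
      ultimately show ?thesis unfolding p_def using \<kappa> by linarith
    qed
    have "?z * ?\<eta> powr ((1 + \<theta>) / 2) = ?z powr (1 + (- 2 + \<kappa>) * ((1 + \<theta>) / 2))"
      by (simp only: powr_powr powr_add[of _ 1] powr_one abs_ge_zero)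
    also have "\<dots> \<le> ?z powr (- p)" using z ex by (intro powr_mono) auto
    finally have b3: "C * (?z * ?\<eta> powr ((1 + \<theta>) / 2)) \<le> C * ?z powr (- p)" using c by (intro mult_left_mono) auto
    have "f \<xi> \<le> exp (- (c * \<xi>\<^sup>2 * ?\<eta>)) + C * ?\<eta> powr \<theta> + C * ?z * ?\<eta> powr ((1 + \<theta>) / 2)"
      by (rule bound[OF \<eta> \<eta>le])
    also have "\<dots> \<le> (real n / c) ^ n * ?z powr (- p) + C * ?z powr (- p) + C * ?z powr (- p)"
      using b1 b2 b3 by (intro add_mono) (auto simp: mult.assoc)
    finally show ?thesis unfolding A_def by (simp add: algebra_simps)
  qed
  \<comment> \<open>The exponent is -2 p = -1 - 2 \<kappa>; the negative half line is reached by
    reflection.\<close>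
  let ?g = "\<lambda>\<xi>::real. ennreal (\<xi> powr (- (2 * \<kappa>) - 1)) * indicator {R..} \<xi>"
  have gm [measurable]: "?g \<in> borel_measurable borel" by measurable
  have "msq lborel f \<le> (\<integral>\<^sup>+\<xi>. indicator {- R..R} \<xi> + ennreal (A\<^sup>2) * (?g \<xi> + ?g (- \<xi>)) \<partial>lborel)"
  proof (rule nn_integral_mono)
    fix \<xi> :: real
    show "ennreal ((f \<xi>)\<^sup>2) \<le> indicator {- R..R} \<xi> + ennreal (A\<^sup>2) * (?g \<xi> + ?g (- \<xi>))"
    proof (cases "\<bar>\<xi>\<bar> \<le> R")
      case True
      have "(f \<xi>)\<^sup>2 \<le> 1" using f0[of \<xi>] f1[of \<xi>] by (simp add: power_le_one)
      then have "ennreal ((f \<xi>)\<^sup>2) \<le> 1" by simp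
      then show ?thesis using True by (auto simp: abs_le_iff intro: add_increasing2)
    next
      case False
      then have "(f \<xi>)\<^sup>2 \<le> (A * \<bar>\<xi>\<bar> powr (- p))\<^sup>2" using f0[of \<xi>] decay[of \<xi>] by (intro power_mono) auto
      also have "\<dots> = A\<^sup>2 * \<bar>\<xi>\<bar> powr (- (2 * \<kappa>) - 1)"
      proof -
        have "(\<bar>\<xi>\<bar> powr (- p))\<^sup>2 = \<bar>\<xi>\<bar> powr (- (2 * \<kappa>) - 1)"
          unfolding power2_eq_square powr_add[symmetric] by (rule arg_cong) (simp add: p_def)
        then show ?thesis by (simp only: power_mult_distrib)
      qed
      finally have 1: "ennreal ((f \<xi>)\<^sup>2) \<le> ennreal (A\<^sup>2) * ennreal (\<bar>\<xi>\<bar> powr (- (2 * \<kappa>) - 1))"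
        by (simp add: ennreal_leI flip: ennreal_mult)
      have "ennreal (\<bar>\<xi>\<bar> powr (- (2 * \<kappa>) - 1)) \<le> ?g \<xi> + ?g (- \<xi>)"
        using False R1 by (auto simp: abs_if indicator_def)
      then have "ennreal (A\<^sup>2) * ennreal (\<bar>\<xi>\<bar> powr (- (2 * \<kappa>) - 1)) \<le> ennreal (A\<^sup>2) * (?g \<xi> + ?g (- \<xi>))"
        by (rule mult_left_mono) simp
      with 1 have "ennreal ((f \<xi>)\<^sup>2) \<le> ennreal (A\<^sup>2) * (?g \<xi> + ?g (- \<xi>))" by (rule order_trans)
      then show ?thesis by (rule add_increasing[OF zero_le])
    qed
  qed
  also have "\<dots> = (\<integral>\<^sup>+\<xi>. indicator {- R..R} \<xi> \<partial>lborel) + ennreal (A\<^sup>2) * ((\<integral>\<^sup>+\<xi>. ?g \<xi> \<partial>lborel) + (\<integral>\<^sup>+\<xi>. ?g (- \<xi>) \<partial>lborel))"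
    by (simp add: nn_integral_add nn_integral_cmult)
  also have "(\<integral>\<^sup>+\<xi>. ?g (- \<xi>) \<partial>lborel) = (\<integral>\<^sup>+\<xi>. ?g \<xi> \<partial>lborel)"
    using nn_integral_real_affine[OF gm, of "- 1" 0] by simp
  also have "(\<integral>\<^sup>+\<xi>. indicator {- R..R} \<xi> \<partial>lborel) + ennreal (A\<^sup>2) * ((\<integral>\<^sup>+\<xi>. ?g \<xi> \<partial>lborel) + (\<integral>\<^sup>+\<xi>. ?g \<xi> \<partial>lborel)) < \<infinity>"
    using nn_integral_powr_tail[of "2 * \<kappa>" R] \<kappa> R1 by (simp add: ennreal_mult_less_top emeasure_lborel_Icc_eq)
  finally show ?thesis .
qed

context spde_estimates
begin

section \<open>Mean square distance of the solution from its past\<close>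

lemma measurable_drift:
  assumes y: "y \<in> {0..1}"
  shows "drift L s y a a' \<in> borel_measurable M"
proof -
  have "predictable s (seg a a' (weighted L bU s y))"
    by (intro predictable_seg predictable_weighted predictable_b y order_refl)
  from lborel.borel_measurable_lebesgue_integral[OF predictable_jointly[OF this, unfolded jointly_def]]
  show ?thesis unfolding drift_def .
qed

lemma mb_nonneg: "0 \<le> mb"
  using moment_infinity by (simp add: moment_def)

lemma drift_late_square:
  assumes s: "t1 \<le> a" "a \<le> s" "s \<le> T" and y: "y \<in> {0..1}"
  shows "msq M (\<lambda>w. drift \<infinity> s y a s w) \<le> ennreal (CK * sqrt (s - a) * (2 * CG\<^sup>2 * (1 + mb) * (s - a)))"
proof (rule order_trans[OF _ drift_mass_late[OF moment_infinity s y]])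
  show "msq M (\<lambda>w. drift \<infinity> s y a s w) \<le> (\<integral>\<^sup>+w. (drift_mass \<infinity> s y a s w)\<^sup>2 \<partial>M)"
  proof (rule nn_integral_mono)
    fix w
    have "ennreal ((drift \<infinity> s y a s w)\<^sup>2) = (ennreal \<bar>drift \<infinity> s y a s w\<bar>)\<^sup>2" by (simp add: ennreal_power)
    also have "\<dots> \<le> (drift_mass \<infinity> s y a s w)\<^sup>2" by (intro power_mono drift_le_mass) simp
    finally show "ennreal ((drift \<infinity> s y a s w)\<^sup>2) \<le> (drift_mass \<infinity> s y a s w)\<^sup>2" .
  qed
qed

definition CV :: real where
  "CV = 2 * (CK * T * (2 * CG\<^sup>2 * (1 + mb))) + 2 * (16 * (2 * CG\<^sup>2 * (1 + mb) * CK))"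

lemma CV_nonneg: "0 \<le> CV"
  unfolding CV_def using CK(1) times mb_nonneg by (intro add_nonneg_nonneg mult_nonneg_nonneg) auto

text \<open>The comparison variable is not U(t', y) but the part of the equation at (s, y) that is
  determined at t'. The remainder is drift and noise over (t', s], both bounded through the uniform
  second moment.\<close>

lemma frozen_solution:
  assumes t': "t1 \<le> t'" and s: "t' < s" "s \<le> T" and y: "y \<in> {0..1}"
  shows "\<exists>V\<in>borel_measurable (F t'). (\<integral>\<^sup>+w. ennreal (indicator good w * (U s y w - V w)\<^sup>2) \<partial>M) \<le> ennreal (CV * sqrt (s - t'))"
proof -
  have s1: "t1 < s" using t' s by simp
  have t0': "0 \<le> t'" using t' times by simp
  obtain I' where I': "L2_walsh s (weighted \<infinity> \<sigma>U s y) I'"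
    by (rule coefficient_walsh[OF coefficient_\<sigma> moment_infinity s1 s(2) y])
  from split_at[OF coefficient_\<sigma> t' less_imp_le[OF s(1)] s1 s(2) y I'] obtain Z I2
    where Z: "Z \<in> borel_measurable (F t')" and I2: "L2_walsh s (seg t' s (weighted \<infinity> \<sigma>U s y)) I2"
      and eq: "AE w in M. J0 s y + drift \<infinity> s y 0 s w + I' w = Z w + drift \<infinity> s y t' s w + I2 w"
    by blast
  have [measurable]: "I2 \<in> borel_measurable M"
    using I2 s1 times unfolding L2_walsh_def by (intro measurable_F[of s]) auto
  note [measurable] = measurable_drift[OF y]
  let ?B = "2 * CG\<^sup>2 * (1 + mb)"
  have B: "0 \<le> ?B" using mb_nonneg by simp
  have "(\<integral>\<^sup>+w. ennreal (indicator good w * (U s y w - Z w)\<^sup>2) \<partial>M) \<le> msq M (\<lambda>w. drift \<infinity> s y t' s w + I2 w)"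
  proof (rule nn_integral_mono_AE)
    show "AE w in M. ennreal (indicator good w * (U s y w - Z w)\<^sup>2) \<le> ennreal ((drift \<infinity> s y t' s w + I2 w)\<^sup>2)"
      using eq representation[OF s1 s(2) y I'] AE_space
    proof eventually_elim
      case (elim w)
      show ?case
      proof (cases "w \<in> good")
        case True
        then have "kill \<infinity> s w = 1" using kill_infinity[OF s1 elim(3)] by simp
        then have "U s y w - Z w = drift \<infinity> s y t' s w + I2 w" using elim(1,2) by simp
        then show ?thesis by (simp add: indicator_def)
      qed simp
    qed
  qed
  also have "\<dots> \<le> 2 * msq M (\<lambda>w. drift \<infinity> s y t' s w) + 2 * msq M I2"
    by (rule nn_integral_square_add) measurable
  also have "\<dots> \<le> 2 * ennreal (CK * T * ?B * sqrt (s - t')) + 2 * (16 * ennreal (?B * CK * sqrt (s - t')))"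
  proof (intro add_mono mult_left_mono)
    have "CK * sqrt (s - t') * (?B * (s - t')) \<le> CK * sqrt (s - t') * (?B * T)"
      using CK(1) B s t0' by (intro mult_left_mono) auto
    then have "CK * sqrt (s - t') * (?B * (s - t')) \<le> CK * T * ?B * sqrt (s - t')" by (simp only: mult_ac)
    then show "msq M (\<lambda>w. drift \<infinity> s y t' s w) \<le> ennreal (CK * T * ?B * sqrt (s - t'))"
      by (intro order_trans[OF drift_late_square[OF t' less_imp_le[OF s(1)] s(2) y]] ennreal_leI)
    have "msq M I2 \<le> 16 * sqnorm s (seg t' s (weighted \<infinity> \<sigma>U s y))"
      by (rule L2_walsh_bound0[OF I2])
    also have "\<dots> \<le> 16 * ennreal (?B * CK * sqrt (s - t'))"
    proof (intro mult_left_mono sqnorm_seg_weighted[OF coefficientD(2)[OF coefficient_\<sigma> s(2)] y s(2) t0' less_imp_le[OF s(1)] B])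
      fix r z :: real assume r: "t' < r" "r \<le> s" and z: "z \<in> {0..1}"
      show "(\<integral>\<^sup>+w. ennreal (kill \<infinity> r w * (\<sigma> (U r z w))\<^sup>2) \<partial>M) \<le> ennreal ?B"
        using r t' s growth by (intro moment_growth[OF moment_infinity _ _ z]) auto
    qed simp
    finally show "msq M I2 \<le> 16 * ennreal (?B * CK * sqrt (s - t'))" .
  qed auto
  also have "\<dots> = ennreal (CV * sqrt (s - t'))"
  proof -
    have n: "0 \<le> CK * T * ?B * sqrt (s - t')" "0 \<le> ?B * CK * sqrt (s - t')" using CK(1) times B s by auto
    have num: "2 * ennreal u + 2 * (16 * ennreal w) = ennreal (2 * u + 2 * (16 * w))" if "0 \<le> u" "0 \<le> w" for u w
      using ennreal_twice_add[of u "16 * w"] that by (simp add: ennreal_mult')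
    have "2 * (CK * T * ?B * sqrt (s - t')) + 2 * (16 * (?B * CK * sqrt (s - t'))) = CV * sqrt (s - t')"
      unfolding CV_def by (simp only: distrib_right mult.assoc)
    then show ?thesis unfolding num[OF n] by (rule arg_cong)
  qed
  finally show ?thesis using Z by blast
qed

end

text \<open>A pointwise substitute for Jensen's inequality with exponent \<theta>: if a has the size
  of the mean of d^2, the right side has mean of order a^\<theta>. With q = d^2 / a it reduces to
  q^\<theta> \<le> 1 + q.\<close>

lemma powr_square_le:
  fixes d :: real
  assumes \<theta>: "0 < \<theta>" "\<theta> \<le> 1" and a: "0 < a"
  shows "(\<bar>d\<bar> powr \<theta>)\<^sup>2 \<le> a powr \<theta> * (1 + d\<^sup>2 / a)"
proof -
  let ?q = "d\<^sup>2 / a"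
  have q: "0 \<le> ?q" using a by simp
  have "(\<bar>d\<bar> * \<bar>d\<bar>) powr \<theta> = \<bar>d\<bar> powr \<theta> * \<bar>d\<bar> powr \<theta>" by (rule powr_mult)
  moreover have "\<bar>d\<bar> * \<bar>d\<bar> = d\<^sup>2" by (simp add: power2_eq_square)
  ultimately have "(\<bar>d\<bar> powr \<theta>)\<^sup>2 = (d\<^sup>2) powr \<theta>" by (simp add: power2_eq_square[of "\<bar>d\<bar> powr \<theta>"])
  also have "d\<^sup>2 = a * ?q" using a by simp
  also have "(a * ?q) powr \<theta> = a powr \<theta> * ?q powr \<theta>" by (rule powr_mult)
  finally have eq: "(\<bar>d\<bar> powr \<theta>)\<^sup>2 = a powr \<theta> * ?q powr \<theta>" .
  have "?q powr \<theta> \<le> 1 + ?q"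
  proof (cases "?q \<le> 1")
    case True
    then have "?q powr \<theta> \<le> 1" using q \<theta> by (intro powr_le1) auto
    then show ?thesis using q by linarith
  next
    case False
    then have "?q powr \<theta> \<le> ?q powr 1" using \<theta> by (intro powr_mono) auto
    then show ?thesis using q by simp
  qed
  then show ?thesis unfolding eq by (rule mult_left_mono) simp
qed

text \<open>\<open>sg\<close> is the sign of \<sigma>(U) near (T, x); the two signs are treated one
  at a time.\<close>

locale spde_nondegenerate = spde_estimates M F W \<sigma> b U I J0 \<theta> CH CG t0 t1 K T CK CU BJ
  for M :: "'a measure" and F W \<sigma> b U I J0 \<theta> CH CG t0 t1 K T CK CU BJ +
  fixes x \<delta> \<rho> sg :: real
  assumes x: "x \<in> {0..1}" and \<delta>: "0 < \<delta>" and \<rho>: "0 < \<rho>" and sg: "sg = 1 \<or> sg = -1"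
begin

text \<open>After t1 and near x the coefficient is kept at distance \<delta> from 0. Taking the
  maximum with a constant is 1-Lipschitz, so the Hoelder bound of \<sigma> survives with the same
  constant, and nothing changes where \<open>sg\<close> times \<sigma> is at least \<delta>.\<close>

definition elliptic :: "real => real => real => real" where
  "elliptic r z u = (if t1 < r \<and> \<bar>z - x\<bar> \<le> \<rho> then sg * max (sg * \<sigma> u) \<delta> else \<sigma> u)"

lemma elliptic_holder: "\<bar>elliptic r z u - elliptic r z v\<bar> \<le> CH * \<bar>u - v\<bar> powr \<theta>"
proof (rule order_trans[OF _ holder(2)])
  show "\<bar>elliptic r z u - elliptic r z v\<bar> \<le> \<bar>\<sigma> u - \<sigma> v\<bar>"
    using sg unfolding elliptic_def max_def by auto
qed

lemma elliptic_lower: "t1 < r ==> \<bar>z - x\<bar> \<le> \<rho> ==> \<delta> \<le> \<bar>elliptic r z u\<bar>"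
  using sg unfolding elliptic_def max_def by auto

lemma elliptic_measurable [measurable]: "elliptic r z \<in> borel_measurable borel"
  unfolding elliptic_def by measurable

lemma coefficient_elliptic: "coefficient (CG + \<delta>) (\<lambda>r z w. elliptic r z (U r z w))"
  unfolding coefficient_def
proof (intro conjI allI impI)
  show "CG \<le> CG + \<delta>" using \<delta> by simp
  fix r z w
  show "r \<le> t1 ==> elliptic r z (U r z w) = \<sigma> (U r z w)" by (simp add: elliptic_def)
  have "\<bar>elliptic r z (U r z w)\<bar> \<le> \<bar>\<sigma> (U r z w)\<bar> + \<delta>"
    using sg \<delta> unfolding elliptic_def max_def by auto
  also have "\<dots> \<le> CG * (1 + \<bar>U r z w\<bar>) + \<delta> * (1 + \<bar>U r z w\<bar>)"
    using growth(2) \<delta> by (intro add_mono) auto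
  finally show "\<bar>elliptic r z (U r z w)\<bar> \<le> (CG + \<delta>) * (1 + \<bar>U r z w\<bar>)" by (simp add: distrib_right)
next
  let ?i = "\<lambda>r z. of_bool (t1 < r \<and> \<bar>z - x\<bar> \<le> \<rho>) :: real"
  have "predictable T (\<lambda>r z w. ?i r z)"
  proof (rule predictable_deterministic)
    have 1: "(\<lambda>p. ?i (fst p) (snd p)) \<in> borel_measurable (borel :: (real \<times> real) measure)"
      unfolding borel_prod[symmetric] by measurable
    have [measurable]: "{..T} \<times> {0..1::real} \<in> sets borel" by (intro borel_Times) auto
    show "(\<lambda>p. ?i (fst p) (snd p) * indicator ({..T} \<times> {0..1}) p) \<in> borel_measurable borel" using 1 by measurable
  qed
  moreover have "predictable T (\<lambda>r z w. sg * max (sg * \<sigma> (U r z w)) \<delta> - \<sigma> (U r z w))"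
    by (rule predictable_compose[OF predictable_U, where g = "\<lambda>u. sg * max (sg * \<sigma> u) \<delta> - \<sigma> u"]) measurable
  ultimately have 1: "predictable T (\<lambda>r z w. ?i r z * (sg * max (sg * \<sigma> (U r z w)) \<delta> - \<sigma> (U r z w)))"
    by (rule predictable_mult)
  have "(\<lambda>q. (case q of (r, z, w) => ?i r z * (sg * max (sg * \<sigma> (U r z w)) \<delta> - \<sigma> (U r z w))) + (case q of (r, z, w) => \<sigma> (U r z w)))
    \<in> borel_measurable (predictable_sigma M F T)"
    by (rule borel_measurable_add[OF 1 predictable_compose[OF predictable_U \<sigma>_measurable]])
  also have "(\<lambda>q. (case q of (r, z, w) => ?i r z * (sg * max (sg * \<sigma> (U r z w)) \<delta> - \<sigma> (U r z w))) + (case q of (r, z, w) => \<sigma> (U r z w)))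
    = (\<lambda>(r, z, w). elliptic r z (U r z w))"
    by (simp add: fun_eq_iff elliptic_def)
  finally show "predictable T (\<lambda>r z w. elliptic r z (U r z w))" .
qed

abbreviation (input) field where "field \<equiv> weighted \<infinity> (\<lambda>r z w. elliptic r z (U r z w)) T x"

definition e0 :: real where "e0 = exp (- 1 / 2) / (2 * pi)"

lemma e0_pos: "0 < e0" unfolding e0_def by simp

text \<open>On \<open>good\<close> the switch stays on up to T, so the integrand is at least
  \<delta> times the kernel in absolute value on the region covered by
  \<open>kernel_square_integral_lower\<close>.\<close>

lemma energy_lower:
  assumes \<epsilon>: "0 < \<epsilon>" "\<epsilon> \<le> 1 / 4" "\<epsilon> \<le> \<rho>\<^sup>2" "t1 \<le> T - \<epsilon>" and w: "w \<in> good"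
  shows "ennreal (\<delta>\<^sup>2 * (e0 * sqrt \<epsilon>)) \<le> energy T (seg (T - \<epsilon>) T field) w"
proof -
  have wM: "w \<in> space M" using w by (simp add: good_def)
  let ?R = "{T - \<epsilon><..T} \<times> ({0..1} \<inter> {x - \<rho>..x + \<rho>})"
  have "ennreal (\<delta>\<^sup>2 * (e0 * sqrt \<epsilon>)) = ennreal (\<delta>\<^sup>2) * ennreal (e0 * sqrt \<epsilon>)"
    using e0_pos \<epsilon> by (simp add: ennreal_mult)
  also have "\<dots> \<le> ennreal (\<delta>\<^sup>2) * (\<integral>\<^sup>+p. ennreal ((neumann_kernel (T - fst p) x (snd p))\<^sup>2) * indicator ?R p \<partial>lborel)"
    unfolding e0_def by (intro mult_left_mono kernel_square_integral_lower x \<epsilon> \<rho>) simp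
  also have "\<dots> = (\<integral>\<^sup>+p. ennreal (\<delta>\<^sup>2) * (ennreal ((neumann_kernel (T - fst p) x (snd p))\<^sup>2) * indicator ?R p) \<partial>lborel)"
  proof (rule nn_integral_cmult[symmetric])
    have R: "?R \<in> sets borel" by (intro borel_Times) auto
    have "(\<lambda>p. ennreal ((neumann_kernel (T - fst p) x (snd p))\<^sup>2) * indicator ({T - \<epsilon><..T} \<times> {0..1}) p * indicator ?R p) \<in> borel_measurable lborel"
      using measurable_kernel_square[OF x order_refl[of T], of "T - \<epsilon>"] R by measurable
    also have "(\<lambda>p. ennreal ((neumann_kernel (T - fst p) x (snd p))\<^sup>2) * indicator ({T - \<epsilon><..T} \<times> {0..1}) p * indicator ?R p)
      = (\<lambda>p. ennreal ((neumann_kernel (T - fst p) x (snd p))\<^sup>2) * indicator ?R p)"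
      by (auto simp: fun_eq_iff indicator_def)
    finally show "(\<lambda>p. ennreal ((neumann_kernel (T - fst p) x (snd p))\<^sup>2) * indicator ?R p) \<in> borel_measurable lborel" .
  qed
  also have "\<dots> \<le> energy T (seg (T - \<epsilon>) T field) w"
    unfolding energy_def
  proof (rule nn_integral_mono)
    fix p :: "real \<times> real"
    obtain r z where p: "p = (r, z)" by (rule prod.exhaust)
    show "ennreal (\<delta>\<^sup>2) * (ennreal ((neumann_kernel (T - fst p) x (snd p))\<^sup>2) * indicator ?R p)
      \<le> ennreal ((seg (T - \<epsilon>) T field (fst p) (snd p) w)\<^sup>2) * indicator (strip T) p"
    proof (cases "p \<in> ?R")
      case True
      then have r: "T - \<epsilon> < r" "r \<le> T" and z: "z \<in> {0..1}" "\<bar>z - x\<bar> \<le> \<rho>" by (auto simp: p)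
      have r1: "t1 < r" using r \<epsilon> by simp
      then have r0: "0 < r" using times by simp
      have "kill \<infinity> r w = 1" using kill_infinity[OF r1 wM] w by simp
      then have eq: "seg (T - \<epsilon>) T field r z w = neumann_kernel (T - r) x z * elliptic r z (U r z w)"
        using r by (simp add: seg_def weighted_def)
      have "\<delta>\<^sup>2 \<le> (elliptic r z (U r z w))\<^sup>2"
        using power_mono[OF elliptic_lower[OF r1 z(2)], of 2] \<delta> by simp
      then have "\<delta>\<^sup>2 * (neumann_kernel (T - r) x z)\<^sup>2 \<le> (seg (T - \<epsilon>) T field r z w)\<^sup>2"
        unfolding eq power_mult_distrib by (subst mult.commute) (intro mult_left_mono, auto)
      then have "ennreal (\<delta>\<^sup>2) * ennreal ((neumann_kernel (T - r) x z)\<^sup>2) \<le> ennreal ((seg (T - \<epsilon>) T field r z w)\<^sup>2)"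
        by (simp add: ennreal_leI flip: ennreal_mult)
      moreover have "p \<in> strip T" using r r0 z by (simp add: p strip_def)
      ultimately show ?thesis using True by (simp add: p)
    qed simp
  qed
  finally show ?thesis .
qed

text \<open>U is frozen inside the coefficient, and Hoelder continuity turns the mean square error
  sqrt (T - t') into its power \<theta>. The indicator of \<open>good\<close> may be part of v,
  since it is known at t1 \<le> t'.\<close>

lemma frozen_field:
  assumes t': "t1 \<le> t'" and s: "t' < s" "s \<le> T" and y: "y \<in> {0..1}"
  shows "\<exists>v\<in>borel_measurable (F t'). (msq M (\<lambda>w. seg t' T field s y w - v w))
    \<le> ennreal ((neumann_kernel (T - s) x y)\<^sup>2) * ennreal (CH\<^sup>2 * (1 + CV) * (sqrt (T - t')) powr \<theta>)"
proof -
  let ?G = "neumann_kernel (T - s) x y" and ?a = "sqrt (T - t')"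
  have a: "0 < ?a" using s by simp
  have s1: "t1 < s" using t' s by simp
  have t0': "0 \<le> t'" using t' times by simp
  from frozen_solution[OF t' s y] obtain V where V: "V \<in> borel_measurable (F t')"
    and VU: "(\<integral>\<^sup>+w. ennreal (indicator good w * (U s y w - V w)\<^sup>2) \<partial>M) \<le> ennreal (CV * sqrt (s - t'))" ..
  define v where "v w = indicator good w * (?G * elliptic s y (V w))" for w
  have good': "good \<in> sets (F t')" using good_sets sets_F_mono[of t1 t'] t' times by auto
  have goodM: "good \<in> sets M" by (rule sets_F_sub[OF t0' good'])
  have vm: "v \<in> borel_measurable (F t')" unfolding v_def using good' V by measurable
  have [measurable]: "U s y \<in> borel_measurable M" using s t0' by (intro U_measurable_M y) auto
  note [measurable] = measurable_F[OF t0' V] goodM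
  have "msq M (\<lambda>w. seg t' T field s y w - v w)
    \<le> (\<integral>\<^sup>+w. ennreal (?G\<^sup>2 * CH\<^sup>2 * ?a powr \<theta>) * (1 + ennreal (1 / ?a) * ennreal (indicator good w * (U s y w - V w)\<^sup>2)) \<partial>M)"
  proof (rule nn_integral_mono)
    fix w assume w: "w \<in> space M"
    have k: "kill \<infinity> s w = indicator good w" by (rule kill_infinity[OF s1 w])
    have "(seg t' T field s y w - v w)\<^sup>2 \<le> ?G\<^sup>2 * CH\<^sup>2 * ?a powr \<theta> * (1 + 1 / ?a * (indicator good w * (U s y w - V w)\<^sup>2))"
    proof (cases "w \<in> good")
      case True
      have "seg t' T field s y w - v w = ?G * (elliptic s y (U s y w) - elliptic s y (V w))"
        using True s by (simp add: seg_def weighted_def v_def k right_diff_distrib)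
      then have "(seg t' T field s y w - v w)\<^sup>2 = ?G\<^sup>2 * \<bar>elliptic s y (U s y w) - elliptic s y (V w)\<bar>\<^sup>2"
        by (simp add: power_mult_distrib)
      also have "\<dots> \<le> ?G\<^sup>2 * (CH * \<bar>U s y w - V w\<bar> powr \<theta>)\<^sup>2"
        by (intro mult_left_mono power_mono elliptic_holder) auto
      also have "\<dots> = ?G\<^sup>2 * CH\<^sup>2 * (\<bar>U s y w - V w\<bar> powr \<theta>)\<^sup>2" by (simp add: power_mult_distrib)
      also have "\<dots> \<le> ?G\<^sup>2 * CH\<^sup>2 * (?a powr \<theta> * (1 + (U s y w - V w)\<^sup>2 / ?a))"
        using \<theta> by (intro mult_left_mono powr_square_le a) auto
      finally show ?thesis using True by (simp add: mult.assoc)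
    next
      case False
      then have "seg t' T field s y w - v w = 0" by (simp add: seg_def weighted_def v_def k)
      then show ?thesis using False by simp
    qed
    then have "ennreal ((seg t' T field s y w - v w)\<^sup>2) \<le> ennreal (?G\<^sup>2 * CH\<^sup>2 * ?a powr \<theta> * (1 + 1 / ?a * (indicator good w * (U s y w - V w)\<^sup>2)))"
      by (rule ennreal_leI)
    also have "\<dots> = ennreal (?G\<^sup>2 * CH\<^sup>2 * ?a powr \<theta>) * ennreal (1 + 1 / ?a * (indicator good w * (U s y w - V w)\<^sup>2))"
      by (rule ennreal_mult) (use a in \<open>auto intro!: add_nonneg_nonneg\<close>)
    also have "ennreal (1 + 1 / ?a * (indicator good w * (U s y w - V w)\<^sup>2)) = 1 + ennreal (1 / ?a) * ennreal (indicator good w * (U s y w - V w)\<^sup>2)"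
      using a by (subst ennreal_plus) (auto simp flip: ennreal_mult)
    finally show "ennreal ((seg t' T field s y w - v w)\<^sup>2) \<le> ennreal (?G\<^sup>2 * CH\<^sup>2 * ?a powr \<theta>) * (1 + ennreal (1 / ?a) * ennreal (indicator good w * (U s y w - V w)\<^sup>2))" .
  qed
  also have "\<dots> = ennreal (?G\<^sup>2 * CH\<^sup>2 * ?a powr \<theta>) * (1 + ennreal (1 / ?a) * (\<integral>\<^sup>+w. ennreal (indicator good w * (U s y w - V w)\<^sup>2) \<partial>M))"
    by (simp add: nn_integral_cmult nn_integral_add emeasure_space_1)
  also have "\<dots> \<le> ennreal (?G\<^sup>2 * CH\<^sup>2 * ?a powr \<theta>) * (1 + ennreal (1 / ?a) * ennreal (CV * ?a))"
  proof (intro mult_left_mono add_left_mono order_trans[OF VU] ennreal_leI)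
    show "sqrt (s - t') \<le> ?a" using s by simp
  qed (use CV_nonneg in auto)
  also have "ennreal (1 / ?a) * ennreal (CV * ?a) = ennreal CV" using a CV_nonneg by (simp flip: ennreal_mult)
  also have "1 + ennreal CV = ennreal (1 + CV)" using CV_nonneg by simp
  also have "ennreal (?G\<^sup>2 * CH\<^sup>2 * ?a powr \<theta>) * ennreal (1 + CV) = ennreal (?G\<^sup>2) * ennreal (CH\<^sup>2 * (1 + CV) * ?a powr \<theta>)"
  proof -
    have "ennreal (?G\<^sup>2 * CH\<^sup>2 * ?a powr \<theta>) * ennreal (1 + CV) = ennreal ((?G\<^sup>2 * CH\<^sup>2 * ?a powr \<theta>) * (1 + CV))"
      using CV_nonneg by (intro ennreal_mult[symmetric]) auto
    also have "(?G\<^sup>2 * CH\<^sup>2 * ?a powr \<theta>) * (1 + CV) = ?G\<^sup>2 * (CH\<^sup>2 * (1 + CV) * ?a powr \<theta>)" by (simp only: mult_ac)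
    also have "ennreal \<dots> = ennreal (?G\<^sup>2) * ennreal (CH\<^sup>2 * (1 + CV) * ?a powr \<theta>)"
      using CV_nonneg by (intro ennreal_mult) auto
    finally show ?thesis .
  qed
  finally show ?thesis using vm by blast
qed

lemma char_decay:
  assumes IX: "L2_walsh T field IX"
  shows "\<exists>C c \<eta>0. 0 < c \<and> 0 \<le> C \<and> 0 < \<eta>0 \<and> (\<forall>\<xi> \<eta>. 0 < \<eta> \<and> \<eta> \<le> \<eta>0 \<longrightarrow>
    norm (LINT w|M. complex_of_real (indicator good w) * iexp (\<xi> * (J0 T x + drift \<infinity> T x 0 T w + IX w)))
      \<le> exp (- (c * \<xi>\<^sup>2 * \<eta>)) + C * \<eta> powr \<theta> + C * \<bar>\<xi>\<bar> * \<eta> powr ((1 + \<theta>) / 2))"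
proof -
  let ?B = "2 * CG\<^sup>2 * (1 + mb)" and ?N = "CH\<^sup>2 * (1 + CV)"
  define C1 where "C1 = 136 * (?N * CK) / (\<delta>\<^sup>2 * e0)"
  define C2 where "C2 = sqrt (CK * ?B) + sqrt (544 * (?N * CK))"
  \<comment> \<open>The three bounds give \<epsilon> \<le> 1/4, \<epsilon> \<le> \<rho>^2 and t' = T
    - \<epsilon> \<ge> t1.\<close>
  define \<eta>0 where "\<eta>0 = min (1 / 2) (min \<rho> (sqrt (T - t1)))"
  have B: "0 \<le> ?B" using mb_nonneg by simp
  have N: "0 < ?N" using holder(1) CV_nonneg by simp
  have C1: "0 \<le> C1" unfolding C1_def using N CK(1) \<delta> e0_pos by simp
  have C2: "0 \<le> C2" unfolding C2_def using N CK(1) B by simp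
  have \<eta>0: "0 < \<eta>0" unfolding \<eta>0_def using \<rho> t1T by simp
  let ?X = "\<lambda>w. J0 T x + drift \<infinity> T x 0 T w + IX w"
  have Xm: "?X \<in> borel_measurable M"
  proof -
    have [measurable]: "IX \<in> borel_measurable M" using IX times unfolding L2_walsh_def by (intro measurable_F[of T]) auto
    note [measurable] = measurable_drift[OF x]
    show ?thesis by measurable
  qed
  have pf: "predictable T field" by (rule predictable_weighted[OF coefficientD(2)[OF coefficient_elliptic order_refl] order_refl x])
  have "norm (LINT w|M. complex_of_real (indicator good w) * iexp (\<xi> * ?X w))
      \<le> exp (- (\<delta>\<^sup>2 * e0 / 8 * \<xi>\<^sup>2 * \<eta>)) + (C1 + C2) * \<eta> powr \<theta> + (C1 + C2) * \<bar>\<xi>\<bar> * \<eta> powr ((1 + \<theta>) / 2)"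
    if \<eta>: "0 < \<eta>" "\<eta> \<le> \<eta>0" for \<xi> \<eta>
  proof -
    have \<eta>1: "\<eta> \<le> 1 / 2" "\<eta> \<le> \<rho>" "\<eta> \<le> sqrt (T - t1)" using \<eta>(2) unfolding \<eta>0_def by auto
    define \<epsilon> where "\<epsilon> = \<eta>\<^sup>2"
    define t' where "t' = T - \<epsilon>"
    have \<epsilon>: "0 < \<epsilon>" "\<epsilon> \<le> 1 / 4" "\<epsilon> \<le> \<rho>\<^sup>2"
      using \<eta> power_mono[OF \<eta>1(1), of 2] power_mono[OF \<eta>1(2), of 2] unfolding \<epsilon>_def by (auto simp: power2_eq_square)
    have s\<epsilon>: "sqrt \<epsilon> = \<eta>" using \<eta> by (simp add: \<epsilon>_def)
    have "\<epsilon> \<le> T - t1" using power_mono[OF \<eta>1(3), of 2] \<eta> t1T by (simp add: \<epsilon>_def)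
    then have t1': "t1 \<le> t'" by (simp add: t'_def)
    then have t': "0 \<le> t'" "t' \<le> T" "t' < T" using times \<epsilon> by (auto simp: t'_def)
    have Tt: "sqrt (T - t') = \<eta>" by (simp add: t'_def s\<epsilon>)
    from split_at[OF coefficient_elliptic t1' t'(2) t1T order_refl x IX] obtain Z I2
      where Z: "Z \<in> borel_measurable (F t')" and I2: "L2_walsh T (seg t' T field) I2"
        and eq: "AE w in M. ?X w = Z w + drift \<infinity> T x t' T w + I2 w" by blast
    define \<beta> where "\<beta> p = ennreal ((neumann_kernel (T - fst p) x (snd p))\<^sup>2) * ennreal (?N * \<eta> powr \<theta>)" for p :: "real \<times> real"
    define \<kappa> where "\<kappa> = ?N * CK * (\<eta> powr \<theta> * \<eta>)"
    define d where "d = sqrt (CK * ?B) * \<eta> powr (3 / 2)"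
    have \<kappa>: "0 < \<kappa>" unfolding \<kappa>_def using N CK(1) \<eta> by simp
    have fin: "sqnorm T (seg t' T field) < \<infinity>"
    proof -
      have D: "0 \<le> CG + \<delta>" using growth \<delta> by simp
      have "sqnorm T (seg t' T field) \<le> ennreal (2 * (CG + \<delta>)\<^sup>2 * (1 + mb) * CK * sqrt (T - t'))"
      proof (rule sqnorm_seg_weighted[OF coefficientD(2)[OF coefficient_elliptic order_refl] x order_refl t'(1,2)])
        show "0 \<le> 2 * (CG + \<delta>)\<^sup>2 * (1 + mb)" using mb_nonneg by simp
        fix r z :: real assume r: "t' < r" "r \<le> T" and z: "z \<in> {0..1}"
        show "(\<integral>\<^sup>+w. ennreal (kill \<infinity> r w * (elliptic r z (U r z w))\<^sup>2) \<partial>M) \<le> ennreal (2 * (CG + \<delta>)\<^sup>2 * (1 + mb))"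
          using r t1' by (intro moment_growth[OF moment_infinity _ _ z D] coefficientD(3)[OF coefficient_elliptic]) auto
      qed
      then show ?thesis by (rule le_less_trans) simp
    qed
    have \<beta>m: "(\<lambda>p. \<beta> p * indicator ({t'<..T} \<times> {0..1}) p) \<in> borel_measurable lborel"
    proof -
      have "(\<lambda>p. (kernel_sq T x t' T p) * ennreal (?N * \<eta> powr \<theta>)) \<in> borel_measurable lborel"
        using measurable_kernel_square[OF x order_refl[of T], of t'] by simp
      then show ?thesis unfolding \<beta>_def by (simp only: mult_ac)
    qed
    have \<beta>i: "(\<integral>\<^sup>+p. \<beta> p * indicator ({t'<..T} \<times> {0..1}) p \<partial>lborel) \<le> ennreal \<kappa>"
    proof -
      have "(\<integral>\<^sup>+p. \<beta> p * indicator ({t'<..T} \<times> {0..1}) p \<partial>lborel)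
        = (\<integral>\<^sup>+p. ennreal (?N * \<eta> powr \<theta>) * (kernel_sq T x t' T p) \<partial>lborel)"
        unfolding \<beta>_def by (simp only: mult_ac)
      also have "\<dots> = ennreal (?N * \<eta> powr \<theta>) * (\<integral>\<^sup>+p. kernel_sq T x t' T p \<partial>lborel)"
        by (rule nn_integral_cmult[OF measurable_kernel_square[OF x order_refl]])
      also have "\<dots> \<le> ennreal (?N * \<eta> powr \<theta>) * ennreal (CK * sqrt (T - t'))"
        using t' x by (intro mult_left_mono CK) auto
      also have "\<dots> = ennreal (?N * \<eta> powr \<theta> * (CK * \<eta>))"
        unfolding Tt using N CK(1) \<eta> by (intro ennreal_mult[symmetric]) auto
      also have "?N * \<eta> powr \<theta> * (CK * \<eta>) = \<kappa>" unfolding \<kappa>_def by (simp only: mult_ac)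
      finally show ?thesis .
    qed
    have good': "good \<in> sets (F t')" using good_sets sets_F_mono[of t1 t'] t1' times by auto
    have Dd: "msq M (\<lambda>w. drift \<infinity> T x t' T w) \<le> ennreal (d\<^sup>2)"
    proof -
      have "(\<eta> powr (3 / 2))\<^sup>2 = \<eta> powr 3" by (simp add: power2_eq_square flip: powr_add)
      also have "\<dots> = \<eta> ^ 3" using \<eta> by (simp add: powr_numeral)
      finally have d2: "d\<^sup>2 = CK * ?B * \<eta> ^ 3" using CK(1) B unfolding d_def power_mult_distrib by simp
      have "CK * sqrt (T - t') * (?B * (T - t')) = d\<^sup>2"
        unfolding Tt d2 by (simp add: t'_def \<epsilon>_def power3_eq_cube power2_eq_square)
      with drift_late_square[OF t1' t'(2) order_refl x] show ?thesis by simp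
    qed
    have d0: "0 \<le> d" unfolding d_def using CK(1) B by simp
    have l: "0 < \<delta>\<^sup>2 * (e0 * \<eta>)" using \<delta> e0_pos \<eta> by simp
    have "norm (LINT w|M. complex_of_real (indicator good w) * iexp (\<xi> * ?X w))
      \<le> exp (- (\<xi>\<^sup>2 * (\<delta>\<^sup>2 * (e0 * \<eta>)) / 8)) + 136 * \<kappa> / (\<delta>\<^sup>2 * (e0 * \<eta>)) + \<bar>\<xi>\<bar> * (d + sqrt (544 * \<kappa>))"
    proof (rule char_bound[OF t'(1,2) predictable_seg[OF pf] fin _ _ \<beta>m \<beta>i \<kappa> Z good' I2 _ l measurable_drift[OF x] Dd d0 Xm eq])
      show "seg t' T field s y w = 0" if "s \<le> t'" for s y w using that by (simp add: seg_def)
      show "\<exists>v\<in>borel_measurable (F t'). (msq M (\<lambda>w. seg t' T field s y w - v w)) \<le> \<beta> (s, y)"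
        if "t' < s" "s \<le> T" "y \<in> {0..1}" for s y
        using frozen_field[OF t1' that] unfolding \<beta>_def Tt by simp
      show "ennreal (\<delta>\<^sup>2 * (e0 * \<eta>)) \<le> energy T (seg t' T field) w" if "w \<in> good" for w
        using energy_lower[OF \<epsilon> _ that] t1' unfolding t'_def s\<epsilon> by simp
    qed
    also have "exp (- (\<xi>\<^sup>2 * (\<delta>\<^sup>2 * (e0 * \<eta>)) / 8)) = exp (- (\<delta>\<^sup>2 * e0 / 8 * \<xi>\<^sup>2 * \<eta>))" by (simp add: mult_ac)
    also have "136 * \<kappa> / (\<delta>\<^sup>2 * (e0 * \<eta>)) = C1 * \<eta> powr \<theta>"
      unfolding \<kappa>_def C1_def using \<eta> \<delta> e0_pos by (simp add: field_simps)
    also have "d + sqrt (544 * \<kappa>) \<le> C2 * \<eta> powr ((1 + \<theta>) / 2)"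
    proof -
      have "sqrt (\<eta> powr \<theta> * \<eta>) = \<eta> powr ((1 + \<theta>) / 2)"
      proof -
        have e: "\<eta> powr \<theta> * \<eta> = \<eta> powr (1 + \<theta>)" using \<eta> by (simp add: powr_add)
        show ?thesis unfolding e by (simp only: powr_half_sqrt[symmetric] powr_ge_zero powr_powr times_divide_eq_right mult_1_right)
      qed
      then have "sqrt (544 * \<kappa>) = sqrt (544 * (?N * CK)) * \<eta> powr ((1 + \<theta>) / 2)"
        unfolding \<kappa>_def by (simp add: real_sqrt_mult mult.assoc)
      moreover have "d \<le> sqrt (CK * ?B) * \<eta> powr ((1 + \<theta>) / 2)"
        unfolding d_def using \<eta> \<eta>1 \<theta> CK(1) B by (intro mult_left_mono powr_mono') auto
      ultimately show ?thesis unfolding C2_def by (simp add: distrib_right)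
    qed
    finally have "norm (LINT w|M. complex_of_real (indicator good w) * iexp (\<xi> * ?X w))
      \<le> exp (- (\<delta>\<^sup>2 * e0 / 8 * \<xi>\<^sup>2 * \<eta>)) + C1 * \<eta> powr \<theta> + \<bar>\<xi>\<bar> * (C2 * \<eta> powr ((1 + \<theta>) / 2))"
      by (simp add: mult_left_mono)
    also have "\<dots> \<le> exp (- (\<delta>\<^sup>2 * e0 / 8 * \<xi>\<^sup>2 * \<eta>)) + (C1 + C2) * \<eta> powr \<theta> + \<bar>\<xi>\<bar> * ((C1 + C2) * \<eta> powr ((1 + \<theta>) / 2))"
      using C1 C2 by (intro add_mono mult_left_mono mult_right_mono) auto
    finally show ?thesis by (simp only: mult_ac)
  qed
  then show ?thesis using C1 C2 \<eta>0 \<delta> e0_pos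
    by (intro exI[of _ "C1 + C2"] exI[of _ "\<delta>\<^sup>2 * e0 / 8"] exI[of _ \<eta>0] conjI) auto
qed

text \<open>X is not the solution of a modified equation: only the integrand of the noise is made
  elliptic, still evaluated along the given U. Its law, restricted to \<open>good\<close>, has a
  square integrable characteristic function. On the nondegeneracy event the two integrands coincide
  along the path, so X = U(T, x) by locality.\<close>

lemma no_atoms:
  assumes B: "B \<in> null_sets lborel"
  shows "AE w in M. w \<in> good \<and> (\<forall>s\<in>{t1<..T}. \<forall>z\<in>{0..1} \<inter> {x - \<rho>..x + \<rho>}. \<delta> \<le> sg * \<sigma> (U s z w)) \<longrightarrow> U T x w \<notin> B"
proof -
  obtain IX where IX: "L2_walsh T field IX"
    by (rule coefficient_walsh[OF coefficient_elliptic moment_infinity t1T order_refl x])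
  obtain I' where I': "L2_walsh T (weighted \<infinity> \<sigma>U T x) I'"
    by (rule coefficient_walsh[OF coefficient_\<sigma> moment_infinity t1T order_refl x])
  define X where "X w = J0 T x + drift \<infinity> T x 0 T w + IX w" for w
  have Xm [measurable]: "X \<in> borel_measurable M"
  proof -
    have [measurable]: "IX \<in> borel_measurable M" using IX times unfolding L2_walsh_def by (intro measurable_F[of T]) auto
    note [measurable] = measurable_drift[OF x]
    show ?thesis unfolding X_def by measurable
  qed
  have goodM [measurable]: "good \<in> sets M" using sets_F_sub[OF _ good_sets] times by simp
  define \<nu> where "\<nu> = distr (density M (\<lambda>w. ennreal (indicator good w))) borel X"
  have char: "char \<nu> \<xi> = (LINT w|M. complex_of_real (indicator good w) * iexp (\<xi> * X w))" for \<xi>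
  proof -
    have "char \<nu> \<xi> = (LINT w|density M (\<lambda>w. ennreal (indicator good w)). iexp (\<xi> * X w))"
      unfolding char_def \<nu>_def by (rule integral_distr) measurable
    also have "\<dots> = (LINT w|M. indicator good w *\<^sub>R iexp (\<xi> * X w))"
      by (rule integral_density) (auto intro: AE_I2)
    finally show ?thesis by (simp add: scaleR_conv_of_real)
  qed
  have fin: "finite_measure \<nu>" unfolding \<nu>_def
  proof (rule finite_measure.finite_measure_distr)
    show "finite_measure (density M (\<lambda>w. ennreal (indicator good w)))"
    proof (rule finite_measureI)
      have "emeasure (density M (\<lambda>w. ennreal (indicator good w))) (space M) = (\<integral>\<^sup>+w. ennreal (indicator good w) * indicator (space M) w \<partial>M)"
        by (rule emeasure_density) auto
      also have "\<dots> \<le> (\<integral>\<^sup>+w. 1 \<partial>M)" by (intro nn_integral_mono) (auto simp: indicator_def)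
      finally show "emeasure (density M (\<lambda>w. ennreal (indicator good w))) (space (density M (\<lambda>w. ennreal (indicator good w)))) \<noteq> \<infinity>"
        by (auto simp: emeasure_space_1 top_unique)
    qed
  qed simp
  have le1: "norm (char \<nu> \<xi>) \<le> 1" for \<xi>
  proof -
    have "norm (LINT w|M. complex_of_real (indicator good w) * iexp (\<xi> * X w)) \<le> (LINT w|M. 1)"
      by (rule integral_norm_bound_integral_AE)
        (auto intro!: integrable_const_bound[where B = 1] AE_I2 simp: indicator_def norm_mult)
    then show ?thesis unfolding char by (simp add: prob_space)
  qed
  from char_decay[OF IX] obtain C c \<eta>0 where cC: "0 < c" "0 \<le> C" "0 < \<eta>0"
    and dec: "\<And>\<xi> \<eta>. 0 < \<eta> ==> \<eta> \<le> \<eta>0 ==> norm (char \<nu> \<xi>) \<le> exp (- (c * \<xi>\<^sup>2 * \<eta>)) + C * \<eta> powr \<theta> + C * \<bar>\<xi>\<bar> * \<eta> powr ((1 + \<theta>) / 2)"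
    unfolding char X_def by blast
  have "msq lborel (\<lambda>\<xi>. norm (char \<nu> \<xi>)) < \<infinity>"
    by (rule square_integrable_of_decay[OF \<theta> cC _ le1 dec]) auto
  from null_set_of_square_integrable_char[OF fin _ this B]
  have "emeasure \<nu> B = 0" by (simp add: \<nu>_def)
  moreover have Bb [measurable]: "B \<in> sets borel" using B by auto
  ultimately have "emeasure (density M (\<lambda>w. ennreal (indicator good w))) (X -` B \<inter> space M) = 0"
    unfolding \<nu>_def by (simp add: emeasure_distr)
  then have "(\<integral>\<^sup>+w. ennreal (indicator good w) * indicator (X -` B \<inter> space M) w \<partial>M) = 0"
    by (subst (asm) emeasure_density) auto
  then have ae: "AE w in M. ennreal (indicator good w) * indicator (X -` B \<inter> space M) w = 0"
    by (subst (asm) nn_integral_0_iff_AE) auto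
  show ?thesis
    using ae walsh_integral_local[OF less_imp_le[OF times(3)] L2_walsh_walsh_integral[OF IX] L2_walsh_walsh_integral[OF I']]
      representation[OF t1T order_refl x I'] AE_space
  proof eventually_elim
    case (elim w)
    show ?case
    proof (intro impI notI)
      assume A: "w \<in> good \<and> (\<forall>s\<in>{t1<..T}. \<forall>z\<in>{0..1} \<inter> {x - \<rho>..x + \<rho>}. \<delta> \<le> sg * \<sigma> (U s z w))" and UB: "U T x w \<in> B"
      have el: "elliptic s z (U s z w) = \<sigma> (U s z w)" if "s \<in> {0<..T}" "z \<in> {0..1}" for s z
      proof (cases "t1 < s \<and> \<bar>z - x\<bar> \<le> \<rho>")
        case True
        then have "s \<in> {t1<..T}" "z \<in> {0..1} \<inter> {x - \<rho>..x + \<rho>}" using that by auto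
        then have "\<delta> \<le> sg * \<sigma> (U s z w)" using A by blast
        then show ?thesis using sg True unfolding elliptic_def by auto
      next
        case False
        then show ?thesis unfolding elliptic_def by auto
      qed
      have "IX w = I' w" using elim(2) times el by (simp add: weighted_def)
      moreover have "kill \<infinity> T w = 1" using A kill_infinity[OF t1T elim(4)] by simp
      ultimately have "X w = U T x w" using elim(3) by (simp add: X_def)
      then show False using elim(1,4) A UB by (simp add: indicator_def)
    qed
  qed
qed

end

section \<open>Absolute continuity\<close>

context spde
begin

text \<open>Read off from the equation at the later time t1 and the point 0. Up to t0 the kernel
  there is bounded below by g > 0, and the integrals of the squared noise integrand and of the
  absolute drift integrand are almost surely finite by the notion of solution.\<close>

lemma intensity_energy_finite:
  assumes t: "0 < t0" "t0 < t1"
  shows "AE w in M. energy t0 intensity w < \<infinity>"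
proof -
  define g where "g = 1 / sqrt (4 * pi * t1) * exp (- 1 / (4 * (t1 - t0)))"
  have t1: "0 < t1" using t by simp
  have x0: "0 \<in> {0..1::real}" by simp
  have g: "0 < g" unfolding g_def using t by simp
  have G: "g \<le> neumann_kernel (t1 - s) 0 y" if "0 < s" "s \<le> t0" "y \<in> {0..1}" for s y
  proof -
    have p: "0 < t1 - s" using that t by simp
    have "g \<le> 1 / sqrt (4 * pi * (t1 - s)) * exp (- (y - 0)\<^sup>2 / (4 * (t1 - s)))"
      unfolding g_def
    proof (rule mult_mono)
      show "1 / sqrt (4 * pi * t1) \<le> 1 / sqrt (4 * pi * (t1 - s))"
        using that p by (intro divide_left_mono) auto
      have "(y - 0)\<^sup>2 / (4 * (t1 - s)) \<le> 1 / (4 * (t1 - t0))"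
        using that t by (intro frac_le) (auto simp: power_le_one)
      then show "exp (- 1 / (4 * (t1 - t0))) \<le> exp (- (y - 0)\<^sup>2 / (4 * (t1 - s)))" by simp
    qed (use p in auto)
    also have "\<dots> \<le> neumann_kernel (t1 - s) 0 y" using that by (intro neumann_kernel_lower p) auto
    finally show ?thesis .
  qed
  have "AE w in M. energy t1 (\<lambda>s y w. neumann_kernel (t1 - s) 0 y * \<sigma> (U s y w)) w < \<infinity>"
    by (rule walsh_integral_energy_finite[OF U_walsh[OF t1 x0]])
  then show ?thesis using U_eq AE_space
  proof eventually_elim
    case (elim w)
    let ?H = "\<lambda>s y w. neumann_kernel (t1 - s) 0 y * \<sigma> (U s y w)"
    let ?b = "\<lambda>p. indicator ({0<..<t1} \<times> {0..1}) p *\<^sub>R (neumann_kernel (t1 - fst p) 0 (snd p) * b (U (fst p) (snd p) w))"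
    have "set_integrable lborel ({0<..<t1} \<times> {0..1}) (\<lambda>(s, y). neumann_kernel (t1 - s) 0 y * b (U s y w))"
      by (rule elim(2)[rule_format, OF t1 x0, THEN conjunct1])
    then have bi: "integrable lborel ?b"
      unfolding set_integrable_def by (simp add: case_prod_beta)
    have pH: "predictable t1 ?H"
      by (rule U_walsh[OF t1 x0, unfolded walsh_integral_energy, THEN conjunct1])
    have Hm: "(\<lambda>p. ennreal ((?H (fst p) (snd p) w * indicator (strip t1) p)\<^sup>2)) \<in> borel_measurable lborel"
      using jointly_section[OF predictable_jointly[OF pH] elim(3)] by measurable
    have bm: "(\<lambda>p. ennreal (norm (?b p))) \<in> borel_measurable lborel"
      using borel_measurable_integrable[OF bi] by measurable
    have "energy t0 intensity w \<le> (\<integral>\<^sup>+p. ennreal (1 / g\<^sup>2) * ennreal ((?H (fst p) (snd p) w * indicator (strip t1) p)\<^sup>2) + ennreal (1 / g) * ennreal (norm (?b p)) \<partial>lborel)"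
      unfolding energy_def
    proof (rule nn_integral_mono)
      fix p :: "real \<times> real"
      obtain s y where p: "p = (s, y)" by (rule prod.exhaust)
      show "ennreal ((intensity (fst p) (snd p) w)\<^sup>2) * indicator (strip t0) p
        \<le> ennreal (1 / g\<^sup>2) * ennreal ((?H (fst p) (snd p) w * indicator (strip t1) p)\<^sup>2) + ennreal (1 / g) * ennreal (norm (?b p))"
      proof (cases "p \<in> strip t0")
        case True
        then have s: "0 < s" "s \<le> t0" "y \<in> {0..1}" by (auto simp: p strip_def)
        let ?G = "neumann_kernel (t1 - s) 0 y"
        have Gg: "g \<le> ?G" by (rule G[OF s])
        have "g\<^sup>2 * (\<sigma> (U s y w))\<^sup>2 \<le> ?G\<^sup>2 * (\<sigma> (U s y w))\<^sup>2"
          using Gg g by (intro mult_right_mono power_mono) auto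
        then have 1: "(\<sigma> (U s y w))\<^sup>2 \<le> 1 / g\<^sup>2 * (?G * \<sigma> (U s y w))\<^sup>2"
          using g by (simp add: field_simps power_mult_distrib)
        have "g * \<bar>b (U s y w)\<bar> \<le> ?G * \<bar>b (U s y w)\<bar>" using Gg by (intro mult_right_mono) auto
        also have "\<dots> = \<bar>?G * b (U s y w)\<bar>" using Gg g by (simp add: abs_mult)
        finally have 2: "\<bar>b (U s y w)\<bar> \<le> 1 / g * \<bar>?G * b (U s y w)\<bar>"
          using g by (simp add: field_simps)
        have "(intensity s y w)\<^sup>2 \<le> 1 / g\<^sup>2 * (?G * \<sigma> (U s y w))\<^sup>2 + 1 / g * \<bar>?G * b (U s y w)\<bar>"
          unfolding intensity_sq using 1 2 by (rule add_mono)
        then have "ennreal ((intensity s y w)\<^sup>2) \<le> ennreal (1 / g\<^sup>2) * ennreal ((?G * \<sigma> (U s y w))\<^sup>2) + ennreal (1 / g) * ennreal \<bar>?G * b (U s y w)\<bar>"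
          using g by (simp flip: ennreal_mult ennreal_plus add: ennreal_leI)
        moreover have "p \<in> strip t1" "p \<in> {0<..<t1} \<times> {0..1}" using s t by (auto simp: p strip_def)
        ultimately show ?thesis using True by (simp add: p)
      qed simp
    qed
    also have "\<dots> = ennreal (1 / g\<^sup>2) * energy t1 ?H w + ennreal (1 / g) * (\<integral>\<^sup>+p. ennreal (norm (?b p)) \<partial>lborel)"
      unfolding energy_alt using Hm bm by (simp add: nn_integral_add nn_integral_cmult)
    also have "\<dots> < \<infinity>"
    proof -
      have "(\<integral>\<^sup>+p. ennreal (norm (?b p)) \<partial>lborel) < \<infinity>" using bi unfolding integrable_iff_bounded by blast
      then show ?thesis using elim(1) by (simp add: ennreal_mult_less_top)
    qed
    finally show ?case .
  qed
qed

text \<open>Finite energy up to t0 and boundedness of the path on [t0, t1] are both met by some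
  integer level.\<close>

lemma good_exhausts:
  assumes t: "0 < t0" "t0 < t1"
  shows "AE w in M. \<exists>k. w \<in> spde_window.good M \<sigma> b U t0 t1 (real k)"
  using intensity_energy_finite[OF t] AE_space
proof eventually_elim
  case (elim w)
  from bounded_path[OF elim(2) t(1), of t1] obtain B where B: "\<forall>r\<in>{t0..t1}. \<forall>y\<in>{0..1}. \<bar>U r y w\<bar> \<le> B" ..
  obtain k :: nat where k: "max B (enn2real (energy t0 intensity w)) \<le> real k" using real_arch_simple by blast
  interpret spde_window M F W \<sigma> b U I J0 \<theta> CH CG t0 t1 "real k" by unfold_locales (use t in auto)
  have al: "alive \<infinity> r w" if r: "r \<in> \<rat> \<inter> {0<..t1}" for r
  proof -
    have "energy r intensity w \<le> ennreal (real k)" if "r \<le> t0"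
    proof -
      have "energy r intensity w \<le> energy t0 intensity w" by (rule energy_mono_time[OF that])
      also have "\<dots> = ennreal (enn2real (energy t0 intensity w))" using elim(1) by simp
      also have "\<dots> \<le> ennreal (real k)" using k by (intro ennreal_leI) simp
      finally show ?thesis .
    qed
    moreover have "\<bar>U r y w\<bar> \<le> real k" if "t0 < r" "r \<le> t1" "y \<in> \<rat> \<inter> {0..1}" for y
    proof -
      have "\<bar>U r y w\<bar> \<le> B" using B that by simp
      then show ?thesis using k by simp
    qed
    ultimately show ?thesis unfolding alive_def by simp
  qed
  have "w \<in> good" unfolding good_def by (intro CollectI conjI ballI elim(2)) (rule al)
  then show ?case by (rule exI)
qed

text \<open>By continuity. A single number d serves as time radius, space radius and lower bound, so
  that a sequence of parameters suffices later.\<close>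

lemma path_nondegenerate:
  assumes w: "w \<in> space M" and t: "0 < t" and x: "x \<in> {0..1}" and pos: "0 < sg * \<sigma> (U t x w)"
  shows "\<exists>d>0. \<forall>s z. 0 < s \<and> \<bar>s - t\<bar> < d \<and> z \<in> {0..1} \<and> \<bar>z - x\<bar> < d \<longrightarrow> d \<le> sg * \<sigma> (U s z w)"
proof -
  let ?f = "\<lambda>p. sg * \<sigma> ((\<lambda>(t, x). U t x w) p)"
  have "continuous_on ({0<..} \<times> {0..1}) ?f"
    by (intro continuous_intros continuous_on_compose2[OF \<sigma>_continuous U_path[OF w]]) auto
  then have "\<forall>q\<in>{0<..} \<times> {0..1}. \<forall>e>0. \<exists>d>0. \<forall>p\<in>{0<..} \<times> {0..1}. dist p q < d \<longrightarrow> dist (?f p) (?f q) < e"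
    unfolding continuous_on_iff .
  from this[rule_format, of "(t, x)" "sg * \<sigma> (U t x w) / 2"] t x pos
  obtain d where d0: "0 < d" and d': "\<forall>p\<in>{0<..} \<times> {0..1}. dist p (t, x) < d \<longrightarrow> dist (?f p) (?f (t, x)) < sg * \<sigma> (U t x w) / 2"
    by auto
  define e where "e = min (d / 2) (sg * \<sigma> (U t x w) / 2)"
  have "e \<le> sg * \<sigma> (U s z w)" if "0 < s" "\<bar>s - t\<bar> < e" "z \<in> {0..1}" "\<bar>z - x\<bar> < e" for s z
  proof -
    have "dist (s, z) (t, x) \<le> dist s t + dist z x"
      unfolding dist_Pair_Pair by (rule order_trans[OF sqrt_sum_squares_le_sum_abs]) (simp add: dist_real_def)
    also have "\<dots> < d" using that unfolding e_def by (auto simp: dist_real_def)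
    finally have ds: "dist (s, z) (t, x) < d" .
    have "(s, z) \<in> {0<..} \<times> {0..1}" using that by simp
    from d'[rule_format, OF this ds] have "dist (?f (s, z)) (?f (t, x)) < sg * \<sigma> (U t x w) / 2" .
    then have "sg * \<sigma> (U t x w) / 2 < sg * \<sigma> (U s z w)" by (simp add: dist_real_def abs_if split: if_splits)
    then show ?thesis unfolding e_def by simp
  qed
  moreover have "0 < e" using d0 pos unfolding e_def by simp
  ultimately show ?thesis by blast
qed

text \<open>Countable exhaustion: on almost every path with \<sigma>(U(t, x)) nonzero the event of
  \<open>no_atoms\<close> occurs for some j, k and one of the two signs. Large j makes the window
  short enough for \<open>small\<close> and for the path to be nondegenerate there; k is chosen
  afterwards.\<close>

lemma solution_avoids_null_set:
  assumes t: "0 < t" and x: "x \<in> {0..1}" and B: "B \<in> null_sets lborel"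
  shows "AE w in M. \<sigma> (U t x w) \<noteq> 0 \<longrightarrow> U t x w \<notin> B"
proof -
  obtain CK where CK: "0 < CK" "\<And>a s x. a \<le> s ==> s - a \<le> t ==> x \<in> {0..1} ==>
      (\<integral>\<^sup>+p. kernel_sq s x a s p \<partial>lborel) \<le> ennreal (CK * sqrt (s - a))"
    by (rule kernel_square_integral[OF t]) (rule that)
  obtain CU where CU: "0 < CU" "\<And>s x y. 0 < s ==> s \<le> t ==> x \<in> {0..1} ==> y \<in> {0..1} ==> neumann_kernel s x y \<le> CU / sqrt s * exp (- (y - x)\<^sup>2 / (8 * s))"
    by (rule neumann_kernel_upper[OF t]) (rule that)
  have CU': "neumann_kernel s x y \<le> CU / sqrt s" if s: "0 < s" "s \<le> t" and xy: "x \<in> {0..1}" "y \<in> {0..1}" for s x y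
  proof -
    have "CU / sqrt s * exp (- (y - x)\<^sup>2 / (8 * s)) \<le> CU / sqrt s * 1" using s CU(1) by (intro mult_left_mono) auto
    then show ?thesis using CU(2)[OF s xy] by simp
  qed
  from J0_bound[of "t / 2" t] t obtain BJ where BJ: "\<forall>s\<in>{t / 2..t}. \<forall>x\<in>{0..1}. \<bar>J0 s x\<bar> \<le> BJ" by auto
  \<comment> \<open>The 2 keeps the window inside [t/2, t], where BJ bounds the initial term for all
    j at once.\<close>
  define h where "h j = t / real (j + 2)" for j
  define small where "small j \<longleftrightarrow> 8 * CK * CG\<^sup>2 * (sqrt t * h j + 64 * sqrt (h j)) \<le> 1 / 2" for j
  have h: "0 < h j" "h j \<le> t / 2" for j
  proof -
    show "0 < h j" unfolding h_def using t by simp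
    show "h j \<le> t / 2" unfolding h_def using t by (intro divide_left_mono) auto
  qed
  have h0: "h \<longlonglongrightarrow> 0" unfolding h_def by real_asymp
  \<comment> \<open>Here \<delta> = \<rho> = 1 / (j + 1); t1 = t - h j, t0 is half of it, and K =
    k.\<close>
  have null: "AE w in M. w \<in> spde_window.good M \<sigma> b U ((t - h j) / 2) (t - h j) (real k) \<and>
      (\<forall>s\<in>{t - h j<..t}. \<forall>z\<in>{0..1} \<inter> {x - 1 / real (Suc j)..x + 1 / real (Suc j)}. 1 / real (Suc j) \<le> sg * \<sigma> (U s z w)) \<longrightarrow> U t x w \<notin> B"
    if j: "small j" and sg: "sg = 1 \<or> sg = -1" for j k and sg :: real
  proof -
    interpret N: spde_nondegenerate M F W \<sigma> b U I J0 \<theta> CH CG "(t - h j) / 2" "t - h j" "real k" t CK CU "\<bar>BJ\<bar>" x "1 / real (Suc j)" "1 / real (Suc j)" sg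
    proof unfold_locales
      show "0 < (t - h j) / 2" "(t - h j) / 2 < t - h j" "t - h j < t" using h[of j] t by auto
      show "8 * CK * CG\<^sup>2 * (sqrt t * (t - (t - h j)) + 64 * sqrt (t - (t - h j))) \<le> 1 / 2"
        using j unfolding small_def by simp
      show "\<bar>J0 s x\<bar> \<le> \<bar>BJ\<bar>" if "s \<in> {t - h j..t}" "x \<in> {0..1}" for s x
      proof -
        have "s \<in> {t / 2..t}" using that h[of j] by auto
        then have "\<bar>J0 s x\<bar> \<le> BJ" using BJ that(2) by blast
        then show ?thesis by simp
      qed
    qed (use CK CU' CU(1) x sg in auto)
    show ?thesis by (rule N.no_atoms[OF B])
  qed
  have "AE w in M. \<forall>j k. small j \<longrightarrow> (\<forall>sg\<in>{1, -1}. w \<in> spde_window.good M \<sigma> b U ((t - h j) / 2) (t - h j) (real k) \<and>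
      (\<forall>s\<in>{t - h j<..t}. \<forall>z\<in>{0..1} \<inter> {x - 1 / real (Suc j)..x + 1 / real (Suc j)}. 1 / real (Suc j) \<le> sg * \<sigma> (U s z w)) \<longrightarrow> U t x w \<notin> B)"
    unfolding AE_all_countable
  proof (intro allI)
    fix j k
    show "AE w in M. small j \<longrightarrow> (\<forall>sg\<in>{1, -1}. w \<in> spde_window.good M \<sigma> b U ((t - h j) / 2) (t - h j) (real k) \<and>
      (\<forall>s\<in>{t - h j<..t}. \<forall>z\<in>{0..1} \<inter> {x - 1 / real (Suc j)..x + 1 / real (Suc j)}. 1 / real (Suc j) \<le> sg * \<sigma> (U s z w)) \<longrightarrow> U t x w \<notin> B)"
    proof (cases "small j")
      case True
      have 1: "(1::real) = 1 \<or> (1::real) = -1" "(-1::real) = 1 \<or> (-1::real) = -1" by simp_all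
      from null[OF True 1(1), of k] null[OF True 1(2), of k] show ?thesis
        by eventually_elim (intro impI ballI; elim insertE emptyE; hypsubst; (rule mp, assumption, assumption))
    next
      case False
      then show ?thesis by simp
    qed
  qed
  moreover have "AE w in M. \<forall>j. \<exists>k. w \<in> spde_window.good M \<sigma> b U ((t - h j) / 2) (t - h j) (real k)"
    unfolding AE_all_countable
  proof
    fix j show "AE w in M. \<exists>k. w \<in> spde_window.good M \<sigma> b U ((t - h j) / 2) (t - h j) (real k)"
      using h[of j] t by (intro good_exhausts) auto
  qed
  ultimately show ?thesis using AE_space
  proof eventually_elim
    case (elim w)
    show ?case
    proof
      assume nz: "\<sigma> (U t x w) \<noteq> 0"
      obtain sg :: real where sg: "sg \<in> {1, -1}" and pos: "0 < sg * \<sigma> (U t x w)"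
      proof (cases "0 < \<sigma> (U t x w)")
        case True
        then show ?thesis using that[of 1] by simp
      next
        case False
        then show ?thesis using that[of "-1"] nz by simp
      qed
      from path_nondegenerate[OF elim(3) t x pos] obtain d where d: "0 < d"
        and dl: "\<And>s z. 0 < s ==> \<bar>s - t\<bar> < d ==> z \<in> {0..1} ==> \<bar>z - x\<bar> < d ==> d \<le> sg * \<sigma> (U s z w)" by blast
      have "(\<lambda>j. 8 * CK * CG\<^sup>2 * (sqrt t * h j + 64 * sqrt (h j))) \<longlonglongrightarrow> 8 * CK * CG\<^sup>2 * (sqrt t * 0 + 64 * sqrt 0)"
        by (intro tendsto_intros h0)
      then have "\<forall>\<^sub>F j in sequentially. 8 * CK * CG\<^sup>2 * (sqrt t * h j + 64 * sqrt (h j)) < 1 / 2"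
        by (rule order_tendstoD(2)) simp
      moreover have "\<forall>\<^sub>F j in sequentially. h j < d" by (rule order_tendstoD(2)[OF h0 d])
      moreover have "\<forall>\<^sub>F j in sequentially. 1 / real (Suc j) < d"
        by (rule order_tendstoD(2)[OF _ d]) (rule LIMSEQ_Suc[OF lim_1_over_n])
      ultimately have "\<forall>\<^sub>F j in sequentially. small j \<and> h j < d \<and> 1 / real (Suc j) < d"
        by eventually_elim (simp add: small_def)
      then obtain j where j: "small j" "h j < d" "1 / real (Suc j) < d"
        using eventually_happens'[OF sequentially_bot] by blast
      from elim(2) obtain k where k: "w \<in> spde_window.good M \<sigma> b U ((t - h j) / 2) (t - h j) (real k)" by blast
      have "1 / real (Suc j) \<le> sg * \<sigma> (U s z w)"
        if s: "s \<in> {t - h j<..t}" and z: "z \<in> {0..1} \<inter> {x - 1 / real (Suc j)..x + 1 / real (Suc j)}" for s z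
      proof -
        have "d \<le> sg * \<sigma> (U s z w)"
        proof (rule dl)
          show "0 < s" "\<bar>s - t\<bar> < d" using s j(2) h[of j] t by auto
          have "\<bar>z - x\<bar> \<le> 1 / real (Suc j)" using z by (simp only: Int_iff atLeastAtMost_iff) linarith
          then show "\<bar>z - x\<bar> < d" using j(3) by linarith
        qed (use z in simp)
        then show ?thesis using j(3) by linarith
      qed
      then show "U t x w \<notin> B" using elim(1) j(1) k sg by blast
    qed
  qed
qed

end

text \<open>Away from time 0 the kernel is at most CU / sqrt t. A nonintegrable product has integral
  0 by default, which satisfies the bound as well.\<close>

lemma initial_value_bounded:
  assumes U0: "in_Linf_unit_interval U0" and t: "0 < t"
  shows "\<exists>B. \<forall>s\<in>{t..T}. \<forall>x\<in>{0..1}. \<bar>LINT y|lebesgue_on {0..1}. neumann_kernel s x y * U0 y\<bar> \<le> B"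
proof -
  from U0 obtain C where C: "AE y in lebesgue_on {0..1}. \<bar>U0 y\<bar> \<le> C" unfolding in_Linf_unit_interval_def by blast
  have mt: "0 < max t T" using t by simp
  obtain CU where CU: "0 < CU" "\<And>s x y. 0 < s ==> s \<le> max t T ==> x \<in> {0..1} ==> y \<in> {0..1} ==> neumann_kernel s x y \<le> CU / sqrt s * exp (- (y - x)\<^sup>2 / (8 * s))"
    by (rule neumann_kernel_upper[OF mt]) (rule that)
  let ?B = "CU / sqrt t * \<bar>C\<bar>"
  have B0: "0 \<le> ?B" using CU(1) t by simp
  have "\<bar>LINT y|lebesgue_on {0..1}. neumann_kernel s x y * U0 y\<bar> \<le> ?B" if s: "s \<in> {t..T}" and x: "x \<in> {0..1}" for s x
  proof (cases "integrable (lebesgue_on {0..1}) (\<lambda>y. neumann_kernel s x y * U0 y)")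
    case True
    have fin: "finite_measure (lebesgue_on {0..1::real})" by (rule finite_measure_lebesgue_on) simp
    have "norm (LINT y|lebesgue_on {0..1}. neumann_kernel s x y * U0 y) \<le> (LINT y|lebesgue_on {0..1::real}. ?B)"
    proof (rule integral_norm_bound_integral_AE[OF True finite_measure.integrable_const[OF fin]])
      show "AE y in lebesgue_on {0..1}. norm (neumann_kernel s x y * U0 y) \<le> ?B"
        using C AE_space
      proof eventually_elim
        case (elim y)
        then have y: "y \<in> {0..1}" by simp
        have s0: "0 < s" "s \<le> max t T" "t \<le> s" using s t by auto
        have "neumann_kernel s x y \<le> CU / sqrt s * exp (- (y - x)\<^sup>2 / (8 * s))" by (rule CU(2)[OF s0(1,2) x y])
        also have "\<dots> \<le> CU / sqrt s * 1" using s0 CU(1) by (intro mult_left_mono) auto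
        also have "\<dots> \<le> CU / sqrt t" using s0 CU(1) t by (simp add: divide_left_mono)
        finally have "\<bar>neumann_kernel s x y\<bar> \<le> CU / sqrt t" using neumann_kernel_nonneg[of s x y] s0 x y by simp
        moreover have "\<bar>U0 y\<bar> \<le> \<bar>C\<bar>" using elim(1) by simp
        ultimately show ?case unfolding real_norm_def abs_mult by (intro mult_mono) auto
      qed
    qed
    also have "\<dots> = ?B" by (simp add: measure_restrict_space)
    finally show ?thesis by simp
  next
    case False
    then show ?thesis using B0 by (simp add: not_integrable_integral_eq)
  qed
  then show ?thesis by blast
qed

theorem theorem4p1:
  fixes M :: "'a measure"
    and F :: "real \<Rightarrow> 'a measure"
    and W :: "(real \<times> real) set \<Rightarrow> 'a \<Rightarrow> real"
    and U0 \<sigma> b :: "real \<Rightarrow> real"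
    and \<theta> :: real
    and U :: "real \<Rightarrow> real \<Rightarrow> 'a \<Rightarrow> real"
  assumes "filtered_prob_space M F"
    and "filtration_white_noise M F W"
    and "in_Linf_unit_interval U0"
    and "b \<in> borel_measurable borel" and "linear_growth b"
    and "1 / 2 < \<theta>" and "\<theta> \<le> 1" and "holder_continuous \<theta> \<sigma>"
    and "weak_solution M F W b \<sigma> U0 U"
  shows "\<forall>x\<in>{0..1}. \<forall>t>0. has_density_on (distr M borel (U t x)) {u. \<sigma> u \<noteq> 0}"
proof -
  from assms(5) obtain Cb where Cb: "\<And>u. \<bar>b u\<bar> \<le> Cb * (1 + \<bar>u\<bar>)" unfolding linear_growth_def by blast
  from assms(8) obtain Ch where Ch: "\<And>u v. \<bar>\<sigma> u - \<sigma> v\<bar> \<le> Ch * \<bar>u - v\<bar> powr \<theta>" unfolding holder_continuous_def by blast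
  \<comment> \<open>The added 1 makes the constant positive while keeping the Hoelder bound.\<close>
  define CH where "CH = \<bar>Ch\<bar> + 1"
  define CG where "CG = CH + \<bar>Cb\<bar> + \<bar>\<sigma> 0\<bar>"
  have H: "\<bar>\<sigma> u - \<sigma> v\<bar> \<le> CH * \<bar>u - v\<bar> powr \<theta>" for u v
    unfolding CH_def by (rule order_trans[OF Ch]) (auto intro!: mult_right_mono)
  have H0: "0 < CH" "CH \<le> CG" "\<bar>Cb\<bar> \<le> CG" unfolding CG_def CH_def by auto
  \<comment> \<open>Hoelder continuity with \<theta> \<le> 1 gives linear growth, through
    |u|^\<theta> \<le> 1 + |u|.\<close>
  have G\<sigma>: "\<bar>\<sigma> u\<bar> \<le> CG * (1 + \<bar>u\<bar>)" for u
  proof -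
    have "\<bar>u\<bar> powr \<theta> \<le> 1 + \<bar>u\<bar>"
    proof (cases "\<bar>u\<bar> \<le> 1")
      case True
      then have "\<bar>u\<bar> powr \<theta> \<le> 1" using assms(6) by (intro powr_le1) auto
      then show ?thesis by simp
    next
      case False
      then have "\<bar>u\<bar> powr \<theta> \<le> \<bar>u\<bar> powr 1" using assms(7) by (intro powr_mono) auto
      then show ?thesis by simp
    qed
    then have "CH * \<bar>u\<bar> powr \<theta> \<le> CH * (1 + \<bar>u\<bar>)" using H0 by (intro mult_left_mono) auto
    moreover have "\<bar>\<sigma> u\<bar> \<le> \<bar>\<sigma> 0\<bar> + CH * \<bar>u\<bar> powr \<theta>" using H[of u 0] by simp
    moreover have "\<bar>\<sigma> 0\<bar> * 1 + CH * (1 + \<bar>u\<bar>) \<le> \<bar>\<sigma> 0\<bar> * (1 + \<bar>u\<bar>) + CH * (1 + \<bar>u\<bar>)"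
      by (intro add_right_mono mult_left_mono) auto
    moreover have "(\<bar>\<sigma> 0\<bar> + CH) * (1 + \<bar>u\<bar>) \<le> CG * (1 + \<bar>u\<bar>)" unfolding CG_def by (intro mult_right_mono) auto
    ultimately show ?thesis by (simp add: distrib_right)
  qed
  have Gb: "\<bar>b u\<bar> \<le> CG * (1 + \<bar>u\<bar>)" for u
  proof -
    have "Cb * (1 + \<bar>u\<bar>) \<le> CG * (1 + \<bar>u\<bar>)" using H0 by (intro mult_right_mono) auto
    then show ?thesis using Cb[of u] by linarith
  qed
  from assms(9) obtain I where cont: "continuous_field M U" and ad: "adapted_field F U"
    and walsh: "\<And>t x. 0 < t \<Longrightarrow> x \<in> {0..1} \<Longrightarrow> walsh_integral M F W t (\<lambda>s y w. neumann_kernel (t - s) x y * \<sigma> (U s y w)) (I t x)"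
    and eq: "AE w in M. \<forall>t>0. \<forall>x\<in>{0..1}.
           set_integrable lborel ({0<..<t} \<times> {0..1}) (\<lambda>(s, y). neumann_kernel (t - s) x y * b (U s y w)) \<and>
           U t x w = (LINT y|lebesgue_on {0..1}. neumann_kernel t x y * U0 y) +
             set_lebesgue_integral lborel ({0<..<t} \<times> {0..1}) (\<lambda>(s, y). neumann_kernel (t - s) x y * b (U s y w)) + I t x w"
    unfolding weak_solution_def by blast
  interpret spde M F W \<sigma> b U I "\<lambda>t x. LINT y|lebesgue_on {0..1}. neumann_kernel t x y * U0 y" \<theta> CH CG
    by unfold_locales (use assms cont ad walsh eq H H0 G\<sigma> Gb initial_value_bounded[OF assms(3)] in auto)
  show ?thesis unfolding has_density_on_def
  proof (intro ballI allI impI)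
    fix x t :: real and A :: "real set" assume x: "x \<in> {0..1}" and t: "0 < t" and A: "A \<in> null_sets lborel"
    have Um: "U t x \<in> borel_measurable M" by (rule U_measurable_M[OF t x])
    have "{u. \<sigma> u \<noteq> 0} \<in> sets borel" by measurable
    moreover have "A \<in> sets borel" using A by auto
    ultimately have AD [measurable]: "A \<inter> {u. \<sigma> u \<noteq> 0} \<in> sets borel" by (rule sets.Int[rotated])
    have "AE w in M. w \<notin> U t x -` (A \<inter> {u. \<sigma> u \<noteq> 0}) \<inter> space M"
      using solution_avoids_null_set[OF t x A] by eventually_elim auto
    then have "U t x -` (A \<inter> {u. \<sigma> u \<noteq> 0}) \<inter> space M \<in> null_sets M"
      by (subst AE_iff_null_sets) (rule measurable_sets[OF Um AD])
    then have "emeasure M (U t x -` (A \<inter> {u. \<sigma> u \<noteq> 0}) \<inter> space M) = 0" by (rule null_setsD1)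
    then show "emeasure (distr M borel (U t x)) (A \<inter> {u. \<sigma> u \<noteq> 0}) = 0"
      by (simp only: emeasure_distr[OF Um AD])
  qed
qed

end
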